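(* Let $d\ge 4$ be an integer, let $p$ be an odd prime and let $a\in\mathbb Z/p\mathbb Z$. (1) Suppose $a\neq 0$. If $d\ge 5$, then for every function $f:X_{p,d}(a)\to\mathbb C$, $$\lim_{\substack{n\to\infty\\ n\equiv a \ (\mathrm{mod}\ p)}}\frac{1}{|X_d(n)|}\sum_{x\in X_d(n)} f(x[p])=\frac{1}{|X_{p,d}(a)|}\sum_{x\in X_{p,d}(a)}f(x).$$ If $d=4$, then for every $f:X_{p,4}(a)\to\mathbb C$ the same limit formula holds when $n\to\infty$ through odd integers $n\equiv a \pmod p$. (2) Suppose $a=0$. If $d\ge5$, then for every function $f:X_{p,d}(0)\setminus\{(0,\dots,0)\}\to\mathbb C$, $$\lim_{\substack{n\to\infty\\ n\in p\mathbb Z}}\frac{1}{\left|\{x\in\mathbb Z^d\setminus(p\mathbb Z)^d: Q(x,x)=n\}\right|}\sum_{\substack{x\in\mathbb Z^d\setminus(p\mathbb Z)^d\\ Q(x,x)=n}} f(x[p])=\frac{1}{|X_{p,d}(0)|-1}\sum_{\substack{x\in X_{p,d}(0)\\ x\neq 0}}f(x).$$ If $d=4$, then for every $f:X_{p,4}(0)\setminus\{(0,\dots,0)\}\to\mathbb C$ the same limit formula holds when $n\to\infty$ through odd integers $n\in p\mathbb Z$.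
   Context: $Q(x,y)=x_1y_1+\dots+x_dy_d$ denotes the standard symmetric bilinear form on $\mathbb Z^d$, and also the analogous form on $(\mathbb Z/p\mathbb Z)^d$. For $n\in\mathbb N$, $X_d(n)=\{x\in\mathbb Z^d: Q(x,x)=n\}$. For $a\in\mathbb Z/p\mathbb Z$, $X_{p,d}(a)=\{x\in(\mathbb Z/p\mathbb Z)^d: Q(x,x)=a\}$. For $x\in\mathbb Z^d$, $x[p]$ denotes its reduction modulo $p$ in $(\mathbb Z/p\mathbb Z)^d$. *)

theory Defs
  imports Complex_Main "HOL-Number_Theory.Residues"
begin

text \<open>
  Vectors of length \<open>d\<close> are extensional functions on \<open>{..<d}\<close>, and
  \<open>\<int>/p\<int>\<close> is the library ring \<^const>\<open>residue_ring\<close> with carrier \<open>{0..p - 1}\<close>.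
\<close>

definition int_vecs :: "nat \<Rightarrow> (nat \<Rightarrow> int) set" where
  "int_vecs d = {..<d} \<rightarrow>\<^sub>E UNIV"

definition multiple_vecs :: "nat \<Rightarrow> nat \<Rightarrow> (nat \<Rightarrow> int) set" where
  "multiple_vecs p d = {..<d} \<rightarrow>\<^sub>E {z. int p dvd z}"

definition residue_vecs :: "nat \<Rightarrow> nat \<Rightarrow> (nat \<Rightarrow> int) set" where
  "residue_vecs p d = {..<d} \<rightarrow>\<^sub>E carrier (residue_ring (int p))"

definition zero_vec :: "nat \<Rightarrow> nat \<Rightarrow> int" where
  "zero_vec d = (\<lambda>i\<in>{..<d}. 0)"

definition reduce :: "nat \<Rightarrow> nat \<Rightarrow> (nat \<Rightarrow> int) \<Rightarrow> nat \<Rightarrow> int" where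
  "reduce p d x = (\<lambda>i\<in>{..<d}. x i mod int p)"

definition Q_int :: "nat \<Rightarrow> (nat \<Rightarrow> int) \<Rightarrow> (nat \<Rightarrow> int) \<Rightarrow> int" where
  "Q_int d x y = (\<Sum>i<d. x i * y i)"

definition Q_mod :: "nat \<Rightarrow> nat \<Rightarrow> (nat \<Rightarrow> int) \<Rightarrow> (nat \<Rightarrow> int) \<Rightarrow> int" where
  "Q_mod p d x y =
     finsum (residue_ring (int p)) (\<lambda>i. x i \<otimes>\<^bsub>residue_ring (int p)\<^esub> y i) {..<d}"

definition X_int :: "nat \<Rightarrow> nat \<Rightarrow> (nat \<Rightarrow> int) set" where
  "X_int d n = {x \<in> int_vecs d. Q_int d x x = int n}"

definition X_mod :: "nat \<Rightarrow> nat \<Rightarrow> int \<Rightarrow> (nat \<Rightarrow> int) set" where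
  "X_mod p d a = {x \<in> residue_vecs p d. Q_mod p d x x = a}"

definition X_int' :: "nat \<Rightarrow> nat \<Rightarrow> nat \<Rightarrow> (nat \<Rightarrow> int) set" where
  "X_int' p d n = {x \<in> int_vecs d - multiple_vecs p d. Q_int d x x = int n}"

definition at_top_through :: "nat set \<Rightarrow> nat filter" where
  "at_top_through N = inf sequentially (principal N)"

end

theory Submission
  imports Defs "HOL-Analysis.L2_Norm"
begin

text \<open>
  For \<open>d = 4\<close> identify \<open>\<int>\<^sup>4\<close> with the Lipschitz quaternions and fix an auxiliary odd prime \<open>l \<noteq> p\<close>. Left
  multiplications by primitive quaternions of norm \<open>l ^ k\<close> act on functions modulo \<open>p\<close> as Hecke operators;
  on the orthogonal complement of the functions that only see norms they have a spectral gap, which the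
  Hecke recursion turns into exponential decay. A sum \<open>S\<close> of such a function over the primitive quaternions
  of norm \<open>n\<close> is unchanged by the Hecke correspondences \<open>y \<mapsto> \<alpha> y \<beta>\<^sup>* / l ^ k\<close> up to their degree.
  Splitting according to the residue of \<open>y\<close> modulo \<open>q = l ^ k\<close> and applying Cauchy--Schwarz bounds
  \<open>S\<^sup>2\<close> by the decay factor times the number of pairs \<open>y \<equiv> y' (mod q)\<close> of norm \<open>n\<close>. For such a pair the real
  part of \<open>y y'\<^sup>*\<close> is determined modulo \<open>q\<^sup>2\<close>, so for \<open>q\<^sup>3\<close> of size \<open>n\<close> there are at most \<open>n powr (1 + \<epsilon>)\<close>
  pairs, and \<open>S\<close> is smaller than \<open>n\<close> by a power of \<open>n\<close>.

  Any two nonzero classes modulo \<open>p\<close> of equal norm are linked by multiplications of this kind, so they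
  contain almost equally many vectors of norm \<open>n\<close>; even \<open>n\<close> reduces to odd \<open>n\<close> by dividing by a
  quaternion of norm 2. For \<open>d > 4\<close> fix the first or the last coordinate and sum the bound in
  dimension \<open>d - 1\<close>: moves of these two kinds link all nonzero classes of equal norm. The number of all
  vectors exceeds a multiple of \<open>n powr (d / 2 - 1)\<close>, for \<open>d = 4\<close> when \<open>n\<close> is odd.
\<close>

section \<open>Lipschitz quaternions\<close>

text \<open>In dimension 4 the number of vectors of odd norm \<open>n\<close> exceeds a multiple of
  \<open>n\<close>, so any fixed power saving suffices. The spectral gap may therefore be soft: it
  comes from a finite graph, with a constant depending on \<open>l\<close> and \<open>p\<close> in
  an uncontrolled way. In exchange, the other steps may lose no fixed power of \<open>n\<close>.
  Here lies the obstacle: Cauchy--Schwarz over the residues of \<open>y\<close> modulo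
  \<open>q\<close> alone is too expensive by a factor \<open>q\<close>, which no such gap repays.
  The remedy is that divisibility of \<open>\<alpha> * y * qcnj \<beta>\<close> by \<open>q\<close>
  does not change when \<open>y\<close> is multiplied by a unit \<open>c\<close> modulo
  \<open>q\<close>. Counting all \<open>c * y\<close> together multiplies the square of the sum by
  the squared number of units, but the collisions only by twice that number. Then
  \<open>q ^ 3\<close> times the number of pairs is what the gap has to beat, and for
  \<open>q ^ 3\<close> near \<open>n\<close> this is about \<open>n ^ 2\<close>, the square of the
  trivial bound. The Lipschitz order is the lattice of the statement itself. It is not Euclidean,
  but the failure sits at the prime 2, and the factorisation theory below concerns odd
  norms.\<close>

datatype quat = Quat (q0: int) (q1: int) (q2: int) (q3: int)

lemma quat_eq_iff: "x = y \<longleftrightarrow> q0 x = q0 y \<and> q1 x = q1 y \<and> q2 x = q2 y \<and> q3 x = q3 y"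
  by (cases x; cases y) auto

instantiation quat :: ring_1
begin

definition "0 = Quat 0 0 0 0"
definition "1 = Quat 1 0 0 0"
definition "x + y = Quat (q0 x + q0 y) (q1 x + q1 y) (q2 x + q2 y) (q3 x + q3 y)"
definition "x - y = Quat (q0 x - q0 y) (q1 x - q1 y) (q2 x - q2 y) (q3 x - q3 y)"
definition "- x = Quat (- q0 x) (- q1 x) (- q2 x) (- q3 x)"
definition "x * y = Quat
  (q0 x * q0 y - q1 x * q1 y - q2 x * q2 y - q3 x * q3 y)
  (q0 x * q1 y + q1 x * q0 y + q2 x * q3 y - q3 x * q2 y)
  (q0 x * q2 y - q1 x * q3 y + q2 x * q0 y + q3 x * q1 y)
  (q0 x * q3 y + q1 x * q2 y - q2 x * q1 y + q3 x * q0 y)"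

lemma quat_sel [simp]:
  "q0 0 = 0" "q1 0 = 0" "q2 0 = 0" "q3 0 = 0"
  "q0 1 = 1" "q1 1 = 0" "q2 1 = 0" "q3 1 = 0"
  "q0 (x + y) = q0 x + q0 y" "q1 (x + y) = q1 x + q1 y"
  "q2 (x + y) = q2 x + q2 y" "q3 (x + y) = q3 x + q3 y"
  "q0 (x - y) = q0 x - q0 y" "q1 (x - y) = q1 x - q1 y"
  "q2 (x - y) = q2 x - q2 y" "q3 (x - y) = q3 x - q3 y"
  "q0 (- x) = - q0 x" "q1 (- x) = - q1 x" "q2 (- x) = - q2 x" "q3 (- x) = - q3 x"
  "q0 (x * y) = q0 x * q0 y - q1 x * q1 y - q2 x * q2 y - q3 x * q3 y"
  "q1 (x * y) = q0 x * q1 y + q1 x * q0 y + q2 x * q3 y - q3 x * q2 y"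
  "q2 (x * y) = q0 x * q2 y - q1 x * q3 y + q2 x * q0 y + q3 x * q1 y"
  "q3 (x * y) = q0 x * q3 y + q1 x * q2 y - q2 x * q1 y + q3 x * q0 y"
  by (simp_all add: zero_quat_def one_quat_def plus_quat_def minus_quat_def uminus_quat_def times_quat_def)

instance
  by standard (auto simp: quat_eq_iff algebra_simps)

end

lemma of_nat_quat: "(of_nat n :: quat) = Quat (int n) 0 0 0"
  by (induction n) (auto simp: quat_eq_iff)

lemma of_int_quat: "(of_int m :: quat) = Quat m 0 0 0"
proof (cases m)
  case (nonneg n)
  then show ?thesis by (simp add: of_nat_quat)
next
  case (neg n)
  then show ?thesis
    using of_nat_quat[of "Suc n"] by (simp add: quat_eq_iff)
qed

lemma of_int_sel [simp]:
  "q0 (of_int m) = m" "q1 (of_int m) = 0" "q2 (of_int m) = 0" "q3 (of_int m) = 0"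
  by (simp_all add: of_int_quat)

lemma numeral_sel [simp]:
  "q0 (numeral k) = numeral k" "q1 (numeral k) = 0" "q2 (numeral k) = 0" "q3 (numeral k) = 0"
  using of_int_sel[of "numeral k"] by simp_all

lemma of_int_comm: "x * of_int m = of_int m * (x :: quat)"
  by (simp add: quat_eq_iff)

lemma of_int_mid: "x * (of_int m * y) = of_int m * (x * (y :: quat))"
  by (simp add: quat_eq_iff algebra_simps)

definition qcnj :: "quat \<Rightarrow> quat" where
  "qcnj x = Quat (q0 x) (- q1 x) (- q2 x) (- q3 x)"

definition nrm :: "quat \<Rightarrow> int" where
  "nrm x = (q0 x)\<^sup>2 + (q1 x)\<^sup>2 + (q2 x)\<^sup>2 + (q3 x)\<^sup>2"

definition tr :: "quat \<Rightarrow> int" where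
  "tr x = 2 * q0 x"

lemma cnj_sel [simp]:
  "q0 (qcnj x) = q0 x" "q1 (qcnj x) = - q1 x" "q2 (qcnj x) = - q2 x" "q3 (qcnj x) = - q3 x"
  by (simp_all add: qcnj_def)

lemma cnj_simps [simp]:
  "qcnj (qcnj x) = x" "qcnj 0 = 0" "qcnj 1 = 1" "qcnj (of_int m) = of_int m"
  "qcnj (x + y) = qcnj x + qcnj y" "qcnj (x - y) = qcnj x - qcnj y" "qcnj (- x) = - qcnj x"
  by (simp_all add: quat_eq_iff)

lemma cnj_mult: "qcnj (x * y) = qcnj y * qcnj x"
  by (simp add: quat_eq_iff algebra_simps)

lemma cnj_eq_iff [simp]: "qcnj x = qcnj y \<longleftrightarrow> x = y"
  by (metis cnj_simps(1))

lemma nrm_mult: "nrm (x * y) = nrm x * nrm y"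
  by (simp add: nrm_def power2_eq_square algebra_simps)

lemma nrm_cnj [simp]: "nrm (qcnj x) = nrm x"
  by (simp add: nrm_def)

lemma nrm_uminus [simp]: "nrm (- x) = nrm x"
  by (simp add: nrm_def)

lemma nrm_of_int [simp]: "nrm (of_int m) = m\<^sup>2"
  by (simp add: nrm_def)

lemma nrm_01 [simp]: "nrm 0 = 0" "nrm 1 = 1"
  by (simp_all add: nrm_def)

lemma nrm_ge_0 [simp]: "0 \<le> nrm x"
  by (simp add: nrm_def)

lemma nrm_eq_0_iff [simp]: "nrm x = 0 \<longleftrightarrow> x = 0"
proof
  assume "nrm x = 0"
  then have "(q0 x)\<^sup>2 = 0" "(q1 x)\<^sup>2 = 0" "(q2 x)\<^sup>2 = 0" "(q3 x)\<^sup>2 = 0"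
    unfolding nrm_def using zero_le_power2[of "q0 x"] zero_le_power2[of "q1 x"]
      zero_le_power2[of "q2 x"] zero_le_power2[of "q3 x"] by linarith+
  then show "x = 0" by (simp add: quat_eq_iff)
qed auto

lemma nrm_pos_iff: "0 < nrm x \<longleftrightarrow> x \<noteq> 0"
  using nrm_ge_0[of x] nrm_eq_0_iff[of x] by linarith

lemma mult_cnj: "x * qcnj x = of_int (nrm x)" "qcnj x * x = of_int (nrm x)"
  by (simp_all add: quat_eq_iff nrm_def power2_eq_square algebra_simps)

lemma mult_cnj': "x * (qcnj x * y) = of_int (nrm x) * y" "qcnj x * (x * y) = of_int (nrm x) * y"
  by (simp_all add: mult_cnj mult.assoc[symmetric])

lemma quat_mult_eq_0: "x * y = 0 \<longleftrightarrow> x = 0 \<or> y = (0::quat)"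
  by (metis mult_eq_0_iff mult_zero_left mult_zero_right nrm_eq_0_iff nrm_mult)

lemma quat_cancel_left: "x \<noteq> (0::quat) \<Longrightarrow> x * y = x * z \<longleftrightarrow> y = z"
  using quat_mult_eq_0[of x "y - z"] by (simp add: right_diff_distrib)

lemma quat_cancel_right: "x \<noteq> (0::quat) \<Longrightarrow> y * x = z * x \<longleftrightarrow> y = z"
  using quat_mult_eq_0[of "y - z" x] by (simp add: left_diff_distrib)

lemma of_int_cancel: "m \<noteq> 0 \<Longrightarrow> of_int m * y = of_int m * z \<longleftrightarrow> y = (z::quat)"
  by (simp add: quat_eq_iff)

lemma tr_comm: "tr (x * y) = tr (y * x)"
  by (simp add: tr_def algebra_simps)

section \<open>Divisibility of quaternions by integers\<close>

definition qdvd :: "int \<Rightarrow> quat \<Rightarrow> bool" where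
  "qdvd m x \<longleftrightarrow> m dvd q0 x \<and> m dvd q1 x \<and> m dvd q2 x \<and> m dvd q3 x"

lemma qdvd_iff: "qdvd m x \<longleftrightarrow> (\<exists>y. x = of_int m * y)"
proof
  assume "qdvd m x"
  then obtain a b c d where "q0 x = m * a" "q1 x = m * b" "q2 x = m * c" "q3 x = m * d"
    unfolding qdvd_def dvd_def by blast
  then have "x = of_int m * Quat a b c d" by (simp add: quat_eq_iff)
  then show "\<exists>y. x = of_int m * y" ..
qed (auto simp: qdvd_def)

lemma qdvdE: "qdvd m x \<Longrightarrow> (\<And>y. x = of_int m * y \<Longrightarrow> P) \<Longrightarrow> P"
  using qdvd_iff by blast

lemma qdvd_add: "qdvd m x \<Longrightarrow> qdvd m y \<Longrightarrow> qdvd m (x + y)"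
  and qdvd_diff: "qdvd m x \<Longrightarrow> qdvd m y \<Longrightarrow> qdvd m (x - y)"
  and qdvd_minus [simp]: "qdvd m (- x) \<longleftrightarrow> qdvd m x"
  and qdvd_0 [simp]: "qdvd m 0"
  and qdvd_cnj [simp]: "qdvd m (qcnj x) \<longleftrightarrow> qdvd m x"
  and qdvd_triv [simp]: "qdvd m (of_int m * x)"
  and qdvd_1 [simp]: "qdvd 1 x"
  by (auto simp: qdvd_def)

lemma qdvd_multl: "qdvd m x \<Longrightarrow> qdvd m (y * x)"
  and qdvd_multr: "qdvd m x \<Longrightarrow> qdvd m (x * y)"
  by (auto simp: qdvd_def intro!: dvd_add dvd_diff)

lemma qdvd_of_int_dvd: "m dvd c \<Longrightarrow> qdvd m (of_int c * x)"
  by (auto simp: qdvd_def)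

lemma qdvd_of_int_coprime: "coprime m c \<Longrightarrow> qdvd m (of_int c * x) \<longleftrightarrow> qdvd m x"
  by (simp add: qdvd_def coprime_dvd_mult_right_iff)

lemma qdvd_mult_cancel: "c \<noteq> 0 \<Longrightarrow> qdvd (c * m) (of_int c * x) \<longleftrightarrow> qdvd m x"
  by (simp add: qdvd_def)

lemma qdvd_nrm: "qdvd m x \<Longrightarrow> m\<^sup>2 dvd nrm x"
  by (auto simp: qdvd_def nrm_def intro!: dvd_add)

lemma finite_nrm: "finite {x. nrm x = n}"
proof -
  have b: "\<bar>a\<bar> \<le> n" if "a\<^sup>2 \<le> n" for a :: int
    using that abs_le_square_iff[of a n]
    by (smt (verit, ccfv_SIG) mult_left_mono power2_eq_square zero_le_power2 abs_mult_self_eq mult_le_cancel_right1)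
  have "{x. nrm x = n} \<subseteq> (\<lambda>(a,b,c,d). Quat a b c d) ` ({-n..n} \<times> {-n..n} \<times> {-n..n} \<times> {-n..n})"
  proof
    fix x assume "x \<in> {x. nrm x = n}"
    then have "(q0 x)\<^sup>2 + (q1 x)\<^sup>2 + (q2 x)\<^sup>2 + (q3 x)\<^sup>2 = n" by (simp add: nrm_def)
    then have "(q0 x)\<^sup>2 \<le> n" "(q1 x)\<^sup>2 \<le> n" "(q2 x)\<^sup>2 \<le> n" "(q3 x)\<^sup>2 \<le> n"
      using zero_le_power2[of "q0 x"] zero_le_power2[of "q1 x"]
      zero_le_power2[of "q2 x"] zero_le_power2[of "q3 x"] by linarith+
    then have "\<bar>q0 x\<bar> \<le> n" "\<bar>q1 x\<bar> \<le> n" "\<bar>q2 x\<bar> \<le> n" "\<bar>q3 x\<bar> \<le> n" using b by blast+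
    then show "x \<in> (\<lambda>(a,b,c,d). Quat a b c d) ` ({-n..n} \<times> {-n..n} \<times> {-n..n} \<times> {-n..n})"
      by (intro image_eqI[of _ _ "(q0 x, q1 x, q2 x, q3 x)"]) (auto simp: abs_le_iff)
  qed
  then show ?thesis by (rule finite_subset) auto
qed

abbreviation "qi \<equiv> Quat 0 1 0 0"
abbreviation "qj \<equiv> Quat 0 0 1 0"
abbreviation "qk \<equiv> Quat 0 0 0 1"

lemma card_units: "card {u. nrm u = 1} = 8"
proof -
  have "{u. nrm u = 1} = {Quat 1 0 0 0, Quat (-1) 0 0 0, Quat 0 1 0 0, Quat 0 (-1) 0 0,
     Quat 0 0 1 0, Quat 0 0 (-1) 0, Quat 0 0 0 1, Quat 0 0 0 (-1)}" (is "_ = ?S")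
  proof
    show "{u. nrm u = 1} \<subseteq> ?S"
    proof
      fix u assume "u \<in> {u. nrm u = 1}"
      then have e: "(q0 u)\<^sup>2 + (q1 u)\<^sup>2 + (q2 u)\<^sup>2 + (q3 u)\<^sup>2 = 1" by (simp add: nrm_def)
      have b: "a \<in> {-1,0,1}" if "a\<^sup>2 \<le> 1" for a :: int
        using that abs_square_le_1[of a] by auto
      have "q0 u \<in> {-1,0,1}" "q1 u \<in> {-1,0,1}" "q2 u \<in> {-1,0,1}" "q3 u \<in> {-1,0,1}"
        using e zero_le_power2[of "q0 u"] zero_le_power2[of "q1 u"]
      zero_le_power2[of "q2 u"] zero_le_power2[of "q3 u"] by (intro b; linarith)+
      then show "u \<in> ?S" using e by (cases u) (simp, elim disjE; simp)
    qed
  qed (auto simp: nrm_def)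
  then show ?thesis by simp
qed

section \<open>Division with remainder and generators of right ideals\<close>

lemma round_half: "\<exists>w::int. \<bar>2 * (a - t * w)\<bar> \<le> t" if "t > 0" for a t :: int
proof -
  define w where "w = (2 * a + t) div (2 * t)"
  have m: "(2 * a + t) = 2 * t * w + (2 * a + t) mod (2 * t)" by (simp add: w_def)
  have "0 \<le> (2 * a + t) mod (2 * t)" "(2 * a + t) mod (2 * t) < 2 * t" using that by auto
  then show ?thesis using m by (intro exI[of _ w]) (simp add: algebra_simps abs_le_iff)
qed

text \<open>The remainder fails to be strictly smaller only when all four coordinates of the quotient are half-integral.\<close>

lemma quat_division:
  assumes "y \<noteq> 0"
  obtains w where "nrm (z - y * w) < nrm y" | c where "2 * z = y * c"
proof -
  define t where "t = nrm y"
  have t: "t > 0" using assms by (simp add: t_def nrm_pos_iff)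
  define a where "a = qcnj y * z"
  obtain w0 w1 w2 w3 where w: "\<bar>2 * (q0 a - t * w0)\<bar> \<le> t" "\<bar>2 * (q1 a - t * w1)\<bar> \<le> t"
    "\<bar>2 * (q2 a - t * w2)\<bar> \<le> t" "\<bar>2 * (q3 a - t * w3)\<bar> \<le> t"
    using round_half[OF t] by metis
  define w where "w = Quat w0 w1 w2 w3"
  define r where "r = a - of_int t * w"
  have r: "qcnj y * (z - y * w) = r"
    by (simp add: r_def a_def right_diff_distrib mult_cnj' t_def)
  have nr: "t * nrm (z - y * w) = nrm r"
    using arg_cong[OF r, of nrm] by (simp add: nrm_mult t_def)
  have s: "(2 * q0 r)\<^sup>2 \<le> t\<^sup>2" "(2 * q1 r)\<^sup>2 \<le> t\<^sup>2" "(2 * q2 r)\<^sup>2 \<le> t\<^sup>2" "(2 * q3 r)\<^sup>2 \<le> t\<^sup>2"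
    using w t by (auto simp: r_def w_def abs_le_square_iff[symmetric])
  have four: "4 * nrm r = (2 * q0 r)\<^sup>2 + (2 * q1 r)\<^sup>2 + (2 * q2 r)\<^sup>2 + (2 * q3 r)\<^sup>2"
    by (simp add: nrm_def power2_eq_square)
  show thesis
  proof (cases "nrm r < t\<^sup>2")
    case True
    then have "nrm (z - y * w) < t" using nr t by (simp add: power2_eq_square) (metis mult_less_cancel_left_pos)
    then show thesis using that(1) by (simp add: t_def)
  next
    \<comment> \<open>Four squares, each at most \<open>t\<^sup>2\<close>, add up to at least
      \<open>4 * t\<^sup>2\<close>: all of them are equal to \<open>t\<^sup>2\<close>, so
      \<open>t\<close> divides \<open>2 * r\<close>.\<close>
    case False
    then have "(2 * q0 r)\<^sup>2 = t\<^sup>2" "(2 * q1 r)\<^sup>2 = t\<^sup>2" "(2 * q2 r)\<^sup>2 = t\<^sup>2" "(2 * q3 r)\<^sup>2 = t\<^sup>2"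
      using s four by linarith+
    then have "qdvd t (2 * r)"
      unfolding power2_eq_iff qdvd_def by auto
    then obtain e where e: "2 * r = of_int t * e" by (rule qdvdE)
    have "of_int t * (2 * (z - y * w)) = y * (qcnj y * (2 * (z - y * w)))"
      by (simp only: mult_cnj' t_def)
    also have "\<dots> = y * (2 * (qcnj y * (z - y * w)))"
      using of_int_mid[of "qcnj y" 2 "z - y * w"] by simp
    also have "\<dots> = of_int t * (y * e)" by (simp add: r e of_int_mid)
    finally have "2 * (z - y * w) = y * e" using t by (simp add: of_int_cancel)
    then have "2 * z = y * (e + 2 * w)"
      using of_int_mid[of y 2 w] by (simp add: algebra_simps)
    then show thesis by (rule that(2))
  qed
qed

text \<open>An even norm has an even number of odd coordinates, so the coordinates split into two
  pairs of even sum; the pairing selects \<open>1 + i\<close>, \<open>1 + j\<close> or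
  \<open>1 + k\<close> as \<open>e\<close>. The resulting \<open>y'\<close> has half the norm of
  \<open>y\<close>.\<close>

lemma even_nrm_split:
  assumes "even (nrm y)"
  obtains e y' where "2 * y' = y * e" "nrm e = 2"
proof -
  have p: "even (q0 y + q1 y + q2 y + q3 y)"
    using assms by (simp add: nrm_def)
  consider "even (q0 y + q1 y)" "even (q2 y + q3 y)" | "even (q0 y + q2 y)" "even (q1 y + q3 y)"
    | "even (q0 y + q3 y)" "even (q1 y + q2 y)"
    using p by fastforce
  then show thesis
  proof cases
    case 1
    then have "qdvd 2 (y * Quat 1 1 0 0)" by (auto simp: qdvd_def)
    then obtain y' where "y * Quat 1 1 0 0 = of_int 2 * y'" by (rule qdvdE)
    then show thesis by (intro that[of y' "Quat 1 1 0 0"]) (auto simp: nrm_def)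
  next
    case 2
    then have "qdvd 2 (y * Quat 1 0 1 0)" by (auto simp: qdvd_def)
    then obtain y' where "y * Quat 1 0 1 0 = of_int 2 * y'" by (rule qdvdE)
    then show thesis by (intro that[of y' "Quat 1 0 1 0"]) (auto simp: nrm_def)
  next
    case 3
    then have "qdvd 2 (y * Quat 1 0 0 1)" by (auto simp: qdvd_def)
    then obtain y' where "y * Quat 1 0 0 1 = of_int 2 * y'" by (rule qdvdE)
    then show thesis by (intro that[of y' "Quat 1 0 0 1"]) (auto simp: nrm_def)
  qed
qed

text \<open>\<open>y\<close> is an element of minimal norm of the right ideal generated by \<open>x\<close> and \<open>m\<close>.\<close>

lemma ideal_generator:
  assumes m: "odd m" "m > 0" "m dvd nrm x"
    and prim: "\<And>r. prime r \<Longrightarrow> r dvd m \<Longrightarrow> \<not> qdvd r x"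
  obtains y a b d where "nrm y = m" "y = x * a + of_int m * b" "x = y * d"
proof -
  define J where "J = {x * a + of_int m * b | a b. True}"
  have J_mult: "z * c \<in> J" if z: "z \<in> J" for z c
  proof -
    obtain a b where "z = x * a + of_int m * b" using z by (auto simp: J_def)
    then have "z * c = x * (a * c) + of_int m * (b * c)" by (simp add: algebra_simps)
    then show ?thesis by (auto simp: J_def)
  qed
  have J_diff: "z - w \<in> J" if zw: "z \<in> J" "w \<in> J" for z w
  proof -
    obtain a b a' b' where "z = x * a + of_int m * b" "w = x * a' + of_int m * b'"
      using zw by (auto simp: J_def)
    then have "z - w = x * (a - a') + of_int m * (b - b')" by (simp add: algebra_simps)
    then show ?thesis by (auto simp: J_def)
  qed
  have J_m: "of_int m * b \<in> J" for b
    by (force simp: J_def intro: exI[of _ 0])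
  have "x = x * 1 + of_int m * 0" by simp
  then have J_x: "x \<in> J" unfolding J_def by blast
  \<comment> \<open>As \<open>m\<close> is odd and all multiples of \<open>m\<close> belong to
    \<open>J\<close>, halving does not leave \<open>J\<close>. This repairs the factor 2 in the bad
    case of the division.\<close>
  have half: "z \<in> J" if "2 * z \<in> J" for z
  proof -
    obtain k where k: "m = 2 * k + 1" using m(1) by (auto elim: oddE)
    have "z = of_int m * z - 2 * z * of_int k" by (simp add: k quat_eq_iff algebra_simps)
    then show ?thesis using J_diff[OF J_m J_mult[OF that]] by metis
  qed
  have J_dvd: "m dvd nrm z" if zJ: "z \<in> J" for z
  proof -
    obtain a b where z: "z = x * a + of_int m * b" using zJ by (auto simp: J_def)
    have "nrm z = nrm (x * a) + m * (tr (x * a * qcnj b) + m * nrm b)"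
      by (simp add: z nrm_def tr_def power2_eq_square algebra_simps)
    then show ?thesis using m(3) by (simp add: nrm_mult)
  qed
  have ex: "of_int m \<in> J \<and> of_int m \<noteq> (0::quat)"
    using J_m[of 1] m(2) by (auto simp: quat_eq_iff)
  obtain y where y: "y \<in> J" "y \<noteq> 0" and ymin: "\<And>z. z \<in> J \<Longrightarrow> z \<noteq> 0 \<Longrightarrow> nrm y \<le> nrm z"
    using ex_has_least_nat[of "\<lambda>z. z \<in> J \<and> z \<noteq> 0" _ "\<lambda>z. nat (nrm z)", OF ex]
    by (metis nat_le_eq_zle nrm_ge_0 nat_mono nat_0_le)
  have two: "\<exists>c. 2 * z = y * c" if "z \<in> J" for z
  proof (rule quat_division[OF y(2), of z])
    fix w assume "nrm (z - y * w) < nrm y"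
    moreover have "z - y * w \<in> J" using that y J_diff J_mult by blast
    ultimately have "z - y * w = 0" using ymin by force
    then have "2 * z = y * (2 * w)" using of_int_mid[of y 2 w] by simp
    then show ?thesis by blast
  qed blast
  \<comment> \<open>The aim is \<open>s = 1\<close>. An odd prime in \<open>s\<close> would divide
    both \<open>x\<close> and \<open>m\<close>; a factor 4 or 2 would produce a smaller element of
    \<open>J\<close>, by halving \<open>y\<close> or by \<open>even_nrm_split\<close>.\<close>
  obtain s where s: "nrm y = m * s" using J_dvd[OF y(1)] by (auto elim: dvdE)
  have s0: "s > 0" using s y(2) m(2) nrm_pos_iff[of y] by (simp add: zero_less_mult_iff)
  obtain b where b: "2 * of_int m = y * b" using two[of "of_int m"] ex by blast
  obtain c where c: "2 * x = y * c" using two[OF J_x] by blast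
  have sb: "of_int s * b = 2 * qcnj y"
  proof -
    have "of_int m * (of_int s * b) = qcnj y * (y * b)" by (simp add: mult_cnj' s mult.assoc)
    also have "\<dots> = of_int m * (2 * qcnj y)"
      unfolding b[symmetric] by (simp add: quat_eq_iff)
    finally show ?thesis using m(2) by (simp add: of_int_cancel)
  qed
  have odd_s: "\<not> prime r" if "odd r" "r dvd s" for r
  proof
    assume r: "prime r"
    have cop: "coprime r 2" using that(1) by simp
    have "qdvd r (of_int 2 * qcnj y)" using sb qdvd_of_int_dvd[OF that(2), of b] by simp
    then have ry: "qdvd r y" using qdvd_of_int_coprime[OF cop] by simp
    have "qdvd r (of_int 2 * x)" using c qdvd_multr[OF ry, of c] by simp
    then have rx: "qdvd r x" using qdvd_of_int_coprime[OF cop] by simp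
    have "qdvd r (of_int 2 * of_int m)" using b qdvd_multr[OF ry, of b] by simp
    then have "qdvd r (of_int m)" using qdvd_of_int_coprime[OF cop] by blast
    then have "r dvd m" by (simp add: qdvd_def)
    then show False using prim[OF r] rx by blast
  qed
  have not4: "\<not> 4 dvd s"
  proof
    assume "4 dvd s"
    then obtain t where t: "s = 4 * t" by (auto elim: dvdE)
    have "of_int 2 * (of_int (2 * t) * b) = of_int 2 * qcnj y"
      using sb by (simp add: t mult.assoc)
    then have "of_int (2 * t) * b = qcnj y" by (subst (asm) of_int_cancel) auto
    then have "qdvd 2 (qcnj y)" using qdvd_of_int_dvd[of 2 "2 * t" b] by simp
    then have "qdvd 2 y" by simp
    then obtain y' where y': "y = of_int 2 * y'" by (rule qdvdE)
    then have "y' \<in> J" using half y(1) by simp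
    moreover have "y' \<noteq> 0" "nrm y = 4 * nrm y'" using y(2) by (auto simp: y' nrm_mult simp del: of_int_numeral)
    ultimately show False using ymin[of y'] nrm_pos_iff[of y'] by linarith
  qed
  have "s = 1 \<or> s = 2"
  proof (rule ccontr)
    assume "\<not> ?thesis"
    then have s2: "s \<ge> 3" using s0 by linarith
    obtain j where j: "s = 2 * j \<or> s = 2 * j + 1" by (metis evenE oddE)
    define u where "u = (if even s then s div 2 else s)"
    have "odd u" using not4 unfolding u_def by (auto elim!: evenE)
    moreover have "u dvd s" by (auto simp: u_def)
    moreover have "\<bar>u\<bar> \<noteq> 1" using s2 by (auto simp: u_def)
    moreover have "u \<noteq> 0" using \<open>odd u\<close> by auto
    ultimately obtain r where "prime r" "r dvd u" using prime_divisor_exists[of u] by auto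
    moreover have "odd r" using \<open>odd u\<close> \<open>r dvd u\<close> by (auto elim: dvdE)
    ultimately show False using odd_s \<open>u dvd s\<close> dvd_trans by blast
  qed
  moreover have "s \<noteq> 2"
  proof
    assume s2: "s = 2"
    then have "even (nrm y)" by (simp add: s)
    then obtain e y' where e: "2 * y' = y * e" "nrm e = 2" by (rule even_nrm_split)
    then have "y' \<in> J" using half J_mult y(1) by metis
    have "nrm (of_int 2 * y') = nrm y * 2" using e by (simp add: nrm_mult del: nrm_of_int)
    then have "4 * nrm y' = nrm y * 2" by (simp add: nrm_mult del: of_int_numeral)
    then have "2 * nrm y' = nrm y" by linarith
    moreover have "y' \<noteq> 0" using calculation y(2) by auto
    ultimately show False using ymin[OF \<open>y' \<in> J\<close>] nrm_pos_iff[of y'] by linarith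
  qed
  ultimately have l2norm: "nrm y = m" using s by simp
  obtain k where k: "m = 2 * k + 1" using m(1) by (auto elim: oddE)
  \<comment> \<open>Both \<open>2 * x\<close> and \<open>m = y * qcnj y\<close> are left-divisible
    by \<open>y\<close>, and \<open>m\<close> is odd; hence so is \<open>x\<close>.\<close>
  have "x = of_int m * x - of_int k * (2 * x)" by (simp add: k quat_eq_iff algebra_simps)
  also have "\<dots> = y * (qcnj y * x - of_int k * c)"
    by (simp add: c right_diff_distrib mult_cnj' l2norm of_int_mid)
  finally have "x = y * (qcnj y * x - of_int k * c)" .
  moreover obtain a b' where "y = x * a + of_int m * b'" using y(1) by (auto simp: J_def)
  ultimately show thesis using that l2norm by metis
qed

section \<open>Factors of prescribed norm\<close>

definition left_factors :: "int \<Rightarrow> quat \<Rightarrow> quat set" where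
  "left_factors m x = {y. nrm y = m \<and> (\<exists>d. x = y * d)}"

definition right_factors :: "int \<Rightarrow> quat \<Rightarrow> quat set" where
  "right_factors m x = {y. nrm y = m \<and> (\<exists>d. x = d * y)}"

lemma left_factors_cnj: "left_factors m (qcnj x) = qcnj ` right_factors m x"
proof -
  have "qcnj y \<in> left_factors m (qcnj x) \<longleftrightarrow> y \<in> right_factors m x" for y
    unfolding left_factors_def right_factors_def mem_Collect_eq nrm_cnj by (metis cnj_mult cnj_simps(1))
  then have "z \<in> left_factors m (qcnj x) \<longleftrightarrow> z \<in> qcnj ` right_factors m x" for z
    using image_iff[of z qcnj "right_factors m x"] cnj_simps(1)[of z] by (metis cnj_simps(1))
  then show ?thesis by blast
qed

text \<open>A left factor \<open>z\<close> of norm \<open>m\<close> divides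
  \<open>m = z * qcnj z\<close> as well as \<open>x\<close>, hence also the generator
  \<open>y\<close> of the right ideal of \<open>x\<close> and \<open>m\<close>. Equal norms make the
  quotient a unit, so the factors form one coset of the eight units.\<close>

lemma left_factors_eq:
  assumes "odd m" "m > 0" "m dvd nrm x" "\<And>r. prime r \<Longrightarrow> r dvd m \<Longrightarrow> \<not> qdvd r x"
  obtains y where "nrm y = m" "left_factors m x = (\<lambda>u. y * u) ` {u. nrm u = 1}"
proof -
  obtain y a b d where y: "nrm y = m" "y = x * a + of_int m * b" "x = y * d"
    using ideal_generator[OF assms] by metis
  have "left_factors m x = (\<lambda>u. y * u) ` {u. nrm u = 1}"
  proof (intro Set.set_eqI iffI)
    fix z assume "z \<in> left_factors m x"
    then obtain d' where z: "nrm z = m" "x = z * d'" by (auto simp: left_factors_def)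
    have "y = z * (d' * a + qcnj z * b)"
      using mult_cnj(1)[of z] by (simp add: y(2) z algebra_simps mult_cnj')
    then obtain c where c: "y = z * c" by blast
    then have "nrm c = 1" using assms(2) y(1) z(1) by (simp add: nrm_mult)
    then have "z = y * qcnj c" by (simp add: c mult.assoc mult_cnj)
    then show "z \<in> (\<lambda>u. y * u) ` {u. nrm u = 1}" using \<open>nrm c = 1\<close> by force
  next
    fix z assume "z \<in> (\<lambda>u. y * u) ` {u. nrm u = 1}"
    then obtain u where u: "nrm u = 1" "z = y * u" by auto
    have "x = z * (qcnj u * d)" by (simp add: u mult.assoc mult_cnj' y(3))
    then show "z \<in> left_factors m x" using u y(1) by (auto simp: left_factors_def nrm_mult)
  qed
  then show thesis using that y(1) by blast
qed

lemma card_left_factors: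
  assumes "odd m" "m > 0" "m dvd nrm x" "\<And>r. prime r \<Longrightarrow> r dvd m \<Longrightarrow> \<not> qdvd r x"
  shows "card (left_factors m x) = 8"
proof -
  obtain y where y: "nrm y = m" "left_factors m x = (\<lambda>u. y * u) ` {u. nrm u = 1}"
    using left_factors_eq[OF assms] by metis
  have "y \<noteq> 0" using y(1) assms(2) by auto
  then have "inj_on (\<lambda>u. y * u) {u. nrm u = 1}" by (auto simp: inj_on_def quat_cancel_left)
  then show ?thesis by (simp add: y card_image card_units)
qed

lemma card_right_factors:
  assumes "odd m" "m > 0" "m dvd nrm x" "\<And>r. prime r \<Longrightarrow> r dvd m \<Longrightarrow> \<not> qdvd r x"
  shows "card (right_factors m x) = 8"
proof -
  have "card (left_factors m (qcnj x)) = 8" using assms by (intro card_left_factors) auto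
  moreover have "card (left_factors m (qcnj x)) = card (right_factors m x)"
    unfolding left_factors_cnj by (intro card_image) (auto simp: inj_on_def)
  ultimately show ?thesis by simp
qed

lemma fiber_sum:
  fixes F :: "'b \<Rightarrow> real"
  assumes "finite S" "finite T" "g ` S \<subseteq> T" "\<And>y. y \<in> T \<Longrightarrow> card {x \<in> S. g x = y} = c"
  shows "(\<Sum>x\<in>S. F (g x)) = real c * (\<Sum>y\<in>T. F y)"
proof -
  have "(\<Sum>x\<in>S. F (g x)) = (\<Sum>y\<in>T. \<Sum>x\<in>{x \<in> S. g x = y}. F (g x))"
    using sum.group[OF assms(1-3), of "\<lambda>x. F (g x)"] by simp
  also have "\<dots> = (\<Sum>y\<in>T. real (card {x \<in> S. g x = y}) * F y)"
    by (intro sum.cong refl) simp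
  also have "\<dots> = real c * (\<Sum>y\<in>T. F y)"
    using assms(4) by (simp add: sum_distrib_left)
  finally show ?thesis .
qed

text \<open>Pigeonhole: with \<open>r = 2 * h + 1\<close>, the residues of \<open>x\<^sup>2\<close>
  and of \<open>c - y\<^sup>2\<close> over \<open>0..h\<close> are \<open>h + 1\<close> each, too
  many to be disjoint.\<close>

lemma sum_two_squares_mod:
  fixes r c :: int
  assumes "prime r" "odd r"
  obtains x y where "r dvd x\<^sup>2 + y\<^sup>2 - c"
proof -
  have r: "r > 2" using assms prime_ge_2_int[of r] by (cases "r = 2") auto
  obtain h where h: "r = 2 * h + 1" using assms(2) by (auto elim: oddE)
  have h0: "h > 0" using r h by simp
  have inj: "x = y" if "x \<in> {0..h}" "y \<in> {0..h}" "r dvd x\<^sup>2 - y\<^sup>2" for x y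
  proof -
    have "r dvd (x - y) * (x + y)" using that(3) by (simp add: power2_eq_square algebra_simps)
    then have "r dvd x - y \<or> r dvd x + y" using assms(1) prime_dvd_mult_iff by blast
    then show ?thesis
    proof
      assume "r dvd x - y"
      moreover have "\<bar>x - y\<bar> < r" using that h by auto
      ultimately show ?thesis using dvd_imp_le_int[of "x - y" r] r by force
    next
      assume "r dvd x + y"
      moreover have "\<bar>x + y\<bar> < r" using that h by auto
      ultimately have "x + y = 0" using dvd_imp_le_int[of "x + y" r] r by force
      then show ?thesis using that by auto
    qed
  qed
  define A where "A = (\<lambda>x. x\<^sup>2 mod r) ` {0..h}"
  define B where "B = (\<lambda>y. (c - y\<^sup>2) mod r) ` {0..h}"
  have "inj_on (\<lambda>x. x\<^sup>2 mod r) {0..h}"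
    by (intro inj_onI inj) (auto simp: mod_eq_dvd_iff)
  then have cA: "int (card A) = h + 1" using h0 by (simp add: A_def card_image)
  have "inj_on (\<lambda>y. (c - y\<^sup>2) mod r) {0..h}"
  proof (intro inj_onI)
    fix x y assume "x \<in> {0..h}" "y \<in> {0..h}" "(c - x\<^sup>2) mod r = (c - y\<^sup>2) mod r"
    then show "x = y" using inj[of y x] by (auto simp: mod_eq_dvd_iff)
  qed
  then have cB: "int (card B) = h + 1" using h0 by (simp add: B_def card_image)
  have "A \<inter> B \<noteq> {}"
  proof
    assume "A \<inter> B = {}"
    then have "card (A \<union> B) = card A + card B"
      by (intro card_Un_disjoint) (auto simp: A_def B_def)
    moreover have "A \<union> B \<subseteq> {0..<r}" using r by (auto simp: A_def B_def)
    then have "card (A \<union> B) \<le> card {0..<r}" by (intro card_mono) auto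
    ultimately show False using cA cB h h0 by simp
  qed
  then obtain x y where "x\<^sup>2 mod r = (c - y\<^sup>2) mod r" by (auto simp: A_def B_def)
  then have "r dvd x\<^sup>2 + y\<^sup>2 - c" by (simp add: mod_eq_dvd_iff algebra_simps)
  then show thesis by (rule that)
qed

text \<open>Conjugating \<open>c * v\<close> by 1, i, j, k and adding leaves four times its real
  part. This turns divisibility of all \<open>u * \<kappa> * v\<close> into a statement about scalar
  multiples of \<open>u\<close>.\<close>

lemma conj_average:
  "u * (1 * c) * v + u * (qi * c) * v * qcnj qi + u * (qj * c) * v * qcnj qj + u * (qk * c) * v * qcnj qk
    = of_int (4 * q0 (c * v)) * u"
  by (simp add: quat_eq_iff algebra_simps)

text \<open>Modulo an odd prime the quaternions form a full matrix ring, in which zero is a prime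
  ideal. By the averaging identity, if all products vanish then so do all
  \<open>4 * q0 (c * v) * u\<close>, hence the real parts of all \<open>c * v\<close>, hence
  \<open>v\<close>.\<close>

lemma quat_prime:
  assumes r: "prime r" "odd r" and u: "\<not> qdvd r u" and v: "\<not> qdvd r v"
  obtains \<kappa> where "\<not> qdvd r (u * \<kappa> * v)"
proof (rule ccontr)
  assume "\<not> thesis"
  then have all: "qdvd r (u * \<kappa> * v)" for \<kappa> using that by blast
  have r4: "coprime r 4"
    using r(2) by (metis coprime_power_right_iff coprime_right_2_iff_odd power2_eq_square numeral_times_numeral
        mult_2 numeral_code(2) one_add_one numeral_plus_numeral semiring_norm(2))
  have "r dvd q0 (c * v)" for c
  proof (rule ccontr)
    assume "\<not> r dvd q0 (c * v)"
    then have "coprime r (4 * q0 (c * v))"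
      using r4 r(1) by (simp only: coprime_mult_right_iff prime_imp_coprime not_False_eq_True simp_thms)
    moreover have "qdvd r (of_int (4 * q0 (c * v)) * u)"
      unfolding conj_average[symmetric]
      by (intro qdvd_add qdvd_multr[of r "_ * _ * _"] all)
    ultimately show False using u qdvd_of_int_coprime by blast
  qed
  from this[of 1] this[of qi] this[of qj] this[of qk] have "qdvd r v" by (simp add: qdvd_def)
  then show False using v by simp
qed

text \<open>Nondegeneracy of the trace form at an odd prime. A trace prime to \<open>l\<close> is a
  unit modulo every \<open>l ^ k\<close>, which makes the later rank one arguments
  reversible.\<close>

lemma tr_witness:
  assumes r: "prime r" "odd r" and u: "\<not> qdvd r u"
  obtains g where "\<not> r dvd tr (u * g)"
proof (rule ccontr)
  assume "\<not> thesis"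
  then have all: "r dvd tr (u * g)" for g using that by blast
  have "coprime r 2" using r(2) by simp
  then have "r dvd q0 (u * g)" for g using all[of g] unfolding tr_def by (simp only: coprime_dvd_mult_right_iff)
  from this[of 1] this[of qi] this[of qj] this[of qk] have "qdvd r u" by (simp add: qdvd_def)
  then show False using u by simp
qed

text \<open>Modulo \<open>nrm a\<close> the element \<open>a\<close> behaves like a matrix of rank one.\<close>

lemma rank_one: "a * z * a = of_int (tr (a * z)) * a - of_int (nrm a) * qcnj z"
  by (simp add: quat_eq_iff tr_def nrm_def power2_eq_square algebra_simps)

text \<open>For matrices of rank one the two hypotheses say that \<open>u\<close> and
  \<open>v\<close> have the same kernel and the same image. Then they are proportional, and the
  traces against \<open>g\<close> give the ratio.\<close>

lemma proportional_tr:
  assumes "qdvd m (u * qcnj v)" "qdvd m (qcnj u * v)"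
  shows "qdvd m (of_int (tr (u * g)) * v - of_int (tr (v * g)) * u)"
proof -
  have "of_int (tr (u * g)) * v - of_int (tr (v * g)) * u = qcnj g * (qcnj u * v) - (u * qcnj v) * qcnj g"
    by (simp add: quat_eq_iff tr_def algebra_simps)
  then show ?thesis using assms by (simp add: qdvd_diff qdvd_multl qdvd_multr)
qed

lemma inverse_mod:
  fixes c m :: int
  assumes "coprime c m"
  obtains c' k where "c' * c = 1 + m * k"
proof -
  obtain c' where "[c * c' = 1] (mod m)" using cong_solve_coprime_int[OF assms] by blast
  then obtain k where "c * c' - 1 = m * k" by (auto simp: cong_iff_dvd_diff elim: dvdE)
  then show thesis using that[of c' k] by (simp add: algebra_simps)
qed

text \<open>Multiples of \<open>m = qcnj a * a\<close> have \<open>a\<close> as a right factor, so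
  divisibility by \<open>a\<close> may be tested modulo \<open>m\<close>, and up to a unit
  \<open>c\<close>.\<close>

lemma right_factor_cong:
  assumes "nrm a = m" "coprime c m" "qdvd m (of_int c * y - x * a)"
  obtains d where "y = d * a"
proof -
  obtain c' k where c': "c' * c = 1 + m * k" using inverse_mod[OF assms(2)] by metis
  obtain w where w: "of_int c * y - x * a = of_int m * w" using assms(3) by (rule qdvdE)
  have 1: "of_int m * z = (z * qcnj a) * a" for z
    by (simp add: mult.assoc mult_cnj assms(1) of_int_comm)
  have "y = of_int (c' * c) * y - of_int m * (of_int k * y)"
    unfolding c' by (simp add: quat_eq_iff algebra_simps)
  also have "\<dots> = of_int c' * (x * a + of_int m * w) - of_int m * (of_int k * y)"
  proof -
    have "of_int c * y = x * a + of_int m * w" using w by (simp add: algebra_simps)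
    then show ?thesis by (simp only: of_int_mult mult.assoc)
  qed
  also have "\<dots> = (of_int c' * x + of_int c' * (w * qcnj a) - of_int k * (y * qcnj a)) * a"
    unfolding 1 by (simp add: algebra_simps)
  finally show thesis by (rule that)
qed

section \<open>Primitive quaternions and their factorisations\<close>

definition primitive :: "int \<Rightarrow> quat set" where
  "primitive n = {x. nrm x = n \<and> (\<forall>r. prime r \<longrightarrow> \<not> qdvd r x)}"

lemma finite_primitive: "finite (primitive n)"
  by (rule finite_subset[OF _ finite_nrm[of n]]) (auto simp: primitive_def)

text \<open>For prime \<open>l\<close> this is \<open>primitive (l ^ k)\<close>, because
  divisibility by \<open>r\<close> forces \<open>r\<^sup>2\<close> to divide the norm. Testing
  \<open>l\<close> alone suits arguments modulo \<open>l\<close>.\<close>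

definition primitive_pow :: "int \<Rightarrow> nat \<Rightarrow> quat set" where
  "primitive_pow l k = {x. nrm x = l ^ k \<and> \<not> qdvd l x}"

lemma finite_primitive_pow: "finite (primitive_pow l k)"
  by (rule finite_subset[OF _ finite_nrm[of "l^k"]]) (auto simp: primitive_pow_def)

definition quat_div :: "int \<Rightarrow> quat \<Rightarrow> quat" where
  "quat_div q x = Quat (q0 x div q) (q1 x div q) (q2 x div q) (q3 x div q)"

lemma quat_div: "q \<noteq> 0 \<Longrightarrow> quat_div q (of_int q * x) = x"
  by (simp add: quat_div_def quat_eq_iff)

locale odd_prime =
  fixes l :: int
  assumes prime_l: "prime l" and odd_l: "odd l"
begin

lemma l_gt_2: "l > 2"
  using prime_l odd_l prime_ge_2_int[of l] by (cases "l = 2") auto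

lemma l_pow_pos: "l ^ k > 0"
  using l_gt_2 by simp

lemma coprime_l: "\<not> l dvd a \<Longrightarrow> coprime a l"
  using prime_imp_coprime[OF prime_l, of a] coprime_commute by blast

lemma prime_dvd_l_pow: "prime r \<Longrightarrow> r dvd l ^ k \<Longrightarrow> r = l"
  using prime_l by (metis prime_dvd_power primes_dvd_imp_eq)

lemma card_left_factors_l: "l ^ i dvd nrm x \<Longrightarrow> \<not> qdvd l x \<Longrightarrow> card (left_factors (l ^ i) x) = 8"
  using odd_l l_pow_pos prime_dvd_l_pow by (intro card_left_factors) auto

lemma card_right_factors_l: "l ^ i dvd nrm x \<Longrightarrow> \<not> qdvd l x \<Longrightarrow> card (right_factors (l ^ i) x) = 8"
  using odd_l l_pow_pos prime_dvd_l_pow by (intro card_right_factors) auto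

lemma primitive_pow_0: "primitive_pow l 0 = {u. nrm u = 1}"
proof -
  have "\<not> qdvd l u" if "nrm u = 1" for u
  proof
    assume "qdvd l u"
    then have "l\<^sup>2 dvd 1" using qdvd_nrm[of l u] that by simp
    then have "l dvd 1" by (metis dvd_trans dvd_triv_left power2_eq_square)
    then show False using l_gt_2 by simp
  qed
  then show ?thesis by (auto simp: primitive_pow_def)
qed

lemma not_qdvd_norm_l: "nrm x = l \<Longrightarrow> \<not> qdvd l x"
proof
  assume "nrm x = l" "qdvd l x"
  then have "l * l dvd l * 1" using qdvd_nrm[of l x] by (simp add: power2_eq_square)
  then have "l dvd 1" using l_gt_2 by (subst (asm) dvd_times_left_cancel_iff) auto
  then show False using l_gt_2 by auto
qed

lemma primitive_pow_1: "primitive_pow l 1 = {x. nrm x = l}"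
  using not_qdvd_norm_l by (auto simp: primitive_pow_def)

text \<open>Jacobi's count for a prime norm. If \<open>l\<close> divides \<open>nrm D\<close> but
  not \<open>D\<close>, left multiplication by \<open>D\<close> modulo \<open>l\<close> has a plane
  as image. Its \<open>l + 1\<close> lines are spanned by the \<open>D * z\<close> with
  \<open>z\<close> in \<open>Z\<close>; each \<open>\<alpha>\<close> of norm \<open>l\<close> is a
  right factor of exactly one of these, and each of them has eight such factors.\<close>

lemma card_primitive_pow_1: "int (card (primitive_pow l 1)) = 8 * (l + 1)"
proof -
  obtain s' t' where st': "l dvd s'\<^sup>2 + t'\<^sup>2 - (-1)" using sum_two_squares_mod[OF prime_l odd_l] by metis
  obtain s t where st: "l dvd s\<^sup>2 + t\<^sup>2 + 1" and t: "\<not> l dvd t"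
  proof (cases "l dvd t'")
    case False
    then show thesis using that[of s' t'] st' by simp
  next
    case True
    have "\<not> l dvd s'"
    proof
      assume "l dvd s'"
      then have "l dvd s'\<^sup>2 + t'\<^sup>2" using True by (auto simp: power2_eq_square)
      then have "l dvd 1" using st' dvd_add_right_iff[of l "s'\<^sup>2 + t'\<^sup>2" 1] by simp
      then show False using l_gt_2 by auto
    qed
    then show thesis using that[of t' s'] st' by (simp add: add.commute)
  qed
  \<comment> \<open>A zero of the norm modulo \<open>l\<close>. That \<open>t\<close> is prime to
    \<open>l\<close> makes \<open>D\<close> and \<open>D * qi\<close> independent, so no
    \<open>D * z\<close> vanishes.\<close>
  define D where "D = Quat 1 s t 0"
  have "l dvd nrm D" using st by (simp add: D_def nrm_def algebra_simps)
  then have D: "l dvd nrm (D * z)" for z by (simp add: nrm_mult)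
  define Z where "Z = insert qi ((\<lambda>b. Quat 1 b 0 0) ` {0..<l})"
  have cZ: "int (card Z) = l + 1"
  proof -
    have "card Z = Suc (card ((\<lambda>b. Quat 1 b 0 0) ` {0..<l}))" unfolding Z_def by (subst card_insert_disjoint) auto
    also have "card ((\<lambda>b. Quat 1 b 0 0) ` {0..<l}) = card {0..<l}" by (intro card_image) (auto simp: inj_on_def)
    finally show ?thesis using l_gt_2 by simp
  qed
  have fZ: "finite Z" by (simp add: Z_def)
  have DZ: "\<not> qdvd l (D * z)" if "z \<in> Z" for z
    using that t by (auto simp: Z_def D_def qdvd_def)
  have D0: "qdvd l (qcnj (D * z) * (D * w))" for z w
  proof -
    have "qcnj (D * z) * (D * w) = of_int (nrm D) * (qcnj z * w)"
      by (simp add: cnj_mult mult.assoc mult_cnj' of_int_mid)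
    then show ?thesis using D[of 1] by (simp add: qdvd_of_int_dvd)
  qed
  have eq: "primitive_pow l 1 = (\<Union>z\<in>Z. right_factors l (D * z))"
  proof
    show "(\<Union>z\<in>Z. right_factors l (D * z)) \<subseteq> primitive_pow l 1" unfolding primitive_pow_1 by (auto simp: right_factors_def)
    show "primitive_pow l 1 \<subseteq> (\<Union>z\<in>Z. right_factors l (D * z))"
    proof
      fix \<alpha> assume "\<alpha> \<in> primitive_pow l 1"
      then have \<alpha>: "nrm \<alpha> = l" "\<not> qdvd l \<alpha>" by (auto simp: primitive_pow_def)
      \<comment> \<open>Some nonzero element of the plane has \<open>\<alpha>\<close> as a right
        factor; it remains to see which of the chosen lines contains it.\<close>
      have "\<not> qdvd l D" using DZ[of qi] qdvd_multr[of l D qi] by (auto simp: Z_def)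
      then obtain g where g: "\<not> qdvd l (D * g * \<alpha>)"
        using quat_prime[OF prime_l odd_l _ \<alpha>(2)] by metis
      define x where "x = g * \<alpha>"
      have gx: "\<not> qdvd l (D * x)" using g by (simp add: x_def mult.assoc)
      \<comment> \<open>With \<open>A\<close> inverse to \<open>t\<close> and
        \<open>B = - s * A\<close>, modulo \<open>l\<close> the product \<open>D * qj\<close> equals
        \<open>D * Quat A B 0 0\<close>, and \<open>D * qk\<close> equals
        \<open>D * Quat B (- A) 0 0\<close>. This rewrites \<open>D * x\<close> as
        \<open>D * Quat a b 0 0\<close>.\<close>
      have "coprime t l" using t coprime_l by blast
      then obtain A k where A: "A * t = 1 + l * k" using inverse_mod by metis
      define B where "B = - s * A"
      define a where "a = q0 x + A * q2 x + B * q3 x"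
      define b where "b = q1 x + B * q2 x - A * q3 x"
      obtain h where h: "s\<^sup>2 + t\<^sup>2 + 1 = l * h" using st by (auto elim: dvdE)
      have 1: "A - s * B + t = l * (A * h - t * k)"
      proof -
        have "A - s * B + t = A * (s\<^sup>2 + t\<^sup>2 + 1) - t * (A * t - 1)"
          by (simp add: B_def power2_eq_square algebra_simps)
        also have "\<dots> = A * (l * h) - t * ((1 + l * k) - 1)" by (simp only: h A)
        finally show ?thesis by (simp add: algebra_simps)
      qed
      have ab: "qdvd l (D * Quat a b 0 0 - D * x)"
      proof -
        define E where "E = A - s * B + t"
        define G where "G = A * t - 1"
        have EG: "l dvd E" "l dvd G" using 1 A by (simp_all add: E_def G_def)
        have "D * Quat a b 0 0 - D * x
          = Quat (E * q2 x) (- (E * q3 x)) (G * q2 x - s * (G * q3 x)) (s * (G * q2 x) + G * q3 x)"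
          by (simp add: quat_eq_iff D_def a_def b_def B_def E_def G_def algebra_simps)
        then show ?thesis using EG by (simp add: qdvd_def)
      qed
      show "\<alpha> \<in> (\<Union>z\<in>Z. right_factors l (D * z))"
      proof (cases "l dvd a")
        case False
        then have "coprime a l" using coprime_l by blast
        then obtain a' k' where a': "a' * a = 1 + l * k'" using inverse_mod by metis
        define z where "z = Quat 1 ((a' * b) mod l) 0 0"
        have "z \<in> Z" using l_gt_2 by (simp add: z_def Z_def)
        have "l dvd a * ((a' * b) mod l) - b"
        proof -
          have "[a * ((a' * b) mod l) = a * (a' * b)] (mod l)" by (simp add: cong_def mod_mult_right_eq)
          moreover have "a * (a' * b) - b = l * (k' * b)" using arg_cong[OF a', of "\<lambda>t. t * b"] by (simp add: algebra_simps)
          then have "[a * (a' * b) = b] (mod l)" by (simp add: cong_iff_dvd_diff)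
          ultimately show ?thesis by (meson cong_iff_dvd_diff cong_trans)
        qed
        then have "qdvd l (of_int a * z - Quat a b 0 0)" by (simp add: qdvd_def z_def)
        then have "qdvd l (D * (of_int a * z - Quat a b 0 0))" by (rule qdvd_multl)
        from qdvd_add[OF this ab] have "qdvd l (of_int a * (D * z) - (D * g) * \<alpha>)"
          by (simp add: right_diff_distrib of_int_mid x_def mult.assoc)
        then obtain d where "D * z = d * \<alpha>" using right_factor_cong[OF \<alpha>(1)] \<open>coprime a l\<close> by metis
        then have "\<alpha> \<in> right_factors l (D * z)" using \<alpha> by (auto simp: right_factors_def)
        then show ?thesis using \<open>z \<in> Z\<close> by blast
      next
        case True
        have lb: "\<not> l dvd b"
        proof
          assume "l dvd b"
          then have "qdvd l (Quat a b 0 0)" using True by (simp add: qdvd_def)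
          then have "qdvd l (D * Quat a b 0 0)" by (rule qdvd_multl)
          from qdvd_diff[OF this ab] have "qdvd l (D * x)" by simp
          then show False using gx by simp
        qed
        then have "coprime b l" using coprime_l by blast
        have "qdvd l (of_int b * qi - Quat a b 0 0)" using True by (simp add: qdvd_def)
        then have "qdvd l (D * (of_int b * qi - Quat a b 0 0))" by (rule qdvd_multl)
        from qdvd_add[OF this ab] have "qdvd l (of_int b * (D * qi) - (D * g) * \<alpha>)"
          by (simp add: right_diff_distrib of_int_mid x_def mult.assoc)
        then obtain d where "D * qi = d * \<alpha>" using right_factor_cong[OF \<alpha>(1)] \<open>coprime b l\<close> by metis
        then have "\<alpha> \<in> right_factors l (D * qi)" using \<alpha> by (auto simp: right_factors_def)
        then show ?thesis by (auto simp: Z_def)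
      qed
    qed
  qed
  \<comment> \<open>With a common right factor both products of \<open>D * z\<close> and
    \<open>D * w\<close> with a conjugate vanish modulo \<open>l\<close>, so the two are
    proportional. Comparing coordinates of the representatives gives equality.\<close>
  have disj: "z = w" if z: "z \<in> Z" and w: "w \<in> Z" and \<alpha>: "\<alpha> \<in> right_factors l (D * z)" "\<alpha> \<in> right_factors l (D * w)" for z w \<alpha>
  proof -
    obtain d d' where d: "D * z = d * \<alpha>" "D * w = d' * \<alpha>" "nrm \<alpha> = l" using \<alpha> by (auto simp: right_factors_def)
    have "D * z * qcnj (D * w) = of_int l * (d * qcnj d')"
      unfolding d(1,2) by (simp add: cnj_mult mult.assoc mult_cnj' d of_int_mid)
    then have "qdvd l (D * z * qcnj (D * w))" by simp
    from proportional_tr[OF this D0]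
    have pr: "qdvd l (of_int (tr (D * z * g)) * (D * w) - of_int (tr (D * w * g)) * (D * z))" for g .
    obtain g where g: "\<not> l dvd tr (D * z * g)" using tr_witness[OF prime_l odd_l DZ[OF z]] by metis
    define c c' where "c = tr (D * z * g)" and "c' = tr (D * w * g)"
    have c: "\<not> l dvd c" "qdvd l (of_int c * (D * w) - of_int c' * (D * z))" using g pr by (auto simp: c_def c'_def)
    have P: "l dvd x * y \<longleftrightarrow> l dvd x \<or> l dvd y" for x y using prime_l by (simp add: prime_dvd_mult_iff)
    show "z = w"
    proof (cases "z = qi")
      case zi: True
      show ?thesis
      proof (rule ccontr)
        assume "z \<noteq> w"
        then obtain b where b: "w = Quat 1 b 0 0" using w zi by (auto simp: Z_def)
        then have "l dvd c * t" using c(2) zi by (simp add: qdvd_def D_def)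
        then show False using c(1) t P by blast
      qed
    next
      case False
      then obtain b where b: "z = Quat 1 b 0 0" "0 \<le> b" "b < l" using z by (auto simp: Z_def)
      show ?thesis
      proof (cases "w = qi")
        case True
        then have "l dvd c' * t" and 2: "l dvd c' * (t * b) - c * t" using c(2) b by (simp_all add: qdvd_def D_def)
        then have "l dvd c'" using t P by blast
        then have "l dvd c * t" using 2 by (metis dvd_diff_right_iff dvd_mult2)
        then show ?thesis using c(1) t P by blast
      next
        case False
        then obtain b' where b': "w = Quat 1 b' 0 0" "0 \<le> b'" "b' < l" using w by (auto simp: Z_def)
        have 1: "l dvd c * t - c' * t" and 2: "l dvd c' * (t * b) - c * (t * b')"
          using c(2) b b' by (simp_all add: qdvd_def D_def)
        have "l dvd (c * t - c' * t) * b + (c' * (t * b) - c * (t * b'))" using 1 2 by simp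
        also have "(c * t - c' * t) * b + (c' * (t * b) - c * (t * b')) = (c * t) * (b - b')" by (simp add: algebra_simps)
        finally have "l dvd b - b'" using c(1) t P by blast
        moreover have "\<bar>b - b'\<bar> < l" using b b' by auto
        ultimately have "b = b'" using dvd_imp_le_int[of "b - b'" l] l_gt_2 by force
        then show ?thesis using b b' by simp
      qed
    qed
  qed
  have "card (primitive_pow l 1) = (\<Sum>z\<in>Z. card (right_factors l (D * z)))"
    unfolding eq
  proof (rule card_UN_disjoint[OF fZ])
    show "\<forall>z\<in>Z. finite (right_factors l (D * z))"
      by (auto intro: finite_subset[OF _ finite_nrm[of l]] simp: right_factors_def)
    show "\<forall>z\<in>Z. \<forall>w\<in>Z. z \<noteq> w \<longrightarrow> right_factors l (D * z) \<inter> right_factors l (D * w) = {}" using disj by blast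
  qed
  also have "\<dots> = 8 * card Z"
    using card_right_factors_l[of 1] D DZ by simp
  finally show ?thesis using cZ by simp
qed

text \<open>\<open>l\<close> divides \<open>a * b\<close> exactly when \<open>qcnj b\<close> is a
  right factor of \<open>a\<close>. In the picture of the tree this is the single step backwards, up
  to the eight units.\<close>

lemma card_left_factors_primitive_pow: "a \<in> primitive_pow l m \<Longrightarrow> m \<ge> 1 \<Longrightarrow> card {b \<in> primitive_pow l 1. qdvd l (a * b)} = 8"
proof -
  assume a: "a \<in> primitive_pow l m" "m \<ge> 1"
  have "{b \<in> primitive_pow l 1. qdvd l (a * b)} = qcnj ` right_factors l a"
  proof (intro Set.set_eqI iffI)
    fix b assume "b \<in> {b \<in> primitive_pow l 1. qdvd l (a * b)}"
    then have b: "nrm b = l" "qdvd l (a * b)" by (auto simp: primitive_pow_1[simplified])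
    obtain w where "a * b = of_int l * w" using b(2) by (rule qdvdE)
    then have "of_int l * a = of_int l * (w * qcnj b)"
      by (metis b(1) mult.assoc mult_cnj(1) of_int_comm)
    then have "a = w * qcnj b" using l_gt_2 by (simp add: of_int_cancel)
    then have "qcnj b \<in> right_factors l a" using b by (auto simp: right_factors_def)
    then show "b \<in> qcnj ` right_factors l a" by (metis cnj_simps(1) image_eqI)
  next
    fix b assume "b \<in> qcnj ` right_factors l a"
    then obtain c d where c: "b = qcnj c" "nrm c = l" "a = d * c" by (auto simp: right_factors_def)
    then have "a * b = of_int l * d" by (simp add: mult.assoc mult_cnj of_int_comm)
    then show "b \<in> {b \<in> primitive_pow l 1. qdvd l (a * b)}" using c by (simp add: primitive_pow_1[simplified])
  qed
  moreover have "card (qcnj ` right_factors l a) = card (right_factors l a)" by (intro card_image) (auto simp: inj_on_def)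
  moreover have "card (right_factors l a) = 8" using card_right_factors_l[of 1 a] a by (auto simp: primitive_pow_def)
  ultimately show ?thesis by simp
qed

lemma primitive_pow_mult_fiber:
  assumes x: "x \<in> primitive_pow l (Suc m)"
  shows "card {(a, b) \<in> {(a, b) \<in> primitive_pow l m \<times> primitive_pow l 1. \<not> qdvd l (a * b)}. a * b = x} = 8"
proof -
  have "bij_betw snd {(a, b) \<in> {(a, b) \<in> primitive_pow l m \<times> primitive_pow l 1. \<not> qdvd l (a * b)}. a * b = x} (right_factors l x)"
  proof (rule bij_betw_imageI)
    show "inj_on snd {(a, b) \<in> {(a, b) \<in> primitive_pow l m \<times> primitive_pow l 1. \<not> qdvd l (a * b)}. a * b = x}"
    proof (rule inj_onI)
      fix p p' assume p: "p \<in> {(a, b) \<in> {(a, b) \<in> primitive_pow l m \<times> primitive_pow l 1. \<not> qdvd l (a * b)}. a * b = x}"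
        "p' \<in> {(a, b) \<in> {(a, b) \<in> primitive_pow l m \<times> primitive_pow l 1. \<not> qdvd l (a * b)}. a * b = x}" "snd p = snd p'"
      have "nrm (snd p) = l" using p(1) by (simp add: case_prod_unfold primitive_pow_def)
      then have "snd p \<noteq> 0" using l_gt_2 by auto
      moreover have "fst p * snd p = fst p' * snd p" using p by (simp add: case_prod_unfold)
      ultimately have "fst p = fst p'" by (simp add: quat_cancel_right)
      then show "p = p'" using p(3) by (simp add: prod_eq_iff)
    qed
    show "snd ` {(a, b) \<in> {(a, b) \<in> primitive_pow l m \<times> primitive_pow l 1. \<not> qdvd l (a * b)}. a * b = x} = right_factors l x"
    proof (intro Set.set_eqI iffI)
      fix b assume "b \<in> right_factors l x"
      then obtain a where a: "nrm b = l" "x = a * b" by (auto simp: right_factors_def)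
      then have "nrm a * l = l ^ m * l" using x by (simp add: primitive_pow_def nrm_mult)
      then have "nrm a = l ^ m" using l_gt_2 by simp
      moreover have "\<not> qdvd l a" using x a qdvd_multr by (auto simp: primitive_pow_def)
      ultimately have "(a, b) \<in> {(a, b) \<in> {(a, b) \<in> primitive_pow l m \<times> primitive_pow l 1. \<not> qdvd l (a * b)}. a * b = x}"
        using a x by (simp add: primitive_pow_def not_qdvd_norm_l)
      then show "b \<in> snd ` {(a, b) \<in> {(a, b) \<in> primitive_pow l m \<times> primitive_pow l 1. \<not> qdvd l (a * b)}. a * b = x}" by force
    qed (auto simp: right_factors_def primitive_pow_def)
  qed
  then have "card {(a, b) \<in> {(a, b) \<in> primitive_pow l m \<times> primitive_pow l 1. \<not> qdvd l (a * b)}. a * b = x} = card (right_factors l x)"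
    by (rule bij_betw_same_card)
  also have "\<dots> = 8" using card_right_factors_l[of 1 x] x by (auto simp: primitive_pow_def)
  finally show ?thesis .
qed

lemma primitive_pow_mult_sum:
  fixes F :: "quat \<Rightarrow> real"
  shows "(\<Sum>(a, b)\<in>{(a, b) \<in> primitive_pow l m \<times> primitive_pow l 1. \<not> qdvd l (a * b)}. F (a * b)) = 8 * (\<Sum>x\<in>primitive_pow l (Suc m). F x)"
proof -
  have "(\<Sum>p\<in>{(a, b) \<in> primitive_pow l m \<times> primitive_pow l 1. \<not> qdvd l (a * b)}. F (case p of (a, b) \<Rightarrow> a * b))
    = real 8 * (\<Sum>x\<in>primitive_pow l (Suc m). F x)"
  proof (rule fiber_sum)
    show "finite {(a, b) \<in> primitive_pow l m \<times> primitive_pow l 1. \<not> qdvd l (a * b)}"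
      by (rule finite_subset[of _ "primitive_pow l m \<times> primitive_pow l 1"]) (auto simp: finite_primitive_pow)
    show "(\<lambda>p. case p of (a, b) \<Rightarrow> a * b) ` {(a, b) \<in> primitive_pow l m \<times> primitive_pow l 1. \<not> qdvd l (a * b)} \<subseteq> primitive_pow l (Suc m)"
      by (auto simp: primitive_pow_def nrm_mult mult.commute)
    show "card {p \<in> {(a, b) \<in> primitive_pow l m \<times> primitive_pow l 1. \<not> qdvd l (a * b)}. (case p of (a, b) \<Rightarrow> a * b) = x} = 8"
      if "x \<in> primitive_pow l (Suc m)" for x
    proof -
      have "{p \<in> {(a, b) \<in> primitive_pow l m \<times> primitive_pow l 1. \<not> qdvd l (a * b)}. (case p of (a, b) \<Rightarrow> a * b) = x}
        = {(a, b) \<in> {(a, b) \<in> primitive_pow l m \<times> primitive_pow l 1. \<not> qdvd l (a * b)}. a * b = x}" by auto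
      then show ?thesis using primitive_pow_mult_fiber[OF that] by simp
    qed
  qed (simp add: finite_primitive_pow)
  then show ?thesis by (simp add: case_prod_unfold)
qed

lemma card_primitive_pow_Suc:
  assumes "m \<ge> 1"
  shows "int (card (primitive_pow l (Suc m))) = l * int (card (primitive_pow l m))"
proof -
  let ?S = "{(a, b) \<in> primitive_pow l m \<times> primitive_pow l 1. \<not> qdvd l (a * b)}"
  have "?S = Sigma (primitive_pow l m) (\<lambda>a. {b \<in> primitive_pow l 1. \<not> qdvd l (a * b)})" by auto
  then have "card ?S = (\<Sum>a\<in>primitive_pow l m. card {b \<in> primitive_pow l 1. \<not> qdvd l (a * b)})"
    by (simp add: card_SigmaI finite_primitive_pow)
  moreover have "int (card {b \<in> primitive_pow l 1. \<not> qdvd l (a * b)}) = 8 * l" if "a \<in> primitive_pow l m" for a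
  proof -
    have "card {b \<in> primitive_pow l 1. \<not> qdvd l (a * b)} + card {b \<in> primitive_pow l 1. qdvd l (a * b)} = card (primitive_pow l 1)"
      by (subst card_Un_disjoint[symmetric]) (auto simp: finite_primitive_pow intro: arg_cong[where f = card])
    then show ?thesis using card_left_factors_primitive_pow[OF that assms] card_primitive_pow_1 by simp
  qed
  ultimately have "int (card ?S) = 8 * l * int (card (primitive_pow l m))" by simp
  moreover have "real (card ?S) = 8 * real (card (primitive_pow l (Suc m)))"
    using primitive_pow_mult_sum[of "\<lambda>_. 1" m] by simp
  ultimately show ?thesis by linarith
qed

lemma card_primitive_pow:
  assumes "m \<ge> 1"
  shows "int (card (primitive_pow l m)) = 8 * (l + 1) * l ^ (m - 1)"
  using assms
proof (induction m rule: nat_induct_at_least)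
  case base
  then show ?case using card_primitive_pow_1 by simp
next
  case (Suc m)
  then show ?case using card_primitive_pow_Suc[of m] by (cases m) (auto simp: algebra_simps)
qed

lemma card_primitive_pow_ge: "int (card (primitive_pow l m)) \<ge> 8 * l ^ m"
proof (cases m)
  case 0
  then show ?thesis by (simp add: primitive_pow_0 card_units)
next
  case (Suc k)
  have "l ^ k \<ge> 0" using l_gt_2 by simp
  then show ?thesis using card_primitive_pow[of m] Suc by (simp add: algebra_simps)
qed

lemma card_primitive_pow_le: "int (card (primitive_pow l m)) \<le> 16 * l ^ m"
proof (cases m)
  case 0
  then show ?thesis by (simp add: primitive_pow_0 card_units)
next
  case (Suc k)
  have "l ^ k \<ge> 0" using l_gt_2 by simp
  then have "8 * (l + 1) * l ^ k \<le> 8 * (2 * l) * l ^ k" using l_gt_2 by (intro mult_right_mono) auto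
  then show ?thesis using card_primitive_pow[of m] Suc by (simp add: algebra_simps)
qed

text \<open>The Hecke recursion. A product \<open>a * b\<close> is either primitive, and then arises
  from eight pairs, or it steps back: \<open>a = w * qcnj b\<close> and
  \<open>a * b = l * w\<close>.\<close>

lemma primitive_pow_recursion:
  fixes F :: "quat \<Rightarrow> real"
  assumes "m \<ge> 2"
  shows "(\<Sum>a\<in>primitive_pow l m. \<Sum>b\<in>primitive_pow l 1. F (a * b))
    = 8 * (\<Sum>x\<in>primitive_pow l (Suc m). F x) + 8 * real_of_int l * (\<Sum>a\<in>primitive_pow l (m - 1). F (of_int l * a))"
proof -
  \<comment> \<open>\<open>k \<ge> 1\<close> matters: only then do eight of the
    \<open>8 * (l + 1)\<close> choices of \<open>b\<close> cancel against an element of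
    \<open>primitive_pow l k\<close>, which leaves the factor \<open>8 * l\<close>.\<close>
  obtain k where k: "m = Suc k" "k \<ge> 1" using assms by (cases m) auto
  let ?S = "{(a, b) \<in> primitive_pow l m \<times> primitive_pow l 1. \<not> qdvd l (a * b)}"
  let ?T = "{(a, b) \<in> primitive_pow l m \<times> primitive_pow l 1. qdvd l (a * b)}"
  let ?U = "{(a, b) \<in> primitive_pow l k \<times> primitive_pow l 1. \<not> qdvd l (a * b)}"
  have un: "primitive_pow l m \<times> primitive_pow l 1 = ?S \<union> ?T" by auto
  have fin: "finite ?S" "finite ?T"
    by (rule finite_subset[of _ "primitive_pow l m \<times> primitive_pow l 1"], force, simp add: finite_primitive_pow)+
  have "(\<Sum>a\<in>primitive_pow l m. \<Sum>b\<in>primitive_pow l 1. F (a * b)) = (\<Sum>(a, b)\<in>?S. F (a * b)) + (\<Sum>(a, b)\<in>?T. F (a * b))"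
    unfolding sum.cartesian_product by (subst un, subst sum.union_disjoint) (use fin in auto)
  moreover have "(\<Sum>(a, b)\<in>?T. F (a * b)) = (\<Sum>(a, b)\<in>?U. F (of_int l * a))"
  proof (rule sum.reindex_bij_witness[of _ "\<lambda>(a, b). (a * b, qcnj b)"
        "\<lambda>(a, b). (Quat (q0 (a * b) div l) (q1 (a * b) div l) (q2 (a * b) div l) (q3 (a * b) div l), qcnj b)"])
    fix p assume "p \<in> ?T"
    then obtain a b where p: "p = (a, b)" "a \<in> primitive_pow l m" "nrm b = l" "qdvd l (a * b)" by (auto simp: primitive_pow_1[simplified] primitive_pow_def)
    obtain w where w: "a * b = of_int l * w" using p(4) by (rule qdvdE)
    then have q: "Quat (q0 (a * b) div l) (q1 (a * b) div l) (q2 (a * b) div l) (q3 (a * b) div l) = w"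
      unfolding w using l_gt_2 by (simp add: quat_eq_iff)
    have "of_int l * a = of_int l * (w * qcnj b)"
      using w by (metis p(3) mult.assoc mult_cnj(1) of_int_comm)
    then have aw: "a = w * qcnj b" using l_gt_2 by (simp add: of_int_cancel)
    show "(case case p of (a, b) \<Rightarrow> (Quat (q0 (a * b) div l) (q1 (a * b) div l) (q2 (a * b) div l) (q3 (a * b) div l), qcnj b)
        of (a, b) \<Rightarrow> (a * b, qcnj b)) = p"
      unfolding p prod.case q using aw by simp
    have "nrm w * l = l ^ k * l" using aw p(2,3) k by (simp add: primitive_pow_def nrm_mult)
    then have "nrm w = l ^ k" using l_gt_2 by simp
    moreover have "\<not> qdvd l w" using aw p(2) qdvd_multr by (auto simp: primitive_pow_def)
    ultimately show "(case p of (a, b) \<Rightarrow> (Quat (q0 (a * b) div l) (q1 (a * b) div l) (q2 (a * b) div l) (q3 (a * b) div l), qcnj b)) \<in> ?U"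
      unfolding p prod.case q using aw p(2,3) by (auto simp: primitive_pow_def not_qdvd_norm_l)
    show "(case case p of (a, b) \<Rightarrow> (Quat (q0 (a * b) div l) (q1 (a * b) div l) (q2 (a * b) div l) (q3 (a * b) div l), qcnj b)
        of (a, b) \<Rightarrow> F (of_int l * a)) = (case p of (a, b) \<Rightarrow> F (a * b))"
      unfolding p prod.case q using w by simp
  next
    fix p assume "p \<in> ?U"
    then obtain a b where p: "p = (a, b)" "a \<in> primitive_pow l k" "nrm b = l" "\<not> qdvd l (a * b)" by (auto simp: primitive_pow_1[simplified] primitive_pow_def)
    have ab: "a * b * qcnj b = of_int l * a" by (simp add: mult.assoc mult_cnj p of_int_comm)
    then show "(case case p of (a, b) \<Rightarrow> (a * b, qcnj b) of (a, b) \<Rightarrow>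
        (Quat (q0 (a * b) div l) (q1 (a * b) div l) (q2 (a * b) div l) (q3 (a * b) div l), qcnj b)) = p"
      unfolding p prod.case ab using l_gt_2 by (simp add: quat_eq_iff)
    show "(case p of (a, b) \<Rightarrow> (a * b, qcnj b)) \<in> ?T"
      unfolding p prod.case using p ab k by (auto simp: primitive_pow_def nrm_mult not_qdvd_norm_l)
  qed
  moreover have "(\<Sum>(a, b)\<in>?U. F (of_int l * a)) = (\<Sum>a\<in>primitive_pow l k. \<Sum>b\<in>{b \<in> primitive_pow l 1. \<not> qdvd l (a * b)}. F (of_int l * a))"
    by (subst sum.Sigma) (auto simp: finite_primitive_pow intro!: sum.cong)
  moreover have "\<dots> = (\<Sum>a\<in>primitive_pow l k. 8 * real_of_int l * F (of_int l * a))"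
  proof (intro sum.cong refl)
    fix a assume a: "a \<in> primitive_pow l k"
    have "card {b \<in> primitive_pow l 1. \<not> qdvd l (a * b)} + card {b \<in> primitive_pow l 1. qdvd l (a * b)} = card (primitive_pow l 1)"
      by (subst card_Un_disjoint[symmetric]) (auto simp: finite_primitive_pow intro: arg_cong[where f = card])
    then have "int (card {b \<in> primitive_pow l 1. \<not> qdvd l (a * b)}) = 8 * l" using card_left_factors_primitive_pow[OF a k(2)] card_primitive_pow_1 by simp
    then have "real (card {b \<in> primitive_pow l 1. \<not> qdvd l (a * b)}) = 8 * real_of_int l" by linarith
    then show "(\<Sum>b\<in>{b \<in> primitive_pow l 1. \<not> qdvd l (a * b)}. F (of_int l * a)) = 8 * real_of_int l * F (of_int l * a)" by simp
  qed
  ultimately show ?thesis using primitive_pow_mult_sum[of F m] k by (simp add: sum_distrib_left)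
qed

text \<open>Coprime parts of the norm separate: a primitive element of norm \<open>l ^ j * m\<close>
  has eight left factors of norm \<open>l ^ j\<close>, each with a primitive cofactor.\<close>

lemma primitive_mult_sum:
  fixes F :: "quat \<Rightarrow> real"
  assumes m: "\<not> l dvd m" "m > 0"
  shows "(\<Sum>a\<in>primitive_pow l j. \<Sum>y\<in>primitive m. F (a * y)) = 8 * (\<Sum>x\<in>primitive (l ^ j * m). F x)"
proof -
  have cop: "coprime l m" using m prime_l by (simp add: prime_imp_coprime)
  have "(\<Sum>p\<in>primitive_pow l j \<times> primitive m. F (case p of (a, y) \<Rightarrow> a * y)) = real 8 * (\<Sum>x\<in>primitive (l ^ j * m). F x)"
  proof (rule fiber_sum)
    show "(\<lambda>p. case p of (a, y) \<Rightarrow> a * y) ` (primitive_pow l j \<times> primitive m) \<subseteq> primitive (l ^ j * m)"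
    proof clarify
      fix a y assume a: "a \<in> primitive_pow l j" and y: "y \<in> primitive m"
      have "\<not> qdvd r (a * y)" if r: "prime r" for r
      proof
        assume d: "qdvd r (a * y)"
        show False
        proof (cases "r = l")
          case True
          have "qdvd l (of_int m * a)"
            using qdvd_multr[OF d, of "qcnj y"] y True by (simp add: mult.assoc mult_cnj primitive_def of_int_comm)
          then show False using a cop by (simp add: primitive_pow_def qdvd_of_int_coprime)
        next
          case False
          then have "coprime r (l ^ j)" using r prime_l by (simp add: primes_coprime)
          moreover have "qdvd r (of_int (l ^ j) * y)"
            using qdvd_multl[OF d, of "qcnj a"] a mult_cnj'(2)[of a y] by (simp add: primitive_pow_def)
          ultimately show False using y r by (auto simp: primitive_def qdvd_of_int_coprime simp del: of_int_power)
        qed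
      qed
      then show "a * y \<in> primitive (l ^ j * m)" using a y by (simp add: primitive_def primitive_pow_def nrm_mult)
    qed
    show "card {p \<in> primitive_pow l j \<times> primitive m. (case p of (a, y) \<Rightarrow> a * y) = x} = 8" if x: "x \<in> primitive (l ^ j * m)" for x
    proof -
      have "bij_betw fst {p \<in> primitive_pow l j \<times> primitive m. (case p of (a, y) \<Rightarrow> a * y) = x} (left_factors (l ^ j) x)"
      proof (rule bij_betw_imageI)
        show "inj_on fst {p \<in> primitive_pow l j \<times> primitive m. (case p of (a, y) \<Rightarrow> a * y) = x}"
        proof (rule inj_onI)
          fix p p' assume p: "p \<in> {p \<in> primitive_pow l j \<times> primitive m. (case p of (a, y) \<Rightarrow> a * y) = x}"
            "p' \<in> {p \<in> primitive_pow l j \<times> primitive m. (case p of (a, y) \<Rightarrow> a * y) = x}" "fst p = fst p'"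
          have "nrm (fst p) = l ^ j" using p(1) by (auto simp: primitive_pow_def)
          then have "fst p \<noteq> 0" using l_gt_2 by auto
          moreover have "fst p * snd p = fst p * snd p'" using p by (simp add: case_prod_unfold)
          ultimately have "snd p = snd p'" by (simp add: quat_cancel_left)
          then show "p = p'" using p(3) by (simp add: prod_eq_iff)
        qed
        show "fst ` {p \<in> primitive_pow l j \<times> primitive m. (case p of (a, y) \<Rightarrow> a * y) = x} = left_factors (l ^ j) x"
        proof (intro Set.set_eqI iffI)
          fix a assume "a \<in> left_factors (l ^ j) x"
          then obtain y where y: "nrm a = l ^ j" "x = a * y" by (auto simp: left_factors_def)
          have "l ^ j * nrm y = l ^ j * m" using x y by (simp add: primitive_def nrm_mult)
          then have "nrm y = m" using l_gt_2 by simp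
          then have "y \<in> primitive m" using x y qdvd_multl by (auto simp: primitive_def)
          moreover have "a \<in> primitive_pow l j" using x y qdvd_multr prime_l by (auto simp: primitive_def primitive_pow_def)
          ultimately show "a \<in> fst ` {p \<in> primitive_pow l j \<times> primitive m. (case p of (a, y) \<Rightarrow> a * y) = x}" using y by force
        qed (auto simp: left_factors_def primitive_pow_def)
      qed
      then have "card {p \<in> primitive_pow l j \<times> primitive m. (case p of (a, y) \<Rightarrow> a * y) = x} = card (left_factors (l ^ j) x)"
        by (rule bij_betw_same_card)
      also have "\<dots> = 8" using card_left_factors_l[of j x] x prime_l by (auto simp: primitive_def)
      finally show ?thesis .
    qed
  qed (auto simp: finite_primitive_pow finite_primitive)
  then show ?thesis by (simp add: sum.cartesian_product case_prod_unfold)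
qed

text \<open>For given \<open>\<alpha>\<close> and \<open>z\<close> the equation
  \<open>\<alpha> * y = z * \<beta>\<close> means that \<open>\<beta>\<close> is a left factor of
  norm \<open>l ^ k\<close> of \<open>qcnj z * \<alpha>\<close>, with cofactor
  \<open>qcnj y\<close>. This product is not divisible by \<open>l\<close>, because \<open>m\<close>
  is prime to \<open>l\<close>; so every \<open>z\<close> is reached exactly eight times.\<close>

lemma correspondence:
  fixes F :: "quat \<Rightarrow> real"
  assumes m: "\<not> l dvd m" "m > 0" and \<alpha>: "\<alpha> \<in> primitive_pow l k"
  shows "(\<Sum>y\<in>primitive m. \<Sum>\<beta>\<in>{\<beta> \<in> primitive_pow l k. qdvd (l ^ k) (\<alpha> * y * qcnj \<beta>)}. F (quat_div (l ^ k) (\<alpha> * y * qcnj \<beta>)))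
    = 8 * (\<Sum>z\<in>primitive m. F z)"
proof -
  have cop: "coprime l m" using m prime_l by (simp add: prime_imp_coprime)
  define q where "q = l ^ k"
  have q: "q > 0" using l_pow_pos by (simp add: q_def)
  have \<alpha>q: "nrm \<alpha> = q" "\<not> qdvd l \<alpha>" using \<alpha> by (auto simp: primitive_pow_def q_def)
  let ?S = "{(y, \<beta>) \<in> primitive m \<times> primitive_pow l k. qdvd q (\<alpha> * y * qcnj \<beta>)}"
  let ?g = "\<lambda>(y, \<beta>). quat_div q (\<alpha> * y * qcnj \<beta>)"
  have "(\<Sum>p\<in>?S. F (?g p)) = real 8 * (\<Sum>z\<in>primitive m. F z)"
  proof (rule fiber_sum)
    show "finite ?S" by (rule finite_subset[of _ "primitive m \<times> primitive_pow l k"]) (auto simp: finite_primitive_pow finite_primitive)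
    have mem: "z \<in> primitive m" if y: "y \<in> primitive m" and \<beta>: "\<beta> \<in> primitive_pow l k" and z: "\<alpha> * y * qcnj \<beta> = of_int q * z" for y \<beta> z
    proof -
      have \<beta>q: "nrm \<beta> = q" using \<beta> by (simp add: primitive_pow_def q_def)
      have "q * m * q = q\<^sup>2 * nrm z" using arg_cong[OF z, of nrm] y \<beta> \<alpha>q by (simp add: nrm_mult primitive_def primitive_pow_def flip: q_def)
      then have nz: "nrm z = m" using q by (simp add: power2_eq_square)
      have "\<not> qdvd r z" if r: "prime r" for r
      proof
        assume d: "qdvd r z"
        show False
        proof (cases "r = l")
          case True
          then have "l\<^sup>2 dvd m" using qdvd_nrm[OF d] nz by simp
          then show False using m by (metis dvd_trans dvd_triv_left power2_eq_square)
        next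
          case False
          then have "coprime r (q * q)" using r prime_l by (simp add: primes_coprime q_def)
          have "qcnj \<alpha> * (\<alpha> * y * qcnj \<beta>) * \<beta> = of_int (q * q) * y"
          proof -
            have "qcnj \<alpha> * (\<alpha> * y * qcnj \<beta>) * \<beta> = (qcnj \<alpha> * \<alpha>) * y * (qcnj \<beta> * \<beta>)" by (simp only: mult.assoc)
            also have "\<dots> = of_int q * y * of_int q" by (simp only: mult_cnj \<alpha>q \<beta>q)
            finally show ?thesis by (simp add: quat_eq_iff)
          qed
          moreover have "qdvd r (qcnj \<alpha> * (\<alpha> * y * qcnj \<beta>) * \<beta>)"
            unfolding z using d by (simp add: of_int_mid mult.assoc qdvd_multl qdvd_multr)
          ultimately have "qdvd r y" using \<open>coprime r (q * q)\<close> qdvd_of_int_coprime by metis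
          then show False using y r by (auto simp: primitive_def)
        qed
      qed
      then show ?thesis using nz by (simp add: primitive_def)
    qed
    show "?g ` ?S \<subseteq> primitive m"
    proof clarify
      fix y \<beta> assume y: "y \<in> primitive m" "\<beta> \<in> primitive_pow l k" "qdvd q (\<alpha> * y * qcnj \<beta>)"
      obtain z where z: "\<alpha> * y * qcnj \<beta> = of_int q * z" using y(3) by (rule qdvdE)
      show "quat_div q (\<alpha> * y * qcnj \<beta>) \<in> primitive m" using mem[OF y(1,2) z] q by (simp add: z quat_div)
    qed
    show "card {p \<in> ?S. ?g p = z} = 8" if z: "z \<in> primitive m" for z
    proof -
      let ?x = "qcnj z * \<alpha>"
      have "bij_betw snd {p \<in> ?S. ?g p = z} (left_factors q ?x)"
      proof (rule bij_betw_imageI)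
        have eq: "\<alpha> * y = z * \<beta>" if "(y, \<beta>) \<in> {p \<in> ?S. ?g p = z}" for y \<beta>
        proof -
          have \<beta>q: "nrm \<beta> = q" using that by (auto simp: primitive_pow_def q_def)
          have p: "\<beta> \<in> primitive_pow l k" "qdvd q (\<alpha> * y * qcnj \<beta>)" "quat_div q (\<alpha> * y * qcnj \<beta>) = z" using that by auto
          obtain w where w: "\<alpha> * y * qcnj \<beta> = of_int q * w" using p(2) by (rule qdvdE)
          then have "w = z" using p(3) q by (simp add: quat_div)
          then have "of_int q * (\<alpha> * y) = of_int q * (z * \<beta>)"
            using arg_cong[OF w, of "\<lambda>t. t * \<beta>"] \<beta>q
            by (simp add: mult.assoc mult_cnj of_int_comm of_int_mid)
          then show ?thesis using q by (simp add: of_int_cancel)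
        qed
        show "inj_on snd {p \<in> ?S. ?g p = z}"
        proof (rule inj_onI)
          fix p p' assume p: "p \<in> {p \<in> ?S. ?g p = z}" "p' \<in> {p \<in> ?S. ?g p = z}" "snd p = snd p'"
          have "\<alpha> * fst p = \<alpha> * fst p'" using eq[of "fst p" "snd p"] eq[of "fst p'" "snd p'"] p by (simp add: case_prod_unfold)
          then have "fst p = fst p'" using q \<alpha>q by (subst (asm) quat_cancel_left) auto
          then show "p = p'" using p(3) by (simp add: prod_eq_iff)
        qed
        show "snd ` {p \<in> ?S. ?g p = z} = left_factors q ?x"
        proof (intro Set.set_eqI iffI)
          fix \<beta> assume "\<beta> \<in> snd ` {p \<in> ?S. ?g p = z}"
          then obtain y where p: "(y, \<beta>) \<in> {p \<in> ?S. ?g p = z}" by force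
          have \<beta>q: "nrm \<beta> = q" using p by (auto simp: primitive_pow_def q_def)
          have "qcnj \<beta> * qcnj z = qcnj y * qcnj \<alpha>" using arg_cong[OF eq[OF p], of qcnj] by (simp add: cnj_mult)
          then have "\<beta> * (qcnj \<beta> * qcnj z) * \<alpha> = \<beta> * (qcnj y * qcnj \<alpha>) * \<alpha>" by simp
          then have "of_int q * ?x = of_int q * (\<beta> * qcnj y)"
            using \<beta>q \<alpha>q by (simp add: mult.assoc mult_cnj mult_cnj' of_int_comm of_int_mid)
          then have "?x = \<beta> * qcnj y" using q by (simp add: of_int_cancel)
          then show "\<beta> \<in> left_factors q ?x" using p by (auto simp: left_factors_def primitive_pow_def q_def)
        next
          fix \<beta> assume "\<beta> \<in> left_factors q ?x"
          then obtain d where d: "nrm \<beta> = q" "?x = \<beta> * d" by (auto simp: left_factors_def)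
          have nx: "nrm ?x = m * q" using z \<alpha>q by (simp add: nrm_mult primitive_def)
          have "\<not> qdvd l ?x"
          proof
            assume "qdvd l ?x"
            then have "qdvd l (z * ?x)" by (rule qdvd_multl)
            then have "qdvd l (of_int m * \<alpha>)" using z by (simp add: mult_cnj' primitive_def)
            then show False using cop \<alpha>q by (simp add: qdvd_of_int_coprime)
          qed
          then have "\<beta> \<in> primitive_pow l k" using d qdvd_multr by (auto simp: primitive_pow_def q_def)
          have "qcnj \<alpha> * z = qcnj d * qcnj \<beta>" using arg_cong[OF d(2), of qcnj] by (simp add: cnj_mult)
          then have "\<alpha> * (qcnj \<alpha> * z) = \<alpha> * qcnj d * qcnj \<beta>" by (simp add: mult.assoc)
          then have e: "\<alpha> * qcnj d * qcnj \<beta> = of_int q * z" by (simp add: mult_cnj' \<alpha>q)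
          have "nrm (qcnj d) = m" using nx q unfolding d by (simp add: nrm_mult d)
          moreover have "\<not> qdvd r (qcnj d)" if r: "prime r" for r
          proof
            assume dd: "qdvd r (qcnj d)"
            show False
            proof (cases "r = l")
              case True
              then have "l\<^sup>2 dvd m" using qdvd_nrm[OF dd] \<open>nrm (qcnj d) = m\<close> by simp
              then show False using m by (metis dvd_trans dvd_triv_left power2_eq_square)
            next
              case False
              then have "coprime r q" using r prime_l by (simp add: primes_coprime q_def)
              moreover have "qdvd r (of_int q * z)" using dd e qdvd_multl qdvd_multr by metis
              ultimately show False using z r by (auto simp: primitive_def qdvd_of_int_coprime)
            qed
          qed
          ultimately have "qcnj d \<in> primitive m" by (simp add: primitive_def)
          then have "(qcnj d, \<beta>) \<in> {p \<in> ?S. ?g p = z}"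
            using \<open>\<beta> \<in> primitive_pow l k\<close> e q by (simp add: quat_div)
          then show "\<beta> \<in> snd ` {p \<in> ?S. ?g p = z}" by force
        qed
      qed
      then have "card {p \<in> ?S. ?g p = z} = card (left_factors q ?x)"
        by (rule bij_betw_same_card)
      also have "\<dots> = 8"
      proof -
        have "\<not> qdvd l ?x"
        proof
          assume "qdvd l ?x"
          then have "qdvd l (z * ?x)" by (rule qdvd_multl)
          then have "qdvd l (of_int m * \<alpha>)" using z by (simp add: mult_cnj' primitive_def)
          then show False using cop \<alpha>q by (simp add: qdvd_of_int_coprime)
        qed
        moreover have "q dvd nrm ?x" using z \<alpha>q by (simp add: nrm_mult primitive_def)
        ultimately show ?thesis using card_left_factors_l[of k ?x] by (simp add: q_def)
      qed
      finally show ?thesis .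
    qed
  qed (simp add: finite_primitive)
  moreover have "(\<Sum>y\<in>primitive m. \<Sum>\<beta>\<in>{\<beta> \<in> primitive_pow l k. qdvd q (\<alpha> * y * qcnj \<beta>)}. F (quat_div q (\<alpha> * y * qcnj \<beta>)))
     = (\<Sum>p\<in>?S. F (?g p))"
    by (subst sum.Sigma) (auto simp: finite_primitive_pow finite_primitive intro!: sum.cong)
  ultimately show ?thesis by (simp add: q_def)
qed

end

section \<open>Incidences modulo a prime power\<close>

definition quat_residues :: "int \<Rightarrow> quat set" where
  "quat_residues m = {x. q0 x \<in> {0..<m} \<and> q1 x \<in> {0..<m} \<and> q2 x \<in> {0..<m} \<and> q3 x \<in> {0..<m}}"

lemma sum_quat_residues:
  "(\<Sum>x\<in>quat_residues m. f x) = (\<Sum>a=0..<m. \<Sum>b=0..<m. \<Sum>c=0..<m. \<Sum>d=0..<m. f (Quat a b c d))"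
proof -
  have "(\<Sum>x\<in>quat_residues m. f x) = (\<Sum>(a, b, c, d)\<in>{0..<m} \<times> {0..<m} \<times> {0..<m} \<times> {0..<m}. f (Quat a b c d))"
    by (rule sum.reindex_bij_witness[of _ "\<lambda>(a, b, c, d). Quat a b c d" "\<lambda>x. (q0 x, q1 x, q2 x, q3 x)"])
      (auto simp: quat_residues_def)
  then show ?thesis by (simp add: sum.cartesian_product)
qed

lemma finite_quat_residues: "finite (quat_residues m)"
proof -
  have "quat_residues m \<subseteq> (\<lambda>(a, b, c, d). Quat a b c d) ` ({0..<m} \<times> {0..<m} \<times> {0..<m} \<times> {0..<m})"
  proof
    fix x assume "x \<in> quat_residues m"
    then show "x \<in> (\<lambda>(a, b, c, d). Quat a b c d) ` ({0..<m} \<times> {0..<m} \<times> {0..<m} \<times> {0..<m})"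
      by (intro image_eqI[of _ _ "(q0 x, q1 x, q2 x, q3 x)"]) (auto simp: quat_residues_def)
  qed
  then show ?thesis by (rule finite_subset) auto
qed

section \<open>Additive characters and pairs of linear congruences\<close>

definition additive_char :: "int \<Rightarrow> int \<Rightarrow> complex" where
  "additive_char q x = cis (2 * pi * of_int x / of_int q)"

lemma additive_char_add: "additive_char q (x + y) = additive_char q x * additive_char q y"
  by (simp add: additive_char_def cis_mult add_divide_distrib distrib_left)

lemma additive_char_0 [simp]: "additive_char q 0 = 1"
  by (simp add: additive_char_def)

lemma additive_char_eq_1_iff:
  assumes "q > 0"
  shows "additive_char q x = 1 \<longleftrightarrow> q dvd x"
proof
  assume "q dvd x"
  then obtain k where "x = q * k" ..
  then have "2 * pi * of_int x / of_int q = 2 * pi * of_int k" using assms by simp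
  then show "additive_char q x = 1" by (simp add: additive_char_def)
next
  assume "additive_char q x = 1"
  then have "cos (2 * pi * of_int x / of_int q) = 1" by (simp add: additive_char_def complex_eq_iff)
  then obtain k where "2 * pi * of_int x / of_int q = of_int k * 2 * pi"
    using cos_one_2pi_int by blast
  then have "of_int x = (of_int (q * k) :: real)" using assms by (simp add: field_simps)
  then have "x = q * k" by (simp only: of_int_eq_iff)
  then show "q dvd x" by simp
qed

lemma additive_char_sum:
  assumes q: "q > 0"
  shows "(\<Sum>x=0..<q. additive_char q (a * x)) = (if q dvd a then of_int q else 0)"
proof (cases "q dvd a")
  case True
  then have "additive_char q (a * x) = 1" for x using additive_char_eq_1_iff[OF q] by simp
  then show ?thesis using True q by simp
next
  case False
  define S where "S = (\<Sum>x=0..<q. additive_char q (a * x))"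
  have "(\<Sum>x=0..<q. additive_char q (a * (x + 1))) = S"
  proof -
    have "(\<Sum>x=0..<q. additive_char q (a * (x + 1))) = (\<Sum>x=1..<q+1. additive_char q (a * x))"
      by (rule sum.reindex_bij_witness[of _ "\<lambda>x. x - 1" "\<lambda>x. x + 1"]) auto
    also have "{1..<q+1} = insert q {1..<q}" using q by auto
    also have "(\<Sum>x\<in>insert q {1..<q}. additive_char q (a * x)) = additive_char q (a * q) + (\<Sum>x=1..<q. additive_char q (a * x))" by simp
    also have "additive_char q (a * q) = additive_char q (a * 0)" using additive_char_eq_1_iff[OF q, of "a * q"] by simp
    also have "additive_char q (a * 0) + (\<Sum>x=1..<q. additive_char q (a * x)) = (\<Sum>x\<in>insert 0 {1..<q}. additive_char q (a * x))" by simp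
    also have "insert 0 {1..<q} = {0..<q}" using q by auto
    finally show ?thesis by (simp add: S_def)
  qed
  then have "additive_char q a * S = S" by (simp add: S_def sum_distrib_left additive_char_add distrib_left mult.commute)
  then have "S = 0" using False additive_char_eq_1_iff[OF q, of a] by simp
  then show ?thesis using False by (simp add: S_def)
qed

lemma additive_char_sum_tr:
  assumes q: "q > 0" "odd q"
  shows "(\<Sum>g\<in>quat_residues q. additive_char q (tr (u * g))) = (if qdvd q u then of_int (q ^ 4) else 0)"
proof -
  have t: "tr (u * Quat a b c d) = 2 * q0 u * a + (- 2 * q1 u) * b + (- 2 * q2 u) * c + (- 2 * q3 u) * d" for a b c d
    by (simp add: tr_def algebra_simps)
  have cop: "coprime q 2" using q by simp
  have d: "q dvd 2 * z \<longleftrightarrow> q dvd z" "q dvd - 2 * z \<longleftrightarrow> q dvd z" for z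
    using coprime_dvd_mult_right_iff[OF cop, of z] by (simp_all)
  have "(\<Sum>g\<in>quat_residues q. additive_char q (tr (u * g)))
    = (\<Sum>a=0..<q. additive_char q (2 * q0 u * a)) * (\<Sum>b=0..<q. additive_char q (- 2 * q1 u * b)) *
      (\<Sum>c=0..<q. additive_char q (- 2 * q2 u * c)) * (\<Sum>d=0..<q. additive_char q (- 2 * q3 u * d))"
    unfolding sum_quat_residues t additive_char_add
    by (simp only: sum_distrib_left[symmetric] sum_distrib_right[symmetric])
  also have "\<dots> = (if qdvd q u then of_int (q ^ 4) else 0)"
    unfolding additive_char_sum[OF q(1)] d by (auto simp: qdvd_def power4_eq_xxxx)
  finally show ?thesis .
qed

text \<open>Detecting both conditions by additive characters and summing over \<open>g\<close>
  first, only those coefficients survive for which \<open>c * u\<close> and \<open>c' * v\<close>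
  are congruent. A count of common zeros becomes a count of relations between the two forms.\<close>

lemma linear_incidence:
  assumes q: "q > 0" "odd q"
  shows "int (card {g \<in> quat_residues q. q dvd tr (u * g) \<and> q dvd tr (v * g)})
    = q\<^sup>2 * int (card {(c, c'). c \<in> {0..<q} \<and> c' \<in> {0..<q} \<and> qdvd q (of_int c * u - of_int c' * v)})"
proof -
  let ?I = "{0..<q}"
  have ind: "(of_int q :: complex) * (if q dvd x then 1 else 0) = (\<Sum>c\<in>?I. additive_char q (x * c))" for x
    using additive_char_sum[OF q(1), of x] by simp
  have ind': "(of_int q :: complex) * (if q dvd x then 1 else 0) = (\<Sum>c\<in>?I. additive_char q (- x * c))" for x
    using additive_char_sum[OF q(1), of "- x"] by simp
  have "(of_int q)\<^sup>2 * (of_nat (card {g \<in> quat_residues q. q dvd tr (u * g) \<and> q dvd tr (v * g)}) :: complex)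
    = (of_int q)\<^sup>2 * (\<Sum>g\<in>quat_residues q. if q dvd tr (u * g) \<and> q dvd tr (v * g) then 1 else 0)"
    by (simp add: sum.If_cases finite_quat_residues Int_def)
  also have "\<dots> = (\<Sum>g\<in>quat_residues q. (of_int q * (if q dvd tr (u * g) then 1 else 0)) * (of_int q * (if q dvd tr (v * g) then 1 else 0)))"
    unfolding sum_distrib_left by (intro sum.cong refl) (auto simp: power2_eq_square)
  also have "\<dots> = (\<Sum>g\<in>quat_residues q. (\<Sum>c\<in>?I. additive_char q (tr (u * g) * c)) * (\<Sum>c'\<in>?I. additive_char q (- tr (v * g) * c')))"
    by (intro sum.cong refl arg_cong2[where f = "(*)"] ind ind')
  also have "\<dots> = (\<Sum>g\<in>quat_residues q. \<Sum>c\<in>?I. \<Sum>c'\<in>?I. additive_char q (tr ((of_int c * u - of_int c' * v) * g)))"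
  proof (intro sum.cong refl)
    fix g
    have "tr ((of_int c * u - of_int c' * v) * g) = tr (u * g) * c + - tr (v * g) * c'" for c c'
      by (simp add: tr_def algebra_simps)
    then show "(\<Sum>c\<in>?I. additive_char q (tr (u * g) * c)) * (\<Sum>c'\<in>?I. additive_char q (- tr (v * g) * c'))
      = (\<Sum>c\<in>?I. \<Sum>c'\<in>?I. additive_char q (tr ((of_int c * u - of_int c' * v) * g)))"
      by (simp only: additive_char_add sum_product)
  qed
  also have "\<dots> = (\<Sum>c\<in>?I. \<Sum>c'\<in>?I. \<Sum>g\<in>quat_residues q. additive_char q (tr ((of_int c * u - of_int c' * v) * g)))"
    by (subst sum.swap, intro sum.cong refl, rule sum.swap)
  also have "\<dots> = (\<Sum>(c, c')\<in>?I \<times> ?I. if qdvd q (of_int c * u - of_int c' * v) then of_int (q ^ 4) else 0)"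
    by (simp only: additive_char_sum_tr[OF q] sum.cartesian_product)
  also have "\<dots> = (\<Sum>x\<in>{x\<in>?I \<times> ?I. qdvd q (of_int (fst x) * u - of_int (snd x) * v)}. of_int (q ^ 4))"
    by (subst sum.inter_filter) (auto simp: case_prod_unfold)
  also have "{x\<in>?I \<times> ?I. qdvd q (of_int (fst x) * u - of_int (snd x) * v)} =
     {(c, c'). c \<in> {0..<q} \<and> c' \<in> {0..<q} \<and> qdvd q (of_int c * u - of_int c' * v)}" (is "_ = ?C") by auto
  finally have "of_int (q\<^sup>2 * int (card {g \<in> quat_residues q. q dvd tr (u * g) \<and> q dvd tr (v * g)}))
    = (of_int (q\<^sup>2 * (q\<^sup>2 * int (card ?C))) :: complex)"
    by (simp add: power4_eq_xxxx power2_eq_square mult_ac)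
  then have "q\<^sup>2 * int (card {g \<in> quat_residues q. q dvd tr (u * g) \<and> q dvd tr (v * g)}) = q\<^sup>2 * (q\<^sup>2 * int (card ?C))"
    by (simp only: of_int_eq_iff)
  moreover have "q\<^sup>2 \<noteq> 0" using q by simp
  ultimately show ?thesis using mult_left_cancel by blast
qed

lemma qdvd_diff_triv: "qdvd m (x - of_int m * y) \<longleftrightarrow> qdvd m x"
  by (metis diff_add_cancel qdvd_add qdvd_diff qdvd_triv)

context odd_prime
begin

lemma coprime_l_pow: "\<not> l dvd a \<Longrightarrow> coprime (l ^ k) a"
  using coprime_l[of a] by (simp add: coprime_commute)

lemma odd_l_pow: "odd (l ^ k)"
  using odd_l by simp

text \<open>\<open>\<kappa> = \<beta>\<^sup>* \<xi> \<alpha>\<close> represents the linear form that cuts out the condition \<open>l ^ k | \<alpha> g \<beta>\<^sup>*\<close>.\<close>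

lemma form_exists:
  assumes "\<alpha> \<in> primitive_pow l k" "\<beta> \<in> primitive_pow l k"
  obtains \<xi> where "\<not> qdvd l (qcnj \<beta> * \<xi> * \<alpha>)"
  using assms quat_prime[OF prime_l odd_l, of "qcnj \<beta>" \<alpha>] by (auto simp: primitive_pow_def)

text \<open>Modulo \<open>l ^ k\<close> both \<open>\<alpha>\<close> and \<open>qcnj \<beta>\<close>
  have rank one, so \<open>\<alpha> * g * qcnj \<beta>\<close> carries a single residue. Applying
  \<open>rank_one\<close> to \<open>\<alpha>\<close> and then to \<open>qcnj \<beta>\<close>
  recovers it up to the trace against \<open>g'\<close>, a unit.\<close>

lemma form_iff:
  assumes a: "\<alpha> \<in> primitive_pow l k" and b: "\<beta> \<in> primitive_pow l k" and k: "\<not> qdvd l (qcnj \<beta> * \<xi> * \<alpha>)"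
  shows "qdvd (l ^ k) (\<alpha> * g * qcnj \<beta>) \<longleftrightarrow> l ^ k dvd tr (qcnj \<beta> * \<xi> * \<alpha> * g)"
proof
  assume "qdvd (l ^ k) (\<alpha> * g * qcnj \<beta>)"
  then have "qdvd (l ^ k) (\<alpha> * g * qcnj \<beta> * \<xi>)" by (rule qdvd_multr)
  then have "l ^ k dvd tr (\<alpha> * g * qcnj \<beta> * \<xi>)" by (simp only: qdvd_def tr_def dvd_mult)
  also have "tr (\<alpha> * g * qcnj \<beta> * \<xi>) = tr (qcnj \<beta> * \<xi> * \<alpha> * g)"
    using tr_comm[of "\<alpha> * g" "qcnj \<beta> * \<xi>"] by (simp add: mult.assoc)
  finally show "l ^ k dvd tr (qcnj \<beta> * \<xi> * \<alpha> * g)" .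
next
  let ?q = "l ^ k"
  assume d: "?q dvd tr (qcnj \<beta> * \<xi> * \<alpha> * g)"
  obtain g' where g': "\<not> l dvd tr (qcnj \<beta> * \<xi> * \<alpha> * g')" using tr_witness[OF prime_l odd_l k] by metis
  have na: "nrm \<alpha> = ?q" "nrm (qcnj \<beta>) = ?q" using a b by (auto simp: primitive_pow_def)
  have t: "tr (\<alpha> * (g * qcnj \<beta> * \<xi>)) = tr (qcnj \<beta> * \<xi> * \<alpha> * g)"
    using tr_comm[of "\<alpha> * g" "qcnj \<beta> * \<xi>"] by (simp add: mult.assoc)
  have "\<alpha> * (g * qcnj \<beta> * \<xi>) * \<alpha> = of_int (tr (qcnj \<beta> * \<xi> * \<alpha> * g)) * \<alpha> - of_int ?q * qcnj (g * qcnj \<beta> * \<xi>)"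
    unfolding rank_one t na ..
  then have "qdvd ?q (\<alpha> * (g * qcnj \<beta> * \<xi>) * \<alpha>)"
    using qdvd_of_int_dvd[OF d, of \<alpha>] by (simp only: qdvd_diff_triv)
  then have 1: "qdvd ?q (\<alpha> * (g * qcnj \<beta> * \<xi>) * \<alpha> * (g' * qcnj \<beta>))" by (rule qdvd_multr)
  have "\<alpha> * (g * qcnj \<beta> * \<xi>) * \<alpha> * (g' * qcnj \<beta>) = \<alpha> * g * (qcnj \<beta> * (\<xi> * \<alpha> * g') * qcnj \<beta>)"
    by (simp only: mult.assoc)
  also have "\<dots> = \<alpha> * g * (of_int (tr (qcnj \<beta> * \<xi> * \<alpha> * g')) * qcnj \<beta> - of_int ?q * qcnj (\<xi> * \<alpha> * g'))"
    unfolding rank_one na by (simp only: mult.assoc)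
  also have "\<dots> = of_int (tr (qcnj \<beta> * \<xi> * \<alpha> * g')) * (\<alpha> * g * qcnj \<beta>) - of_int ?q * (\<alpha> * g * qcnj (\<xi> * \<alpha> * g'))"
    by (simp only: right_diff_distrib of_int_mid)
  finally have "qdvd ?q (of_int (tr (qcnj \<beta> * \<xi> * \<alpha> * g')) * (\<alpha> * g * qcnj \<beta>) - of_int ?q * (\<alpha> * g * qcnj (\<xi> * \<alpha> * g')))"
    using 1 by simp
  then have "qdvd ?q (of_int (tr (qcnj \<beta> * \<xi> * \<alpha> * g')) * (\<alpha> * g * qcnj \<beta>))"
    by (simp only: qdvd_diff_triv)
  then show "qdvd ?q (\<alpha> * g * qcnj \<beta>)"
    using qdvd_of_int_coprime[OF coprime_l_pow[OF g']] by blast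
qed

text \<open>As a matrix of rank one, \<open>qcnj \<beta> * \<xi> * \<alpha>\<close> has its kernel
  given by \<open>\<alpha>\<close> and its image by \<open>qcnj \<beta>\<close>. Proportionality
  therefore separates into one condition on each side, and the auxiliary \<open>\<xi>\<close> and
  \<open>\<xi>'\<close> drop out.\<close>

lemma forms_proportional_iff:
  assumes a: "\<alpha> \<in> primitive_pow l k" "\<beta> \<in> primitive_pow l k" and a': "\<alpha>' \<in> primitive_pow l k" "\<beta>' \<in> primitive_pow l k"
    and k: "\<not> qdvd l (qcnj \<beta> * \<xi> * \<alpha>)" and k': "\<not> qdvd l (qcnj \<beta>' * \<xi>' * \<alpha>')"
  shows "(\<exists>c'. qdvd (l ^ k) (of_int c * (qcnj \<beta> * \<xi> * \<alpha>) - of_int c' * (qcnj \<beta>' * \<xi>' * \<alpha>')))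
    \<longleftrightarrow> qdvd (l ^ k) (of_int c * (\<alpha> * qcnj \<alpha>')) \<and> qdvd (l ^ k) (of_int c * (\<beta> * qcnj \<beta>'))"
proof
  let ?q = "l ^ k"
  have na: "nrm \<alpha> = ?q" "nrm (qcnj \<beta>) = ?q" "nrm \<alpha>' = ?q" "nrm \<beta>' = ?q" using a a' by (auto simp: primitive_pow_def)
  assume "\<exists>c'. qdvd ?q (of_int c * (qcnj \<beta> * \<xi> * \<alpha>) - of_int c' * (qcnj \<beta>' * \<xi>' * \<alpha>'))"
  then obtain c' where c': "qdvd ?q (of_int c * (qcnj \<beta> * \<xi> * \<alpha>) - of_int c' * (qcnj \<beta>' * \<xi>' * \<alpha>'))" by blast
  obtain g where g: "\<not> l dvd tr (qcnj \<beta> * \<xi> * \<alpha> * g)" using tr_witness[OF prime_l odd_l k] by metis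
  have "(of_int c * (qcnj \<beta> * \<xi> * \<alpha>) - of_int c' * (qcnj \<beta>' * \<xi>' * \<alpha>')) * qcnj \<alpha>'
    = of_int c * (qcnj \<beta> * \<xi> * (\<alpha> * qcnj \<alpha>')) - of_int ?q * (of_int c' * (qcnj \<beta>' * \<xi>'))"
  proof -
    have "of_int c' * (qcnj \<beta>' * \<xi>' * \<alpha>') * qcnj \<alpha>' = of_int c' * (qcnj \<beta>' * (\<xi>' * (\<alpha>' * qcnj \<alpha>')))"
      by (simp only: mult.assoc)
    also have "\<dots> = of_int ?q * (of_int c' * (qcnj \<beta>' * \<xi>'))"
      unfolding mult_cnj na by (simp only: of_int_comm[of _ "l ^ k"] of_int_mid[of _ "l ^ k"])
    finally show ?thesis by (simp only: left_diff_distrib mult.assoc)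
  qed
  then have "qdvd ?q (of_int c * (qcnj \<beta> * \<xi> * (\<alpha> * qcnj \<alpha>')))"
    using qdvd_multr[OF c', of "qcnj \<alpha>'"] by (simp only: qdvd_diff_triv)
  from qdvd_multl[OF this, of "\<alpha> * g"]
  have "qdvd ?q (of_int c * ((\<alpha> * (g * qcnj \<beta> * \<xi>) * \<alpha>) * qcnj \<alpha>'))"
    by (simp only: of_int_mid mult.assoc)
  moreover have "tr (\<alpha> * (g * qcnj \<beta> * \<xi>)) = tr (qcnj \<beta> * \<xi> * \<alpha> * g)"
    using tr_comm[of "\<alpha> * g" "qcnj \<beta> * \<xi>"] by (simp add: mult.assoc)
  then have "of_int c * ((\<alpha> * (g * qcnj \<beta> * \<xi>) * \<alpha>) * qcnj \<alpha>')
    = of_int (tr (qcnj \<beta> * \<xi> * \<alpha> * g)) * (of_int c * (\<alpha> * qcnj \<alpha>')) - of_int ?q * (of_int c * (qcnj (g * qcnj \<beta> * \<xi>) * qcnj \<alpha>'))"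
    unfolding rank_one na by (simp only: left_diff_distrib right_diff_distrib mult.assoc of_int_mid[of "of_int c"])
  ultimately have "qdvd ?q (of_int (tr (qcnj \<beta> * \<xi> * \<alpha> * g)) * (of_int c * (\<alpha> * qcnj \<alpha>')))"
    by (simp only: qdvd_diff_triv)
  then have A: "qdvd ?q (of_int c * (\<alpha> * qcnj \<alpha>'))"
    using qdvd_of_int_coprime[OF coprime_l_pow[OF g]] by blast
  have "\<beta>' * (of_int c * (qcnj \<beta> * \<xi> * \<alpha>) - of_int c' * (qcnj \<beta>' * \<xi>' * \<alpha>'))
    = of_int c * (\<beta>' * qcnj \<beta> * (\<xi> * \<alpha>)) - of_int ?q * (of_int c' * (\<xi>' * \<alpha>'))"
  proof -
    have "\<beta>' * (of_int c' * (qcnj \<beta>' * \<xi>' * \<alpha>')) = of_int c' * (\<beta>' * (qcnj \<beta>' * (\<xi>' * \<alpha>')))"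
      by (simp only: mult.assoc of_int_mid)
    also have "\<dots> = of_int ?q * (of_int c' * (\<xi>' * \<alpha>'))"
      unfolding mult_cnj' na by (rule of_int_mid)
    finally show ?thesis by (simp only: right_diff_distrib mult.assoc of_int_mid[of \<beta>'])
  qed
  then have "qdvd ?q (of_int c * (\<beta>' * qcnj \<beta> * (\<xi> * \<alpha>)))"
    using qdvd_multl[OF c', of "\<beta>'"] by (simp only: qdvd_diff_triv)
  from qdvd_multr[OF this, of "g * qcnj \<beta>"]
  have "qdvd ?q (of_int c * (\<beta>' * (qcnj \<beta> * (\<xi> * \<alpha> * g) * qcnj \<beta>)))"
    by (simp only: mult.assoc)
  moreover have "of_int c * (\<beta>' * (qcnj \<beta> * (\<xi> * \<alpha> * g) * qcnj \<beta>))
    = of_int (tr (qcnj \<beta> * \<xi> * \<alpha> * g)) * (of_int c * (\<beta>' * qcnj \<beta>)) - of_int ?q * (of_int c * (\<beta>' * qcnj (\<xi> * \<alpha> * g)))"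
    unfolding rank_one na by (simp only: left_diff_distrib right_diff_distrib mult.assoc of_int_mid[of "of_int c"] of_int_mid[of \<beta>'])
  ultimately have "qdvd ?q (of_int (tr (qcnj \<beta> * \<xi> * \<alpha> * g)) * (of_int c * (\<beta>' * qcnj \<beta>)))"
    by (simp only: qdvd_diff_triv)
  then have "qdvd ?q (of_int c * (\<beta>' * qcnj \<beta>))"
    using qdvd_of_int_coprime[OF coprime_l_pow[OF g]] by blast
  then have "qdvd ?q (qcnj (of_int c * (\<beta>' * qcnj \<beta>)))" by (simp only: qdvd_cnj)
  then have B: "qdvd ?q (of_int c * (\<beta> * qcnj \<beta>'))" by (simp add: cnj_mult of_int_comm)
  from A B show "qdvd ?q (of_int c * (\<alpha> * qcnj \<alpha>')) \<and> qdvd ?q (of_int c * (\<beta> * qcnj \<beta>'))" ..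
next
  let ?q = "l ^ k"
  let ?u = "qcnj \<beta> * \<xi> * \<alpha>" and ?v = "qcnj \<beta>' * \<xi>' * \<alpha>'"
  assume "qdvd ?q (of_int c * (\<alpha> * qcnj \<alpha>')) \<and> qdvd ?q (of_int c * (\<beta> * qcnj \<beta>'))"
  then have A: "qdvd ?q (of_int c * (\<alpha> * qcnj \<alpha>'))" and B: "qdvd ?q (of_int c * (\<beta> * qcnj \<beta>'))" by auto
  obtain g where g: "\<not> l dvd tr (?v * g)" using tr_witness[OF prime_l odd_l k'] by metis
  have cc: "qdvd ?q ((of_int c * ?u) * qcnj ?v)"
  proof -
    have "(of_int c * ?u) * qcnj ?v = (qcnj \<beta> * \<xi>) * (of_int c * (\<alpha> * qcnj \<alpha>')) * (qcnj \<xi>' * \<beta>')"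
      by (simp only: cnj_mult mult.assoc of_int_mid cnj_simps)
    then show ?thesis using A by (simp only: qdvd_multl qdvd_multr)
  qed
  have "qdvd ?q (qcnj (of_int c * ?u) * ?v)"
  proof -
    have "qcnj (of_int c * ?u) * ?v = (qcnj \<alpha> * qcnj \<xi>) * (of_int c * (\<beta> * qcnj \<beta>')) * (\<xi>' * \<alpha>')"
      by (simp only: cnj_mult mult.assoc of_int_mid cnj_simps of_int_comm)
    then show ?thesis using B by (simp only: qdvd_multl qdvd_multr)
  qed
  from proportional_tr[OF cc this, of g]
  have pr: "qdvd ?q (of_int (tr (of_int c * ?u * g)) * ?v - of_int (tr (?v * g)) * (of_int c * ?u))" .
  \<comment> \<open>\<open>proportional_tr\<close> yields the ratio only after multiplication by
    \<open>tr (?v * g)\<close>; this is a unit and is inverted here.\<close>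
  obtain d k' where d: "d * tr (?v * g) = 1 + ?q * k'"
    using inverse_mod[of "tr (?v * g)" ?q] coprime_l_pow[OF g] coprime_commute by metis
  define c' where "c' = d * tr (of_int c * ?u * g)"
  have "of_int c * ?u - of_int c' * ?v = - (of_int d * (of_int (tr (of_int c * ?u * g)) * ?v - of_int (tr (?v * g)) * (of_int c * ?u)))
      - of_int ?q * (of_int (k' * c) * ?u)"
  proof -
    have "of_int d * (of_int (tr (?v * g)) * (of_int c * ?u)) = of_int (1 + ?q * k') * (of_int c * ?u)"
      unfolding d[symmetric] by (simp only: of_int_mult mult.assoc)
    also have "\<dots> = of_int c * ?u + of_int ?q * (of_int (k' * c) * ?u)"
      by (simp only: of_int_add of_int_mult of_int_1 distrib_right mult_1 mult.assoc)
    finally show ?thesis unfolding right_diff_distrib c'_def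
      by (simp only: of_int_mult mult.assoc minus_diff_eq) (simp del: of_int_power)
  qed
  then have "qdvd ?q (of_int c * ?u - of_int c' * ?v)"
    using qdvd_diff[OF _ qdvd_triv] qdvd_multl[OF pr, of "of_int d"] by (metis qdvd_minus)
  then show "\<exists>c'. qdvd ?q (of_int c * ?u - of_int c' * ?v)" by blast
qed

text \<open>The trace of the second form against some \<open>g\<close> is a unit, so in a relation
  between the two forms \<open>c\<close> determines \<open>c'\<close>. Relations may therefore be
  counted by \<open>c\<close> alone.\<close>

lemma incidence:
  assumes a: "\<alpha> \<in> primitive_pow l k" "\<beta> \<in> primitive_pow l k" and a': "\<alpha>' \<in> primitive_pow l k" "\<beta>' \<in> primitive_pow l k"
  shows "int (card {g \<in> quat_residues (l ^ k). qdvd (l ^ k) (\<alpha> * g * qcnj \<beta>) \<and> qdvd (l ^ k) (\<alpha>' * g * qcnj \<beta>')})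
    = (l ^ k)\<^sup>2 * int (card {c \<in> {0..<l ^ k}. qdvd (l ^ k) (of_int c * (\<alpha> * qcnj \<alpha>')) \<and> qdvd (l ^ k) (of_int c * (\<beta> * qcnj \<beta>'))})"
proof -
  let ?q = "l ^ k"
  have q: "?q > 0" "odd ?q" using l_pow_pos odd_l_pow by auto
  obtain \<xi> where k: "\<not> qdvd l (qcnj \<beta> * \<xi> * \<alpha>)" using form_exists[OF a] by metis
  obtain \<xi>' where k': "\<not> qdvd l (qcnj \<beta>' * \<xi>' * \<alpha>')" using form_exists[OF a'] by metis
  let ?u = "qcnj \<beta> * \<xi> * \<alpha>" and ?v = "qcnj \<beta>' * \<xi>' * \<alpha>'"
  let ?C = "{(c, c'). c \<in> {0..<?q} \<and> c' \<in> {0..<?q} \<and> qdvd ?q (of_int c * ?u - of_int c' * ?v)}"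
  have uniq: "c' = c''" if "c' \<in> {0..<?q}" "c'' \<in> {0..<?q}" "qdvd ?q (of_int c * ?u - of_int c' * ?v)"
    "qdvd ?q (of_int c * ?u - of_int c'' * ?v)" for c c' c''
  proof -
    have "qdvd ?q (of_int (c'' - c') * ?v)"
      using qdvd_diff[OF that(3,4)] by (simp add: algebra_simps)
    from qdvd_multr[OF this, of g for g] have all: "qdvd ?q (of_int (c'' - c') * (?v * g))" for g by (simp only: mult.assoc)
    obtain g where g: "\<not> l dvd tr (?v * g)" using tr_witness[OF prime_l odd_l k'] by metis
    have "?q dvd 2 * q0 (of_int (c'' - c') * (?v * g))" using all[of g] by (simp add: qdvd_def)
    then have "?q dvd tr (?v * g) * (c'' - c')" by (simp add: tr_def algebra_simps)
    then have "?q dvd c'' - c'" using coprime_l_pow[OF g, of k] by (simp only: coprime_dvd_mult_right_iff)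
    moreover have "\<bar>c'' - c'\<bar> < ?q" using that by auto
    ultimately show ?thesis using dvd_imp_le_int[of "c'' - c'" ?q] q by force
  qed
  have "card ?C = card (fst ` ?C)"
    by (rule card_image[symmetric]) (use uniq in \<open>fastforce simp: inj_on_def\<close>)
  also have "fst ` ?C = {c \<in> {0..<?q}. \<exists>c'. qdvd ?q (of_int c * ?u - of_int c' * ?v)}"
  proof (intro Set.set_eqI iffI)
    fix c assume "c \<in> {c \<in> {0..<?q}. \<exists>c'. qdvd ?q (of_int c * ?u - of_int c' * ?v)}"
    then obtain c' where c: "c \<in> {0..<?q}" and c': "qdvd ?q (of_int c * ?u - of_int c' * ?v)" by blast
    have e: "(of_int (c' mod ?q) :: quat) = of_int c' - of_int ?q * of_int (c' div ?q)"
      by (simp only: minus_mult_div_eq_mod[symmetric] of_int_diff of_int_mult)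
    have "of_int c * ?u - of_int (c' mod ?q) * ?v = (of_int c * ?u - of_int c' * ?v) + of_int ?q * (of_int (c' div ?q) * ?v)"
      unfolding e by (simp only: left_diff_distrib mult.assoc diff_diff_eq2 diff_add_eq)
    then have "qdvd ?q (of_int c * ?u - of_int (c' mod ?q) * ?v)" using qdvd_add[OF c' qdvd_triv] by metis
    then have "(c, c' mod ?q) \<in> ?C" using c q by simp
    then show "c \<in> fst ` ?C" by (rule image_eqI[rotated]) simp
  qed auto
  also have "\<dots> = {c \<in> {0..<?q}. qdvd ?q (of_int c * (\<alpha> * qcnj \<alpha>')) \<and> qdvd ?q (of_int c * (\<beta> * qcnj \<beta>'))}"
    using forms_proportional_iff[OF a a' k k'] by blast
  finally have C: "card ?C = card {c \<in> {0..<?q}. qdvd ?q (of_int c * (\<alpha> * qcnj \<alpha>')) \<and> qdvd ?q (of_int c * (\<beta> * qcnj \<beta>'))}" .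
  show ?thesis
    unfolding form_iff[OF a k] form_iff[OF a' k'] linear_incidence[OF q] C ..
qed

end

lemma sum_square_expand:
  fixes J :: "'i \<Rightarrow> 'g \<Rightarrow> real"
  shows "(\<Sum>g\<in>G. (\<Sum>i\<in>I. J i g * H i)\<^sup>2) = (\<Sum>i\<in>I. \<Sum>i'\<in>I. (\<Sum>g\<in>G. J i g * J i' g) * (H i * H i'))"
proof -
  have "(\<Sum>g\<in>G. (\<Sum>i\<in>I. J i g * H i)\<^sup>2) = (\<Sum>g\<in>G. \<Sum>i\<in>I. \<Sum>i'\<in>I. (J i g * H i) * (J i' g * H i'))"
    by (simp add: power2_eq_square sum_product)
  also have "\<dots> = (\<Sum>i\<in>I. \<Sum>i'\<in>I. \<Sum>g\<in>G. (J i g * H i) * (J i' g * H i'))"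
    by (subst sum.swap, intro sum.cong refl, rule sum.swap)
  also have "\<dots> = (\<Sum>i\<in>I. \<Sum>i'\<in>I. (\<Sum>g\<in>G. J i g * J i' g) * (H i * H i'))"
    by (intro sum.cong refl) (simp add: sum_distrib_left sum_distrib_right mult_ac)
  finally show ?thesis .
qed

lemma right_factors_units:
  assumes "card (right_factors m x) = 8" "y \<in> right_factors m x" "m > 0"
  shows "right_factors m x = (\<lambda>u. u * y) ` {u. nrm u = 1}"
proof -
  obtain d where d: "nrm y = m" "x = d * y" using assms(2) by (auto simp: right_factors_def)
  have "y \<noteq> 0" using d(1) assms(3) by auto
  have "(\<lambda>u. u * y) ` {u. nrm u = 1} \<subseteq> right_factors m x"
  proof clarify
    fix u assume u: "nrm u = 1"
    have "x = (d * qcnj u) * (u * y)" by (simp add: mult.assoc mult_cnj' u d)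
    then show "u * y \<in> right_factors m x" using u d by (auto simp: right_factors_def nrm_mult)
  qed
  moreover have "card ((\<lambda>u. u * y) ` {u. nrm u = 1}) = 8"
    using \<open>y \<noteq> 0\<close> by (subst card_image) (auto simp: inj_on_def quat_cancel_right card_units)
  moreover have "finite (right_factors m x)" using assms(1) card.infinite by fastforce
  ultimately show ?thesis using assms(1) card_subset_eq by metis
qed

context odd_prime
begin

text \<open>This turns the congruences of \<open>incidence\<close> back into factors: the kernel
  that tests divisibility of \<open>\<alpha> * qcnj \<alpha>'\<close> by \<open>l ^ e\<close> is a
  sum over common right factors, hence positive semidefinite. One common factor of norm
  \<open>l ^ e\<close> makes all eight common, since they form a coset of the units.\<close>

lemma card_right_factors_common:
  assumes a: "\<alpha> \<in> primitive_pow l k" "\<alpha>' \<in> primitive_pow l k" and e: "e \<le> k"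
  shows "card (right_factors (l ^ e) \<alpha> \<inter> right_factors (l ^ e) \<alpha>') = (if qdvd (l ^ e) (\<alpha> * qcnj \<alpha>') then 8 else 0)"
proof -
  let ?m = "l ^ e"
  have dv: "?m dvd nrm \<alpha>" "?m dvd nrm \<alpha>'" "\<not> qdvd l \<alpha>" "\<not> qdvd l \<alpha>'"
    using a e by (auto simp: primitive_pow_def le_imp_power_dvd)
  have c8: "card (right_factors ?m \<alpha>) = 8" "card (right_factors ?m \<alpha>') = 8" using dv card_right_factors_l by auto
  show ?thesis
  proof (cases "qdvd ?m (\<alpha> * qcnj \<alpha>')")
    case False
    have "right_factors ?m \<alpha> \<inter> right_factors ?m \<alpha>' = {}"
    proof (rule ccontr)
      assume "right_factors ?m \<alpha> \<inter> right_factors ?m \<alpha>' \<noteq> {}"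
      then obtain \<gamma> d d' where g: "nrm \<gamma> = ?m" "\<alpha> = d * \<gamma>" "\<alpha>' = d' * \<gamma>" by (auto simp: right_factors_def)
      have "\<alpha> * qcnj \<alpha>' = d * (\<gamma> * (qcnj \<gamma> * qcnj d'))" by (simp add: g cnj_mult mult.assoc)
      also have "\<dots> = of_int ?m * (d * qcnj d')" unfolding mult_cnj' g by (rule of_int_mid)
      finally show False using False by (simp only: qdvd_triv simp_thms)
    qed
    then show ?thesis using False by simp
  next
    case True
    obtain y a b d where y: "nrm y = ?m" "y = qcnj \<alpha> * a + of_int ?m * b" "qcnj \<alpha> = y * d"
      using ideal_generator[of ?m "qcnj \<alpha>"] dv odd_l_pow l_pow_pos prime_dvd_l_pow
      by (metis nrm_cnj qdvd_cnj)
    have "\<alpha> = qcnj d * qcnj y" using arg_cong[OF y(3), of qcnj] by (simp add: cnj_mult)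
    then have 1: "qcnj y \<in> right_factors ?m \<alpha>" using y(1) by (auto simp: right_factors_def)
    have "qcnj y = qcnj a * \<alpha> + of_int ?m * qcnj b"
      using arg_cong[OF y(2), of qcnj] by (simp only: cnj_simps cnj_mult of_int_comm)
    then have "qcnj y * qcnj \<alpha>' = qcnj a * (\<alpha> * qcnj \<alpha>') + of_int ?m * (qcnj b * qcnj \<alpha>')"
      by (simp only: distrib_right mult.assoc)
    then have "qdvd ?m (qcnj y * qcnj \<alpha>')" using qdvd_add[OF qdvd_multl[OF True] qdvd_triv] by metis
    then obtain w where w: "qcnj y * qcnj \<alpha>' = of_int ?m * w" by (rule qdvdE)
    have "of_int ?m * qcnj \<alpha>' = y * (qcnj y * qcnj \<alpha>')" by (simp only: mult_cnj' y(1))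
    also have "\<dots> = of_int ?m * (y * w)" unfolding w by (rule of_int_mid)
    finally have "qcnj \<alpha>' = y * w" using l_pow_pos[of e] by (simp only: of_int_cancel)
    then have "\<alpha>' = qcnj w * qcnj y" by (metis cnj_mult cnj_simps(1))
    then have 2: "qcnj y \<in> right_factors ?m \<alpha>'" using y(1) by (auto simp: right_factors_def)
    have "right_factors ?m \<alpha> = right_factors ?m \<alpha>'"
      using right_factors_units[OF c8(1) 1] right_factors_units[OF c8(2) 2] l_pow_pos by simp
    then show ?thesis using True c8 by simp
  qed
qed

text \<open>The conditions in \<open>incidence\<close> see of \<open>c\<close> only its gcd with
  \<open>l ^ k\<close>. The level \<open>e\<close> measures what is left of the modulus after the
  gcd is cancelled.\<close>

lemma gcd_level:
  assumes "c \<in> {0..<l ^ k}"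
  obtains e where "e \<le> k" "gcd c (l ^ k) = l ^ (k - e)"
    "\<And>z. qdvd (l ^ k) (of_int c * z) \<longleftrightarrow> qdvd (l ^ e) z"
proof -
  have "gcd c (l ^ k) dvd l ^ k" by simp
  then obtain i where i: "i \<le> k" "normalize (gcd c (l ^ k)) = l ^ i"
    by (rule divides_primepow[OF prime_l])
  then have g: "gcd c (l ^ k) = l ^ i" using l_pow_pos[of i] by simp
  have q: "l ^ k = l ^ i * l ^ (k - i)" using i by (simp flip: power_add)
  define c1 where "c1 = c div l ^ i"
  have c: "c = l ^ i * c1" using g by (metis c1_def dvd_mult_div_cancel gcd_dvd1)
  have "coprime (c div gcd c (l ^ k)) (l ^ k div gcd c (l ^ k))"
    using l_gt_2 by (intro div_gcd_coprime) auto
  moreover have "l ^ k div l ^ i = l ^ (k - i)" using q l_gt_2 by simp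
  ultimately have cop: "coprime (l ^ (k - i)) c1" unfolding g c1_def by (simp add: coprime_commute)
  have "qdvd (l ^ k) (of_int c * z) \<longleftrightarrow> qdvd (l ^ (k - i)) z" for z
  proof -
    have "qdvd (l ^ k) (of_int c * z) \<longleftrightarrow> qdvd (l ^ i * l ^ (k - i)) (of_int (l ^ i) * (of_int c1 * z))"
      unfolding q[symmetric] c by (simp only: of_int_mult mult.assoc)
    also have "\<dots> \<longleftrightarrow> qdvd (l ^ (k - i)) (of_int c1 * z)"
      using l_gt_2 by (intro qdvd_mult_cancel) simp
    also have "\<dots> \<longleftrightarrow> qdvd (l ^ (k - i)) z" using cop by (rule qdvd_of_int_coprime)
    finally show ?thesis .
  qed
  then show thesis using that[of "k - i"] i g by simp
qed

lemma card_gcd_level: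
  assumes "e \<le> k"
  shows "int (card {c \<in> {0..<l ^ k}. gcd c (l ^ k) = l ^ (k - e)}) \<le> l ^ e"
proof -
  have q: "l ^ k = l ^ (k - e) * l ^ e" using assms by (simp flip: power_add)
  have "{c \<in> {0..<l ^ k}. gcd c (l ^ k) = l ^ (k - e)} \<subseteq> (\<lambda>j. l ^ (k - e) * j) ` {0..<l ^ e}"
  proof
    fix c assume "c \<in> {c \<in> {0..<l ^ k}. gcd c (l ^ k) = l ^ (k - e)}"
    then have c: "0 \<le> c" "c < l ^ k" "l ^ (k - e) dvd c" by (auto, metis gcd_dvd1)
    then obtain j where j: "c = l ^ (k - e) * j" by (auto elim: dvdE)
    have "0 \<le> j" using c(1) j l_pow_pos[of "k - e"] by (simp add: zero_le_mult_iff)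
    moreover have "j < l ^ e" using c(2) j q l_pow_pos[of "k - e"] by simp
    ultimately show "c \<in> (\<lambda>j. l ^ (k - e) * j) ` {0..<l ^ e}" using j by auto
  qed
  then have "card {c \<in> {0..<l ^ k}. gcd c (l ^ k) = l ^ (k - e)} \<le> card {0..<l ^ e}"
    by (rule surj_card_le[rotated]) simp
  then show ?thesis using l_pow_pos[of e] by simp
qed

text \<open>Expanding the square over \<open>g\<close> produces the kernel counted in
  \<open>incidence\<close>. Sorted by levels and rewritten through common right factors, it becomes
  a positive combination of squares; so an upper bound for the number of residues on each level is
  enough.\<close>

lemma incidence_square_sum:
  fixes H :: "quat \<Rightarrow> quat \<Rightarrow> 'x \<Rightarrow> real"
  assumes X: "finite X"
  shows "(\<Sum>g\<in>quat_residues (l ^ k). \<Sum>x\<in>X. (\<Sum>\<alpha>\<in>primitive_pow l k. \<Sum>\<beta>\<in>primitive_pow l k. if qdvd (l ^ k) (\<alpha> * g * qcnj \<beta>) then H \<alpha> \<beta> x else 0)\<^sup>2)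
    \<le> (of_int (l ^ k))\<^sup>2 / 64 * (\<Sum>e\<le>k. of_int (l ^ e) * (\<Sum>\<gamma>\<in>primitive_pow l e. \<Sum>\<delta>\<in>primitive_pow l e. \<Sum>x\<in>X.
        (\<Sum>\<alpha>\<in>{\<alpha> \<in> primitive_pow l k. \<gamma> \<in> right_factors (l ^ e) \<alpha>}. \<Sum>\<beta>\<in>{\<beta> \<in> primitive_pow l k. \<delta> \<in> right_factors (l ^ e) \<beta>}. H \<alpha> \<beta> x)\<^sup>2))"
proof -
  let ?q = "l ^ k" and ?A = "primitive_pow l k"
  define I where "I = ?A \<times> ?A"
  define J :: "quat \<times> quat \<Rightarrow> quat \<Rightarrow> real" where "J i g = (if qdvd ?q (fst i * g * qcnj (snd i)) then 1 else 0)" for i g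
  define K :: "nat \<Rightarrow> quat \<times> quat \<Rightarrow> quat \<times> quat \<Rightarrow> real" where
    "K e i c = (if fst c \<in> right_factors (l ^ e) (fst i) \<and> snd c \<in> right_factors (l ^ e) (snd i) then 1 else 0)" for e i c
  define h where "h x i = H (fst i) (snd i) x" for x i
  define D where "D c i i' \<longleftrightarrow> qdvd ?q (of_int c * (fst i * qcnj (fst i'))) \<and> qdvd ?q (of_int c * (snd i * qcnj (snd i')))" for c i i'
  define W where "W e x = (\<Sum>c\<in>primitive_pow l e \<times> primitive_pow l e. (\<Sum>i\<in>I. K e i c * h x i)\<^sup>2)" for e x
  have fI: "finite I" by (simp add: I_def finite_primitive_pow)
  have W0: "W e x \<ge> 0" for e x unfolding W_def by (intro sum_nonneg) auto
  have lhs: "(\<Sum>\<alpha>\<in>?A. \<Sum>\<beta>\<in>?A. if qdvd ?q (\<alpha> * g * qcnj \<beta>) then H \<alpha> \<beta> x else 0) = (\<Sum>i\<in>I. J i g * h x i)" for g x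
    unfolding I_def sum.cartesian_product by (intro sum.cong refl) (auto simp: J_def h_def)
  have rhs: "(\<Sum>\<alpha>\<in>{\<alpha> \<in> ?A. \<gamma> \<in> right_factors (l ^ e) \<alpha>}. \<Sum>\<beta>\<in>{\<beta> \<in> ?A. \<delta> \<in> right_factors (l ^ e) \<beta>}. H \<alpha> \<beta> x)
      = (\<Sum>i\<in>I. K e i (\<gamma>, \<delta>) * h x i)" for e \<gamma> \<delta> x
  proof -
    have "(\<Sum>i\<in>I. K e i (\<gamma>, \<delta>) * h x i) = (\<Sum>i\<in>{i \<in> I. \<gamma> \<in> right_factors (l ^ e) (fst i) \<and> \<delta> \<in> right_factors (l ^ e) (snd i)}. h x i)"
      by (subst sum.inter_filter[OF fI]) (auto simp: K_def intro!: sum.cong)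
    also have "{i \<in> I. \<gamma> \<in> right_factors (l ^ e) (fst i) \<and> \<delta> \<in> right_factors (l ^ e) (snd i)}
      = {\<alpha> \<in> ?A. \<gamma> \<in> right_factors (l ^ e) \<alpha>} \<times> {\<beta> \<in> ?A. \<delta> \<in> right_factors (l ^ e) \<beta>}" by (auto simp: I_def)
    finally show ?thesis by (simp add: sum.cartesian_product h_def case_prod_unfold)
  qed
  have Jsum: "(\<Sum>g\<in>quat_residues ?q. J i g * J i' g) = (of_int ?q)\<^sup>2 * (\<Sum>c=0..<?q. if D c i i' then 1 else 0)"
    if i: "i \<in> I" "i' \<in> I" for i i'
  proof -
    have "(\<Sum>g\<in>quat_residues ?q. J i g * J i' g) = (\<Sum>g\<in>quat_residues ?q. if qdvd ?q (fst i * g * qcnj (snd i)) \<and> qdvd ?q (fst i' * g * qcnj (snd i')) then 1 else 0)"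
      by (intro sum.cong refl) (auto simp: J_def)
    also have "\<dots> = real (card {g \<in> quat_residues ?q. qdvd ?q (fst i * g * qcnj (snd i)) \<and> qdvd ?q (fst i' * g * qcnj (snd i'))})"
      by (simp add: finite_quat_residues flip: sum.inter_filter)
    also have "\<dots> = of_int ((?q)\<^sup>2 * int (card {c \<in> {0..<?q}. D c i i'}))"
    proof -
      have m: "fst i \<in> ?A" "snd i \<in> ?A" "fst i' \<in> ?A" "snd i' \<in> ?A" using i by (auto simp: I_def)
      show ?thesis unfolding D_def
        using arg_cong[OF incidence[OF m], of real_of_int] by (simp only: of_int_of_nat_eq)
    qed
    also have "real (card {c \<in> {0..<?q}. D c i i'}) = (\<Sum>c=0..<?q. if D c i i' then 1 else 0)"
      by (simp flip: sum.inter_filter)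
    then have "of_int ((?q)\<^sup>2 * int (card {c \<in> {0..<?q}. D c i i'})) = (of_int ?q)\<^sup>2 * (\<Sum>c=0..<?q. if D c i i' then (1::real) else 0)"
      by simp
    finally show ?thesis .
  qed
  \<comment> \<open>64 = 8 * 8: eight common right factors on the side of \<open>\<alpha>\<close>
    and eight on the side of \<open>\<beta>\<close>.\<close>
  have Ksum: "(\<Sum>c\<in>primitive_pow l e \<times> primitive_pow l e. K e i c * K e i' c)
      = (if qdvd (l ^ e) (fst i * qcnj (fst i')) \<and> qdvd (l ^ e) (snd i * qcnj (snd i')) then 64 else 0)"
    if i: "i \<in> I" "i' \<in> I" and e: "e \<le> k" for i i' e
  proof -
    let ?R = "\<lambda>x y. right_factors (l ^ e) x \<inter> right_factors (l ^ e) y"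
    have sub: "?R (fst i) y \<subseteq> primitive_pow l e" "?R (snd i) y \<subseteq> primitive_pow l e" for y
      using i qdvd_multl by (auto simp: I_def right_factors_def primitive_pow_def)
    have "(\<Sum>c\<in>primitive_pow l e \<times> primitive_pow l e. K e i c * K e i' c)
      = (\<Sum>c\<in>primitive_pow l e \<times> primitive_pow l e. if c \<in> ?R (fst i) (fst i') \<times> ?R (snd i) (snd i') then 1 else 0)"
      by (intro sum.cong refl) (auto simp: K_def)
    also have "\<dots> = real (card {c \<in> primitive_pow l e \<times> primitive_pow l e. c \<in> ?R (fst i) (fst i') \<times> ?R (snd i) (snd i')})"
      by (simp add: finite_primitive_pow flip: sum.inter_filter)
    also have "{c \<in> primitive_pow l e \<times> primitive_pow l e. c \<in> ?R (fst i) (fst i') \<times> ?R (snd i) (snd i')} = ?R (fst i) (fst i') \<times> ?R (snd i) (snd i')"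
      using sub by blast
    finally show ?thesis
      using card_right_factors_common[OF _ _ e, of "fst i" "fst i'"] card_right_factors_common[OF _ _ e, of "snd i" "snd i'"] i
      by (simp add: card_cartesian_product I_def mem_Times_iff)
  qed
  have main: "(\<Sum>g\<in>quat_residues ?q. (\<Sum>i\<in>I. J i g * h x i)\<^sup>2) \<le> (of_int ?q)\<^sup>2 / 64 * (\<Sum>e\<le>k. of_int (l ^ e) * W e x)" for x
  proof -
    have "(\<Sum>g\<in>quat_residues ?q. (\<Sum>i\<in>I. J i g * h x i)\<^sup>2) = (\<Sum>i\<in>I. \<Sum>i'\<in>I. (\<Sum>g\<in>quat_residues ?q. J i g * J i' g) * (h x i * h x i'))"
      by (rule sum_square_expand)
    also have "\<dots> = (\<Sum>i\<in>I. \<Sum>i'\<in>I. (of_int ?q)\<^sup>2 * (\<Sum>c=0..<?q. (if D c i i' then 1 else 0) * (h x i * h x i')))"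
      by (intro sum.cong refl) (simp only: Jsum sum_distrib_right mult.assoc)
    also have "\<dots> = (of_int ?q)\<^sup>2 * (\<Sum>i\<in>I. \<Sum>i'\<in>I. \<Sum>c=0..<?q. (if D c i i' then 1 else 0) * (h x i * h x i'))"
      by (simp only: sum_distrib_left)
    also have "(\<Sum>i\<in>I. \<Sum>i'\<in>I. \<Sum>c=0..<?q. (if D c i i' then 1 else 0) * (h x i * h x i'))
      = (\<Sum>c=0..<?q. \<Sum>i\<in>I. \<Sum>i'\<in>I. (if D c i i' then 1 else 0) * (h x i * h x i'))"
    proof -
      have "(\<Sum>i\<in>I. \<Sum>i'\<in>I. \<Sum>c=0..<?q. (if D c i i' then 1 else 0) * (h x i * h x i'))
        = (\<Sum>i\<in>I. \<Sum>c=0..<?q. \<Sum>i'\<in>I. (if D c i i' then 1 else 0) * (h x i * h x i'))"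
        by (intro sum.cong refl, rule sum.swap)
      also have "\<dots> = (\<Sum>c=0..<?q. \<Sum>i\<in>I. \<Sum>i'\<in>I. (if D c i i' then 1 else 0) * (h x i * h x i'))"
        by (rule sum.swap)
      finally show ?thesis .
    qed
    \<comment> \<open>Each \<open>c\<close> is matched with its own level; all other terms are
      nonnegative.\<close>
    also have "\<dots> \<le> (\<Sum>c=0..<?q. \<Sum>e\<le>k. if gcd c ?q = l ^ (k - e) then W e x / 64 else 0)"
    proof (rule sum_mono)
      fix c assume c: "c \<in> {0..<?q}"
      obtain e where e: "e \<le> k" "gcd c ?q = l ^ (k - e)" "\<And>z. qdvd ?q (of_int c * z) \<longleftrightarrow> qdvd (l ^ e) z"
        using gcd_level[OF c] by blast
      have "(\<Sum>i\<in>I. \<Sum>i'\<in>I. (if D c i i' then 1 else 0) * (h x i * h x i'))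
        = (\<Sum>i\<in>I. \<Sum>i'\<in>I. (\<Sum>c\<in>primitive_pow l e \<times> primitive_pow l e. K e i c * K e i' c) * (h x i * h x i')) / 64"
        unfolding sum_divide_distrib
        by (intro sum.cong refl) (auto simp: Ksum[OF _ _ e(1)] D_def e(3))
      also have "\<dots> = W e x / 64" unfolding W_def sum_square_expand ..
      also have "W e x / 64 = (if gcd c ?q = l ^ (k - e) then W e x / 64 else 0)" using e by simp
      also have "\<dots> \<le> (\<Sum>e\<le>k. if gcd c ?q = l ^ (k - e) then W e x / 64 else 0)"
        by (rule member_le_sum) (use e W0 in auto)
      finally show "(\<Sum>i\<in>I. \<Sum>i'\<in>I. (if D c i i' then 1 else 0) * (h x i * h x i'))
        \<le> (\<Sum>e\<le>k. if gcd c ?q = l ^ (k - e) then W e x / 64 else 0)" .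
    qed
    also have "\<dots> = (\<Sum>e\<le>k. \<Sum>c=0..<?q. if gcd c ?q = l ^ (k - e) then W e x / 64 else 0)"
      by (rule sum.swap)
    also have "\<dots> \<le> (\<Sum>e\<le>k. of_int (l ^ e) * (W e x / 64))"
    proof (rule sum_mono)
      fix e assume "e \<in> {..k}"
      then have "real (card {c \<in> {0..<?q}. gcd c ?q = l ^ (k - e)}) \<le> of_int (l ^ e)"
        using card_gcd_level[of e k] by (metis atMost_iff of_int_le_iff of_int_of_nat_eq)
      then have "real (card {c \<in> {0..<?q}. gcd c ?q = l ^ (k - e)}) * (W e x / 64) \<le> of_int (l ^ e) * (W e x / 64)"
        by (rule mult_right_mono) (simp add: W0)
      then show "(\<Sum>c=0..<?q. if gcd c ?q = l ^ (k - e) then W e x / 64 else 0) \<le> of_int (l ^ e) * (W e x / 64)"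
        by (simp flip: sum.inter_filter)
    qed
    finally have "(\<Sum>g\<in>quat_residues ?q. (\<Sum>i\<in>I. J i g * h x i)\<^sup>2) \<le> (of_int ?q)\<^sup>2 * (\<Sum>e\<le>k. of_int (l ^ e) * (W e x / 64))"
      by (simp add: mult_left_mono)
    moreover have "(\<Sum>e\<le>k. of_int (l ^ e) * (W e x / 64)) = (\<Sum>e\<le>k. of_int (l ^ e) * W e x) / 64"
      by (simp add: sum_divide_distrib)
    ultimately show ?thesis by (simp only: times_divide_eq_right times_divide_eq_left)
  qed
  have "(\<Sum>g\<in>quat_residues ?q. \<Sum>x\<in>X. (\<Sum>i\<in>I. J i g * h x i)\<^sup>2) = (\<Sum>x\<in>X. \<Sum>g\<in>quat_residues ?q. (\<Sum>i\<in>I. J i g * h x i)\<^sup>2)"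
    by (rule sum.swap)
  also have "\<dots> \<le> (\<Sum>x\<in>X. (of_int ?q)\<^sup>2 / 64 * (\<Sum>e\<le>k. of_int (l ^ e) * W e x))"
    by (rule sum_mono) (rule main)
  also have "\<dots> = (of_int ?q)\<^sup>2 / 64 * (\<Sum>e\<le>k. of_int (l ^ e) * (\<Sum>x\<in>X. W e x))"
    unfolding sum_distrib_left[symmetric] by (subst sum.swap) (simp only: sum_distrib_left)
  also have "(\<lambda>e. \<Sum>x\<in>X. W e x) = (\<lambda>e. \<Sum>\<gamma>\<in>primitive_pow l e. \<Sum>\<delta>\<in>primitive_pow l e. \<Sum>x\<in>X. (\<Sum>i\<in>I. K e i (\<gamma>, \<delta>) * h x i)\<^sup>2)"
  proof
    fix e
    have "(\<Sum>x\<in>X. W e x) = (\<Sum>c\<in>primitive_pow l e \<times> primitive_pow l e. \<Sum>x\<in>X. (\<Sum>i\<in>I. K e i c * h x i)\<^sup>2)"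
      unfolding W_def by (rule sum.swap)
    then show "(\<Sum>x\<in>X. W e x) = (\<Sum>\<gamma>\<in>primitive_pow l e. \<Sum>\<delta>\<in>primitive_pow l e. \<Sum>x\<in>X. (\<Sum>i\<in>I. K e i (\<gamma>, \<delta>) * h x i)\<^sup>2)"
      using sum.cartesian_product[of "\<lambda>\<gamma> \<delta>. \<Sum>x\<in>X. (\<Sum>i\<in>I. K e i (\<gamma>, \<delta>) * h x i)\<^sup>2" "primitive_pow l e" "primitive_pow l e"]
      by (simp only: case_prod_unfold prod.collapse)
  qed
  finally show ?thesis unfolding lhs rhs .
qed

end

section \<open>Hecke operators on functions modulo \<open>p\<close>\<close>

definition quat_mod :: "int \<Rightarrow> quat \<Rightarrow> quat" where
  "quat_mod m x = Quat (q0 x mod m) (q1 x mod m) (q2 x mod m) (q3 x mod m)"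

lemma quat_mod_in_quat_residues: "m > 0 \<Longrightarrow> quat_mod m x \<in> quat_residues m"
  by (simp add: quat_mod_def quat_residues_def)

lemma qdvd_quat_mod: "qdvd m (x - quat_mod m x)"
  by (simp add: quat_mod_def qdvd_def)

lemma quat_residues_eq: "x \<in> quat_residues m \<Longrightarrow> y \<in> quat_residues m \<Longrightarrow> qdvd m (x - y) \<Longrightarrow> x = y"
proof -
  have e: "a = b" if "a \<in> {0..<m}" "b \<in> {0..<m}" "m dvd a - b" for a b
    using that by (metis atLeastLessThan_iff mod_eq_dvd_iff mod_pos_pos_trivial)
  show "x \<in> quat_residues m \<Longrightarrow> y \<in> quat_residues m \<Longrightarrow> qdvd m (x - y) \<Longrightarrow> x = y"
    unfolding quat_residues_def qdvd_def quat_eq_iff mem_Collect_eq by (auto intro!: e)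
qed

lemma qdvd_diff_sym: "qdvd m (x - y) \<longleftrightarrow> qdvd m (y - x)"
  using qdvd_minus[of m "x - y"] by simp

definition periodic :: "int \<Rightarrow> (quat \<Rightarrow> real) \<Rightarrow> bool" where
  "periodic p f \<longleftrightarrow> (\<forall>x y. qdvd p (x - y) \<longrightarrow> f x = f y)"

lemma perD: "periodic p f \<Longrightarrow> qdvd p (x - y) \<Longrightarrow> f x = f y"
  unfolding periodic_def by blast

lemma periodic_mult: "periodic p f \<Longrightarrow> periodic p (\<lambda>x. f (a * x * b))"
  unfolding periodic_def
proof (intro allI impI)
  fix x y assume f: "\<forall>x y. qdvd p (x - y) \<longrightarrow> f x = f y" and "qdvd p (x - y)"
  then have "qdvd p (a * (x - y) * b)" by (intro qdvd_multl qdvd_multr)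
  then have "qdvd p (a * x * b - a * y * b)" by (simp add: algebra_simps)
  then show "f (a * x * b) = f (a * y * b)" using f by blast
qed

lemma periodic_multl: "periodic p f \<Longrightarrow> periodic p (\<lambda>x. f (a * x))"
  using periodic_mult[of p f a 1] by simp

lemma sum_mod_shift:
  assumes p: "prime p" and f: "periodic p f" and a: "\<not> p dvd nrm a" and b: "\<not> p dvd nrm b"
  shows "(\<Sum>x\<in>quat_residues p. f (a * x * b)) = (\<Sum>x\<in>quat_residues p. f x)"
proof -
  have p0: "p > 0" using p prime_gt_0_int by blast
  define t where "t x = quat_mod p (a * x * b)" for x
  have inj: "inj_on t (quat_residues p)"
  proof (rule inj_onI)
    fix x y assume x: "x \<in> quat_residues p" "y \<in> quat_residues p" and "t x = t y"
    then have "qdvd p ((a * x * b - t x) - (a * y * b - t y))"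
      unfolding t_def by (intro qdvd_diff[OF qdvd_quat_mod qdvd_quat_mod])
    then have "qdvd p (a * (x - y) * b)" using \<open>t x = t y\<close> by (simp add: algebra_simps)
    then have "qdvd p (qcnj a * (a * (x - y) * b) * qcnj b)" by (rule qdvd_multr[OF qdvd_multl])
    also have "qcnj a * (a * (x - y) * b) * qcnj b = (qcnj a * a) * (x - y) * (b * qcnj b)" by (simp only: mult.assoc)
    also have "\<dots> = of_int (nrm a * nrm b) * (x - y)" by (simp add: mult_cnj quat_eq_iff)
    finally have "qdvd p (x - y)"
      using a b p by (subst (asm) qdvd_of_int_coprime) (auto intro!: prime_imp_coprime simp: prime_dvd_mult_iff)
    then show "x = y" using x quat_residues_eq by blast
  qed
  have sub: "t ` quat_residues p \<subseteq> quat_residues p" using p0 by (auto simp: t_def quat_mod_in_quat_residues)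
  have "t ` quat_residues p = quat_residues p" using endo_inj_surj[OF finite_quat_residues sub inj] .
  then have "(\<Sum>x\<in>quat_residues p. f x) = (\<Sum>x\<in>quat_residues p. f (t x))" using sum.reindex[OF inj, of f] by simp
  also have "\<dots> = (\<Sum>x\<in>quat_residues p. f (a * x * b))"
    by (intro sum.cong refl) (auto simp: t_def intro!: perD[OF f, symmetric] qdvd_quat_mod)
  finally show ?thesis by simp
qed

locale level = odd_prime +
  fixes p :: int
  assumes prime_p: "prime p" and odd_p: "odd p" and l_neq_p: "l \<noteq> p"
begin

lemma p_gt_2: "p > 2"
  using prime_p odd_p prime_ge_2_int[of p] by (cases "p = 2") auto

lemma p_ndvd_l_pow: "\<not> p dvd l ^ k"
  using prime_dvd_l_pow[OF prime_p, of k] l_neq_p by auto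

lemma coprime_p: "\<not> p dvd c \<Longrightarrow> coprime c p"
  using prime_imp_coprime[OF prime_p, of c] coprime_commute by blast

definition inv_p :: "int \<Rightarrow> int" where
  "inv_p c = (SOME c'. p dvd c' * c - 1)"

lemma inv_p: "\<not> p dvd c \<Longrightarrow> p dvd inv_p c * c - 1"
proof -
  assume "\<not> p dvd c"
  then obtain c' k where "c' * c = 1 + p * k" using inverse_mod[OF coprime_p] by metis
  then have "p dvd c' * c - 1" by simp
  then show ?thesis unfolding inv_p_def by (rule someI)
qed

lemma inv_p_ndvd: "\<not> p dvd c \<Longrightarrow> \<not> p dvd inv_p c"
proof
  assume "\<not> p dvd c" "p dvd inv_p c"
  then have "p dvd inv_p c * c - (inv_p c * c - 1)" using inv_p dvd_diff dvd_mult2 by blast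
  then show False using p_gt_2 by simp
qed

lemma periodic_inv:
  assumes "periodic p f" "\<not> p dvd c"
  shows "f (of_int (inv_p c) * (of_int c * x)) = f x" "f (of_int c * (of_int (inv_p c) * x)) = f x"
proof -
  have "of_int (inv_p c) * (of_int c * x) - x = of_int (inv_p c * c - 1) * x"
    by (simp add: left_diff_distrib mult.assoc)
  then have 1: "qdvd p (of_int (inv_p c) * (of_int c * x) - x)"
    using qdvd_of_int_dvd[OF inv_p[OF assms(2)], of x] by simp
  then show "f (of_int (inv_p c) * (of_int c * x)) = f x" using assms(1) perD by blast
  then show "f (of_int c * (of_int (inv_p c) * x)) = f x"
    using of_int_mid[of "of_int c" "inv_p c" x] by simp
qed

definition l2norm :: "(quat \<Rightarrow> real) \<Rightarrow> real" where
  "l2norm f = L2_set f (quat_residues p)"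

definition l2inner :: "(quat \<Rightarrow> real) \<Rightarrow> (quat \<Rightarrow> real) \<Rightarrow> real" where
  "l2inner f g = (\<Sum>x\<in>quat_residues p. f x * g x)"

lemma l2norm_sq: "(l2norm f)\<^sup>2 = l2inner f f"
  by (simp add: l2norm_def l2inner_def L2_set_def sum_nonneg power2_eq_square)

lemma l2norm_sq_sum: "(l2norm f)\<^sup>2 = (\<Sum>x\<in>quat_residues p. (f x)\<^sup>2)"
  by (simp add: l2norm_def L2_set_def sum_nonneg)

lemma l2norm_ge_0 [simp]: "l2norm f \<ge> 0"
  by (simp add: l2norm_def)

lemma l2norm_triangle: "l2norm (\<lambda>x. f x + g x) \<le> l2norm f + l2norm g"
  unfolding l2norm_def by (rule L2_set_triangle_ineq)

lemma l2norm_sum: "finite A \<Longrightarrow> l2norm (\<lambda>x. \<Sum>a\<in>A. f a x) \<le> (\<Sum>a\<in>A. l2norm (f a))"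
proof (induction A rule: finite_induct)
  case empty
  then show ?case by (simp add: l2norm_def L2_set_def)
next
  case (insert a A)
  then show ?case using l2norm_triangle[of "f a" "\<lambda>x. \<Sum>a\<in>A. f a x"] by simp
qed

lemma l2inner_le: "\<bar>l2inner f g\<bar> \<le> l2norm f * l2norm g"
proof -
  have "\<bar>l2inner f g\<bar> \<le> (\<Sum>x\<in>quat_residues p. \<bar>f x\<bar> * \<bar>g x\<bar>)" unfolding l2inner_def by (rule order_trans[OF sum_abs]) (simp add: abs_mult)
  also have "\<dots> \<le> l2norm f * l2norm g" unfolding l2norm_def by (rule L2_set_mult_ineq)
  finally show ?thesis .
qed

lemma l2inner_shift: "periodic p f \<Longrightarrow> periodic p g \<Longrightarrow> \<not> p dvd nrm a \<Longrightarrow> \<not> p dvd nrm b \<Longrightarrow>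
    l2inner (\<lambda>x. f (a * x * b)) (\<lambda>x. g (a * x * b)) = l2inner f g"
  unfolding l2inner_def by (rule sum_mod_shift[OF prime_p]) (auto simp: periodic_def)

lemma l2norm_shift: "periodic p f \<Longrightarrow> \<not> p dvd nrm a \<Longrightarrow> \<not> p dvd nrm b \<Longrightarrow> l2norm (\<lambda>x. f (a * x * b)) = l2norm f"
  using l2inner_shift[of f f a b] l2norm_sq[of f] l2norm_sq[of "\<lambda>x. f (a * x * b)"]
  by (metis l2norm_ge_0 power2_eq_imp_eq)

lemma l2norm_shiftl: "periodic p f \<Longrightarrow> \<not> p dvd nrm a \<Longrightarrow> l2norm (\<lambda>x. f (a * x)) = l2norm f"
  using l2norm_shift[of f a 1] p_gt_2 by simp

lemma abs_le_l2norm: "periodic p f \<Longrightarrow> \<bar>f x\<bar> \<le> l2norm f"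
proof -
  assume f: "periodic p f"
  have "f x = f (quat_mod p x)" using perD[OF f qdvd_quat_mod] .
  moreover have "\<bar>f (quat_mod p x)\<bar> \<le> l2norm f"
  proof -
    have "(f (quat_mod p x))\<^sup>2 \<le> (\<Sum>x\<in>quat_residues p. (f x)\<^sup>2)"
      using p_gt_2 by (intro member_le_sum) (auto simp: finite_quat_residues quat_mod_in_quat_residues)
    then show ?thesis unfolding l2norm_def L2_set_def by (metis real_sqrt_abs real_sqrt_le_iff)
  qed
  ultimately show ?thesis by simp
qed

text \<open>These functions are constant on the components of the graph that joins
  \<open>a * x\<close> and \<open>a' * x\<close> modulo \<open>p\<close>. Stating this as an
  invariance spares a description of the components.\<close>

definition norm_invariant :: "(quat \<Rightarrow> real) \<Rightarrow> bool" where
  "norm_invariant f \<longleftrightarrow> periodic p f \<and> (\<forall>a a' x. nrm a = l \<longrightarrow> nrm a' = l \<longrightarrow> f (a * x) = f (a' * x))"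

lemma norm_invariant_periodic: "norm_invariant f \<Longrightarrow> periodic p f"
  unfolding norm_invariant_def by blast

lemma norm_invariant_D: "norm_invariant f \<Longrightarrow> nrm a = l \<Longrightarrow> nrm a' = l \<Longrightarrow> f (a * x) = f (a' * x)"
  unfolding norm_invariant_def by blast

text \<open>On a norm-invariant function the operator of norm \<open>l\<close> acts as its degree
  times one translation, so there is no decay; the complement removes this part. The name follows
  the analogy with cusp forms, the complement of the Eisenstein series.\<close>

definition cuspidal :: "(quat \<Rightarrow> real) set" where
  "cuspidal = {f. periodic p f \<and> (\<forall>f0. norm_invariant f0 \<longrightarrow> l2inner f f0 = 0)}"

lemma cuspidal_periodic: "f \<in> cuspidal \<Longrightarrow> periodic p f"
  by (simp add: cuspidal_def)

lemma cuspidal_sum: "finite A \<Longrightarrow> (\<And>a. a \<in> A \<Longrightarrow> f a \<in> cuspidal) \<Longrightarrow> (\<lambda>x. \<Sum>a\<in>A. f a x) \<in> cuspidal"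
proof -
  assume A: "finite A" "\<And>a. a \<in> A \<Longrightarrow> f a \<in> cuspidal"
  have "periodic p (\<lambda>x. \<Sum>a\<in>A. f a x)" unfolding periodic_def using A(2) cuspidal_periodic perD by (auto intro!: sum.cong) blast
  moreover have "l2inner (\<lambda>x. \<Sum>a\<in>A. f a x) f0 = 0" if "norm_invariant f0" for f0
  proof -
    have "l2inner (\<lambda>x. \<Sum>a\<in>A. f a x) f0 = (\<Sum>a\<in>A. l2inner (f a) f0)"
      unfolding l2inner_def by (simp add: sum_distrib_right) (rule sum.swap)
    also have "\<dots> = 0" using A(2) that by (intro sum.neutral) (auto simp: cuspidal_def)
    finally show ?thesis .
  qed
  ultimately show ?thesis by (simp add: cuspidal_def)
qed

text \<open>Modulo \<open>p\<close>, the inverse of \<open>x \<mapsto> a * x * b\<close> is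
  \<open>x \<mapsto> qcnj a * x * qcnj b\<close> up to a unit. Moved to the other side of the inner
  product, it only has to preserve the norm-invariant functions.\<close>

lemma cuspidal_mult:
  assumes f: "f \<in> cuspidal" and a: "\<not> p dvd nrm a" and b: "\<not> p dvd nrm b"
    and inv: "\<And>f0. norm_invariant f0 \<Longrightarrow> norm_invariant (\<lambda>x. f0 (of_int (inv_p (nrm a * nrm b)) * (qcnj a * x * qcnj b)))"
  shows "(\<lambda>x. f (a * x * b)) \<in> cuspidal"
proof -
  let ?c = "inv_p (nrm a * nrm b)"
  have ab: "\<not> p dvd nrm a * nrm b" using a b prime_p by (simp add: prime_dvd_mult_iff)
  have "l2inner (\<lambda>x. f (a * x * b)) f0 = 0" if f0: "norm_invariant f0" for f0
  proof -
    let ?g = "\<lambda>x. f0 (of_int ?c * (qcnj a * x * qcnj b))"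
    have pf: "periodic p f0" using norm_invariant_periodic[OF f0] .
    have pg: "periodic p ?g" using norm_invariant_periodic[OF inv[OF f0]] .
    have "f0 x = ?g (a * x * b)" for x
    proof -
      have "qcnj a * (a * x * b) * qcnj b = (qcnj a * a) * x * (b * qcnj b)" by (simp only: mult.assoc)
      also have "\<dots> = of_int (nrm a * nrm b) * x" by (simp add: mult_cnj quat_eq_iff)
      finally show ?thesis using periodic_inv(1)[OF pf ab, of x] by simp
    qed
    then have "l2inner (\<lambda>x. f (a * x * b)) f0 = l2inner (\<lambda>x. f (a * x * b)) (\<lambda>x. ?g (a * x * b))" by (simp add: l2inner_def)
    also have "\<dots> = l2inner f ?g" by (rule l2inner_shift[OF cuspidal_periodic[OF f] pg a b])
    also have "\<dots> = 0" using f inv[OF f0] by (simp add: cuspidal_def)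
    finally show ?thesis .
  qed
  then show ?thesis using periodic_mult[OF cuspidal_periodic[OF f]] by (simp add: cuspidal_def)
qed

lemma cuspidal_scalar: "f \<in> cuspidal \<Longrightarrow> \<not> p dvd c \<Longrightarrow> (\<lambda>x. f (of_int c * x)) \<in> cuspidal"
proof -
  assume f: "f \<in> cuspidal" and c: "\<not> p dvd c"
  have "(\<lambda>x. f (of_int c * x * 1)) \<in> cuspidal"
  proof (rule cuspidal_mult[OF f])
    show "\<not> p dvd nrm (of_int c)" "\<not> p dvd nrm 1" using c prime_p p_gt_2 by (auto simp: prime_dvd_power_iff)
    fix f0 assume f0: "norm_invariant f0"
    let ?d = "inv_p (nrm (of_int c) * nrm 1)"
    have "f0 (of_int ?d * (qcnj (of_int c) * (a * x) * qcnj 1)) = f0 (of_int ?d * (qcnj (of_int c) * (a' * x) * qcnj 1))"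
      if "nrm a = l" "nrm a' = l" for a a' x
    proof -
      have e: "of_int ?d * (qcnj (of_int c) * (b * x) * qcnj 1) = b * (of_int ?d * (of_int c * x))" for b
        by (simp add: quat_eq_iff algebra_simps)
      show ?thesis unfolding e using norm_invariant_D[OF f0 that] .
    qed
    moreover have "periodic p (\<lambda>x. f0 (of_int ?d * (qcnj (of_int c) * x * qcnj 1)))"
      using periodic_mult[of p "\<lambda>x. f0 (of_int ?d * x)"] periodic_multl[of p f0] norm_invariant_periodic[OF f0] by blast
    ultimately show "norm_invariant (\<lambda>x. f0 (of_int ?d * (qcnj (of_int c) * x * qcnj 1)))"
      unfolding norm_invariant_def by blast
  qed
  then show ?thesis by simp
qed

lemma cuspidal_multl:
  assumes f: "f \<in> cuspidal" and a: "nrm a = 1 \<or> nrm a = l"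
  shows "(\<lambda>x. f (a * x)) \<in> cuspidal"
proof -
  have pa: "\<not> p dvd nrm a" using a p_gt_2 p_ndvd_l_pow[of 1] by auto
  have "(\<lambda>x. f (a * x * 1)) \<in> cuspidal"
  proof (rule cuspidal_mult[OF f pa])
    show "\<not> p dvd nrm 1" using p_gt_2 by simp
    fix f0 assume f0: "norm_invariant f0"
    let ?d = "inv_p (nrm a * nrm 1)"
    have I: "f0 (b * y) = f0 (b' * y)" if "nrm b = l" "nrm b' = l" for b b' y using norm_invariant_D[OF f0 that] .
    have "f0 (of_int ?d * (qcnj a * (b * x) * qcnj 1)) = f0 (of_int ?d * (qcnj a * (b' * x) * qcnj 1))"
      if b: "nrm b = l" "nrm b' = l" for b b' x
    proof (cases "nrm a = 1")
      case True
      have e: "of_int ?d * (qcnj a * (b * x) * qcnj 1) = (qcnj a * b) * (of_int ?d * x)" for b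
        by (simp only: of_int_mid mult.assoc cnj_simps mult_1_right)
      show ?thesis unfolding e using I[of "qcnj a * b" "qcnj a * b'"] b True by (simp add: nrm_mult)
    next
      case False
      have e: "of_int ?d * (qcnj a * (b * x) * qcnj 1) = qcnj a * (b * (of_int ?d * x))" for b
        by (simp only: of_int_mid mult.assoc cnj_simps mult_1_right)
      \<comment> \<open>Invariance replaces \<open>qcnj a\<close> by \<open>qcnj b\<close>, both of
        norm \<open>l\<close>; after that the value no longer depends on \<open>b\<close>.\<close>
      have "f0 (qcnj a * (b * y)) = f0 (of_int l * y)" if "nrm b = l" for b y
        using I[of "qcnj a" "qcnj b" "b * y"] a False that by (simp add: mult_cnj')
      then show ?thesis unfolding e using b by simp
    qed
    moreover have "periodic p (\<lambda>x. f0 (of_int ?d * (qcnj a * x * qcnj 1)))"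
      using periodic_mult[of p "\<lambda>x. f0 (of_int ?d * x)"] periodic_multl[of p f0] norm_invariant_periodic[OF f0] by blast
    ultimately show "norm_invariant (\<lambda>x. f0 (of_int ?d * (qcnj a * x * qcnj 1)))"
      unfolding norm_invariant_def by blast
  qed
  then show ?thesis by simp
qed

lemma cuspidal_primitive_pow: "f \<in> cuspidal \<Longrightarrow> a \<in> primitive_pow l m \<Longrightarrow> (\<lambda>x. f (a * x)) \<in> cuspidal"
proof (induction m arbitrary: a)
  case 0
  then show ?case using cuspidal_multl by (auto simp: primitive_pow_0)
next
  case (Suc m)
  have "card (right_factors l a) = 8" using card_right_factors_l[of 1 a] Suc.prems by (auto simp: primitive_pow_def)
  then have "right_factors l a \<noteq> {}" by auto
  then obtain b d where b: "nrm b = l" "a = d * b" by (auto simp: right_factors_def)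
  have "nrm d * l = l ^ m * l" using b Suc.prems by (simp add: primitive_pow_def nrm_mult)
  then have "nrm d = l ^ m" using l_gt_2 by simp
  moreover have "\<not> qdvd l d" using b Suc.prems qdvd_multr by (auto simp: primitive_pow_def)
  ultimately have "d \<in> primitive_pow l m" by (simp add: primitive_pow_def)
  from cuspidal_multl[OF Suc.IH[OF Suc.prems(1) this], of b] show ?case using b by (simp add: mult.assoc)
qed

text \<open>All unit multiples of \<open>a\<close> are summed, so nothing has to be assumed about
  \<open>f\<close> and units. This is the origin of the factors 8 in the recursion.\<close>

definition hecke_op :: "nat \<Rightarrow> (quat \<Rightarrow> real) \<Rightarrow> quat \<Rightarrow> real" where
  "hecke_op m f x = (\<Sum>a\<in>primitive_pow l m. f (a * x))"

lemma cuspidal_hecke_op: "f \<in> cuspidal \<Longrightarrow> hecke_op m f \<in> cuspidal"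
  unfolding hecke_op_def[abs_def] by (intro cuspidal_sum finite_primitive_pow cuspidal_primitive_pow)

lemma p_ndvd_primitive_pow: "a \<in> primitive_pow l m \<Longrightarrow> \<not> p dvd nrm a"
  using p_ndvd_l_pow by (simp add: primitive_pow_def)

lemma l2norm_hecke_op_le: "periodic p f \<Longrightarrow> l2norm (hecke_op m f) \<le> real (card (primitive_pow l m)) * l2norm f"
proof -
  assume f: "periodic p f"
  have "l2norm (hecke_op m f) \<le> (\<Sum>a\<in>primitive_pow l m. l2norm (\<lambda>x. f (a * x)))"
    unfolding hecke_op_def[abs_def] by (rule l2norm_sum) (rule finite_primitive_pow)
  also have "\<dots> = (\<Sum>a\<in>primitive_pow l m. l2norm f)" using f by (intro sum.cong refl l2norm_shiftl p_ndvd_primitive_pow)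
  finally show ?thesis by simp
qed

section \<open>Dirichlet energy and the spectral gap\<close>

lemma sum_sq_identity:
  fixes g :: "'a \<Rightarrow> real"
  shows "(\<Sum>a\<in>A. g a)\<^sup>2 = real (card A) * (\<Sum>a\<in>A. (g a)\<^sup>2) - (\<Sum>a\<in>A. \<Sum>b\<in>A. (g a - g b)\<^sup>2) / 2"
proof -
  have "(\<Sum>a\<in>A. \<Sum>b\<in>A. (g a - g b)\<^sup>2) = (\<Sum>a\<in>A. \<Sum>b\<in>A. (g a)\<^sup>2 + (g b)\<^sup>2 - 2 * (g a * g b))"
    by (intro sum.cong refl) (simp add: power2_eq_square algebra_simps)
  also have "\<dots> = 2 * (real (card A) * (\<Sum>a\<in>A. (g a)\<^sup>2)) - 2 * (\<Sum>a\<in>A. \<Sum>b\<in>A. g a * g b)"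
    by (simp add: sum.distrib sum_subtractf sum_distrib_left)
  also have "(\<Sum>a\<in>A. \<Sum>b\<in>A. g a * g b) = (\<Sum>a\<in>A. g a)\<^sup>2"
    by (simp add: power2_eq_square sum_product)
  finally show ?thesis by (simp add: diff_divide_distrib)
qed

definition energy :: "(quat \<Rightarrow> real) \<Rightarrow> real" where
  "energy f = (\<Sum>a\<in>primitive_pow l 1. \<Sum>b\<in>primitive_pow l 1. \<Sum>z\<in>quat_residues p. (f (a * z) - f (b * z))\<^sup>2)"

text \<open>A variance identity: the energy is exactly what the sum over norm \<open>l\<close> loses
  against the trivial bound.\<close>

lemma l2norm_hecke_op_1:
  assumes f: "periodic p f"
  shows "(l2norm (hecke_op 1 f))\<^sup>2 = (real (card (primitive_pow l 1)) * l2norm f)\<^sup>2 - energy f / 2"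
proof -
  let ?A = "primitive_pow l 1"
  have "(l2norm (hecke_op 1 f))\<^sup>2 = (\<Sum>z\<in>quat_residues p. (\<Sum>a\<in>?A. f (a * z))\<^sup>2)"
    by (simp add: l2norm_sq_sum hecke_op_def)
  also have "\<dots> = (\<Sum>z\<in>quat_residues p. real (card ?A) * (\<Sum>a\<in>?A. (f (a * z))\<^sup>2) - (\<Sum>a\<in>?A. \<Sum>b\<in>?A. (f (a * z) - f (b * z))\<^sup>2) / 2)"
    by (intro sum.cong refl sum_sq_identity)
  also have "\<dots> = real (card ?A) * (\<Sum>z\<in>quat_residues p. \<Sum>a\<in>?A. (f (a * z))\<^sup>2) - (\<Sum>z\<in>quat_residues p. \<Sum>a\<in>?A. \<Sum>b\<in>?A. (f (a * z) - f (b * z))\<^sup>2) / 2"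
    by (simp add: sum_subtractf sum_distrib_left sum_divide_distrib)
  also have "(\<Sum>z\<in>quat_residues p. \<Sum>a\<in>?A. (f (a * z))\<^sup>2) = (\<Sum>a\<in>?A. (l2norm (\<lambda>x. f (a * x)))\<^sup>2)"
    by (subst sum.swap) (simp add: l2norm_sq_sum)
  also have "\<dots> = (\<Sum>a\<in>?A. (l2norm f)\<^sup>2)"
    using f by (intro sum.cong refl arg_cong[where f = "\<lambda>t. t\<^sup>2"] l2norm_shiftl p_ndvd_primitive_pow)
  also have "(\<Sum>z\<in>quat_residues p. \<Sum>a\<in>?A. \<Sum>b\<in>?A. (f (a * z) - f (b * z))\<^sup>2) = energy f"
  proof -
    have "(\<Sum>z\<in>quat_residues p. \<Sum>a\<in>?A. \<Sum>b\<in>?A. (f (a * z) - f (b * z))\<^sup>2) = (\<Sum>a\<in>?A. \<Sum>z\<in>quat_residues p. \<Sum>b\<in>?A. (f (a * z) - f (b * z))\<^sup>2)"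
      by (rule sum.swap)
    also have "\<dots> = energy f" unfolding energy_def by (rule sum.cong[OF refl]) (rule sum.swap)
    finally show ?thesis .
  qed
  finally show ?thesis by (simp add: power2_eq_square)
qed

text \<open>A Poincare inequality on a finite graph. The indicator of a component is norm-invariant,
  so a cuspidal function has sum zero on each component. Its values are then bounded by its
  variation along paths, whose length is at most the number of edges.\<close>

lemma poincare:
  obtains K where "K \<ge> 1" "\<And>f. f \<in> cuspidal \<Longrightarrow> (l2norm f)\<^sup>2 \<le> K * energy f"
proof -
  define E where "E = {(x, y). x \<in> quat_residues p \<and> y \<in> quat_residues p \<and>
    (\<exists>a b z. a \<in> primitive_pow l 1 \<and> b \<in> primitive_pow l 1 \<and> z \<in> quat_residues p \<and> qdvd p (x - a * z) \<and> qdvd p (y - b * z))}"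
  have finE: "finite E" by (rule finite_subset[of _ "quat_residues p \<times> quat_residues p"]) (auto simp: E_def finite_quat_residues)
  have symE: "sym E" unfolding E_def sym_def by blast
  have p0: "p > 0" using p_gt_2 by simp
  define D where "D = real (card E)"
  define K where "K = real (card (quat_residues p)) * D\<^sup>2 + 1"
  have "(l2norm f)\<^sup>2 \<le> K * energy f" if f: "f \<in> cuspidal" for f
  proof -
    have pf: "periodic p f" using cuspidal_periodic[OF f] .
    define s where "s = sqrt (energy f)"
    have e0: "energy f \<ge> 0" unfolding energy_def by (intro sum_nonneg) auto
    have step: "\<bar>f x - f y\<bar> \<le> s" if xy: "(x, y) \<in> E" for x y
    proof -
      obtain a b z where ab: "a \<in> primitive_pow l 1" "b \<in> primitive_pow l 1" "z \<in> quat_residues p" "qdvd p (x - a * z)" "qdvd p (y - b * z)"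
        using xy by (auto simp: E_def)
      have "(f (a * z) - f (b * z))\<^sup>2 \<le> (\<Sum>z\<in>quat_residues p. (f (a * z) - f (b * z))\<^sup>2)"
        by (rule member_le_sum) (use ab finite_quat_residues in auto)
      also have "\<dots> \<le> (\<Sum>b\<in>primitive_pow l 1. \<Sum>z\<in>quat_residues p. (f (a * z) - f (b * z))\<^sup>2)"
        by (rule member_le_sum) (use ab finite_primitive_pow in \<open>auto intro!: sum_nonneg\<close>)
      also have "\<dots> \<le> energy f" unfolding energy_def
        by (rule member_le_sum[of a]) (use ab finite_primitive_pow in \<open>auto intro!: sum_nonneg\<close>)
      finally have "\<bar>f (a * z) - f (b * z)\<bar> \<le> s" unfolding s_def by (metis real_sqrt_abs real_sqrt_le_iff)
      then show ?thesis using perD[OF pf ab(4)] perD[OF pf ab(5)] by simp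
    qed
    have path: "\<bar>f x - f y\<bar> \<le> real n * s" if "(x, y) \<in> E ^^ n" for x y n
      using that
    proof (induction n arbitrary: y)
      case (Suc n)
      then obtain w where "(x, w) \<in> E ^^ n" "(w, y) \<in> E" by auto
      then have "\<bar>f x - f w\<bar> \<le> real n * s" "\<bar>f w - f y\<bar> \<le> s" using Suc.IH step by auto
      then show ?case by (simp add: algebra_simps)
    qed simp
    have conn: "\<bar>f x - f y\<bar> \<le> D * s" if xy: "(x, y) \<in> E\<^sup>*" for x y
    proof -
      obtain n where n: "n \<le> card E" "(x, y) \<in> E ^^ n"
        using xy rtrancl_finite_eq_relpow[OF finE] by auto
      have "\<bar>f x - f y\<bar> \<le> real n * s" using path n by blast
      also have "\<dots> \<le> D * s" using n e0 by (intro mult_right_mono) (auto simp: D_def s_def)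
      finally show ?thesis .
    qed
    have bound: "\<bar>f x\<bar> \<le> D * s" if x: "x \<in> quat_residues p" for x
    proof -
      define Cl where "Cl = {y \<in> quat_residues p. (x, y) \<in> E\<^sup>*}"
      have fCl: "finite Cl" "x \<in> Cl" using x by (auto simp: Cl_def finite_quat_residues)
      define f0 where "f0 w = (if (x, quat_mod p w) \<in> E\<^sup>* then 1 else 0 :: real)" for w
      have per0: "periodic p f0" unfolding periodic_def
      proof (intro allI impI)
        fix w w' assume "qdvd p (w - w')"
        then have "quat_mod p w = quat_mod p w'" by (auto simp: quat_mod_def qdvd_def mod_eq_dvd_iff)
        then show "f0 w = f0 w'" by (simp add: f0_def)
      qed
      have "f0 (a * z) = f0 (b * z)" if ab: "nrm a = l" "nrm b = l" for a b z
      proof -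
        have k: "qdvd p (quat_mod p (c * z) - c * quat_mod p z)" for c
          using qdvd_diff[OF qdvd_multl[OF qdvd_quat_mod, of p c z] qdvd_quat_mod[of p "c * z"]] by (simp add: algebra_simps)
        have "a \<in> primitive_pow l 1" "b \<in> primitive_pow l 1" "quat_mod p w \<in> quat_residues p" for w
          using ab p0 by (auto simp: primitive_pow_1[simplified] quat_mod_in_quat_residues)
        then have "(quat_mod p (a * z), quat_mod p (b * z)) \<in> E" unfolding E_def using k by blast
        moreover from this have "(quat_mod p (b * z), quat_mod p (a * z)) \<in> E" using symE by (meson symD)
        ultimately show ?thesis unfolding f0_def by (meson rtrancl.rtrancl_into_rtrancl)
      qed
      then have "norm_invariant f0" using per0 unfolding norm_invariant_def by blast
      then have "l2inner f f0 = 0" using f by (simp add: cuspidal_def)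
      moreover have "l2inner f f0 = (\<Sum>y\<in>Cl. f y)"
      proof -
        have "quat_mod p y = y" if "y \<in> quat_residues p" for y using that by (simp add: quat_residues_def quat_mod_def quat_eq_iff)
        then have "l2inner f f0 = (\<Sum>y\<in>quat_residues p. if (x, y) \<in> E\<^sup>* then f y else 0)"
          unfolding l2inner_def by (intro sum.cong refl) (auto simp: f0_def)
        then show ?thesis by (simp add: Cl_def finite_quat_residues sum.inter_filter)
      qed
      ultimately have z: "(\<Sum>y\<in>Cl. f y) = 0" by simp
      have "real (card Cl) * \<bar>f x\<bar> = \<bar>\<Sum>y\<in>Cl. f x - f y\<bar>" using z by (simp add: sum_subtractf abs_mult)
      also have "\<dots> \<le> (\<Sum>y\<in>Cl. D * s)"
        by (rule order_trans[OF sum_abs]) (rule sum_mono, auto simp: Cl_def intro: conn)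
      finally have "real (card Cl) * \<bar>f x\<bar> \<le> real (card Cl) * (D * s)" by simp
      moreover have "real (card Cl) > 0" using fCl by (auto simp: card_gt_0_iff)
      ultimately show ?thesis by simp
    qed
    have "(l2norm f)\<^sup>2 = (\<Sum>x\<in>quat_residues p. (f x)\<^sup>2)" by (rule l2norm_sq_sum)
    also have "\<dots> \<le> (\<Sum>x\<in>quat_residues p. (D * s)\<^sup>2)"
      by (intro sum_mono) (metis bound abs_ge_zero power2_abs power_mono)
    also have "\<dots> = real (card (quat_residues p)) * D\<^sup>2 * energy f" using e0 by (simp add: s_def power_mult_distrib)
    also have "\<dots> \<le> K * energy f" using e0 by (intro mult_right_mono) (auto simp: K_def)
    finally show ?thesis .
  qed
  moreover have "K \<ge> 1" by (simp add: K_def)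
  ultimately show thesis using that by blast
qed

lemma spectral_gap:
  obtains \<rho> where "0 \<le> \<rho>" "\<rho> < 1" "\<And>f. f \<in> cuspidal \<Longrightarrow> l2norm (hecke_op 1 f) \<le> \<rho> * real (card (primitive_pow l 1)) * l2norm f"
proof -
  obtain K where K: "K \<ge> 1" "\<And>f. f \<in> cuspidal \<Longrightarrow> (l2norm f)\<^sup>2 \<le> K * energy f" using poincare by blast
  define N where "N = real (card (primitive_pow l 1))"
  have N: "N \<ge> 1" using card_primitive_pow_1 l_gt_2 by (simp add: N_def)
  \<comment> \<open>By the Poincare inequality \<open>energy f / 2\<close> is at least
    \<open>(l2norm f)\<^sup>2 / (2 * K)\<close>; subtracting this from
    \<open>(N * l2norm f)\<^sup>2\<close> leaves the fraction \<open>r\<close>.\<close>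
  define r where "r = 1 - 1 / (2 * K * N\<^sup>2)"
  have "N\<^sup>2 \<ge> 1" using N by (simp add: one_le_power)
  then have "K * N\<^sup>2 \<ge> 1" using K(1) mult_mono[of 1 K 1 "N\<^sup>2"] by simp
  then have r: "0 \<le> r" "r < 1" using K(1) N by (auto simp: r_def field_simps)
  have "l2norm (hecke_op 1 f) \<le> sqrt r * N * l2norm f" if f: "f \<in> cuspidal" for f
  proof -
    have "(l2norm (hecke_op 1 f))\<^sup>2 = (N * l2norm f)\<^sup>2 - energy f / 2" using l2norm_hecke_op_1[OF cuspidal_periodic[OF f]] by (simp add: N_def)
    also have "\<dots> \<le> (N * l2norm f)\<^sup>2 - (l2norm f)\<^sup>2 / (2 * K)" using K(2)[OF f] K(1) by (simp add: field_simps)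
    also have "\<dots> = (sqrt r * N * l2norm f)\<^sup>2"
      using r(1) N K(1) by (simp add: power_mult_distrib r_def) (simp add: field_simps)
    finally show ?thesis using r N by (elim power2_le_imp_le) (intro mult_nonneg_nonneg, auto)
  qed
  moreover have "sqrt r < 1" using r by simp
  ultimately show thesis using that[of "sqrt r"] r by (simp add: N_def)
qed

end

text \<open>The quadratic form is compared with
  \<open>(x - L * \<theta> * y) * (x - y / \<theta>)\<close>, whose roots have the same product
  \<open>L\<close> but a sum larger than \<open>lam\<close>. When \<open>x / y\<close> is beyond the
  larger root, the form controls a fixed part of \<open>x\<^sup>2\<close>.\<close>

lemma decay_step:
  fixes x y L lam \<theta> :: real
  assumes L: "L \<ge> 3" and \<theta>: "9 / 10 \<le> \<theta>" "\<theta> < 1" "lam < L * \<theta> + 1"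
    and x: "y \<ge> 0" "x \<ge> L * \<theta> * y" "x \<ge> 0"
  shows "x\<^sup>2 - lam * x * y + L * y\<^sup>2 \<ge> min (1 / 2) ((L * \<theta> + 1 - lam) / (L * \<theta>)) * x\<^sup>2"
proof -
  define g where "g = L * \<theta> + 1 - lam"
  define c where "c = min (1 / 2) (g / (L * \<theta>))"
  have t: "L * \<theta> > 0" using L \<theta> by simp
  have c12: "c \<le> 1 / 2" "c \<le> g / (L * \<theta>)" by (simp_all only: c_def min.cobounded1 min.cobounded2)
  have th: "\<theta> * \<theta> \<ge> 81 / 100" using mult_mono[of "9/10" \<theta> "9/10" \<theta>] \<theta> by simp
  \<comment> \<open>Here \<open>9 / 10\<close> and \<open>L \<ge> 3\<close> enter: they keep the two
    roots apart, so that \<open>y / \<theta>\<close> is at most \<open>x / 2\<close>.\<close>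
  have lt2: "L * (\<theta> * \<theta>) \<ge> 2" using mult_mono[OF L th] L by simp
  have "2 * y \<le> L * (\<theta> * \<theta>) * y" using lt2 x(1) by (rule mult_right_mono)
  also have "\<dots> = \<theta> * (L * \<theta> * y)" by simp
  also have "\<dots> \<le> \<theta> * x" using x(2) \<theta> by (intro mult_left_mono) auto
  finally have "y / \<theta> \<le> x / 2" using \<theta> by (simp add: field_simps)
  then have 1: "(x - L * \<theta> * y) * (x - y / \<theta>) \<ge> (x - L * \<theta> * y) * (x / 2)"
    using x(2) by (intro mult_left_mono) auto
  have e: "x\<^sup>2 - lam * x * y + L * y\<^sup>2 = (x - L * \<theta> * y) * (x - y / \<theta>) + (g + (1 / \<theta> - 1)) * (x * y)"
    using \<theta> by (simp add: g_def field_simps power2_eq_square)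
  have "1 / \<theta> \<ge> 1" using \<theta> by simp
  then have "(1 / \<theta> - 1) * (x * y) \<ge> 0" using x by simp
  then have "x\<^sup>2 - lam * x * y + L * y\<^sup>2 \<ge> (x - L * \<theta> * y) * (x / 2) + g * (x * y)"
    using e 1 by (simp add: algebra_simps)
  moreover have "(x - L * \<theta> * y) * (x / 2) + g * (x * y) \<ge> (x - L * \<theta> * y) * (c * x) + c * (L * \<theta>) * (x * y)"
  proof (rule add_mono)
    show "(x - L * \<theta> * y) * (c * x) \<le> (x - L * \<theta> * y) * (x / 2)"
    proof (rule mult_left_mono)
      show "c * x \<le> x / 2" using mult_right_mono[OF c12(1) x(3)] by simp
    qed (use x(2) in simp)
    have "c * (L * \<theta>) \<le> g" using c12(2) t by (simp add: pos_le_divide_eq)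
    then show "c * (L * \<theta>) * (x * y) \<le> g * (x * y)" using x by (intro mult_right_mono) auto
  qed
  moreover have "(x - L * \<theta> * y) * (c * x) + c * (L * \<theta>) * (x * y) = c * x\<^sup>2" by (simp add: algebra_simps power2_eq_square)
  ultimately show ?thesis unfolding c_def[unfolded g_def, symmetric] by linarith
qed

text \<open>A sequence satisfying the energy inequality grows at most like the larger root of
  \<open>x\<^sup>2 - lam x + L\<close>, which is below \<open>L\<close> because \<open>lam < L + 1\<close>.\<close>

lemma decay_real:
  fixes L lam :: real
  assumes L: "L \<ge> 3" and lam: "lam < L + 1"
  obtains \<theta> C where "9 / 10 \<le> \<theta>" "\<theta> < 1" "C > 0"
    "\<And>n K m. (\<And>m::nat. n m \<ge> 0) \<Longrightarrow> K \<ge> 0 \<Longrightarrow> n 1 \<le> K \<Longrightarrow>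
      (\<And>m. m \<ge> 1 \<Longrightarrow> (n (Suc m))\<^sup>2 - lam * n (Suc m) * n m + L * (n m)\<^sup>2 \<le> L ^ m * K\<^sup>2) \<Longrightarrow>
      m \<ge> 1 \<Longrightarrow> n m \<le> C * K * (L * \<theta>) ^ m"
proof -
  \<comment> \<open>At least half way from \<open>(lam - 1) / L\<close> to 1, which gives
    \<open>lam < L * \<theta> + 1\<close>; the bound \<open>9 / 10\<close> is what
    \<open>decay_step\<close> asks for.\<close>
  define \<theta> where "\<theta> = max (9 / 10) (((lam - 1) / L + 1) / 2)"
  have half: "v < (v + 1) / 2" if "v < 1" for v :: real using that by simp
  have "(lam - 1) / L < 1" using L lam by simp
  then have \<theta>: "9 / 10 \<le> \<theta>" "\<theta> < 1" by (auto simp: \<theta>_def)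
  have "(lam - 1) / L < ((lam - 1) / L + 1) / 2" using half[OF \<open>(lam - 1) / L < 1\<close>] .
  then have "(lam - 1) / L < \<theta>" by (simp add: \<theta>_def less_max_iff_disj)
  then have \<theta>3: "lam < L * \<theta> + 1" using L by (simp add: field_simps)
  define c where "c = min (1 / 2) ((L * \<theta> + 1 - lam) / (L * \<theta>))"
  have c: "0 < c" using L \<theta> \<theta>3 by (auto simp: c_def)
  have c2: "c \<le> 1 / 2" unfolding c_def by (rule min.cobounded1)
  define C where "C = 1 / sqrt c"
  have "sqrt c \<le> 1" using c2 by simp
  then have C: "C \<ge> 1" using c by (simp add: C_def)
  have th: "\<theta> * \<theta> \<ge> 81 / 100" using mult_mono[of "9/10" \<theta> "9/10" \<theta>] \<theta> by simp
  have lt1: "L * \<theta> \<ge> 1" using mult_mono[of 3 L "9/10" \<theta>] L \<theta> by simp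
  have lt2: "L \<le> (L * \<theta>)\<^sup>2"
  proof -
    have "L * 1 \<le> L * (L * (\<theta> * \<theta>))" using mult_mono[OF L th] L by (intro mult_left_mono) auto
    then show ?thesis by (simp add: power2_eq_square algebra_simps)
  qed
  have "n m \<le> C * K * (L * \<theta>) ^ m"
    if n0: "\<And>m::nat. n m \<ge> 0" and K: "K \<ge> 0" "n 1 \<le> K"
      and rec: "\<And>m. m \<ge> 1 \<Longrightarrow> (n (Suc m))\<^sup>2 - lam * n (Suc m) * n m + L * (n m)\<^sup>2 \<le> L ^ m * K\<^sup>2"
      and "m \<ge> 1" for n K m
    using \<open>m \<ge> 1\<close>
  proof (induction m rule: nat_induct_at_least)
    case base
    have "1 * K * 1 \<le> C * K * (L * \<theta>)" using C K lt1 by (intro mult_mono) auto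
    then show ?case using K(2) by simp
  next
    case (Suc m)
    show ?case
    proof (rule ccontr)
      \<comment> \<open>A first violation forces growth by at least \<open>L * \<theta>\<close> in
        this step, so \<open>decay_step\<close> applies. Its upper bound
        \<open>L ^ m * K\<^sup>2\<close> is then too small, because
        \<open>L \<le> (L * \<theta>)\<^sup>2\<close>.\<close>
      assume "\<not> ?thesis"
      then have big: "n (Suc m) > L * \<theta> * (C * K * (L * \<theta>) ^ m)" by (simp add: algebra_simps)
      have "L * \<theta> * n m \<le> L * \<theta> * (C * K * (L * \<theta>) ^ m)" using Suc.IH lt1 by (intro mult_left_mono) auto
      then have "n (Suc m) \<ge> L * \<theta> * n m" using big by simp
      from decay_step[OF L \<theta> \<theta>3 n0 this n0] have "c * (n (Suc m))\<^sup>2 \<le> L ^ m * K\<^sup>2"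
        using rec[OF Suc.hyps] by (simp add: c_def)
      also have "\<dots> \<le> ((L * \<theta>)\<^sup>2) ^ m * K\<^sup>2" using lt2 L by (intro mult_right_mono power_mono) auto
      also have "\<dots> \<le> (L * \<theta>)\<^sup>2 * (((L * \<theta>)\<^sup>2) ^ m * K\<^sup>2)"
      proof -
        have "1 \<le> (L * \<theta>)\<^sup>2" using lt1 by (simp add: one_le_power)
        then have "1 * (((L * \<theta>)\<^sup>2) ^ m * K\<^sup>2) \<le> (L * \<theta>)\<^sup>2 * (((L * \<theta>)\<^sup>2) ^ m * K\<^sup>2)" by (intro mult_right_mono) auto
        then show ?thesis by simp
      qed
      also have "\<dots> = c * (L * \<theta> * (C * K * (L * \<theta>) ^ m))\<^sup>2"
        using c by (simp add: C_def power_mult_distrib power_divide power_mult[symmetric] mult.commute)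
      finally have "(n (Suc m))\<^sup>2 \<le> (L * \<theta> * (C * K * (L * \<theta>) ^ m))\<^sup>2" using c by simp
      then have "n (Suc m) \<le> L * \<theta> * (C * K * (L * \<theta>) ^ m)"
        using C K L \<theta> by (elim power2_le_imp_le) (intro mult_nonneg_nonneg zero_le_power, auto)
      then show False using big by simp
    qed
  qed
  moreover have "C > 0" using C by simp
  ultimately show thesis using that[OF \<theta>] by blast
qed

context level
begin

lemma l2inner_diff: "l2inner f (\<lambda>x. g x - c * h x) = l2inner f g - c * l2inner f h" "l2inner (\<lambda>x. g x - c * h x) f = l2inner g f - c * l2inner h f"
  by (simp_all add: l2inner_def sum_subtractf sum_distrib_left algebra_simps)

lemma l2inner_scale: "l2inner f (\<lambda>x. c * g x) = c * l2inner f g" "l2inner (\<lambda>x. c * g x) f = c * l2inner g f"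
  by (simp_all add: l2inner_def sum_distrib_left algebra_simps)

text \<open>Multiplication by \<open>a\<close> has the adjoint \<open>x \<mapsto> qcnj a * x\<close>
  up to the scalar \<open>l\<close>, and \<open>qcnj\<close> permutes the quaternions of norm
  \<open>l\<close>. The operator is thus self-adjoint up to that scalar, which need not act
  trivially on functions modulo \<open>p\<close>.\<close>

lemma l2inner_hecke_op_1:
  assumes u: "periodic p u" and v: "periodic p v"
  shows "l2inner (hecke_op 1 u) (\<lambda>x. v (of_int l * x)) = l2inner u (hecke_op 1 v)"
proof -
  have l0: "\<not> p dvd l" using p_ndvd_l_pow[of 1] by simp
  have "l2inner (hecke_op 1 u) (\<lambda>x. v (of_int l * x)) = (\<Sum>a\<in>primitive_pow l 1. l2inner (\<lambda>x. u (a * x)) (\<lambda>x. v (of_int l * x)))"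
    unfolding l2inner_def hecke_op_def sum_distrib_right by (rule sum.swap)
  also have "\<dots> = (\<Sum>a\<in>primitive_pow l 1. l2inner u (\<lambda>x. v (qcnj a * x)))"
  proof (intro sum.cong refl)
    fix a assume "a \<in> primitive_pow l 1"
    then have a: "nrm a = l" by (simp add: primitive_pow_1[simplified])
    have "l2inner u (\<lambda>x. v (qcnj a * x)) = l2inner (\<lambda>x. u (a * x * 1)) (\<lambda>x. v (qcnj a * (a * x * 1)))"
      using l2inner_shift[OF u periodic_multl[OF v], of a 1 "qcnj a"] a l0 p_gt_2 by simp
    also have "\<dots> = l2inner (\<lambda>x. u (a * x)) (\<lambda>x. v (of_int l * x))" by (simp add: mult_cnj' a)
    finally show "l2inner (\<lambda>x. u (a * x)) (\<lambda>x. v (of_int l * x)) = l2inner u (\<lambda>x. v (qcnj a * x))" by simp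
  qed
  also have "\<dots> = (\<Sum>a\<in>primitive_pow l 1. l2inner u (\<lambda>x. v (a * x)))"
    by (rule sum.reindex_bij_witness[of _ qcnj qcnj]) (auto simp: primitive_pow_def)
  also have "\<dots> = l2inner u (hecke_op 1 v)"
    unfolding l2inner_def hecke_op_def sum_distrib_left by (rule sum.swap)
  finally show ?thesis .
qed

lemma hecke_op_rec:
  assumes "m \<ge> 2"
  shows "hecke_op (Suc m) f x = (1 / 8) * hecke_op 1 (hecke_op m f) x - of_int l * hecke_op (m - 1) f (of_int l * x)"
proof -
  have "hecke_op 1 (hecke_op m f) x = (\<Sum>a\<in>primitive_pow l m. \<Sum>b\<in>primitive_pow l 1. f (a * b * x))"
    unfolding hecke_op_def by (subst sum.swap) (simp add: mult.assoc)
  also have "\<dots> = 8 * hecke_op (Suc m) f x + 8 * of_int l * (\<Sum>a\<in>primitive_pow l (m - 1). f (of_int l * a * x))"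
    using primitive_pow_recursion[OF assms, of "\<lambda>y. f (y * x)"] by (simp add: hecke_op_def)
  also have "(\<Sum>a\<in>primitive_pow l (m - 1). f (of_int l * a * x)) = hecke_op (m - 1) f (of_int l * x)"
    unfolding hecke_op_def by (simp add: mult.assoc of_int_mid)
  finally show ?thesis by (simp add: add_divide_distrib)
qed

text \<open>The three-term recursion has a quadratic quantity \<open>En\<close> that is multiplied
  by exactly \<open>L\<close> in each step. Cauchy--Schwarz and the spectral gap bound its mixed
  term, which gives the hypothesis of \<open>decay_real\<close> with
  \<open>lam = \<rho> * (L + 1)\<close>.\<close>

lemma hecke_op_decay:
  obtains \<theta> C where "9 / 10 \<le> \<theta>" "\<theta> < 1" "C > 0"
    "\<And>f m. f \<in> cuspidal \<Longrightarrow> l2norm (hecke_op m f) \<le> C * (of_int l * \<theta>) ^ m * l2norm f"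
proof -
  obtain \<rho> where \<rho>: "0 \<le> \<rho>" "\<rho> < 1" "\<And>f. f \<in> cuspidal \<Longrightarrow> l2norm (hecke_op 1 f) \<le> \<rho> * real (card (primitive_pow l 1)) * l2norm f"
    using spectral_gap by blast
  define L where "L = real_of_int l"
  have L: "L \<ge> 3" using l_gt_2 by (simp add: L_def)
  have N1: "real (card (primitive_pow l 1)) = 8 * (L + 1)"
    using card_primitive_pow_1 by (metis L_def of_int_of_nat_eq of_int_add of_int_mult of_int_1 of_int_numeral)
  define lam where "lam = \<rho> * (L + 1)"
  have lam: "lam < L + 1" "lam \<ge> 0" using \<rho> L by (auto simp: lam_def)
  obtain \<theta> C where \<theta>: "9 / 10 \<le> \<theta>" "\<theta> < 1" "C > 0"
    and dec: "\<And>n K m. (\<And>m::nat. n m \<ge> 0) \<Longrightarrow> K \<ge> 0 \<Longrightarrow> n 1 \<le> K \<Longrightarrow>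
      (\<And>m. m \<ge> 1 \<Longrightarrow> (n (Suc m))\<^sup>2 - lam * n (Suc m) * n m + L * (n m)\<^sup>2 \<le> L ^ m * K\<^sup>2) \<Longrightarrow>
      m \<ge> 1 \<Longrightarrow> n m \<le> C * K * (L * \<theta>) ^ m"
    using decay_real[OF L lam(1)] by blast
  define c where "c m = real (card (primitive_pow l m))" for m
  \<comment> \<open>Built from trivial bounds for lengths 1 and 2; it has to dominate the initial
    energy \<open>En 1\<close> and the square of \<open>c 1\<close>.\<close>
  define K0 where "K0 = (c 2)\<^sup>2 + lam * c 2 * c 1 + (L + 1) * (c 1)\<^sup>2 + 1"
  have c0: "c m \<ge> 0" for m by (simp add: c_def)
  have K0: "K0 \<ge> 1" using c0 lam L by (simp add: K0_def)
  have l0: "\<not> p dvd l" using p_ndvd_l_pow[of 1] by simp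
  have main: "l2norm (hecke_op m f) \<le> C * (sqrt K0 * l2norm f) * (L * \<theta>) ^ m" if f: "f \<in> cuspidal" and m: "m \<ge> 1" for f m
  proof (rule dec[OF _ _ _ _ m])
    let ?z = "\<lambda>m. hecke_op m f"
    have zV: "?z m \<in> cuspidal" for m by (rule cuspidal_hecke_op[OF f])
    have zp: "periodic p (?z m)" for m by (rule cuspidal_periodic[OF zV])
    have nz: "l2norm (?z m) \<le> c m * l2norm f" for m unfolding c_def by (rule l2norm_hecke_op_le[OF cuspidal_periodic[OF f]])
    define T where "T m x = (1 / 8) * hecke_op 1 (?z m) x" for m x
    have T: "\<bar>l2inner u (T m)\<bar> \<le> lam * l2norm u * l2norm (?z m)" for u m
    proof -
      have "\<bar>l2inner u (T m)\<bar> = \<bar>l2inner u (hecke_op 1 (?z m))\<bar> / 8" unfolding T_def[abs_def] l2inner_scale by (simp add: abs_mult)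
      also have "\<dots> \<le> l2norm u * l2norm (hecke_op 1 (?z m)) / 8" using l2inner_le by (intro divide_right_mono) auto
      also have "\<dots> \<le> l2norm u * (\<rho> * (8 * (L + 1)) * l2norm (?z m)) / 8"
        using \<rho>(3)[OF zV[of m]] N1 by (intro divide_right_mono mult_left_mono) auto
      finally show ?thesis by (simp add: lam_def algebra_simps)
    qed
    define En where "En m = (l2norm (?z (Suc m)))\<^sup>2 - l2inner (?z (Suc m)) (T m) + L * (l2norm (?z m))\<^sup>2" for m
    have step: "En (Suc m) = L * En m" if "m \<ge> 1" for m
    proof -
      define w where "w x = ?z m (of_int l * x)" for x
      have z2: "?z (Suc (Suc m)) = (\<lambda>x. T (Suc m) x - L * w x)"
        using hecke_op_rec[of "Suc m" f] that by (auto simp: T_def w_def L_def)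
      have ww: "l2inner w w = (l2norm (?z m))\<^sup>2"
      proof -
        have "l2norm w = l2norm (?z m)" unfolding w_def[abs_def]
          using l0 prime_p by (intro l2norm_shiftl[OF zp]) (simp add: prime_dvd_power_iff)
        then show ?thesis using l2norm_sq[of w] by simp
      qed
      have Tw: "l2inner (T (Suc m)) w = l2inner (?z (Suc m)) (T m)"
        using l2inner_hecke_op_1[OF zp[of "Suc m"] zp[of m]] unfolding T_def[abs_def] w_def[abs_def] l2inner_scale by simp
      have "(l2norm (?z (Suc (Suc m))))\<^sup>2 - l2inner (?z (Suc (Suc m))) (T (Suc m)) = - L * l2inner (?z (Suc (Suc m))) w"
        unfolding l2norm_sq by (subst (2) z2) (simp add: l2inner_diff)
      also have "l2inner (?z (Suc (Suc m))) w = l2inner (?z (Suc m)) (T m) - L * (l2norm (?z m))\<^sup>2"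
        unfolding z2 l2inner_diff Tw ww ..
      finally show ?thesis by (simp add: En_def algebra_simps)
    qed
    have En1: "En 1 \<le> K0 * (l2norm f)\<^sup>2"
    proof -
      have "En 1 \<le> (l2norm (?z 2))\<^sup>2 + lam * l2norm (?z 2) * l2norm (?z 1) + L * (l2norm (?z 1))\<^sup>2"
        using T[of "?z 2" 1] by (simp add: En_def numeral_2_eq_2)
      also have "\<dots> \<le> (c 2 * l2norm f)\<^sup>2 + lam * (c 2 * l2norm f) * (c 1 * l2norm f) + L * (c 1 * l2norm f)\<^sup>2"
        using nz lam(2) c0 L by (intro add_mono power_mono mult_mono mult_nonneg_nonneg) auto
      also have "\<dots> \<le> K0 * (l2norm f)\<^sup>2" by (simp add: K0_def power2_eq_square algebra_simps)
      finally show ?thesis .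
    qed
    have Enm: "En m \<le> L ^ m * (K0 * (l2norm f)\<^sup>2)" if "m \<ge> 1" for m
      using that
    proof (induction m rule: nat_induct_at_least)
      case base
      have "1 * (K0 * (l2norm f)\<^sup>2) \<le> L * (K0 * (l2norm f)\<^sup>2)" using L K0 by (intro mult_right_mono) auto
      then show ?case using En1 by simp
    next
      case (Suc m)
      then have "L * En m \<le> L * (L ^ m * (K0 * (l2norm f)\<^sup>2))" using L by (intro mult_left_mono) auto
      then show ?case using step[OF Suc.hyps] by simp
    qed
    show "(l2norm (?z (Suc m)))\<^sup>2 - lam * l2norm (?z (Suc m)) * l2norm (?z m) + L * (l2norm (?z m))\<^sup>2 \<le> L ^ m * (sqrt K0 * l2norm f)\<^sup>2"
      if "m \<ge> 1" for m
      using Enm[OF that] T[of "?z (Suc m)" m] K0 by (simp add: En_def power_mult_distrib)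
    show "l2norm (?z 1) \<le> sqrt K0 * l2norm f"
    proof -
      have "(c 1)\<^sup>2 \<le> K0"
      proof -
        have "1 * (c 1)\<^sup>2 \<le> (L + 1) * (c 1)\<^sup>2" using L by (intro mult_right_mono) auto
        moreover have "0 \<le> (c 2)\<^sup>2 + lam * c 2 * c 1" using c0 lam by simp
        ultimately show ?thesis unfolding K0_def by linarith
      qed
      then have "c 1 \<le> sqrt K0" using real_le_rsqrt by blast
      then have "c 1 * l2norm f \<le> sqrt K0 * l2norm f" by (rule mult_right_mono) simp
      then show ?thesis using nz[of 1] by linarith
    qed
  qed (use K0 in auto)
  \<comment> \<open>The summand 8 covers \<open>m = 0\<close>, where the sum runs over the eight
    units.\<close>
  define C' where "C' = C * sqrt K0 + 8"
  have "l2norm (hecke_op m f) \<le> C' * (L * \<theta>) ^ m * l2norm f" if f: "f \<in> cuspidal" for f m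
  proof (cases "m \<ge> 1")
    case True
    have "C * (sqrt K0 * l2norm f) * (L * \<theta>) ^ m = C * sqrt K0 * ((L * \<theta>) ^ m * l2norm f)" by simp
    also have "\<dots> \<le> C' * ((L * \<theta>) ^ m * l2norm f)" using L \<theta> by (intro mult_right_mono) (auto simp: C'_def)
    finally show ?thesis using main[OF f True] by simp
  next
    case False
    then have m0: "m = 0" by simp
    then have "l2norm (hecke_op m f) \<le> 8 * l2norm f" using l2norm_hecke_op_le[OF cuspidal_periodic[OF f], of 0] by (simp add: primitive_pow_0 card_units)
    also have "\<dots> \<le> C' * l2norm f" using \<theta> K0 by (intro mult_right_mono) (auto simp: C'_def)
    finally show ?thesis using m0 by simp
  qed
  moreover have "C' > 0" using \<theta> K0 by (simp add: C'_def add_pos_pos)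
  ultimately show thesis using that[of \<theta> C'] \<theta> by (simp add: L_def)
qed

text \<open>Only those \<open>a\<close> occur for which \<open>a * \<gamma>\<close> stays primitive
  at \<open>l\<close>. By \<open>coset_reindex\<close> they parametrise the \<open>\<alpha>\<close>
  with a prescribed right factor \<open>\<gamma>\<close>.\<close>

definition restricted_hecke_op :: "nat \<Rightarrow> quat \<Rightarrow> (quat \<Rightarrow> real) \<Rightarrow> quat \<Rightarrow> real" where
  "restricted_hecke_op m \<gamma> f x = (\<Sum>a\<in>{a \<in> primitive_pow l m. \<not> qdvd l (a * \<gamma>)}. f (a * x))"

text \<open>Whether \<open>l\<close> divides \<open>a * \<gamma>\<close> depends only on a left
  factor \<open>g\<close> of norm \<open>l\<close> of \<open>\<gamma>\<close>. The excluded
  \<open>a\<close> are the \<open>b * qcnj g\<close> with \<open>b\<close> restricted by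
  \<open>qcnj g\<close>, so the difference from the full sum is a shorter restricted sum; iterating
  leaves full Hecke sums.\<close>

lemma l2norm_restricted_hecke_op_le:
  assumes f: "periodic p f" and \<gamma>: "\<gamma> \<in> primitive_pow l j"
  shows "l2norm (restricted_hecke_op m \<gamma> f) \<le> (\<Sum>i\<le>m. l2norm (hecke_op i f))"
  using \<gamma>
proof (induction m arbitrary: \<gamma> j)
  case 0
  have "\<not> qdvd l (a * \<gamma>)" if "a \<in> primitive_pow l 0" for a
  proof
    assume "qdvd l (a * \<gamma>)"
    then have "qdvd l (qcnj a * (a * \<gamma>))" by (rule qdvd_multl)
    then show False using that 0 by (simp add: mult_cnj' primitive_pow_0) (simp add: primitive_pow_def)
  qed
  then have "{a \<in> primitive_pow l 0. \<not> qdvd l (a * \<gamma>)} = primitive_pow l 0" by auto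
  then show ?case unfolding restricted_hecke_op_def[abs_def] hecke_op_def[abs_def] by simp
next
  case (Suc m)
  show ?case
  proof (cases j)
    case 0
    have "\<not> qdvd l (a * \<gamma>)" if "a \<in> primitive_pow l (Suc m)" for a
    proof
      assume "qdvd l (a * \<gamma>)"
      then have "qdvd l (a * \<gamma> * qcnj \<gamma>)" by (rule qdvd_multr)
      then show False using that Suc.prems 0 by (simp add: mult.assoc mult_cnj primitive_pow_0) (simp add: primitive_pow_def)
    qed
    then have "{a \<in> primitive_pow l (Suc m). \<not> qdvd l (a * \<gamma>)} = primitive_pow l (Suc m)" by auto
    then have "l2norm (restricted_hecke_op (Suc m) \<gamma> f) = l2norm (hecke_op (Suc m) f)" unfolding restricted_hecke_op_def[abs_def] hecke_op_def[abs_def] by simp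
    also have "\<dots> \<le> (\<Sum>i\<le>Suc m. l2norm (hecke_op i f))" by (rule member_le_sum) auto
    finally show ?thesis .
  next
    case (Suc j')
    have dv: "l dvd nrm \<gamma>" "\<not> qdvd l \<gamma>" using Suc.prems Suc by (auto simp: primitive_pow_def)
    obtain g a b d where g: "nrm g = l" "g = \<gamma> * a + of_int l * b" "\<gamma> = g * d"
      using ideal_generator[of l \<gamma>] dv odd_l l_gt_2 prime_l primes_dvd_imp_eq
      by (metis less_trans zero_less_numeral)
    have iff: "qdvd l (c * \<gamma>) \<longleftrightarrow> qdvd l (c * g)" for c
    proof
      assume "qdvd l (c * \<gamma>)"
      moreover have "c * g = c * \<gamma> * a + of_int l * (c * b)"
        by (subst g(2)) (simp add: distrib_left mult.assoc of_int_mid)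
      ultimately show "qdvd l (c * g)" using qdvd_add[OF qdvd_multr qdvd_triv] by metis
    next
      assume "qdvd l (c * g)"
      then have "qdvd l (c * g * d)" by (rule qdvd_multr)
      then show "qdvd l (c * \<gamma>)" using g(3) by (simp add: mult.assoc)
    qed
    have fin: "finite {a \<in> primitive_pow l (Suc m). \<not> qdvd l (a * \<gamma>)}" "finite {a \<in> primitive_pow l (Suc m). qdvd l (a * \<gamma>)}"
      by (rule finite_subset[OF _ finite_primitive_pow[of l "Suc m"]], blast)+
    have "hecke_op (Suc m) f x = restricted_hecke_op (Suc m) \<gamma> f x + restricted_hecke_op m (qcnj g) f (qcnj g * x)" for x
    proof -
      have "hecke_op (Suc m) f x = restricted_hecke_op (Suc m) \<gamma> f x + (\<Sum>a\<in>{a \<in> primitive_pow l (Suc m). qdvd l (a * \<gamma>)}. f (a * x))"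
        unfolding hecke_op_def restricted_hecke_op_def by (subst sum.union_disjoint[symmetric]) (use fin in \<open>auto intro!: sum.cong\<close>)
      also have "(\<Sum>a\<in>{a \<in> primitive_pow l (Suc m). qdvd l (a * \<gamma>)}. f (a * x)) = restricted_hecke_op m (qcnj g) f (qcnj g * x)"
        unfolding restricted_hecke_op_def
      proof (rule sum.reindex_bij_witness[of _ "\<lambda>b. b * qcnj g" "\<lambda>a. quat_div l (a * g)"])
        fix a assume "a \<in> {a \<in> primitive_pow l (Suc m). qdvd l (a * \<gamma>)}"
        then have a: "a \<in> primitive_pow l (Suc m)" "qdvd l (a * g)" using iff by auto
        obtain w where w: "a * g = of_int l * w" using a(2) by (rule qdvdE)
        have q: "quat_div l (a * g) = w" using w l_gt_2 by (simp add: quat_div)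
        have "of_int l * a = of_int l * (w * qcnj g)"
          using w by (metis g(1) mult.assoc mult_cnj(1) of_int_comm)
        then have aw: "a = w * qcnj g" using l_gt_2 by (simp add: of_int_cancel)
        show "quat_div l (a * g) * qcnj g = a" unfolding q using aw by simp
        have "nrm w * l = l ^ m * l" using aw a(1) g(1) by (simp add: primitive_pow_def nrm_mult)
        then have "nrm w = l ^ m" using l_gt_2 by simp
        moreover have "\<not> qdvd l w" using aw a(1) qdvd_multr by (auto simp: primitive_pow_def)
        ultimately show "quat_div l (a * g) \<in> {a \<in> primitive_pow l m. \<not> qdvd l (a * qcnj g)}"
          unfolding q using aw a(1) by (auto simp: primitive_pow_def)
        show "f (quat_div l (a * g) * (qcnj g * x)) = f (a * x)" unfolding q using aw by (simp add: mult.assoc)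
      next
        fix b assume b: "b \<in> {a \<in> primitive_pow l m. \<not> qdvd l (a * qcnj g)}"
        have bg: "b * qcnj g * g = of_int l * b" by (simp add: mult.assoc mult_cnj g(1) of_int_comm)
        then show "quat_div l (b * qcnj g * g) = b" using l_gt_2 by (simp add: quat_div)
        show "b * qcnj g \<in> {a \<in> primitive_pow l (Suc m). qdvd l (a * \<gamma>)}"
          using b bg g(1) unfolding iff by (simp add: primitive_pow_def nrm_mult)
      qed
      finally show ?thesis .
    qed
    then have eq: "restricted_hecke_op (Suc m) \<gamma> f = (\<lambda>x. hecke_op (Suc m) f x + - restricted_hecke_op m (qcnj g) f (qcnj g * x))" by auto
    have perX: "periodic p (restricted_hecke_op m (qcnj g) f)" unfolding periodic_def restricted_hecke_op_def
    proof (intro allI impI sum.cong refl)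
      fix x y a assume "qdvd p (x - y)"
      then show "f (a * x) = f (a * y)" using perD[OF periodic_multl[OF f]] by blast
    qed
    have "l2norm (restricted_hecke_op (Suc m) \<gamma> f) \<le> l2norm (hecke_op (Suc m) f) + l2norm (\<lambda>x. - restricted_hecke_op m (qcnj g) f (qcnj g * x))"
      unfolding eq by (rule l2norm_triangle)
    also have "l2norm (\<lambda>x. - restricted_hecke_op m (qcnj g) f (qcnj g * x)) = l2norm (\<lambda>x. restricted_hecke_op m (qcnj g) f (qcnj g * x))"
      by (simp add: l2norm_def L2_set_def)
    also have "\<dots> = l2norm (restricted_hecke_op m (qcnj g) f)"
      using l2norm_shiftl[OF perX, of "qcnj g"] g(1) p_ndvd_l_pow[of 1] by simp
    also have "\<dots> \<le> (\<Sum>i\<le>m. l2norm (hecke_op i f))"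
      by (rule Suc.IH[of _ 1]) (use g(1) not_qdvd_norm_l in \<open>auto simp: primitive_pow_def\<close>)
    finally show ?thesis by simp
  qed
qed

text \<open>\<open>l \<ge> 3\<close> and \<open>\<theta> \<ge> 9 / 10\<close> make the ratio
  \<open>of_int l * \<theta>\<close> at least 2, so the sum over all shorter lengths costs only a
  factor 2.\<close>

lemma cuspidal_restricted_hecke_op_bound:
  obtains \<theta> C where "9 / 10 \<le> \<theta>" "\<theta> < 1" "C > 0"
    "\<And>f m. f \<in> cuspidal \<Longrightarrow> l2norm (hecke_op m f) \<le> C * (of_int l * \<theta>) ^ m * l2norm f"
    "\<And>f m \<gamma> j. f \<in> cuspidal \<Longrightarrow> \<gamma> \<in> primitive_pow l j \<Longrightarrow> l2norm (restricted_hecke_op m \<gamma> f) \<le> C * (of_int l * \<theta>) ^ m * l2norm f"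
proof -
  obtain \<theta> C where \<theta>: "9 / 10 \<le> \<theta>" "\<theta> < 1" "C > 0"
    and B: "\<And>f m. f \<in> cuspidal \<Longrightarrow> l2norm (hecke_op m f) \<le> C * (of_int l * \<theta>) ^ m * l2norm f" using hecke_op_decay by blast
  define r where "r = of_int l * \<theta>"
  have r: "r \<ge> 2" using l_gt_2 \<theta> mult_mono[of 3 "of_int l" "9/10" \<theta>] by (simp add: r_def)
  have geo: "(\<Sum>i\<le>m. r ^ i) \<le> 2 * r ^ m" for m
  proof (induction m)
    case (Suc m)
    have "2 * r ^ m \<le> r * r ^ m" using r by (intro mult_right_mono) auto
    then show ?case using Suc by simp
  qed simp
  have "l2norm (restricted_hecke_op m \<gamma> f) \<le> 2 * C * r ^ m * l2norm f" if f: "f \<in> cuspidal" and g: "\<gamma> \<in> primitive_pow l j" for f m \<gamma> j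
  proof -
    have "l2norm (restricted_hecke_op m \<gamma> f) \<le> (\<Sum>i\<le>m. l2norm (hecke_op i f))" by (rule l2norm_restricted_hecke_op_le[OF cuspidal_periodic[OF f] g])
    also have "\<dots> \<le> (\<Sum>i\<le>m. C * l2norm f * r ^ i)" using B[OF f] by (intro sum_mono) (simp add: r_def algebra_simps)
    also have "\<dots> = C * l2norm f * (\<Sum>i\<le>m. r ^ i)" by (simp add: sum_distrib_left)
    also have "\<dots> \<le> C * l2norm f * (2 * r ^ m)" using geo \<theta> by (intro mult_left_mono) auto
    finally show ?thesis by (simp add: algebra_simps)
  qed
  moreover have "l2norm (hecke_op m f) \<le> 2 * C * r ^ m * l2norm f" if f: "f \<in> cuspidal" for f m
  proof -
    have "0 \<le> C * r ^ m * l2norm f" using \<theta> r by simp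
    then show ?thesis using B[OF f, of m] by (simp add: r_def)
  qed
  ultimately show thesis using that[of \<theta> "2 * C"] \<theta> by (simp add: r_def)
qed

end

section \<open>The collision inequality\<close>

text \<open>Cauchy--Schwarz after grouping by the value of \<open>G\<close>; the sum of the squared
  fibre sizes is the number of colliding pairs.\<close>

lemma collision_inequality:
  fixes \<Psi> :: "'t \<Rightarrow> real"
  assumes I: "finite I" and T: "finite T" "G ` I \<subseteq> T"
  shows "(\<Sum>i\<in>I. \<Psi> (G i))\<^sup>2 \<le> real (card {(i, j) \<in> I \<times> I. G i = G j}) * (\<Sum>t\<in>T. (\<Psi> t)\<^sup>2)"
proof -
  define \<nu> where "\<nu> t = real (card {i \<in> I. G i = t})" for t
  have "(\<Sum>i\<in>I. \<Psi> (G i)) = (\<Sum>t\<in>T. \<Sum>i\<in>{i \<in> I. G i = t}. \<Psi> (G i))"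
    using sum.group[OF I T, of "\<lambda>i. \<Psi> (G i)"] by simp
  also have "\<dots> = (\<Sum>t\<in>T. \<nu> t * \<Psi> t)" by (intro sum.cong refl) (simp add: \<nu>_def)
  finally have "\<bar>\<Sum>i\<in>I. \<Psi> (G i)\<bar> \<le> (\<Sum>t\<in>T. \<bar>\<nu> t\<bar> * \<bar>\<Psi> t\<bar>)"
    using sum_abs[of "\<lambda>t. \<nu> t * \<Psi> t" T] by (simp add: abs_mult)
  also have "\<dots> \<le> L2_set \<nu> T * L2_set \<Psi> T" by (rule L2_set_mult_ineq)
  finally have "\<bar>\<Sum>i\<in>I. \<Psi> (G i)\<bar>\<^sup>2 \<le> (L2_set \<nu> T * L2_set \<Psi> T)\<^sup>2" by (rule power_mono) simp
  then have "(\<Sum>i\<in>I. \<Psi> (G i))\<^sup>2 \<le> (\<Sum>t\<in>T. (\<nu> t)\<^sup>2) * (\<Sum>t\<in>T. (\<Psi> t)\<^sup>2)"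
    by (simp add: L2_set_def power_mult_distrib sum_nonneg)
  moreover have "(\<Sum>t\<in>T. (\<nu> t)\<^sup>2) = real (card {(i, j) \<in> I \<times> I. G i = G j})"
  proof -
    have "(\<Sum>i\<in>I. \<nu> (G i)) = (\<Sum>t\<in>T. \<Sum>i\<in>{i \<in> I. G i = t}. \<nu> (G i))"
      using sum.group[OF I T, of "\<lambda>i. \<nu> (G i)"] by simp
    also have "\<dots> = (\<Sum>t\<in>T. (\<nu> t)\<^sup>2)" by (intro sum.cong refl) (simp add: \<nu>_def power2_eq_square)
    finally have "(\<Sum>t\<in>T. (\<nu> t)\<^sup>2) = real (\<Sum>i\<in>I. card {j \<in> I. G j = G i})" by (simp add: \<nu>_def)
    also have "(\<Sum>i\<in>I. card {j \<in> I. G j = G i}) = card (Sigma I (\<lambda>i. {j \<in> I. G j = G i}))"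
      using I by (simp add: card_SigmaI)
    also have "Sigma I (\<lambda>i. {j \<in> I. G j = G i}) = {(i, j) \<in> I \<times> I. G i = G j}" by auto
    finally show ?thesis .
  qed
  ultimately show ?thesis by simp
qed

definition pairs :: "int \<Rightarrow> int \<Rightarrow> (quat \<times> quat) set" where
  "pairs m q = {(y, y') \<in> primitive m \<times> primitive m. qdvd q (y - y')}"

lemma finite_pairs: "finite (pairs m q)"
  by (rule finite_subset[of _ "primitive m \<times> primitive m"]) (auto simp: pairs_def finite_primitive)

context odd_prime
begin

lemma coset_reindex:
  assumes \<gamma>: "\<gamma> \<in> primitive_pow l e" and e: "e \<le> k"
  shows "bij_betw (\<lambda>a. a * \<gamma>) {a \<in> primitive_pow l (k - e). \<not> qdvd l (a * \<gamma>)} {\<alpha> \<in> primitive_pow l k. \<gamma> \<in> right_factors (l ^ e) \<alpha>}"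
proof (rule bij_betw_imageI)
  have g: "nrm \<gamma> = l ^ e" using \<gamma> by (simp add: primitive_pow_def)
  have g0: "\<gamma> \<noteq> 0" using g l_gt_2 by auto
  have lk: "l ^ (k - e) * l ^ e = l ^ k" using e by (simp flip: power_add)
  show "inj_on (\<lambda>a. a * \<gamma>) {a \<in> primitive_pow l (k - e). \<not> qdvd l (a * \<gamma>)}"
    using g0 by (auto simp: inj_on_def quat_cancel_right)
  show "(\<lambda>a. a * \<gamma>) ` {a \<in> primitive_pow l (k - e). \<not> qdvd l (a * \<gamma>)} = {\<alpha> \<in> primitive_pow l k. \<gamma> \<in> right_factors (l ^ e) \<alpha>}"
  proof (intro Set.set_eqI iffI)
    fix \<alpha> assume "\<alpha> \<in> (\<lambda>a. a * \<gamma>) ` {a \<in> primitive_pow l (k - e). \<not> qdvd l (a * \<gamma>)}"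
    then show "\<alpha> \<in> {\<alpha> \<in> primitive_pow l k. \<gamma> \<in> right_factors (l ^ e) \<alpha>}" using g lk by (auto simp: primitive_pow_def right_factors_def nrm_mult)
  next
    fix \<alpha> assume "\<alpha> \<in> {\<alpha> \<in> primitive_pow l k. \<gamma> \<in> right_factors (l ^ e) \<alpha>}"
    then obtain a where a: "\<alpha> \<in> primitive_pow l k" "\<alpha> = a * \<gamma>" by (auto simp: right_factors_def)
    have "nrm a * l ^ e = l ^ (k - e) * l ^ e" using a g lk by (simp add: primitive_pow_def nrm_mult)
    then have "nrm a = l ^ (k - e)" using l_gt_2 by simp
    then have "a \<in> primitive_pow l (k - e)" "\<not> qdvd l (a * \<gamma>)" using a qdvd_multr by (auto simp: primitive_pow_def)
    then show "\<alpha> \<in> (\<lambda>a. a * \<gamma>) ` {a \<in> primitive_pow l (k - e). \<not> qdvd l (a * \<gamma>)}" using a by blast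
  qed
qed

definition unit_res :: "nat \<Rightarrow> int set" where
  "unit_res k = {c \<in> {0..<l ^ k}. coprime c (l ^ k)}"

lemma finite_unit_res: "finite (unit_res k)"
  by (rule finite_subset[of _ "{0..<l ^ k}"]) (auto simp: unit_res_def)

lemma card_unit_res: "2 * int (card (unit_res k)) \<ge> l ^ k"
proof (cases k)
  case 0
  then have "unit_res k = {0}" by (auto simp: unit_res_def)
  then show ?thesis using 0 by simp
next
  case (Suc j)
  let ?D = "(\<lambda>c. l * c) ` {0..<l ^ j}"
  have "{0..<l ^ k} \<subseteq> unit_res k \<union> ?D"
  proof
    fix c assume c: "c \<in> {0..<l ^ k}"
    show "c \<in> unit_res k \<union> ?D"
    proof (cases "l dvd c")
      case False
      then show ?thesis using c coprime_l[of c] by (simp add: unit_res_def)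
    next
      case True
      then obtain d where d: "c = l * d" by (auto elim: dvdE)
      then have "0 \<le> d" "d < l ^ j" using c Suc l_gt_2 by (auto simp: zero_le_mult_iff)
      then show ?thesis using d by auto
    qed
  qed
  then have "card {0..<l ^ k} \<le> card (unit_res k \<union> ?D)"
    by (rule card_mono[rotated]) (auto simp: finite_unit_res)
  also have "\<dots> \<le> card (unit_res k) + card ?D" by (rule card_Un_le)
  also have "card ?D \<le> card {0..<l ^ j}" by (rule card_image_le) simp
  finally have "card {0..<l ^ k} \<le> card (unit_res k) + card {0..<l ^ j}" by simp
  moreover have "int (card {0..<l ^ i}) = l ^ i" for i using l_pow_pos[of i] by (simp add: less_imp_le)
  from this[of k] this[of j] have "int (card {0..<l ^ k}) = l ^ k" "int (card {0..<l ^ j}) = l ^ j" by auto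
  ultimately have "l ^ k \<le> int (card (unit_res k)) + l ^ j" by linarith
  moreover have "2 * l ^ j \<le> l ^ k" using Suc l_gt_2 l_pow_pos[of j] by simp
  ultimately show ?thesis by simp
qed

text \<open>If \<open>c * y\<close> and \<open>c' * y'\<close> are congruent, then so are
  \<open>c\<^sup>2\<close> and \<open>c'\<^sup>2\<close>, by taking norms, because \<open>m\<close>
  is prime to \<open>l\<close>. Units with equal squares modulo a power of an odd prime agree up to
  sign, and then \<open>y\<close> and \<open>y'\<close> do as well; hence the factor 2.\<close>

lemma card_collisions:
  assumes m: "\<not> l dvd m" "m > 0"
  shows "card {(i, j) \<in> (unit_res k \<times> primitive m) \<times> (unit_res k \<times> primitive m).
      qdvd (l ^ k) (of_int (fst i) * snd i - of_int (fst j) * snd j)}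
    \<le> 2 * card (unit_res k) * card (pairs m (l ^ k))"
proof -
  let ?q = "l ^ k" and ?U = "unit_res k"
  define f1 where "f1 = (\<lambda>(c :: int, y :: quat, y' :: quat). ((c, y), (c, y')))"
  define f2 where "f2 = (\<lambda>(c :: int, y :: quat, y' :: quat). ((c, y), ((- c) mod ?q, - y')))"
  let ?S = "{(i, j) \<in> (?U \<times> primitive m) \<times> (?U \<times> primitive m). qdvd ?q (of_int (fst i) * snd i - of_int (fst j) * snd j)}"
  have "?S \<subseteq> f1 ` (?U \<times> pairs m ?q) \<union> f2 ` (?U \<times> pairs m ?q)"
  proof
    fix s assume "s \<in> ?S"
    then obtain c y c' y' where s: "s = ((c, y), (c', y'))" and c: "c \<in> ?U" "c' \<in> ?U" and y: "y \<in> primitive m" "y' \<in> primitive m"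
      and d: "qdvd ?q (of_int c * y - of_int c' * y')" by auto
    have cop: "coprime ?q c" using c by (simp add: unit_res_def coprime_commute)
    have "?q dvd (c - c') * (c + c')"
    proof -
      obtain w where w: "of_int c * y - of_int c' * y' = of_int ?q * w" using d by (rule qdvdE)
      then have "of_int c * y = of_int c' * y' + of_int ?q * w" by (simp add: algebra_simps)
      then have "nrm (of_int c * y) = nrm (of_int c' * y' + of_int ?q * w)" by simp
      also have "\<dots> = nrm (of_int c' * y') + ?q * (tr (of_int c' * y' * qcnj w) + ?q * nrm w)"
        unfolding nrm_def tr_def by (simp add: power2_eq_square algebra_simps del: of_int_power)
      finally have "c\<^sup>2 * m - c'\<^sup>2 * m = ?q * (tr (of_int c' * y' * qcnj w) + ?q * nrm w)"
        using y by (simp add: nrm_mult primitive_def)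
      moreover have "m * ((c - c') * (c + c')) = c\<^sup>2 * m - c'\<^sup>2 * m" by (simp add: power2_eq_square algebra_simps)
      ultimately have "?q dvd m * ((c - c') * (c + c'))" by (metis dvd_triv_left)
      then show ?thesis using coprime_l_pow[OF m(1), of k] by (simp only: coprime_dvd_mult_right_iff)
    qed
    \<comment> \<open>\<open>l\<close> cannot divide both factors, for then it would divide
      \<open>2 * c\<close>. So one factor is prime to \<open>l\<close> and the other takes the whole
      power; the modulus 1 for \<open>k = 0\<close> is separate.\<close>
    then consider "?q dvd c - c'" | "?q dvd c + c'"
    proof (cases "k = 0 \<or> l dvd c - c'")
      case False
      then have "coprime ?q (c - c')" using coprime_l_pow by blast
      then have "?q dvd c + c'" using \<open>?q dvd (c - c') * (c + c')\<close> by (simp only: coprime_dvd_mult_right_iff)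
      then show thesis using that by blast
    next
      case True
      show thesis
      proof (cases "k = 0")
        case False
        have "\<not> l dvd c + c'"
        proof
          assume "l dvd c + c'"
          then have "l dvd (c - c') + (c + c')" using True False dvd_add[of l "c - c'" "c + c'"] by blast
          then have "l dvd 2 * c" by simp
          then have "l dvd c" using odd_l coprime_dvd_mult_right_iff[of l 2 c] by simp
          then have "\<not> coprime c (l ^ k)" using False prime_l
            by (metis coprime_commute coprime_power_left_iff not_coprimeI dvd_refl not_prime_unit)
          then show False using c by (simp add: unit_res_def)
        qed
        then have "coprime ?q (c + c')" using coprime_l_pow by blast
        then have "?q dvd c - c'" using \<open>?q dvd (c - c') * (c + c')\<close> by (simp only: coprime_dvd_mult_left_iff)
        then show thesis using that by blast
      qed (use that in auto)
    qed
    then show "s \<in> f1 ` (?U \<times> pairs m ?q) \<union> f2 ` (?U \<times> pairs m ?q)"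
    proof cases
      case 1
      then have "c mod ?q = c' mod ?q" by (simp add: mod_eq_dvd_iff)
      then have "c = c'" using c by (simp add: unit_res_def)
      then have "qdvd ?q (of_int c * (y - y'))" using d by (simp add: right_diff_distrib)
      then have "qdvd ?q (y - y')" using cop qdvd_of_int_coprime by blast
      then have "(c, y, y') \<in> ?U \<times> pairs m ?q" using c y by (simp add: pairs_def)
      then show ?thesis using s \<open>c = c'\<close> by (force simp: f1_def)
    next
      case 2
      then have "c' mod ?q = (- c) mod ?q" by (simp add: mod_eq_dvd_iff add.commute)
      then have c': "c' = (- c) mod ?q" using c by (simp add: unit_res_def)
      have "of_int c * (y + y') = (of_int c * y - of_int c' * y') + of_int (c + c') * y'"
        by (simp add: algebra_simps)
      then have "qdvd ?q (of_int c * (y + y'))" using qdvd_add[OF d qdvd_of_int_dvd[OF 2, of y']] by simp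
      then have "qdvd ?q (y - (- y'))" using cop qdvd_of_int_coprime by simp
      then have "(c, y, - y') \<in> ?U \<times> pairs m ?q" using c y by (simp add: pairs_def primitive_def)
      then have "f2 (c, y, - y') \<in> f2 ` (?U \<times> pairs m ?q)" by (rule imageI)
      then show ?thesis using s c' by (simp add: f2_def)
    qed
  qed
  then have "card ?S \<le> card (f1 ` (?U \<times> pairs m ?q) \<union> f2 ` (?U \<times> pairs m ?q))"
    by (rule card_mono[rotated]) (auto simp: finite_pairs finite_unit_res)
  also have "\<dots> \<le> card (f1 ` (?U \<times> pairs m ?q)) + card (f2 ` (?U \<times> pairs m ?q))" by (rule card_Un_le)
  also have "\<dots> \<le> card (?U \<times> pairs m ?q) + card (?U \<times> pairs m ?q)"
    by (intro add_mono card_image_le) (auto simp: finite_pairs finite_unit_res)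
  finally show ?thesis by (simp add: card_cartesian_product)
qed

end

context level
begin

text \<open>The residue \<open>g\<close> modulo \<open>l ^ k\<close> decides which
  \<open>\<beta>\<close> occur, while \<open>x\<close> is the argument modulo \<open>p\<close>.
  Keeping the two independent permits a sum over all pairs of residues.\<close>

definition corr_op :: "nat \<Rightarrow> (quat \<Rightarrow> real) \<Rightarrow> quat \<Rightarrow> quat \<Rightarrow> real" where
  "corr_op k f g x = (\<Sum>\<alpha>\<in>primitive_pow l k. \<Sum>\<beta>\<in>primitive_pow l k. if qdvd (l ^ k) (\<alpha> * g * qcnj \<beta>) then f (\<alpha> * x * qcnj \<beta>) else 0)"

text \<open>On level \<open>e\<close> the sum over the \<open>\<alpha>\<close> with right factor
  \<open>\<gamma>\<close> is a restricted Hecke sum of length \<open>k - e\<close>, which decays;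
  the sum over \<open>\<beta>\<close> is estimated by its length. Higher levels have less decay but
  also fewer terms, and \<open>L * \<theta>\<^sup>2 \<ge> 1\<close> makes \<open>e = 0\<close> the
  worst case.\<close>

lemma corr_op_bound:
  fixes \<theta> C :: real
  assumes \<theta>: "9 / 10 \<le> \<theta>" "\<theta> < 1" "C > 0"
    and X: "\<And>f m \<gamma> j. f \<in> cuspidal \<Longrightarrow> \<gamma> \<in> primitive_pow l j \<Longrightarrow> l2norm (restricted_hecke_op m \<gamma> f) \<le> C * (of_int l * \<theta>) ^ m * l2norm f"
    and f: "f \<in> cuspidal"
  shows "(\<Sum>g\<in>quat_residues (l ^ k). \<Sum>x\<in>quat_residues p. (corr_op k f g x)\<^sup>2) \<le> 1024 * C\<^sup>2 * real (Suc k) * of_int (l ^ k) ^ 6 * \<theta> ^ (2 * k) * (l2norm f)\<^sup>2"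
proof -
  define L where "L = real_of_int l"
  have L: "L \<ge> 3" using l_gt_2 by (simp add: L_def)
  let ?A = "\<lambda>e \<gamma>. {\<alpha> \<in> primitive_pow l k. \<gamma> \<in> right_factors (l ^ e) \<alpha>}"
  have fA: "finite (?A e \<gamma>)" for e \<gamma> by (rule finite_subset[OF _ finite_primitive_pow[of l k]]) auto
  have cPA: "real (card (primitive_pow l j)) \<le> 16 * L ^ j" for j
    using card_primitive_pow_le[of j] of_int_le_iff[of "int (card (primitive_pow l j))" "16 * l ^ j", where ?'a = real] by (simp add: L_def)
  have one: "(\<Sum>x\<in>quat_residues p. (\<Sum>\<alpha>\<in>?A e \<gamma>. \<Sum>\<beta>\<in>?A e \<delta>. f (\<alpha> * x * qcnj \<beta>))\<^sup>2)
      \<le> (16 * L ^ (k - e) * (C * (L * \<theta>) ^ (k - e) * l2norm f))\<^sup>2"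
    if e: "e \<le> k" and \<gamma>: "\<gamma> \<in> primitive_pow l e" and \<delta>: "\<delta> \<in> primitive_pow l e" for e \<gamma> \<delta>
  proof -
    let ?j = "k - e"
    have inner: "(\<Sum>\<alpha>\<in>?A e \<gamma>. f (\<alpha> * y)) = restricted_hecke_op ?j \<gamma> f (\<gamma> * y)" for y
      unfolding restricted_hecke_op_def using sum.reindex_bij_betw[OF coset_reindex[OF \<gamma> e], of "\<lambda>\<alpha>. f (\<alpha> * y)"] by (simp add: mult.assoc)
    have perX: "periodic p (restricted_hecke_op ?j \<gamma> f)" unfolding periodic_def restricted_hecke_op_def
    proof (intro allI impI sum.cong refl)
      fix x y a assume "qdvd p (x - y)"
      then show "f (a * x) = f (a * y)" using perD[OF periodic_multl[OF cuspidal_periodic[OF f]]] by blast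
    qed
    have "l2norm (\<lambda>x. \<Sum>\<alpha>\<in>?A e \<gamma>. \<Sum>\<beta>\<in>?A e \<delta>. f (\<alpha> * x * qcnj \<beta>)) = l2norm (\<lambda>x. \<Sum>\<beta>\<in>?A e \<delta>. restricted_hecke_op ?j \<gamma> f (\<gamma> * x * qcnj \<beta>))"
    proof (rule arg_cong[of _ _ l2norm], rule ext)
      fix x
      have "(\<Sum>\<alpha>\<in>?A e \<gamma>. \<Sum>\<beta>\<in>?A e \<delta>. f (\<alpha> * x * qcnj \<beta>)) = (\<Sum>\<beta>\<in>?A e \<delta>. \<Sum>\<alpha>\<in>?A e \<gamma>. f (\<alpha> * (x * qcnj \<beta>)))"
        by (subst sum.swap) (simp add: mult.assoc)
      then show "(\<Sum>\<alpha>\<in>?A e \<gamma>. \<Sum>\<beta>\<in>?A e \<delta>. f (\<alpha> * x * qcnj \<beta>)) = (\<Sum>\<beta>\<in>?A e \<delta>. restricted_hecke_op ?j \<gamma> f (\<gamma> * x * qcnj \<beta>))"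
        unfolding inner by (simp add: mult.assoc)
    qed
    also have "\<dots> \<le> (\<Sum>\<beta>\<in>?A e \<delta>. l2norm (\<lambda>x. restricted_hecke_op ?j \<gamma> f (\<gamma> * x * qcnj \<beta>)))" by (rule l2norm_sum[OF fA])
    also have "\<dots> = (\<Sum>\<beta>\<in>?A e \<delta>. l2norm (restricted_hecke_op ?j \<gamma> f))"
      using p_ndvd_primitive_pow[OF \<gamma>] p_ndvd_primitive_pow by (intro sum.cong refl l2norm_shift[OF perX]) auto
    also have "\<dots> = real (card (?A e \<delta>)) * l2norm (restricted_hecke_op ?j \<gamma> f)" by simp
    also have "\<dots> \<le> (16 * L ^ ?j) * (C * (L * \<theta>) ^ ?j * l2norm f)"
    proof (rule mult_mono)
      have "card (?A e \<delta>) = card {a \<in> primitive_pow l ?j. \<not> qdvd l (a * \<delta>)}"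
        using bij_betw_same_card[OF coset_reindex[OF \<delta> e]] by simp
      also have "\<dots> \<le> card (primitive_pow l ?j)" by (rule card_mono) (auto simp: finite_primitive_pow)
      finally show "real (card (?A e \<delta>)) \<le> 16 * L ^ ?j" using cPA[of ?j] by linarith
      show "l2norm (restricted_hecke_op ?j \<gamma> f) \<le> C * (L * \<theta>) ^ ?j * l2norm f" using X[OF f \<gamma>] by (simp add: L_def)
    qed (use L in auto)
    finally have "(l2norm (\<lambda>x. \<Sum>\<alpha>\<in>?A e \<gamma>. \<Sum>\<beta>\<in>?A e \<delta>. f (\<alpha> * x * qcnj \<beta>)))\<^sup>2 \<le> (16 * L ^ ?j * (C * (L * \<theta>) ^ ?j * l2norm f))\<^sup>2"
      by (rule power_mono) simp
    then show ?thesis unfolding l2norm_sq_sum .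
  qed
  have "(\<Sum>g\<in>quat_residues (l ^ k). \<Sum>x\<in>quat_residues p. (corr_op k f g x)\<^sup>2)
    \<le> (of_int (l ^ k))\<^sup>2 / 64 * (\<Sum>e\<le>k. of_int (l ^ e) * (\<Sum>\<gamma>\<in>primitive_pow l e. \<Sum>\<delta>\<in>primitive_pow l e. \<Sum>x\<in>quat_residues p.
        (\<Sum>\<alpha>\<in>?A e \<gamma>. \<Sum>\<beta>\<in>?A e \<delta>. f (\<alpha> * x * qcnj \<beta>))\<^sup>2))"
    unfolding corr_op_def by (rule incidence_square_sum[OF finite_quat_residues])
  also have "\<dots> \<le> (L ^ k)\<^sup>2 / 64 * (\<Sum>e\<le>k. 65536 * C\<^sup>2 * (l2norm f)\<^sup>2 * (L ^ k) ^ 4 * \<theta> ^ (2 * k))"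
  proof -
    have "of_int (l ^ e) * (\<Sum>\<gamma>\<in>primitive_pow l e. \<Sum>\<delta>\<in>primitive_pow l e. \<Sum>x\<in>quat_residues p.
        (\<Sum>\<alpha>\<in>?A e \<gamma>. \<Sum>\<beta>\<in>?A e \<delta>. f (\<alpha> * x * qcnj \<beta>))\<^sup>2) \<le> 65536 * C\<^sup>2 * (l2norm f)\<^sup>2 * (L ^ k) ^ 4 * \<theta> ^ (2 * k)"
      if e: "e \<in> {..k}" for e
    proof -
      define j where "j = k - e"
      have kj: "k = e + j" using e by (simp add: j_def)
      let ?R = "(16 * L ^ j * (C * (L * \<theta>) ^ j * l2norm f))\<^sup>2"
      have "(\<Sum>\<gamma>\<in>primitive_pow l e. \<Sum>\<delta>\<in>primitive_pow l e. \<Sum>x\<in>quat_residues p. (\<Sum>\<alpha>\<in>?A e \<gamma>. \<Sum>\<beta>\<in>?A e \<delta>. f (\<alpha> * x * qcnj \<beta>))\<^sup>2)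
        \<le> (\<Sum>\<gamma>\<in>primitive_pow l e. \<Sum>\<delta>\<in>primitive_pow l e. ?R)"
        using one e by (intro sum_mono) (auto simp: j_def)
      also have "\<dots> = (real (card (primitive_pow l e)))\<^sup>2 * ?R" by (simp add: power2_eq_square)
      also have "\<dots> \<le> (16 * L ^ e)\<^sup>2 * ?R" using cPA[of e] by (intro mult_right_mono power_mono) auto
      finally have "of_int (l ^ e) * (\<Sum>\<gamma>\<in>primitive_pow l e. \<Sum>\<delta>\<in>primitive_pow l e. \<Sum>x\<in>quat_residues p. (\<Sum>\<alpha>\<in>?A e \<gamma>. \<Sum>\<beta>\<in>?A e \<delta>. f (\<alpha> * x * qcnj \<beta>))\<^sup>2)
        \<le> L ^ e * ((16 * L ^ e)\<^sup>2 * ?R)" using L unfolding L_def by (simp add: mult_left_mono)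
      \<comment> \<open>65536 = 16 ^ 4: the squares of \<open>16 * L ^ e\<close>, for the number of
        factors, and of \<open>16 * L ^ j\<close>, for the number of \<open>\<beta>\<close>.\<close>
      also have "\<dots> = 65536 * C\<^sup>2 * (l2norm f)\<^sup>2 * ((L ^ e) ^ 3 * (L ^ j) ^ 4 * \<theta> ^ (2 * j))"
        by (simp add: power_mult_distrib power2_eq_square power3_eq_cube power4_eq_xxxx power_mult mult_ac)
      also have "\<dots> \<le> 65536 * C\<^sup>2 * (l2norm f)\<^sup>2 * ((L ^ k) ^ 4 * \<theta> ^ (2 * k))"
      proof (rule mult_left_mono)
        have "81 / 100 \<le> \<theta> * \<theta>" using mult_mono[of "9/10" \<theta> "9/10" \<theta>] \<theta> by simp
        then have "1 \<le> L * \<theta>\<^sup>2" using mult_mono[of 3 L "81/100" "\<theta> * \<theta>"] L by (simp add: power2_eq_square)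
        then have "1 \<le> (L * \<theta>\<^sup>2) ^ e" by (rule one_le_power)
        then have "1 * ((L ^ e) ^ 3 * (L ^ j) ^ 4 * \<theta> ^ (2 * j)) \<le> (L * \<theta>\<^sup>2) ^ e * ((L ^ e) ^ 3 * (L ^ j) ^ 4 * \<theta> ^ (2 * j))"
          using L \<theta> by (intro mult_right_mono) auto
        also have "\<dots> = (L ^ k) ^ 4 * \<theta> ^ (2 * k)"
          by (simp add: kj power_add power_mult_distrib power2_eq_square power3_eq_cube power4_eq_xxxx power_mult mult_ac)
        finally show "(L ^ e) ^ 3 * (L ^ j) ^ 4 * \<theta> ^ (2 * j) \<le> (L ^ k) ^ 4 * \<theta> ^ (2 * k)" by simp
      qed simp
      finally show ?thesis by (simp add: mult.assoc)
    qed
    then show ?thesis unfolding L_def of_int_power by (intro mult_left_mono sum_mono) auto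
  qed
  also have "\<dots> = 1024 * C\<^sup>2 * real (Suc k) * (L ^ k) ^ 6 * \<theta> ^ (2 * k) * (l2norm f)\<^sup>2"
    by (simp add: power_numeral_reduce mult_ac)
  finally show ?thesis by (simp add: L_def)
qed

text \<open>Summed over all \<open>\<alpha>\<close> in \<open>primitive_pow l k\<close>, the
  correspondences reproduce \<open>S\<close> with a known multiplicity, and the summand depends on
  \<open>y\<close> only through residues modulo \<open>q\<close> and \<open>p\<close>. To this sum
  \<open>collision_inequality\<close> applies.\<close>

lemma main_inequality:
  fixes \<theta> C :: real
  assumes \<theta>: "9 / 10 \<le> \<theta>" "\<theta> < 1" "C > 0"
    and X: "\<And>f m \<gamma> j. f \<in> cuspidal \<Longrightarrow> \<gamma> \<in> primitive_pow l j \<Longrightarrow> l2norm (restricted_hecke_op m \<gamma> f) \<le> C * (of_int l * \<theta>) ^ m * l2norm f"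
    and h: "h \<in> cuspidal" and m: "\<not> l dvd m" "m > 0"
  shows "(\<Sum>y\<in>primitive m. h y)\<^sup>2 \<le> C\<^sup>2 * real (Suc k) * of_int (l ^ k) ^ 3 * \<theta> ^ (2 * k) * real (card (pairs m (l ^ k))) * (l2norm h)\<^sup>2"
proof -
  define q where "q = l ^ k"
  have q0: "q > 0" using l_pow_pos by (simp add: q_def)
  have pq: "\<not> p dvd q" using p_ndvd_l_pow by (simp add: q_def)
  \<comment> \<open>The division by \<open>q\<close> in the correspondence is exact for integers,
    but \<open>f\<close> only sees residues modulo \<open>p\<close>; the inverse of \<open>q\<close>
    modulo \<open>p\<close> is therefore built in.\<close>
  define f where "f x = h (of_int (inv_p q) * x)" for x
  have fV: "f \<in> cuspidal" unfolding f_def[abs_def] by (rule cuspidal_scalar[OF h inv_p_ndvd[OF pq]])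
  have fp: "periodic p f" by (rule cuspidal_periodic[OF fV])
  have nf: "l2norm f = l2norm h" unfolding f_def[abs_def]
    using inv_p_ndvd[OF pq] prime_p by (intro l2norm_shiftl[OF cuspidal_periodic[OF h]]) (simp add: prime_dvd_power_iff)
  define S where "S = (\<Sum>y\<in>primitive m. h y)"
  define U where "U = unit_res k"
  have fU: "finite U" by (simp add: U_def finite_unit_res)
  let ?I = "U \<times> primitive m"
  \<comment> \<open>The unit \<open>fst i\<close> does not change \<open>\<Psi>\<close>, since it
    does not affect divisibility by \<open>q\<close>. It multiplies the sum by \<open>card U\<close>
    but the collision bound only by \<open>2 * card U\<close>; this gains a factor of order
    \<open>q\<close>.\<close>
  define G where "G i = (quat_mod q (of_int (fst i) * snd i), quat_mod p (snd i))" for i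
  define \<Psi> where "\<Psi> t = corr_op k f (fst t) (snd t)" for t
  have \<Psi>G: "\<Psi> (G (c, y)) = (\<Sum>\<alpha>\<in>primitive_pow l k. \<Sum>\<beta>\<in>{\<beta> \<in> primitive_pow l k. qdvd q (\<alpha> * y * qcnj \<beta>)}. h (quat_div q (\<alpha> * y * qcnj \<beta>)))"
    if c: "c \<in> U" for c y
    unfolding \<Psi>_def G_def corr_op_def fst_conv snd_conv q_def[symmetric]
  proof (rule sum.cong[OF refl])
    fix \<alpha> assume "\<alpha> \<in> primitive_pow l k"
    have iff: "qdvd q (\<alpha> * quat_mod q (of_int c * y) * qcnj \<beta>) \<longleftrightarrow> qdvd q (\<alpha> * y * qcnj \<beta>)" for \<beta>
    proof -
      have "qdvd q (\<alpha> * (of_int c * y - quat_mod q (of_int c * y)) * qcnj \<beta>)"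
        by (rule qdvd_multr[OF qdvd_multl[OF qdvd_quat_mod]])
      then have d: "qdvd q (\<alpha> * (of_int c * y) * qcnj \<beta> - \<alpha> * quat_mod q (of_int c * y) * qcnj \<beta>)"
        by (simp only: right_diff_distrib left_diff_distrib)
      have "qdvd q (\<alpha> * quat_mod q (of_int c * y) * qcnj \<beta>) \<longleftrightarrow> qdvd q (\<alpha> * (of_int c * y) * qcnj \<beta>)"
        using qdvd_add[OF d] qdvd_diff[OF _ d] by fastforce
      also have "\<alpha> * (of_int c * y) * qcnj \<beta> = of_int c * (\<alpha> * y * qcnj \<beta>)"
        by (simp only: of_int_mid mult.assoc)
      also have "qdvd q \<dots> \<longleftrightarrow> qdvd q (\<alpha> * y * qcnj \<beta>)"
        using c by (intro qdvd_of_int_coprime) (simp add: U_def unit_res_def q_def coprime_commute)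
      finally show ?thesis .
    qed
    have val: "f (\<alpha> * quat_mod p y * qcnj \<beta>) = h (quat_div q (\<alpha> * y * qcnj \<beta>))" if "qdvd q (\<alpha> * y * qcnj \<beta>)" for \<beta>
    proof -
      have "f (\<alpha> * quat_mod p y * qcnj \<beta>) = f (\<alpha> * y * qcnj \<beta>)"
        using perD[OF periodic_mult[OF fp] qdvd_quat_mod, of \<alpha> y "qcnj \<beta>"] by simp
      also obtain z where z: "\<alpha> * y * qcnj \<beta> = of_int q * z" using \<open>qdvd q (\<alpha> * y * qcnj \<beta>)\<close> by (rule qdvdE)
      have "f (of_int q * z) = h z" unfolding f_def by (rule periodic_inv(1)[OF cuspidal_periodic[OF h] pq])
      then have "f (\<alpha> * y * qcnj \<beta>) = h (quat_div q (\<alpha> * y * qcnj \<beta>))" unfolding z using q0 by (simp add: quat_div)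
      finally show ?thesis .
    qed
    have "(\<Sum>\<beta>\<in>primitive_pow l k. if qdvd q (\<alpha> * quat_mod q (of_int c * y) * qcnj \<beta>) then f (\<alpha> * quat_mod p y * qcnj \<beta>) else 0)
      = (\<Sum>\<beta>\<in>primitive_pow l k. if qdvd q (\<alpha> * y * qcnj \<beta>) then h (quat_div q (\<alpha> * y * qcnj \<beta>)) else 0)"
      by (intro sum.cong refl) (auto simp: iff val)
    then show "(\<Sum>\<beta>\<in>primitive_pow l k. if qdvd q (\<alpha> * quat_mod q (of_int c * y) * qcnj \<beta>) then f (\<alpha> * quat_mod p y * qcnj \<beta>) else 0)
      = (\<Sum>\<beta>\<in>{\<beta> \<in> primitive_pow l k. qdvd q (\<alpha> * y * qcnj \<beta>)}. h (quat_div q (\<alpha> * y * qcnj \<beta>)))"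
      by (simp add: sum.inter_filter finite_primitive_pow)
  qed
  have tot: "(\<Sum>i\<in>?I. \<Psi> (G i)) = real (card U) * (8 * real (card (primitive_pow l k)) * S)"
  proof -
    have "(\<Sum>i\<in>?I. \<Psi> (G i)) = (\<Sum>c\<in>U. \<Sum>y\<in>primitive m. \<Psi> (G (c, y)))"
      by (simp add: sum.cartesian_product case_prod_unfold)
    also have "\<dots> = (\<Sum>c\<in>U. \<Sum>\<alpha>\<in>primitive_pow l k. 8 * S)"
    proof (rule sum.cong[OF refl])
      fix c assume c: "c \<in> U"
      have "(\<Sum>y\<in>primitive m. \<Psi> (G (c, y))) = (\<Sum>\<alpha>\<in>primitive_pow l k. \<Sum>y\<in>primitive m. \<Sum>\<beta>\<in>{\<beta> \<in> primitive_pow l k. qdvd q (\<alpha> * y * qcnj \<beta>)}. h (quat_div q (\<alpha> * y * qcnj \<beta>)))"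
        unfolding \<Psi>G[OF c] by (rule sum.swap)
      also have "\<dots> = (\<Sum>\<alpha>\<in>primitive_pow l k. 8 * S)"
        unfolding q_def S_def by (intro sum.cong refl correspondence[OF m])
      finally show "(\<Sum>y\<in>primitive m. \<Psi> (G (c, y))) = (\<Sum>\<alpha>\<in>primitive_pow l k. 8 * S)" .
    qed
    finally show ?thesis by (simp add: algebra_simps)
  qed
  have "(\<Sum>i\<in>?I. \<Psi> (G i))\<^sup>2 \<le> real (card {(i, j) \<in> ?I \<times> ?I. G i = G j}) * (\<Sum>t\<in>quat_residues q \<times> quat_residues p. (\<Psi> t)\<^sup>2)"
    using q0 p_gt_2 by (intro collision_inequality) (auto simp: fU finite_primitive finite_quat_residues G_def quat_mod_in_quat_residues)
  also have "\<dots> \<le> (2 * real (card U) * real (card (pairs m q))) * (\<Sum>t\<in>quat_residues q \<times> quat_residues p. (\<Psi> t)\<^sup>2)"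
  proof (rule mult_right_mono)
    have "card {(i, j) \<in> ?I \<times> ?I. G i = G j} \<le> card {(i, j) \<in> ?I \<times> ?I. qdvd q (of_int (fst i) * snd i - of_int (fst j) * snd j)}"
    proof (rule card_mono)
      show "finite {(i, j) \<in> ?I \<times> ?I. qdvd q (of_int (fst i) * snd i - of_int (fst j) * snd j)}"
        by (rule finite_subset[of _ "?I \<times> ?I"]) (auto simp: fU finite_primitive)
      have "qdvd q (x - y)" if "quat_mod q x = quat_mod q y" for x y
        using that by (simp add: quat_mod_def qdvd_def mod_eq_dvd_iff)
      then show "{(i, j) \<in> ?I \<times> ?I. G i = G j} \<subseteq> {(i, j) \<in> ?I \<times> ?I. qdvd q (of_int (fst i) * snd i - of_int (fst j) * snd j)}"
        by (auto simp: G_def)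
    qed
    also have "\<dots> \<le> 2 * card U * card (pairs m q)"
      unfolding U_def q_def by (rule card_collisions[OF m])
    finally have n: "card {(i, j) \<in> ?I \<times> ?I. G i = G j} \<le> 2 * card U * card (pairs m q)" .
    show "real (card {(i, j) \<in> ?I \<times> ?I. G i = G j}) \<le> 2 * real (card U) * real (card (pairs m q))"
      using of_nat_mono[OF n, where ?'a = real] by (simp only: of_nat_mult of_nat_numeral)
  qed (auto intro: sum_nonneg)
  also have "(\<Sum>t\<in>quat_residues q \<times> quat_residues p. (\<Psi> t)\<^sup>2) = (\<Sum>g\<in>quat_residues q. \<Sum>x\<in>quat_residues p. (corr_op k f g x)\<^sup>2)"
    by (simp add: sum.cartesian_product case_prod_unfold \<Psi>_def)
  finally have 1: "(real (card U) * (8 * real (card (primitive_pow l k)) * S))\<^sup>2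
    \<le> 2 * real (card U) * real (card (pairs m q)) * (\<Sum>g\<in>quat_residues q. \<Sum>x\<in>quat_residues p. (corr_op k f g x)\<^sup>2)" unfolding tot .
  define Q where "Q = real_of_int q"
  have Q0: "Q > 0" using q0 by (simp add: Q_def)
  have u: "Q \<le> 2 * real (card U)" using card_unit_res[of k] unfolding Q_def U_def q_def by linarith
  have a: "8 * Q \<le> real (card (primitive_pow l k))" using card_primitive_pow_ge[of k] unfolding Q_def q_def by linarith
  have u0: "real (card U) > 0" using u Q0 by simp
  let ?W = "\<Sum>g\<in>quat_residues q. \<Sum>x\<in>quat_residues p. (corr_op k f g x)\<^sup>2"
  have W0: "?W \<ge> 0" by (intro sum_nonneg) auto
  have "real (card U) * (real (card U) * (8 * real (card (primitive_pow l k)))\<^sup>2 * S\<^sup>2) \<le> real (card U) * (2 * real (card (pairs m q)) * ?W)"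
    using 1 by (simp add: power2_eq_square mult_ac)
  then have 2: "real (card U) * (8 * real (card (primitive_pow l k)))\<^sup>2 * S\<^sup>2 \<le> 2 * real (card (pairs m q)) * ?W"
    using u0 by simp
  \<comment> \<open>One factor \<open>card U \<ge> Q / 2\<close> has been cancelled above; with at
    least \<open>8 * Q\<close> choices of \<open>\<alpha>\<close> and the multiplicity 8 the
    constant is \<open>2048 * Q ^ 3\<close>.\<close>
  have "(Q / 2) * (8 * (8 * Q))\<^sup>2 * S\<^sup>2 \<le> real (card U) * (8 * real (card (primitive_pow l k)))\<^sup>2 * S\<^sup>2"
    using u a Q0 by (intro mult_right_mono mult_mono power_mono) auto
  also note 2
  also have "2 * real (card (pairs m q)) * ?W \<le> 2 * real (card (pairs m q)) * (1024 * C\<^sup>2 * real (Suc k) * Q ^ 6 * \<theta> ^ (2 * k) * (l2norm f)\<^sup>2)"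
    using corr_op_bound[OF \<theta> X fV, where k = k] by (intro mult_left_mono) (auto simp: Q_def q_def)
  finally have "2048 * Q ^ 3 * S\<^sup>2 \<le> 2048 * Q ^ 3 * (C\<^sup>2 * real (Suc k) * Q ^ 3 * \<theta> ^ (2 * k) * real (card (pairs m q)) * (l2norm h)\<^sup>2)"
    by (simp add: nf power_numeral_reduce mult_ac del: of_nat_Suc)
  then have "S\<^sup>2 \<le> C\<^sup>2 * real (Suc k) * Q ^ 3 * \<theta> ^ (2 * k) * real (card (pairs m q)) * (l2norm h)\<^sup>2"
    using Q0 by simp
  then show ?thesis by (simp add: S_def Q_def q_def)
qed

end

section \<open>Pairs of primitive quaternions that are close \<open>l\<close>-adically\<close>

definition divisor_set :: "nat \<Rightarrow> nat set" where
  "divisor_set n = {d. d dvd n}"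

lemma finite_divisor_set: "n > 0 \<Longrightarrow> finite (divisor_set n)"
  by (simp add: divisor_set_def)

lemma card_divisor_set_prime_power_mult:
  assumes "prime p" "m > 0"
  shows "card (divisor_set (p ^ e * m)) \<le> Suc e * card (divisor_set m)"
proof -
  have "divisor_set (p ^ e * m) \<subseteq> (\<lambda>(i, d). p ^ i * d) ` ({..e} \<times> divisor_set m)"
  proof
    fix d assume "d \<in> divisor_set (p ^ e * m)"
    then obtain a b where ab: "d = a * b" "a dvd p ^ e" "b dvd m" using division_decomp[of d "p ^ e" m] by (auto simp: divisor_set_def)
    obtain i where "i \<le> e" "a = p ^ i" using ab(2) assms(1) divides_primepow_nat by blast
    then show "d \<in> (\<lambda>(i, d). p ^ i * d) ` ({..e} \<times> divisor_set m)" using ab by (auto simp: divisor_set_def)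
  qed
  then have "card (divisor_set (p ^ e * m)) \<le> card ({..e} \<times> divisor_set m)"
    using finite_divisor_set[OF assms(2)] by (meson finite_SigmaI finite_atMost surj_card_le)
  then show ?thesis by (simp add: card_cartesian_product)
qed

text \<open>The factor \<open>Suc e\<close> of a prime power is at most
  \<open>p powr (\<epsilon> * e)\<close> as soon as \<open>p powr \<epsilon> \<ge> 2\<close>. Each
  of the at most \<open>P0\<close> smaller primes costs one constant \<open>K\<close>.\<close>

lemma divisor_bound:
  fixes \<epsilon> :: real
  assumes \<epsilon>: "\<epsilon> > 0"
  obtains C where "C \<ge> 1" "\<And>n. n > 0 \<Longrightarrow> real (card (divisor_set n)) \<le> C * real n powr \<epsilon>"
proof -
  define K where "K = 1 / (\<epsilon> * ln 2) + 1"
  have K1: "K \<ge> 1" using \<epsilon> by (simp add: K_def)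
  have K: "real (Suc e) \<le> K * (2 powr \<epsilon>) ^ e" for e :: nat
  proof -
    have eq: "(2 powr \<epsilon>) ^ e = exp (real e * (\<epsilon> * ln 2))"
      by (simp add: powr_def exp_of_nat_mult)
    have "real e * (\<epsilon> * ln 2) \<le> exp (real e * (\<epsilon> * ln 2))" using exp_ge_add_one_self[of "real e * (\<epsilon> * ln 2)"] by linarith
    then have "real e \<le> 1 / (\<epsilon> * ln 2) * (2 powr \<epsilon>) ^ e" using \<epsilon> by (simp add: eq field_simps)
    moreover have "1 \<le> (2 powr \<epsilon>) ^ e" using \<epsilon> by (simp add: eq)
    ultimately show ?thesis by (simp add: K_def algebra_simps)
  qed
  obtain P0 :: nat where P0: "real P0 \<ge> 2 powr (1 / \<epsilon>)" using real_arch_simple by blast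
  have big: "2 \<le> real p powr \<epsilon>" if "p \<ge> P0" for p :: nat
  proof -
    have "2 = (2 powr (1 / \<epsilon>)) powr \<epsilon>" using \<epsilon> by (simp add: powr_powr)
    also have "\<dots> \<le> real p powr \<epsilon>" using P0 that \<epsilon> by (intro powr_mono2) auto
    finally show ?thesis .
  qed
  define sm where "sm n = card {p. prime p \<and> p dvd n \<and> p < P0}" for n
  have fin: "finite {p. prime p \<and> p dvd n \<and> p < P0}" for n :: nat by (rule finite_subset[of _ "{..<P0}"]) auto
  have main: "real (card (divisor_set n)) \<le> K ^ sm n * real n powr \<epsilon>" if "n > 0" for n
    using that
  proof (induction n rule: less_induct)
    case (less n)
    show ?case
    proof (cases "n = 1")
      case True
      then have "divisor_set n = {1}" by (auto simp: divisor_set_def)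
      then show ?thesis using True K1 by (simp add: one_le_power)
    next
      case False
      then obtain p where p: "prime p" "p dvd n" using prime_factor_nat by blast
      define e where "e = multiplicity p n"
      have e: "e \<ge> 1" using p less.prems by (auto simp: e_def Suc_le_eq prime_multiplicity_gt_zero_iff)
      have "n \<noteq> 0" "\<not> is_unit p" using less.prems p not_prime_unit by auto
      from multiplicity_decompose'[OF this] obtain m where m: "n = p ^ e * m" "\<not> p dvd m"
        unfolding e_def by metis
      have m0: "m > 0" using m less.prems by (cases m) auto
      have "p ^ e > 1" using prime_gt_1_nat[OF p(1)] e one_less_power[of p e] by simp
      then have mn: "m < n" using m m0 by simp
      have IH: "real (card (divisor_set m)) \<le> K ^ sm m * real m powr \<epsilon>" using less.IH[OF mn m0] .
      have "real (card (divisor_set n)) \<le> real (Suc e) * real (card (divisor_set m))"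
        using card_divisor_set_prime_power_mult[OF p(1) m0, of e] unfolding m(1)[symmetric] by (metis of_nat_le_iff of_nat_mult)
      also have "\<dots> \<le> real (Suc e) * (K ^ sm m * real m powr \<epsilon>)" using IH by (intro mult_left_mono) auto
      also have "\<dots> \<le> K ^ sm n * (real p powr \<epsilon>) ^ e * real m powr \<epsilon>"
      proof (cases "p < P0")
        case True
        have "{r. prime r \<and> r dvd n \<and> r < P0} = insert p {r. prime r \<and> r dvd m \<and> r < P0}"
        proof -
          have "r dvd n \<longleftrightarrow> r = p \<or> r dvd m" if "prime r" for r
            using that p m(1) by (metis prime_dvd_mult_iff prime_dvd_power primes_dvd_imp_eq)
          then show ?thesis using p True by blast
        qed
        then have "sm n = Suc (sm m)" using m(2) fin by (simp add: sm_def)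
        moreover have "real (Suc e) \<le> K * (real p powr \<epsilon>) ^ e"
        proof -
          have "2 powr \<epsilon> \<le> real p powr \<epsilon>" using prime_ge_2_nat[OF p(1)] \<epsilon> by (intro powr_mono2) auto
          then have "K * (2 powr \<epsilon>) ^ e \<le> K * (real p powr \<epsilon>) ^ e" using K1 by (intro mult_left_mono power_mono) auto
          then show ?thesis using K[of e] by linarith
        qed
        then have "real (Suc e) * (K ^ sm m * real m powr \<epsilon>) \<le> (K * (real p powr \<epsilon>) ^ e) * (K ^ sm m * real m powr \<epsilon>)"
          using K1 by (intro mult_right_mono) auto
        ultimately show ?thesis by (simp add: mult_ac)
      next
        case False
        have "sm m \<le> sm n" unfolding sm_def using m by (intro card_mono[OF fin]) auto
        then have "K ^ sm m \<le> K ^ sm n" using K1 by (rule power_increasing)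
        moreover have "real (Suc e) \<le> (real p powr \<epsilon>) ^ e"
        proof -
          have "Suc e \<le> 2 ^ e" by (simp add: Suc_leI)
          then have "real (Suc e) \<le> 2 ^ e" by (metis of_nat_le_iff of_nat_numeral of_nat_power)
          also have "\<dots> \<le> (real p powr \<epsilon>) ^ e" using big[of p] False by (intro power_mono) auto
          finally show ?thesis .
        qed
        ultimately have "real (Suc e) * (K ^ sm m) \<le> (real p powr \<epsilon>) ^ e * K ^ sm n" using K1 by (intro mult_mono) auto
        then have "real (Suc e) * (K ^ sm m) * real m powr \<epsilon> \<le> (real p powr \<epsilon>) ^ e * K ^ sm n * real m powr \<epsilon>"
          by (rule mult_right_mono) simp
        then show ?thesis by (simp add: mult_ac)
      qed
      also have "\<dots> = K ^ sm n * real n powr \<epsilon>"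
      proof -
        have "(real p powr \<epsilon>) ^ e = real (p ^ e) powr \<epsilon>"
          using p prime_gt_0_nat[of p] by (simp add: powr_realpow[symmetric] powr_powr mult.commute)
        then show ?thesis unfolding m(1) by (simp add: powr_mult)
      qed
      finally show ?thesis .
    qed
  qed
  have "real (card (divisor_set n)) \<le> K ^ P0 * real n powr \<epsilon>" if "n > 0" for n
  proof -
    have "sm n \<le> card {..<P0}" unfolding sm_def by (rule card_mono) auto
    then have "K ^ sm n \<le> K ^ P0" using K1 by (intro power_increasing) auto
    then have "K ^ sm n * real n powr \<epsilon> \<le> K ^ P0 * real n powr \<epsilon>" by (rule mult_right_mono) simp
    then show ?thesis using main[OF that] by linarith
  qed
  then show thesis using that[of "K ^ P0"] K1 by (simp add: one_le_power)
qed

section \<open>Representations by two, three and four squares\<close>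

definition two_squares :: "int \<Rightarrow> (int \<times> int) set" where
  "two_squares m = {(x, y). x\<^sup>2 + y\<^sup>2 = m}"

definition primitive_two_squares :: "int \<Rightarrow> (int \<times> int) set" where
  "primitive_two_squares m = {(x, y). x\<^sup>2 + y\<^sup>2 = m \<and> coprime x y}"

lemma abs_le_of_square_le: "a\<^sup>2 \<le> n \<Longrightarrow> \<bar>a\<bar> \<le> n" for a n :: int
proof -
  assume a: "a\<^sup>2 \<le> n"
  have "\<bar>a\<bar> \<le> \<bar>a\<bar> * \<bar>a\<bar>"
  proof (cases "a = 0")
    case False
    then have "1 * \<bar>a\<bar> \<le> \<bar>a\<bar> * \<bar>a\<bar>" by (intro mult_right_mono) auto
    then show ?thesis by simp
  qed simp
  then show "\<bar>a\<bar> \<le> n" using a by (simp add: power2_eq_square)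
qed

lemma finite_two_squares: "finite (two_squares m)"
proof -
  have "two_squares m \<subseteq> {-m..m} \<times> {-m..m}"
  proof clarify
    fix x y assume "(x, y) \<in> two_squares m"
    then have "x\<^sup>2 + y\<^sup>2 = m" by (simp add: two_squares_def)
    then have "x\<^sup>2 \<le> m" "y\<^sup>2 \<le> m" using zero_le_power2[of x] zero_le_power2[of y] by linarith+
    then show "x \<in> {-m..m} \<and> y \<in> {-m..m}" using abs_le_of_square_le[of x m] abs_le_of_square_le[of y m] by auto
  qed
  then show ?thesis by (rule finite_subset) auto
qed

text \<open>Square roots of -1 are compared with a fixed root \<open>s0\<close>. With
  \<open>d = gcd (s - s0) m\<close>, a root \<open>s\<close> is \<open>s0\<close> modulo
  \<open>d\<close> and \<open>- s0\<close> modulo \<open>m div d\<close>. These two moduli share at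
  most a factor 2, so \<open>d\<close> determines \<open>2 * s\<close> modulo \<open>m\<close>, and
  \<open>h\<close> tells which half of the residues contains \<open>s\<close>.\<close>

lemma sqrt_minus_one_inj:
  fixes m s0 s1 s2 :: int
  assumes m: "m > 0" and s: "m dvd s0\<^sup>2 + 1" "m dvd s1\<^sup>2 + 1" "m dvd s2\<^sup>2 + 1"
    and r: "0 \<le> s1" "s1 < m" "0 \<le> s2" "s2 < m" and g: "gcd (s1 - s0) m = gcd (s2 - s0) m"
    and h: "2 * s1 < m \<longleftrightarrow> 2 * s2 < m"
  shows "s1 = s2"
proof -
  define d where "d = gcd (s1 - s0) m"
  have d0: "d > 0" using m by (simp add: d_def)
  define e where "e = m div d"
  have me: "m = d * e" by (simp add: e_def d_def)
  have "e dvd s + s0" if ms: "m dvd s\<^sup>2 + 1" and gs: "gcd (s - s0) m = d" for s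
  proof -
    have "m dvd (s\<^sup>2 + 1) - (s0\<^sup>2 + 1)" using ms s(1) by (rule dvd_diff)
    then have "m dvd (s - s0) * (s + s0)" by (simp add: power2_eq_square algebra_simps)
    obtain u where u: "s - s0 = d * u" using gs by (metis dvdE gcd_dvd1)
    have "coprime ((s - s0) div gcd (s - s0) m) (m div gcd (s - s0) m)" using m by (intro div_gcd_coprime) auto
    then have "coprime u e" using gs u d0 by (simp add: e_def)
    have "d * e dvd d * (u * (s + s0))" using \<open>m dvd (s - s0) * (s + s0)\<close> u me by (simp add: mult.assoc)
    then have "e dvd u * (s + s0)" using d0 by simp
    then show ?thesis using \<open>coprime u e\<close> by (simp add: coprime_commute coprime_dvd_mult_right_iff)
  qed
  then have "e dvd s1 + s0" "e dvd s2 + s0" using s g by (auto simp: d_def)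
  then have "e dvd (s1 + s0) - (s2 + s0)" by (rule dvd_diff)
  then have e12: "e dvd s1 - s2" by simp
  have "d dvd s1 - s0" by (simp add: d_def)
  moreover have "d dvd s2 - s0" unfolding d_def g by simp
  ultimately have "d dvd (s1 - s0) - (s2 - s0)" by (rule dvd_diff)
  then have d12: "d dvd s1 - s2" by simp
  define t where "t = gcd d e"
  have "t dvd 2"
  proof -
    have "t dvd s1 - s0" using \<open>d dvd s1 - s0\<close> by (auto simp: t_def intro: dvd_trans)
    moreover have "t dvd s1 + s0" using \<open>e dvd s1 + s0\<close> by (auto simp: t_def intro: dvd_trans)
    ultimately have "t dvd (s1 + s0) - (s1 - s0)" by (meson dvd_diff)
    then have "t dvd 2 * s0" by simp
    moreover have "coprime t s0"
    proof (rule coprimeI)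
      fix c assume "c dvd t" "c dvd s0"
      then have "c dvd m" by (metis dvd_mult2 dvd_trans gcd_dvd1 me t_def)
      then have "c dvd s0\<^sup>2 + 1" using s(1) dvd_trans by blast
      moreover have "c dvd s0\<^sup>2" using \<open>c dvd s0\<close> by (simp add: power2_eq_square)
      ultimately show "c dvd 1" by (simp add: dvd_add_right_iff)
    qed
    ultimately show ?thesis by (metis coprime_dvd_mult_left_iff)
  qed
  have "m dvd 2 * (s1 - s2)"
  proof -
    have "lcm d e dvd s1 - s2" using d12 e12 by (rule lcm_least)
    then have "t * lcm d e dvd 2 * (s1 - s2)" using \<open>t dvd 2\<close> by (intro mult_dvd_mono)
    moreover have "t * lcm d e = m"
    proof -
      have "e > 0" using me m d0 by (simp add: zero_less_mult_iff)
      then show ?thesis using prod_gcd_lcm_int[of d e] d0 me by (simp add: t_def)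
    qed
    ultimately show ?thesis by simp
  qed
  moreover have "\<bar>2 * (s1 - s2)\<bar> < m" using r h by auto
  ultimately show ?thesis using dvd_imp_le_int[of "2 * (s1 - s2)" m] m by force
qed

text \<open>The quotient of \<open>x\<close> by \<open>y\<close> is a square root of -1 modulo
  \<open>m\<close>. Representations with the same root differ by a unit of the Gaussian integers,
  which the signs of \<open>x\<close> and \<open>y\<close> detect. The 18 is 2 halves times 3 * 3
  signs.\<close>

lemma card_primitive_two_squares:
  assumes m: "m > 0"
  shows "card (primitive_two_squares m) \<le> 18 * card (divisor_set (nat m))"
proof -
  have ex: "\<exists>s. 0 \<le> s \<and> s < m \<and> m dvd x - s * y" if "(x, y) \<in> primitive_two_squares m" for x y
  proof -
    have "coprime y m"
    proof (rule coprimeI)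
      fix c assume "c dvd y" "c dvd m"
      then have "c dvd m - y\<^sup>2" by (simp add: power2_eq_square)
      then have "c dvd x\<^sup>2" using that by (auto simp: primitive_two_squares_def)
      moreover have "coprime c (x\<^sup>2)"
        using that \<open>c dvd y\<close> by (auto simp: primitive_two_squares_def intro: coprime_imp_coprime dvd_trans)
      ultimately show "c dvd 1" by (meson coprime_common_divisor dvd_refl)
    qed
    then obtain y' k where y': "y' * y = 1 + m * k" using inverse_mod by metis
    have "m dvd x - (x * y') * y" using y' by (simp add: mult.assoc algebra_simps)
    moreover have "m dvd (x * y') * y - ((x * y') mod m) * y"
      by (metis dvd_mult2 left_diff_distrib minus_mod_eq_mult_div dvd_triv_left)
    ultimately have "m dvd (x - (x * y') * y) + ((x * y') * y - ((x * y') mod m) * y)" by (rule dvd_add)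
    then have "m dvd x - ((x * y') mod m) * y" by simp
    then show ?thesis using m by (intro exI[of _ "(x * y') mod m"]) auto
  qed
  define \<sigma> where "\<sigma> z = (SOME s. 0 \<le> s \<and> s < m \<and> m dvd fst z - s * snd z)" for z
  have \<sigma>: "0 \<le> \<sigma> z" "\<sigma> z < m" "m dvd fst z - \<sigma> z * snd z" if "z \<in> primitive_two_squares m" for z
    using someI_ex[OF ex[of "fst z" "snd z"]] that by (auto simp: \<sigma>_def)
  have \<sigma>2: "m dvd (\<sigma> z)\<^sup>2 + 1" if z: "z \<in> primitive_two_squares m" for z
  proof -
    obtain x y where xy: "z = (x, y)" "x\<^sup>2 + y\<^sup>2 = m" "coprime x y" using z by (auto simp: primitive_two_squares_def)
    obtain k where k: "x = \<sigma> z * y + m * k" using \<sigma>(3)[OF z] xy by (auto simp: algebra_simps dvd_def)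
    have "m = (\<sigma> z)\<^sup>2 * y\<^sup>2 + y\<^sup>2 + m * (2 * \<sigma> z * y * k + m * k\<^sup>2)"
      using xy(2) unfolding k by (simp add: power2_eq_square algebra_simps)
    then have "y\<^sup>2 * ((\<sigma> z)\<^sup>2 + 1) = m * (1 - (2 * \<sigma> z * y * k + m * k\<^sup>2))" by (simp add: algebra_simps)
    then have 1: "m dvd y\<^sup>2 * ((\<sigma> z)\<^sup>2 + 1)" by simp
    have "coprime m (y\<^sup>2)"
    proof (rule coprimeI)
      fix c assume c: "c dvd m" "c dvd y\<^sup>2"
      then have "c dvd m - y\<^sup>2" by (rule dvd_diff)
      then have "c dvd x\<^sup>2" using xy(2) by auto
      moreover have "coprime (x\<^sup>2) (y\<^sup>2)" using xy(3) by simp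
      ultimately show "c dvd 1" using c(2) by (meson coprime_common_divisor)
    qed
    then show ?thesis using 1 by (simp add: coprime_dvd_mult_right_iff)
  qed
  show ?thesis
  proof (cases "primitive_two_squares m = {}")
    case False
    then obtain z0 where z0: "z0 \<in> primitive_two_squares m" by blast
    define F where "F z = (nat (gcd (\<sigma> z - \<sigma> z0) m), 2 * \<sigma> z < m, sgn (fst z), sgn (snd z))" for z
    have "inj_on F (primitive_two_squares m)"
    proof (rule inj_onI)
      fix z z' assume z: "z \<in> primitive_two_squares m" "z' \<in> primitive_two_squares m" and F: "F z = F z'"
      obtain x y where xy: "z = (x, y)" "x\<^sup>2 + y\<^sup>2 = m" using z(1) by (auto simp: primitive_two_squares_def)
      obtain x' y' where xy': "z' = (x', y')" "x'\<^sup>2 + y'\<^sup>2 = m" using z(2) by (auto simp: primitive_two_squares_def)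
      have Fs: "nat (gcd (\<sigma> z - \<sigma> z0) m) = nat (gcd (\<sigma> z' - \<sigma> z0) m)" "2 * \<sigma> z < m \<longleftrightarrow> 2 * \<sigma> z' < m"
        "sgn x = sgn x'" "sgn y = sgn y'" using F by (auto simp: F_def xy xy')
      have "gcd (\<sigma> z - \<sigma> z0) m = gcd (\<sigma> z' - \<sigma> z0) m" using Fs(1) by (metis gcd_ge_0_int int_nat_eq)
      then have s: "\<sigma> z = \<sigma> z'"
        using sqrt_minus_one_inj[OF m \<sigma>2[OF z0] \<sigma>2[OF z(1)] \<sigma>2[OF z(2)]] \<sigma> z Fs(2) by blast
      \<comment> \<open>Up to the factor \<open>m\<close>, these are the real and imaginary part of
        a quotient of two Gaussian integers of norm \<open>m\<close>. From \<open>m dvd B\<close>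
        and \<open>A\<^sup>2 + B\<^sup>2 = m\<^sup>2\<close> the quotient is a unit.\<close>
      define A B where "A = x * x' + y * y'" and "B = x * y' - x' * y"
      have "m dvd (x - \<sigma> z * y) * y' - (x' - \<sigma> z * y') * y"
        using \<sigma>(3)[OF z(1)] \<sigma>(3)[OF z(2)] s by (auto simp: xy xy' intro!: dvd_diff)
      then have mB: "m dvd B" by (simp add: B_def algebra_simps)
      have AB: "A\<^sup>2 + B\<^sup>2 = m\<^sup>2"
      proof -
        have "A\<^sup>2 + B\<^sup>2 = (x\<^sup>2 + y\<^sup>2) * (x'\<^sup>2 + y'\<^sup>2)" by (simp add: A_def B_def power2_eq_square algebra_simps)
        then show ?thesis unfolding xy(2) xy'(2) by (simp add: power2_eq_square)
      qed
      have rx: "m * x' = A * x - B * y" "m * y' = A * y + B * x"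
        unfolding xy(2)[symmetric] A_def B_def by (simp_all add: power2_eq_square algebra_simps)
      obtain b where b: "B = m * b" using mB by (auto elim: dvdE)
      have "B\<^sup>2 \<le> m\<^sup>2" using AB zero_le_power2[of A] by linarith
      then have "m\<^sup>2 * b\<^sup>2 \<le> m\<^sup>2 * 1" unfolding b power_mult_distrib by simp
      then have "b\<^sup>2 \<le> 1" using m by simp
      then consider "b = 0" | "b = 1" | "b = -1" using abs_square_le_1[of b] by fastforce
      then have "x' = x \<and> y' = y"
      proof cases
        case 1
        then have "A\<^sup>2 = m\<^sup>2" "B = 0" using AB b by auto
        then have "A = m \<or> A = - m" by (simp add: power2_eq_iff)
        then show ?thesis
        proof
          assume "A = m"
          then show ?thesis using rx \<open>B = 0\<close> m by simp
        next
          assume "A = - m"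
          then have "m * x' = m * (- x)" "m * y' = m * (- y)" using rx \<open>B = 0\<close> by auto
          then have "x' = - x" "y' = - y" using m by (metis mult_left_cancel less_irrefl)+
          then show ?thesis using Fs by (auto simp: sgn_if split: if_splits)
        qed
      next
        case 2
        then have "A = 0" using AB b by simp
        then have "m * x' = m * (- y)" "m * y' = m * x" using rx b 2 by auto
        then have "x' = - y" "y' = x" using m by (metis mult_left_cancel less_irrefl)+
        then show ?thesis using Fs by (auto simp: sgn_if split: if_splits)
      next
        case 3
        then have "A = 0" using AB b by simp
        then have "m * x' = m * y" "m * y' = m * (- x)" using rx b 3 by auto
        then have "x' = y" "y' = - x" using m by (metis mult_left_cancel less_irrefl)+
        then show ?thesis using Fs by (auto simp: sgn_if split: if_splits)
      qed
      then show "z = z'" by (simp add: xy xy')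
    qed
    moreover have "F ` primitive_two_squares m \<subseteq> divisor_set (nat m) \<times> (UNIV :: bool set) \<times> {-1, 0, 1} \<times> {-1, 0, 1}"
    proof -
      have "nat (gcd a m) dvd nat m" "sgn b \<in> {-1, 0, 1}" for a b :: int
        using m by (simp_all add: nat_dvd_iff sgn_if)
      then show ?thesis unfolding F_def divisor_set_def by blast
    qed
    moreover have "finite (divisor_set (nat m) \<times> (UNIV :: bool set) \<times> {-1, 0, 1 :: int} \<times> {-1, 0, 1 :: int})"
      using m by (simp add: finite_divisor_set)
    ultimately have "card (primitive_two_squares m) \<le> card (divisor_set (nat m) \<times> (UNIV :: bool set) \<times> {-1, 0, 1 :: int} \<times> {-1, 0, 1 :: int})"
      by (rule card_inj_on_le)
    then show ?thesis by (simp add: card_cartesian_product)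
  qed simp
qed

lemma card_two_squares:
  assumes m: "m > 0"
  shows "card (two_squares m) \<le> 18 * (card (divisor_set (nat m)))\<^sup>2"
proof -
  have sub: "two_squares m \<subseteq> (\<Union>g\<in>divisor_set (nat m). (\<lambda>(x, y). (int g * x, int g * y)) ` (if (int g)\<^sup>2 dvd m then primitive_two_squares (m div (int g)\<^sup>2) else {}))"
  proof
    fix z assume "z \<in> two_squares m"
    then obtain x y where xy: "z = (x, y)" "x\<^sup>2 + y\<^sup>2 = m" by (auto simp: two_squares_def)
    define g where "g = gcd x y"
    have g0: "g > 0" using xy(2) m by (auto simp: g_def)
    have "\<exists>x' y'. x = x' * g \<and> y = y' * g \<and> coprime x' y'"
      unfolding g_def by (rule gcd_coprime_exists) (use g0 in \<open>simp add: g_def\<close>)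
    then obtain x' y' where x': "x = g * x'" "y = g * y'" "coprime x' y'" by (auto simp: mult.commute)
    have mg: "m = g\<^sup>2 * (x'\<^sup>2 + y'\<^sup>2)" using xy(2) x' by (simp add: power_mult_distrib algebra_simps)
    have "g dvd m" using mg by (simp add: power2_eq_square)
    then have "nat g \<in> divisor_set (nat m)" using g0 m by (simp add: divisor_set_def nat_dvd_iff)
    moreover have "m div g\<^sup>2 = x'\<^sup>2 + y'\<^sup>2" using mg g0 by simp
    then have "(x', y') \<in> primitive_two_squares (m div g\<^sup>2)" using x' by (simp add: primitive_two_squares_def)
    ultimately show "z \<in> (\<Union>g\<in>divisor_set (nat m). (\<lambda>(x, y). (int g * x, int g * y)) ` (if (int g)\<^sup>2 dvd m then primitive_two_squares (m div (int g)\<^sup>2) else {}))"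
      using xy(1) x' mg g0 by (intro UN_I[of "nat g"]) (auto intro!: image_eqI[of _ _ "(x', y')"])
  qed
  have fP: "finite (primitive_two_squares j)" for j by (rule finite_subset[OF _ finite_two_squares[of j]]) (auto simp: primitive_two_squares_def two_squares_def)
  have "card (two_squares m) \<le> card (\<Union>g\<in>divisor_set (nat m). (\<lambda>(x, y). (int g * x, int g * y)) ` (if (int g)\<^sup>2 dvd m then primitive_two_squares (m div (int g)\<^sup>2) else {}))"
    using m by (intro card_mono[OF _ sub]) (auto simp: finite_divisor_set fP)
  also have "\<dots> \<le> (\<Sum>g\<in>divisor_set (nat m). card ((\<lambda>(x, y). (int g * x, int g * y)) ` (if (int g)\<^sup>2 dvd m then primitive_two_squares (m div (int g)\<^sup>2) else {})))"
    using m by (intro card_UN_le) (simp add: finite_divisor_set)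
  also have "\<dots> \<le> (\<Sum>g\<in>divisor_set (nat m). 18 * card (divisor_set (nat m)))"
  proof (rule sum_mono)
    fix g assume "g \<in> divisor_set (nat m)"
    show "card ((\<lambda>(x, y). (int g * x, int g * y)) ` (if (int g)\<^sup>2 dvd m then primitive_two_squares (m div (int g)\<^sup>2) else {})) \<le> 18 * card (divisor_set (nat m))"
    proof (cases "(int g)\<^sup>2 dvd m")
      case True
      then obtain j where j: "m = (int g)\<^sup>2 * j" by (auto elim: dvdE)
      have g: "(int g)\<^sup>2 > 0" "j > 0" using j m by (auto simp: zero_less_mult_iff)
      have "card ((\<lambda>(x, y). (int g * x, int g * y)) ` primitive_two_squares j) \<le> card (primitive_two_squares j)" by (rule card_image_le[OF fP])
      also have "\<dots> \<le> 18 * card (divisor_set (nat j))" using card_primitive_two_squares[OF g(2)] .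
      also have "card (divisor_set (nat j)) \<le> card (divisor_set (nat m))"
      proof (rule card_mono)
        show "finite (divisor_set (nat m))" using m by (simp add: finite_divisor_set)
        have "nat j dvd nat m" using j g m by (simp add: nat_dvd_iff)
        then show "divisor_set (nat j) \<subseteq> divisor_set (nat m)" by (auto simp: divisor_set_def intro: dvd_trans)
      qed
      finally show ?thesis using True j g by simp
    qed simp
  qed
  finally show ?thesis by (simp add: power2_eq_square algebra_simps)
qed

lemma two_squares_bound:
  fixes \<epsilon> :: real
  assumes "\<epsilon> > 0"
  obtains C where "C \<ge> 1" "\<And>m X. 0 \<le> m \<Longrightarrow> real_of_int m \<le> X \<Longrightarrow> 1 \<le> X \<Longrightarrow> real (card (two_squares m)) \<le> C * X powr \<epsilon>"
proof -
  obtain D where D: "D \<ge> 1" "\<And>n. n > 0 \<Longrightarrow> real (card (divisor_set n)) \<le> D * real n powr (\<epsilon> / 2)"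
    using divisor_bound[of "\<epsilon> / 2"] assms by auto
  have D1: "D\<^sup>2 \<ge> 1" using D(1) by (simp add: one_le_power)
  have "real (card (two_squares m)) \<le> 18 * D\<^sup>2 * X powr \<epsilon>" if m: "0 \<le> m" "real_of_int m \<le> X" "1 \<le> X" for m X
  proof (cases "m = 0")
    case True
    have "two_squares m = {(0, 0)}" using True by (auto simp: two_squares_def sum_power2_eq_zero_iff)
    moreover have "1 * 1 \<le> (18 * D\<^sup>2) * X powr \<epsilon>" using D1 m assms by (intro mult_mono) (auto simp: ge_one_powr_ge_zero)
    ultimately show ?thesis by simp
  next
    case False
    then have m0: "m > 0" using m by simp
    have "real (card (two_squares m)) \<le> real (18 * (card (divisor_set (nat m)))\<^sup>2)" using card_two_squares[OF m0] by (simp only: of_nat_le_iff)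
    also have "\<dots> = 18 * (real (card (divisor_set (nat m))))\<^sup>2" by simp
    also have "\<dots> \<le> 18 * (D * real (nat m) powr (\<epsilon> / 2))\<^sup>2" using D(2)[of "nat m"] m0 by (intro mult_left_mono power_mono) auto
    also have "\<dots> = 18 * D\<^sup>2 * real_of_int m powr \<epsilon>"
      using m0 by (simp add: power_mult_distrib power2_eq_square powr_add[symmetric])
    also have "\<dots> \<le> 18 * D\<^sup>2 * X powr \<epsilon>" using m m0 assms by (intro mult_left_mono powr_mono2) auto
    finally show ?thesis .
  qed
  then show thesis using that[of "18 * D\<^sup>2"] D1 by simp
qed

lemma card_squares_le:
  fixes M :: int
  assumes "M \<ge> 0"
  shows "finite {b::int. b\<^sup>2 \<le> M}" "real (card {b::int. b\<^sup>2 \<le> M}) \<le> 2 * sqrt (real_of_int M) + 1"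
proof -
  define s where "s = \<lfloor>sqrt (real_of_int M)\<rfloor>"
  have s0: "s \<ge> 0" using assms by (simp add: s_def)
  have sub: "{b::int. b\<^sup>2 \<le> M} \<subseteq> {-s..s}"
  proof
    fix b :: int assume "b \<in> {b. b\<^sup>2 \<le> M}"
    then have "(real_of_int b)\<^sup>2 \<le> real_of_int M" by (metis mem_Collect_eq of_int_le_iff of_int_power)
    then have "\<bar>real_of_int b\<bar> \<le> sqrt (real_of_int M)" by (simp add: real_le_rsqrt)
    then have "\<bar>b\<bar> \<le> s" by (simp add: s_def le_floor_iff)
    then show "b \<in> {-s..s}" by auto
  qed
  then show "finite {b::int. b\<^sup>2 \<le> M}" by (rule finite_subset) simp
  have "real (card {b::int. b\<^sup>2 \<le> M}) \<le> real (card {-s..s})" using card_mono[OF _ sub] by simp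
  also have "\<dots> = 2 * real_of_int s + 1" using s0 by simp
  also have "\<dots> \<le> 2 * sqrt (real_of_int M) + 1" by (simp add: s_def)
  finally show "real (card {b::int. b\<^sup>2 \<le> M}) \<le> 2 * sqrt (real_of_int M) + 1" .
qed

definition three_squares :: "int \<Rightarrow> (int \<times> int \<times> int) set" where
  "three_squares M = {(b, c, d). b\<^sup>2 + c\<^sup>2 + d\<^sup>2 = M}"

lemma fiber_count:
  fixes B :: real
  assumes "finite A" and sub: "S \<subseteq> Sigma A F" and F: "\<And>a. a \<in> A \<Longrightarrow> finite (F a)" "\<And>a. a \<in> A \<Longrightarrow> real (card (F a)) \<le> B"
  shows "finite S" "real (card S) \<le> real (card A) * B"
proof -
  have fin: "finite (Sigma A F)" using assms by auto
  then show "finite S" using sub finite_subset by blast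
  have "real (card S) \<le> real (card (Sigma A F))" using card_mono[OF fin sub] by simp
  also have "\<dots> = (\<Sum>a\<in>A. real (card (F a)))" using assms by (simp add: card_SigmaI)
  also have "\<dots> \<le> (\<Sum>a\<in>A. B)" using F by (intro sum_mono)
  finally show "real (card S) \<le> real (card A) * B" by simp
qed

lemma three_squares_bound:
  fixes C \<epsilon> X :: real
  assumes C: "\<And>m. 0 \<le> m \<Longrightarrow> real_of_int m \<le> X \<Longrightarrow> real (card (two_squares m)) \<le> C" and M: "0 \<le> M" "real_of_int M \<le> X"
  shows "finite (three_squares M)" "real (card (three_squares M)) \<le> (2 * sqrt (real_of_int M) + 1) * C"
proof -
  have C0: "C \<ge> 0" using C[OF M] by (meson of_nat_0_le_iff order_trans)
  have sub: "three_squares M \<subseteq> Sigma {b. b\<^sup>2 \<le> M} (\<lambda>b. two_squares (M - b\<^sup>2))"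
  proof
    fix z assume "z \<in> three_squares M"
    then obtain b c d where z: "z = (b, c, d)" and e: "b\<^sup>2 + c\<^sup>2 + d\<^sup>2 = M" by (auto simp: three_squares_def)
    then have "b\<^sup>2 \<le> M" using zero_le_power2[of c] zero_le_power2[of d] by linarith
    then show "z \<in> Sigma {b. b\<^sup>2 \<le> M} (\<lambda>b. two_squares (M - b\<^sup>2))" using e z by (simp add: two_squares_def)
  qed
  have F: "real (card (two_squares (M - b\<^sup>2))) \<le> C" if "b \<in> {b. b\<^sup>2 \<le> M}" for b
  proof (rule C)
    show "0 \<le> M - b\<^sup>2" using that by simp
    have "real_of_int (M - b\<^sup>2) \<le> real_of_int M" by simp
    then show "real_of_int (M - b\<^sup>2) \<le> X" using M(2) by linarith
  qed
  note fc = fiber_count[OF card_squares_le(1)[OF M(1)] sub finite_two_squares F]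
  show "finite (three_squares M)" using fc(1) .
  have "real (card {b. b\<^sup>2 \<le> M}) * C \<le> (2 * sqrt (real_of_int M) + 1) * C"
    using card_squares_le(2)[OF M(1)] C0 by (rule mult_right_mono)
  then show "real (card (three_squares M)) \<le> (2 * sqrt (real_of_int M) + 1) * C" using fc(2) by linarith
qed

text \<open>Two coordinates are chosen freely, with at most \<open>3 * sqrt M\<close> values each,
  hence the 9; what remains is a sum of two squares.\<close>

lemma nrm_bound:
  fixes C \<epsilon> X :: real
  assumes C: "\<And>m. 0 \<le> m \<Longrightarrow> real_of_int m \<le> X \<Longrightarrow> real (card (two_squares m)) \<le> C" and M: "1 \<le> M" "real_of_int M \<le> X"
  shows "real (card {x. nrm x = M}) \<le> 9 * real_of_int M * C"
proof -
  have C0: "C \<ge> 0" using C[of M] M by (meson of_nat_0_le_iff order_trans zero_le_one)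
  let ?f = "\<lambda>x. (q0 x, q1 x, q2 x, q3 x)"
  have inj: "inj_on ?f {x. nrm x = M}" by (auto simp: inj_on_def quat_eq_iff)
  have sub: "?f ` {x. nrm x = M} \<subseteq> Sigma {b. b\<^sup>2 \<le> M} (\<lambda>b. three_squares (M - b\<^sup>2))"
  proof
    fix z assume "z \<in> ?f ` {x. nrm x = M}"
    then obtain x where z: "z = ?f x" and "nrm x = M" by blast
    then have e: "(q0 x)\<^sup>2 + (q1 x)\<^sup>2 + (q2 x)\<^sup>2 + (q3 x)\<^sup>2 = M" by (simp add: nrm_def)
    then have "(q0 x)\<^sup>2 \<le> M" using zero_le_power2[of "q1 x"] zero_le_power2[of "q2 x"] zero_le_power2[of "q3 x"] by linarith
    then show "z \<in> Sigma {b. b\<^sup>2 \<le> M} (\<lambda>b. three_squares (M - b\<^sup>2))" using e z by (simp add: three_squares_def)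
  qed
  have M0: "0 \<le> M" using M by simp
  define s where "s = sqrt (real_of_int M)"
  have s: "s \<ge> 1" "s * s = real_of_int M" using M by (auto simp: s_def)
  have F: "finite (three_squares (M - b\<^sup>2))" "real (card (three_squares (M - b\<^sup>2))) \<le> (2 * s + 1) * C" if "b \<in> {b. b\<^sup>2 \<le> M}" for b
  proof -
    have 1: "0 \<le> M - b\<^sup>2" "real_of_int (M - b\<^sup>2) \<le> real_of_int M" using that by simp_all
    then have 2: "real_of_int (M - b\<^sup>2) \<le> X" using M(2) by linarith
    show "finite (three_squares (M - b\<^sup>2))" using three_squares_bound(1)[OF C 1(1) 2] .
    have "(2 * sqrt (real_of_int (M - b\<^sup>2)) + 1) * C \<le> (2 * s + 1) * C"
      using 1 C0 unfolding s_def by (intro mult_right_mono) auto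
    then show "real (card (three_squares (M - b\<^sup>2))) \<le> (2 * s + 1) * C" using three_squares_bound(2)[OF C 1(1) 2] by linarith
  qed
  have "real (card {x. nrm x = M}) = real (card (?f ` {x. nrm x = M}))" by (simp add: card_image[OF inj])
  also have "\<dots> \<le> real (card {b. b\<^sup>2 \<le> M}) * ((2 * s + 1) * C)"
    by (rule fiber_count(2)[OF card_squares_le(1)[OF M0] sub F])
  also have "\<dots> \<le> (2 * s + 1) * ((2 * s + 1) * C)"
    using card_squares_le(2)[OF M0] s C0 by (intro mult_right_mono) (auto simp: s_def)
  also have "\<dots> \<le> (3 * s) * ((3 * s) * C)" using s C0 by (intro mult_mono) auto
  also have "\<dots> = 9 * real_of_int M * C" by (simp add: s(2)[symmetric])
  finally show ?thesis .
qed

section \<open>Congruent pairs, recovered from the product of \<open>y\<close> and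
  \<open>qcnj y'\<close>\<close>

lemma content_decomp:
  assumes "w \<noteq> 0"
  obtains c w' where "c > 0" "w = of_int c * w'" "\<And>r. prime r \<Longrightarrow> \<not> qdvd r w'"
proof -
  define G where "G = gcd (gcd (q0 w) (q1 w)) (gcd (q2 w) (q3 w))"
  have "qdvd G w" unfolding qdvd_def G_def by (meson dvd_trans gcd_dvd1 gcd_dvd2)
  then obtain w' where w': "w = of_int G * w'" by (rule qdvdE)
  have G0: "G > 0"
  proof -
    have "G \<ge> 0" by (simp add: G_def)
    moreover have "G \<noteq> 0" using assms w' by auto
    ultimately show ?thesis by simp
  qed
  have "\<not> qdvd r w'" if r: "prime r" for r
  proof
    assume "qdvd r w'"
    then obtain v where "w' = of_int r * v" by (rule qdvdE)
    then have "w = of_int (G * r) * v" using w' by (simp add: mult.assoc)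
    then have "qdvd (G * r) w" by (simp only: qdvd_triv)
    then have "G * r dvd G * 1" unfolding qdvd_def G_def by simp
    then have "r dvd 1" using G0 by (simp only: dvd_mult_cancel_left) auto
    then show False using r not_prime_unit by blast
  qed
  then show thesis using that[OF G0 w'] by blast
qed

text \<open>A divisor \<open>c\<close> of \<open>y * qcnj y'\<close> is the norm of a common right
  factor of \<open>y\<close> and \<open>y'\<close>, namely of the conjugate of a generator of the
  ideal of \<open>qcnj y\<close> and \<open>c\<close>. The content of the product is explained in
  this way.\<close>

lemma common_right_factor:
  assumes y: "y \<in> primitive n" and c: "c > 0" "odd c" "c dvd n" and w: "y * qcnj y' = of_int c * w"
  obtains d k t where "nrm t = c" "y = d * t" "y' = qcnj k * t" "w = d * k"
proof -
  have c1: "c dvd nrm (qcnj y)" using c(3) y by (simp add: primitive_def)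
  have pr: "\<not> qdvd r (qcnj y)" if "prime r" "r dvd c" for r using y that by (simp add: primitive_def)
  obtain z a b d0 where z: "nrm z = c" "z = qcnj y * a + of_int c * b" "qcnj y = z * d0"
    by (rule ideal_generator[OF c(2,1) c1 pr])
  define k where "k = qcnj a * w + qcnj b * qcnj y'"
  have yd: "y = qcnj d0 * qcnj z" using arg_cong[OF z(3), of qcnj] by (simp add: cnj_mult)
  have "qcnj z = qcnj a * y + of_int c * qcnj b"
    using arg_cong[OF z(2), of qcnj] by (simp only: cnj_simps cnj_mult of_int_comm)
  then have "qcnj z * qcnj y' = qcnj a * (y * qcnj y') + of_int c * (qcnj b * qcnj y')"
    by (simp only: distrib_right mult.assoc)
  also have "\<dots> = of_int c * k" unfolding w k_def distrib_left of_int_mid ..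
  finally have tk: "qcnj z * qcnj y' = of_int c * k" .
  have "of_int c * qcnj y' = z * (qcnj z * qcnj y')" by (simp only: mult_cnj' z(1))
  also have "\<dots> = of_int c * (z * k)" unfolding tk by (rule of_int_mid)
  finally have yk: "qcnj y' = z * k" using c(1) by (simp add: of_int_cancel)
  then have "y' = qcnj k * qcnj z" by (metis cnj_mult cnj_simps(1))
  moreover have "w = qcnj d0 * k"
  proof -
    have "of_int c * w = qcnj d0 * (qcnj z * (z * k))" unfolding w[symmetric] yk by (subst yd) (simp only: mult.assoc)
    also have "\<dots> = of_int c * (qcnj d0 * k)" unfolding mult_cnj' z(1) by (rule of_int_mid)
    finally show ?thesis using c(1) by (simp add: of_int_cancel)
  qed
  ultimately show thesis using that[of "qcnj z" "qcnj d0" k] z(1) yd by simp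
qed

text \<open>The primitive part of \<open>y * qcnj y'\<close> for distinct congruent
  \<open>y\<close>, \<open>y'\<close> of norm \<open>n\<close>. The modulus \<open>q\<^sup>2\<close>
  comes from \<open>nrm (y - y') = 2 * (n - q0 (y * qcnj y'))\<close>, the norm of a multiple of
  \<open>q\<close>; the last condition reflects \<open>y \<noteq> y'\<close>.\<close>

definition near_scalars :: "int \<Rightarrow> int \<Rightarrow> quat set" where
  "near_scalars m q = {w. nrm w = m\<^sup>2 \<and> (\<forall>r. prime r \<longrightarrow> \<not> qdvd r w) \<and> q dvd q1 w \<and> q dvd q2 w \<and> q dvd q3 w
     \<and> q\<^sup>2 dvd m - q0 w \<and> q0 w \<noteq> m}"

text \<open>The real part has at most \<open>2 * m / q\<^sup>2\<close> values. The other
  coordinates, divided by \<open>q\<close>, solve a three-square equation of size at most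
  \<open>(m / q)\<^sup>2\<close>, which has at most \<open>4 * m / q * C\<close> solutions.\<close>

lemma card_near_scalars:
  fixes X C :: real
  assumes C: "\<And>m. 0 \<le> m \<Longrightarrow> real_of_int m \<le> X \<Longrightarrow> real (card (two_squares m)) \<le> C" and m: "0 < m" "(real_of_int m)\<^sup>2 \<le> X" and q: "q > 0"
  shows "finite (near_scalars m q)" "real (card (near_scalars m q)) \<le> 8 * (real_of_int m)\<^sup>2 / (real_of_int q) ^ 3 * C"
proof -
  have C0: "C \<ge> 0"
  proof -
    have "0 \<le> X" using m(2) zero_le_power2[of "real_of_int m"] by linarith
    then have "real (card (two_squares 0)) \<le> C" by (intro C) auto
    then show ?thesis by (meson of_nat_0_le_iff order_trans)
  qed
  define A where "A = {a. \<bar>a\<bar> \<le> m \<and> q\<^sup>2 dvd m - a \<and> a \<noteq> m}"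
  have Asub: "A \<subseteq> (\<lambda>j. m - q\<^sup>2 * j) ` {1..(2 * m) div q\<^sup>2}"
  proof
    fix a assume "a \<in> A"
    then have a: "\<bar>a\<bar> \<le> m" "q\<^sup>2 dvd m - a" "a \<noteq> m" by (auto simp: A_def)
    obtain j where j: "m - a = q\<^sup>2 * j" using a(2) by (auto elim: dvdE)
    have q2: "q\<^sup>2 > 0" using q by simp
    have "q\<^sup>2 * j > 0" using a j by linarith
    then have "j > 0" using q2 by (simp add: zero_less_mult_iff)
    moreover have "q\<^sup>2 * j \<le> 2 * m" using a j by linarith
    then have "j \<le> (2 * m) div q\<^sup>2" using zdiv_mono1[of "q\<^sup>2 * j" "2 * m" "q\<^sup>2"] q2 by simp
    moreover have "a = m - q\<^sup>2 * j" using j by simp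
    ultimately show "a \<in> (\<lambda>j. m - q\<^sup>2 * j) ` {1..(2 * m) div q\<^sup>2}" by auto
  qed
  have fA: "finite A" by (rule finite_subset[OF Asub]) simp
  have cA: "real (card A) \<le> 2 * real_of_int m / (real_of_int q)\<^sup>2"
  proof -
    have "card A \<le> card {1..(2 * m) div q\<^sup>2}" using Asub by (rule surj_card_le[rotated]) simp
    moreover have "(2 * m) div q\<^sup>2 \<ge> 0" using m q by (simp add: pos_imp_zdiv_nonneg_iff)
    ultimately have "int (card A) \<le> (2 * m) div q\<^sup>2" by simp
    then have "real (card A) \<le> real_of_int ((2 * m) div q\<^sup>2)" by linarith
    also have "\<dots> \<le> real_of_int (2 * m) / real_of_int (q\<^sup>2)" by (rule real_of_int_div4)
    finally show ?thesis by simp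
  qed
  let ?f = "\<lambda>w. (q0 w, q1 w div q, q2 w div q, q3 w div q)"
  let ?F = "\<lambda>a. three_squares ((m\<^sup>2 - a\<^sup>2) div q\<^sup>2)"
  have inj: "inj_on ?f (near_scalars m q)"
  proof (rule inj_onI)
    fix w w' assume w: "w \<in> near_scalars m q" "w' \<in> near_scalars m q" "?f w = ?f w'"
    have e: "a = b" if "a div q = b div q" "q dvd a" "q dvd b" for a b using that by (metis dvd_div_mult_self)
    have d: "q dvd q1 w" "q dvd q2 w" "q dvd q3 w" "q dvd q1 w'" "q dvd q2 w'" "q dvd q3 w'"
      using w(1,2) unfolding near_scalars_def by blast+
    show "w = w'" unfolding quat_eq_iff using w(3) e[of "q1 w" "q1 w'"] e[of "q2 w" "q2 w'"] e[of "q3 w" "q3 w'"] d by simp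
  qed
  have sub: "?f ` near_scalars m q \<subseteq> Sigma A ?F"
  proof
    fix z assume "z \<in> ?f ` near_scalars m q"
    then obtain w where w: "w \<in> near_scalars m q" "z = ?f w" by blast
    obtain b c d where bcd: "q1 w = q * b" "q2 w = q * c" "q3 w = q * d" using w(1) by (auto simp: near_scalars_def dvd_def)
    have n: "(q0 w)\<^sup>2 + q\<^sup>2 * (b\<^sup>2 + c\<^sup>2 + d\<^sup>2) = m\<^sup>2"
      using w(1) bcd by (simp add: near_scalars_def nrm_def power_mult_distrib algebra_simps)
    then have "(m\<^sup>2 - (q0 w)\<^sup>2) div q\<^sup>2 = b\<^sup>2 + c\<^sup>2 + d\<^sup>2" using q by (simp flip: n)
    moreover have "(q0 w)\<^sup>2 \<le> m\<^sup>2"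
      using n zero_le_power2[of q] by (smt (verit) mult_nonneg_nonneg zero_le_power2)
    then have "\<bar>q0 w\<bar> \<le> m" using m by (simp add: abs_le_square_iff[symmetric])
    ultimately show "z \<in> Sigma A ?F" using w bcd q by (auto simp: A_def three_squares_def near_scalars_def)
  qed
  have F: "finite (?F a)" "real (card (?F a)) \<le> 4 * real_of_int m / real_of_int q * C" if a: "a \<in> A" for a
  proof -
    let ?M = "(m\<^sup>2 - a\<^sup>2) div q\<^sup>2"
    have "a\<^sup>2 \<le> m\<^sup>2" using a m by (simp add: A_def abs_le_square_iff[symmetric])
    then have M0: "0 \<le> ?M" using q by (simp add: pos_imp_zdiv_nonneg_iff)
    have "real_of_int ?M \<le> real_of_int (m\<^sup>2 - a\<^sup>2) / real_of_int (q\<^sup>2)" by (rule real_of_int_div4)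
    also have "\<dots> \<le> (real_of_int m)\<^sup>2 / (real_of_int q)\<^sup>2" using q by (simp add: divide_right_mono)
    finally have M1: "real_of_int ?M \<le> (real_of_int m / real_of_int q)\<^sup>2" by (simp add: power_divide)
    have "(real_of_int m)\<^sup>2 / (real_of_int q)\<^sup>2 \<le> (real_of_int m)\<^sup>2"
    proof -
      have "(real_of_int q)\<^sup>2 \<ge> 1" using q by (simp add: one_le_power)
      then show ?thesis by (simp add: divide_le_eq mult_le_cancel_left1)
    qed
    then have M2: "real_of_int ?M \<le> X" using M1 m(2) by (simp add: power_divide)
    show "finite (?F a)" using three_squares_bound(1)[OF C M0 M2] .
    \<comment> \<open>An element of \<open>A\<close> exists only if \<open>q \<le> 2 * m\<close>;
      this absorbs the additive 1 of the three-square bound.\<close>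
    have "\<bar>q\<^sup>2\<bar> \<le> \<bar>m - a\<bar>" using a by (intro dvd_imp_le_int) (auto simp: A_def)
    then have "q\<^sup>2 \<le> \<bar>m - a\<bar>" by simp
    also have "\<dots> \<le> 2 * m" using a by (auto simp: A_def)
    finally have "q\<^sup>2 \<le> 2 * m" .
    moreover have "q * 1 \<le> q * q" using q by (intro mult_left_mono) auto
    ultimately have "q \<le> 2 * m" by (simp add: power2_eq_square)
    then have r: "1 \<le> 2 * (real_of_int m / real_of_int q)" using q by (simp add: field_simps)
    have "sqrt (real_of_int ?M) \<le> real_of_int m / real_of_int q" using M1 m q by (intro real_le_lsqrt) auto
    then have "2 * sqrt (real_of_int ?M) + 1 \<le> 4 * real_of_int m / real_of_int q" using r by simp
    then have "(2 * sqrt (real_of_int ?M) + 1) * C \<le> 4 * real_of_int m / real_of_int q * C" using C0 by (rule mult_right_mono)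
    then show "real (card (?F a)) \<le> 4 * real_of_int m / real_of_int q * C" using three_squares_bound(2)[OF C M0 M2] by linarith
  qed
  note fc = fiber_count[OF fA sub F]
  show "finite (near_scalars m q)" using finite_imageD[OF fc(1) inj] .
  have "real (card (near_scalars m q)) = real (card (?f ` near_scalars m q))" by (simp add: card_image[OF inj])
  also have "\<dots> \<le> real (card A) * (4 * real_of_int m / real_of_int q * C)" by (rule fc(2))
  also have "\<dots> \<le> 2 * real_of_int m / (real_of_int q)\<^sup>2 * (4 * real_of_int m / real_of_int q * C)"
    using cA m q C0 by (intro mult_right_mono) auto
  also have "\<dots> = 8 * (real_of_int m)\<^sup>2 / (real_of_int q) ^ 3 * C" by (simp add: power2_eq_square power3_eq_cube)
  finally show "real (card (near_scalars m q)) \<le> 8 * (real_of_int m)\<^sup>2 / (real_of_int q) ^ 3 * C" .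
qed

text \<open>The content \<open>c\<close>, the primitive part \<open>w\<close>, its left factor
  \<open>d\<close> and the common factor \<open>t\<close> recover the pair: \<open>y = d * t\<close>
  and \<open>y' = qcnj k * t\<close> with \<open>w = d * k\<close>. Because \<open>w\<close> is
  primitive there are only eight \<open>d\<close>, while \<open>t\<close> has just its norm
  prescribed.\<close>

lemma pairs_cover:
  assumes n: "n > 0" "odd n" and q: "q > 0" "odd q" "coprime n q"
  shows "pairs n q \<subseteq> (\<lambda>y. (y, y)) ` primitive n \<union>
    (\<Union>c\<in>int ` divisor_set (nat n). (\<lambda>(w, d, t). (d * t, qcnj (quat_div (n div c) (qcnj d * w)) * t)) `
      (SIGMA w:near_scalars (n div c) q. left_factors (n div c) w \<times> {t. nrm t = c}))"
proof
  fix s assume s: "s \<in> pairs n q"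
  then obtain y y' where yy: "s = (y, y')" "y \<in> primitive n" "y' \<in> primitive n" "qdvd q (y - y')" by (auto simp: pairs_def)
  show "s \<in> (\<lambda>y. (y, y)) ` primitive n \<union>
    (\<Union>c\<in>int ` divisor_set (nat n). (\<lambda>(w, d, t). (d * t, qcnj (quat_div (n div c) (qcnj d * w)) * t)) `
      (SIGMA w:near_scalars (n div c) q. left_factors (n div c) w \<times> {t. nrm t = c}))"
  proof (cases "y = y'")
    case True
    then show ?thesis using yy by blast
  next
    case False
    have ny: "nrm y = n" "nrm y' = n" using yy by (auto simp: primitive_def)
    define w where "w = y * qcnj y'"
    have "y \<noteq> 0" "y' \<noteq> 0" using ny n by auto
    then have "w \<noteq> 0" unfolding w_def using quat_mult_eq_0 nrm_eq_0_iff nrm_cnj by metis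
    then obtain c w' where c: "c > 0" "w = of_int c * w'" "\<And>r. prime r \<Longrightarrow> \<not> qdvd r w'" using content_decomp by blast
    have nw: "nrm w = n\<^sup>2" by (simp add: w_def nrm_mult ny power2_eq_square)
    then have "c\<^sup>2 dvd n\<^sup>2" using c(2) by (metis nrm_mult nrm_of_int dvd_triv_left)
    then have cn: "c dvd n" by (simp add: pow_divides_pow_iff)
    then obtain m where m: "n = c * m" by (auto elim: dvdE)
    have m0: "m > 0" using n c m by (simp add: zero_less_mult_iff)
    have co: "odd c" "odd m" using m n by auto
    have mdiv: "n div c = m" using m c by simp
    have ccop: "coprime q c" using q m by (simp add: coprime_commute)
    obtain d k t where f: "nrm t = c" "y = d * t" "y' = qcnj k * t" "w' = d * k"
      using common_right_factor[OF yy(2) c(1) co(1) cn, of y' w'] c(2) by (metis w_def)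
    have nw': "nrm w' = m\<^sup>2"
    proof -
      have "c\<^sup>2 * nrm w' = c\<^sup>2 * m\<^sup>2" using nw c(2) m by (simp add: nrm_mult power_mult_distrib)
      then show ?thesis using c by simp
    qed
    have nd: "nrm d = m" using ny(1) f(1,2) m c(1) by (simp add: nrm_mult mult.commute)
    have qw: "qdvd q (w - of_int n)"
    proof -
      have "w - of_int n = - (y * qcnj (y - y'))" using mult_cnj(1)[of y] ny by (simp add: w_def algebra_simps)
      then show ?thesis using qdvd_multl[of q "qcnj (y - y')" y] yy(4) by (simp del: cnj_simps)
    qed
    have qq: "q dvd q1 w'" "q dvd q2 w'" "q dvd q3 w'"
      using qw c(2) ccop by (auto simp: qdvd_def coprime_dvd_mult_right_iff)
    have re: "nrm (y - y') = 2 * (n - q0 w)"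
      using ny by (simp add: w_def nrm_def power2_eq_square algebra_simps)
    have "q\<^sup>2 dvd m - q0 w'"
    proof -
      have "q\<^sup>2 dvd 2 * (n - q0 w)" using qdvd_nrm[OF yy(4)] re by simp
      moreover have "coprime (q\<^sup>2) 2" using q by simp
      ultimately have "q\<^sup>2 dvd n - q0 w" by (simp only: coprime_dvd_mult_right_iff)
      also have "n - q0 w = c * (m - q0 w')" using c(2) m by (simp add: algebra_simps)
      finally show ?thesis using ccop by (simp add: coprime_dvd_mult_right_iff)
    qed
    moreover have "q0 w' \<noteq> m"
    proof
      assume "q0 w' = m"
      then have "q0 w = n" using c(2) m by simp
      then have "nrm (y - y') = 0" using re by simp
      then show False using False by simp
    qed
    ultimately have "w' \<in> near_scalars m q" using nw' c(3) qq by (simp add: near_scalars_def)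
    moreover have "d \<in> left_factors m w'" using nd f by (auto simp: left_factors_def)
    moreover have "quat_div m (qcnj d * w') = k" using m0 by (simp add: f(4) mult_cnj' nd quat_div)
    moreover have "c \<in> int ` divisor_set (nat n)" using cn c(1) n
      by (intro image_eqI[of _ _ "nat c"]) (auto simp: divisor_set_def nat_dvd_iff)
    ultimately show ?thesis using yy(1) f mdiv
      by (intro UnI2 UN_I[of c] image_eqI[of _ _ "(w', d, t)"]) auto
  qed
qed

lemma pairs_bound:
  fixes \<epsilon> :: real
  assumes \<epsilon>: "\<epsilon> > 0"
  obtains C where "C > 0" "\<And>n q. n > 0 \<Longrightarrow> odd n \<Longrightarrow> q > 0 \<Longrightarrow> odd q \<Longrightarrow> coprime n q \<Longrightarrow>
    real (card (pairs n q)) \<le> C * of_int n powr \<epsilon> * (of_int n + (of_int n)\<^sup>2 / of_int q ^ 3)"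
proof -
  \<comment> \<open>Five factors \<open>n powr \<eta>\<close> occur: one for the divisors
    \<open>c\<close>, and four in \<open>B\<^sup>2\<close>, as \<open>B\<close> is of size
    \<open>n powr (2 * \<eta>)\<close>.\<close>
  define \<eta> where "\<eta> = \<epsilon> / 5"
  have \<eta>: "\<eta> > 0" using \<epsilon> by (simp add: \<eta>_def)
  obtain C2 where C2: "C2 \<ge> 1" "\<And>m X. 0 \<le> m \<Longrightarrow> real_of_int m \<le> X \<Longrightarrow> 1 \<le> X \<Longrightarrow> real (card (two_squares m)) \<le> C2 * X powr \<eta>"
    using two_squares_bound[OF \<eta>] by blast
  obtain D where D: "D \<ge> 1" "\<And>n. n > 0 \<Longrightarrow> real (card (divisor_set n)) \<le> D * real n powr \<eta>" using divisor_bound[OF \<eta>] by blast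
  define C where "C = 9 * C2 + 576 * D * C2\<^sup>2"
  have C0: "C > 0" using C2 D by (simp add: C_def add_pos_pos)
  have "real (card (pairs n q)) \<le> C * of_int n powr \<epsilon> * (of_int n + (of_int n)\<^sup>2 / of_int q ^ 3)"
    if n: "n > 0" "odd n" and q: "q > 0" "odd q" "coprime n q" for n q
  proof -
    define N where "N = real_of_int n"
    define Q where "Q = real_of_int q"
    have N1: "N \<ge> 1" using n by (simp add: N_def)
    have Q0: "Q > 0" using q by (simp add: Q_def)
    define B where "B = C2 * (N\<^sup>2) powr \<eta>"
    have N2: "N\<^sup>2 \<ge> 1" using N1 by (simp add: one_le_power)
    have B: "real (card (two_squares m)) \<le> B" if "0 \<le> m" "real_of_int m \<le> N\<^sup>2" for m
      unfolding B_def using C2(2)[OF that N2] .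
    have B0: "B \<ge> 0" using C2 by (simp add: B_def)
    have NN: "N \<le> N\<^sup>2" using N1 by (simp add: power2_eq_square mult_le_cancel_left1)
    let ?d = "divisor_set (nat n)"
    let ?T = "\<lambda>c. (SIGMA w:near_scalars (n div c) q. left_factors (n div c) w \<times> {t. nrm t = c})"
    let ?\<Phi> = "\<lambda>c. (\<lambda>(w, d, t). (d * t, qcnj (quat_div (n div c) (qcnj d * w)) * t))"
    have fd: "finite ?d" using n by (simp add: finite_divisor_set)
    \<comment> \<open>576 = 8 * 8 * 9, from the near scalars, the left factors and the quaternions
      of norm \<open>c\<close>.\<close>
    have T: "finite (?T c)" "real (card (?T c)) \<le> 576 * B\<^sup>2 * (N\<^sup>2 / Q ^ 3)" if "c \<in> int ` ?d" for c
    proof -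
      obtain x where x: "c = int x" "x dvd nat n" using \<open>c \<in> int ` ?d\<close> by (auto simp: divisor_set_def)
      have "int x dvd int (nat n)" using x(2) by (simp only: of_nat_dvd_iff)
      moreover have "x > 0" using x(2) n by (cases "x = 0") auto
      ultimately have c: "c > 0" "c dvd n" using x n by auto
      obtain m where m: "n = c * m" using c(2) by (auto elim: dvdE)
      have m0: "m > 0" using n c m by (simp add: zero_less_mult_iff)
      have mdiv: "n div c = m" using m c by simp
      have mo: "odd m" using m n by auto
      have NM: "N = real_of_int c * real_of_int m" by (simp add: N_def m)
      have c1: "real_of_int c \<ge> 1" "real_of_int m \<ge> 1" using c m0 by simp_all
      have "real_of_int m \<le> N" unfolding NM using c1 by (simp add: mult_le_cancel_right1)
      then have mN: "(real_of_int m)\<^sup>2 \<le> N\<^sup>2" using m0 by (intro power_mono) auto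
      have cN: "real_of_int c \<le> N\<^sup>2"
      proof -
        have "real_of_int c \<le> N" unfolding NM using c1 by (simp add: mult_le_cancel_left1)
        then show ?thesis using NN by linarith
      qed
      note W = card_near_scalars[OF B m0 mN q(1)]
      have L8: "card (left_factors m w) = 8" if "w \<in> near_scalars m q" for w
        by (rule card_left_factors) (use that m0 mo in \<open>auto simp: near_scalars_def\<close>)
      have fL: "finite (left_factors m w)" if "w \<in> near_scalars m q" for w using L8[OF that] card.infinite by fastforce
      have r4: "real (card {t. nrm t = c}) \<le> 9 * real_of_int c * B"
        using nrm_bound[OF B _ cN] c by simp
      have F: "finite (left_factors m w \<times> {t. nrm t = c})" "real (card (left_factors m w \<times> {t. nrm t = c})) \<le> 72 * real_of_int c * B"
        if "w \<in> near_scalars m q" for w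
        using fL[OF that] finite_nrm r4 L8[OF that] by (auto simp: card_cartesian_product mult_ac)
      note fc = fiber_count[OF W(1) order_refl F]
      show "finite (?T c)" unfolding mdiv using fc(1) .
      have "real (card (?T c)) \<le> real (card (near_scalars m q)) * (72 * real_of_int c * B)" unfolding mdiv by (rule fc(2))
      also have "\<dots> \<le> (8 * (real_of_int m)\<^sup>2 / Q ^ 3 * B) * (72 * real_of_int c * B)"
        using W(2) c1 B0 by (intro mult_right_mono) (auto simp: Q_def)
      also have "\<dots> = 576 * B\<^sup>2 * ((real_of_int m)\<^sup>2 * real_of_int c / Q ^ 3)" by (simp add: power2_eq_square)
      also have "\<dots> \<le> 576 * B\<^sup>2 * (N\<^sup>2 / Q ^ 3)"
      proof (intro mult_left_mono divide_right_mono)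
        have "(real_of_int m)\<^sup>2 * real_of_int c * 1 \<le> (real_of_int m)\<^sup>2 * real_of_int c * real_of_int c" using c1 by (intro mult_left_mono) auto
        then show "(real_of_int m)\<^sup>2 * real_of_int c \<le> N\<^sup>2" by (simp add: NM power2_eq_square mult_ac)
      qed (use Q0 in auto)
      finally show "real (card (?T c)) \<le> 576 * B\<^sup>2 * (N\<^sup>2 / Q ^ 3)" .
    qed
    have fin: "finite ((\<lambda>y. (y, y)) ` primitive n \<union> (\<Union>c\<in>int ` ?d. ?\<Phi> c ` ?T c))"
      using fd T(1) by (intro finite_UnI finite_imageI finite_primitive finite_UN_I) auto
    have "real (card (pairs n q)) \<le> real (card ((\<lambda>y. (y, y)) ` primitive n \<union> (\<Union>c\<in>int ` ?d. ?\<Phi> c ` ?T c)))"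
      using card_mono[OF fin pairs_cover[OF n q]] by simp
    also have "\<dots> \<le> real (card ((\<lambda>y. (y, y)) ` primitive n)) + real (card (\<Union>c\<in>int ` ?d. ?\<Phi> c ` ?T c))"
      by (simp only: of_nat_add[symmetric] of_nat_le_iff card_Un_le)
    also have "\<dots> \<le> 9 * N * B + real (card ?d) * (576 * B\<^sup>2 * (N\<^sup>2 / Q ^ 3))"
    proof (rule add_mono)
      have "card ((\<lambda>y. (y, y)) ` primitive n) \<le> card (primitive n)" by (rule card_image_le[OF finite_primitive])
      also have "\<dots> \<le> card {x. nrm x = n}" by (rule card_mono[OF finite_nrm]) (auto simp: primitive_def)
      finally have "real (card ((\<lambda>y. (y, y)) ` primitive n)) \<le> real (card {x. nrm x = n})" by simp
      also have "\<dots> \<le> 9 * real_of_int n * B"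
        by (rule nrm_bound[OF B]) (use n NN in \<open>auto simp: N_def\<close>)
      finally show "real (card ((\<lambda>y. (y, y)) ` primitive n)) \<le> 9 * N * B" by (simp add: N_def)
      have "card (\<Union>c\<in>int ` ?d. ?\<Phi> c ` ?T c) \<le> (\<Sum>c\<in>int ` ?d. card (?\<Phi> c ` ?T c))" using fd by (intro card_UN_le) auto
      also have "\<dots> \<le> (\<Sum>c\<in>int ` ?d. card (?T c))" using T(1) by (intro sum_mono card_image_le)
      finally have "real (card (\<Union>c\<in>int ` ?d. ?\<Phi> c ` ?T c)) \<le> (\<Sum>c\<in>int ` ?d. real (card (?T c)))"
        by (simp only: of_nat_sum[symmetric] of_nat_le_iff)
      also have "\<dots> \<le> (\<Sum>c\<in>int ` ?d. 576 * B\<^sup>2 * (N\<^sup>2 / Q ^ 3))" using T(2) by (rule sum_mono)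
      also have "\<dots> = real (card ?d) * (576 * B\<^sup>2 * (N\<^sup>2 / Q ^ 3))" by (simp add: card_image)
      finally show "real (card (\<Union>c\<in>int ` ?d. ?\<Phi> c ` ?T c)) \<le> real (card ?d) * (576 * B\<^sup>2 * (N\<^sup>2 / Q ^ 3))" .
    qed
    also have "\<dots> \<le> 9 * N * B + D * N powr \<eta> * (576 * B\<^sup>2 * (N\<^sup>2 / Q ^ 3))"
      using D(2)[of "nat n"] n Q0 by (intro add_left_mono mult_right_mono) (auto simp: N_def)
    also have "\<dots> = 9 * C2 * N powr (2 * \<eta>) * N + 576 * D * C2\<^sup>2 * N powr (5 * \<eta>) * (N\<^sup>2 / Q ^ 3)"
    proof -
      have e: "(N\<^sup>2) powr \<eta> = N powr (2 * \<eta>)" using N1 by (simp add: power2_eq_square powr_mult powr_add[symmetric])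
      have "N powr \<eta> * (N powr (2 * \<eta>))\<^sup>2 = N powr (5 * \<eta>)" by (simp add: power2_eq_square powr_add[symmetric])
      then show ?thesis unfolding B_def e by (simp add: power_mult_distrib mult_ac)
    qed
    also have "\<dots> \<le> C * N powr \<epsilon> * N + C * N powr \<epsilon> * (N\<^sup>2 / Q ^ 3)"
    proof (intro add_mono mult_right_mono mult_mono)
      show "N powr (2 * \<eta>) \<le> N powr \<epsilon>" "N powr (5 * \<eta>) \<le> N powr \<epsilon>" using N1 \<epsilon> by (auto simp: \<eta>_def intro: powr_mono)
    qed (use C2 D N1 Q0 in \<open>auto simp: C_def\<close>)
    finally show ?thesis by (simp add: N_def Q_def algebra_simps)
  qed
  then show thesis using that[OF C0] by blast
qed

section \<open>Power saving for cuspidal sums\<close>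

lemma power_interval:
  fixes b :: int
  assumes "b \<ge> 2" "n \<ge> 1"
  obtains k :: nat where "b ^ k \<le> n" "n < b ^ Suc k"
proof -
  define j where "j = (LEAST j. n < b ^ j)"
  have ex: "n < b ^ nat n"
  proof -
    have "int (nat n) < 2 ^ nat n" by (metis less_exp of_nat_less_iff of_nat_numeral of_nat_power)
    also have "(2::int) ^ nat n \<le> b ^ nat n" using assms by (intro power_mono) auto
    finally show ?thesis using assms by simp
  qed
  have j: "n < b ^ j" unfolding j_def by (rule LeastI) (rule ex)
  have "j \<noteq> 0" using j assms by (cases j) auto
  then obtain k where k: "j = Suc k" by (cases j) auto
  have "\<not> n < b ^ k" using not_less_Least[of k "\<lambda>j. n < b ^ j"] k unfolding j_def by simp
  then show thesis using that[of k] j k by simp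
qed

text \<open>One of the two factors \<open>\<theta> ^ k\<close> in \<open>main_inequality\<close>
  pays for the number \<open>Suc k\<close> of levels.\<close>

lemma Suc_mult_power_bounded:
  fixes \<theta> :: real
  assumes "0 < \<theta>" "\<theta> < 1"
  shows "real (Suc k) * \<theta> ^ k \<le> 1 / (- ln \<theta>) + 1"
proof -
  define s where "s = - ln \<theta>"
  have s: "s > 0" using assms by (simp add: s_def)
  have e: "\<theta> ^ k = exp (- (real k * s))" using assms by (simp add: s_def exp_of_nat_mult)
  have "real k * s \<le> exp (real k * s)" using exp_ge_add_one_self[of "real k * s"] by linarith
  then have "real k * s * \<theta> ^ k \<le> 1" by (simp add: e exp_minus field_simps)
  then have "real k * \<theta> ^ k \<le> 1 / s" using s by (simp add: field_simps)
  moreover have "\<theta> ^ k \<le> 1" using assms by (simp add: power_le_one)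
  ultimately show ?thesis by (simp add: s_def algebra_simps)
qed

context level
begin

text \<open>\<open>q ^ 3\<close> is the largest power of \<open>l ^ 3\<close> up to
  \<open>m\<close>: for larger \<open>q\<close> the diagonal pairs would dominate, for smaller
  \<open>q\<close> decay is given away.\<close>

lemma primitive_sum_bound_coprime:
  fixes \<theta> C :: real
  assumes \<theta>: "9 / 10 \<le> \<theta>" "\<theta> < 1" "C > 0"
    and X: "\<forall>f m \<gamma> j. f \<in> cuspidal \<longrightarrow> \<gamma> \<in> primitive_pow l j \<longrightarrow> l2norm (restricted_hecke_op m \<gamma> f) \<le> C * (of_int l * \<theta>) ^ m * l2norm f"
  obtains C' \<delta> where "C' > 0" "\<delta> > 0" "\<delta> < 1"
    "\<And>h m. h \<in> cuspidal \<Longrightarrow> m > 0 \<Longrightarrow> odd m \<Longrightarrow> \<not> l dvd m \<Longrightarrow> \<bar>\<Sum>y\<in>primitive m. h y\<bar> \<le> C' * of_int m powr (1 - \<delta>) * l2norm h"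
proof -
  define L where "L = real_of_int l"
  have L: "L \<ge> 3" using l_gt_2 by (simp add: L_def)
  have lnL: "ln L > 0" using L by simp
  have ln\<theta>: "ln \<theta> < 0" using \<theta> by simp
  \<comment> \<open>Chosen so that \<open>\<theta> = L powr (- \<sigma>)\<close>. Then
    \<open>\<theta> ^ k\<close> is of size \<open>m powr (- \<sigma> / 3)\<close>; half of this is
    lost to the count of pairs, and the square root leaves the saving
    \<open>\<sigma> / 12\<close>.\<close>
  define \<sigma> where "\<sigma> = - ln \<theta> / ln L"
  have \<sigma>: "\<sigma> > 0" unfolding \<sigma>_def using lnL ln\<theta> by (intro divide_pos_pos) auto
  have \<sigma>1: "\<sigma> < 1"
  proof -
    have "1 < L * \<theta>" using mult_mono[of 3 L "9/10" \<theta>] \<theta> L by simp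
    then have "1 / \<theta> < L" using \<theta> by (simp add: field_simps)
    then have "ln (1 / \<theta>) < ln L" using \<theta> L by (subst ln_less_cancel_iff) auto
    then have "- ln \<theta> < ln L" using \<theta> by (simp add: ln_div)
    then show ?thesis using lnL unfolding \<sigma>_def by (subst pos_divide_less_eq) auto
  qed
  obtain C1 where C1: "C1 > 0" "\<And>n q. n > 0 \<Longrightarrow> odd n \<Longrightarrow> q > 0 \<Longrightarrow> odd q \<Longrightarrow> coprime n q \<Longrightarrow>
    real (card (pairs n q)) \<le> C1 * of_int n powr (\<sigma> / 6) * (of_int n + (of_int n)\<^sup>2 / of_int q ^ 3)"
    using pairs_bound[of "\<sigma> / 6"] \<sigma> by auto
  define K0 where "K0 = 1 / (- ln \<theta>) + 1"
  have K0: "K0 > 0" using ln\<theta> by (simp add: K0_def add_pos_pos)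
  define K where "K = C\<^sup>2 * K0 * (1 / \<theta>) * (2 * C1)"
  have K: "K > 0" using \<theta> K0 C1 by (simp add: K_def)
  have main: "\<bar>\<Sum>y\<in>primitive m. h y\<bar> \<le> sqrt K * of_int m powr (1 - \<sigma> / 12) * l2norm h"
    if h: "h \<in> cuspidal" and m: "m > 0" "odd m" "\<not> l dvd m" for h m
  proof -
    define N where "N = real_of_int m"
    have N1: "N \<ge> 1" using m by (simp add: N_def)
    have "l ^ 3 \<ge> 2" using l_gt_2 power_mono[of 2 l 3] by simp
    then obtain k where k: "(l ^ 3) ^ k \<le> m" "m < (l ^ 3) ^ Suc k" using power_interval[of "l ^ 3" m] m by auto
    define Q where "Q = L ^ k"
    have Q0: "Q > 0" using L by (simp add: Q_def)
    have Q3: "Q ^ 3 \<le> N"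
    proof -
      have "real_of_int ((l ^ 3) ^ k) \<le> real_of_int m" using k(1) by (simp only: of_int_le_iff)
      then show ?thesis by (simp add: Q_def L_def N_def power_mult[symmetric] mult.commute)
    qed
    have NL: "N < (L ^ 3) ^ Suc k"
    proof -
      have "real_of_int m < real_of_int ((l ^ 3) ^ Suc k)" using k(2) by (simp only: of_int_less_iff)
      then show ?thesis unfolding N_def L_def of_int_power .
    qed
    have P: "real (card (pairs m (l ^ k))) \<le> C1 * N powr (\<sigma> / 6) * (N + N\<^sup>2 / Q ^ 3)"
      using C1(2)[of m "l ^ k"] m l_pow_pos odd_l_pow coprime_l_pow[OF m(3), of k]
      by (simp add: N_def Q_def L_def coprime_commute)
    have \<theta>k: "\<theta> ^ k \<le> (1 / \<theta>) * N powr (- \<sigma> / 3)"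
    proof -
      have "ln N < ln ((L ^ 3) ^ Suc k)" using NL N1 L by (subst ln_less_cancel_iff) auto
      also have "\<dots> = real (Suc k) * (3 * ln L)" using L by (simp add: ln_realpow del: power_Suc of_nat_Suc)
      finally have "ln N / (3 * ln L) < real (Suc k)" using lnL by (simp add: field_simps)
      then have "real (Suc k) * ln \<theta> \<le> ln N / (3 * ln L) * ln \<theta>" using ln\<theta> by (intro mult_right_mono_neg) auto
      also have "\<dots> = - \<sigma> / 3 * ln N" using lnL by (simp add: \<sigma>_def field_simps)
      finally have x0: "exp (real (Suc k) * ln \<theta>) \<le> exp (- \<sigma> / 3 * ln N)" by simp
      have x1: "exp (real (Suc k) * ln \<theta>) = \<theta> ^ Suc k"
        using exp_of_nat_mult[of "Suc k" "ln \<theta>"] \<theta> by (simp only: exp_ln)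
      have x2: "exp (- \<sigma> / 3 * ln N) = N powr (- \<sigma> / 3)" using N1 by (simp add: powr_def)
      have "\<theta> ^ Suc k \<le> N powr (- \<sigma> / 3)" using x0 unfolding x1 x2 .
      then show ?thesis using \<theta> by (simp add: field_simps)
    qed
    have "(\<Sum>y\<in>primitive m. h y)\<^sup>2 \<le> C\<^sup>2 * real (Suc k) * of_int (l ^ k) ^ 3 * \<theta> ^ (2 * k) * real (card (pairs m (l ^ k))) * (l2norm h)\<^sup>2"
      by (rule main_inequality[OF \<theta> X[rule_format] h m(3,1)])
    also have "\<dots> = C\<^sup>2 * ((real (Suc k) * \<theta> ^ k) * \<theta> ^ k) * (Q ^ 3 * real (card (pairs m (l ^ k)))) * (l2norm h)\<^sup>2"
    proof -
      have "\<theta> ^ (2 * k) = \<theta> ^ k * \<theta> ^ k" by (simp add: mult_2 power_add)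
      then show ?thesis by (simp only: Q_def L_def of_int_power mult_ac)
    qed
    also have "\<dots> \<le> C\<^sup>2 * (K0 * ((1 / \<theta>) * N powr (- \<sigma> / 3))) * (2 * C1 * N powr (\<sigma> / 6) * N\<^sup>2) * (l2norm h)\<^sup>2"
    proof -
      have s1: "(real (Suc k) * \<theta> ^ k) * \<theta> ^ k \<le> K0 * ((1 / \<theta>) * N powr (- \<sigma> / 3))"
        by (rule mult_mono) (use Suc_mult_power_bounded[of \<theta> k] \<theta> \<theta>k K0 in \<open>auto simp: K0_def\<close>)
      have "Q ^ 3 * real (card (pairs m (l ^ k))) \<le> Q ^ 3 * (C1 * N powr (\<sigma> / 6) * (N + N\<^sup>2 / Q ^ 3))"
        using P Q0 by (intro mult_left_mono) auto
      also have "\<dots> = C1 * N powr (\<sigma> / 6) * (Q ^ 3 * N + N\<^sup>2)" using Q0 by (simp add: field_simps)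
      also have "\<dots> \<le> C1 * N powr (\<sigma> / 6) * (2 * N\<^sup>2)"
        using Q3 N1 C1 by (intro mult_left_mono) (auto simp: power2_eq_square mult_right_mono)
      finally have s2: "Q ^ 3 * real (card (pairs m (l ^ k))) \<le> 2 * C1 * N powr (\<sigma> / 6) * N\<^sup>2" by (simp add: mult_ac)
      show ?thesis
        by (rule mult_right_mono[OF mult_mono[OF mult_left_mono[OF s1] s2]]) (use \<theta> K0 Q0 C1 N1 in auto)
    qed
    also have "\<dots> = K * (N powr (- \<sigma> / 3) * N powr (\<sigma> / 6) * N\<^sup>2) * (l2norm h)\<^sup>2" by (simp add: K_def mult_ac)
    also have "N powr (- \<sigma> / 3) * N powr (\<sigma> / 6) * N\<^sup>2 = (N powr (1 - \<sigma> / 12))\<^sup>2"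
    proof -
      have "N powr (- \<sigma> / 3) * N powr (\<sigma> / 6) * N\<^sup>2 = N powr (- \<sigma> / 3 + \<sigma> / 6 + 2)"
        unfolding powr_add using N1 by simp
      also have "- \<sigma> / 3 + \<sigma> / 6 + 2 = (1 - \<sigma> / 12) + (1 - \<sigma> / 12)" by simp
      also have "N powr ((1 - \<sigma> / 12) + (1 - \<sigma> / 12)) = (N powr (1 - \<sigma> / 12))\<^sup>2"
        by (simp only: powr_add power2_eq_square)
      finally show ?thesis .
    qed
    also have "K * (N powr (1 - \<sigma> / 12))\<^sup>2 * (l2norm h)\<^sup>2 = (sqrt K * N powr (1 - \<sigma> / 12) * l2norm h)\<^sup>2"
      using K by (simp add: power_mult_distrib)
    finally have "\<bar>\<Sum>y\<in>primitive m. h y\<bar>\<^sup>2 \<le> (sqrt K * N powr (1 - \<sigma> / 12) * l2norm h)\<^sup>2" by simp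
    then show ?thesis unfolding N_def using K by (elim power2_le_imp_le) (intro mult_nonneg_nonneg, auto)
  qed
  show thesis using that[of "sqrt K" "\<sigma> / 12"] K \<sigma> \<sigma>1 main by simp
qed

text \<open>For \<open>n = l ^ j * m\<close> there are two bounds. Estimating each translate by a
  left factor of norm \<open>l ^ j\<close> separately saves a power of \<open>m\<close>; estimating
  the Hecke sum of length \<open>j\<close> saves a power of \<open>l ^ j\<close>. Their geometric
  mean saves a power of \<open>n\<close> whatever \<open>j\<close> is.\<close>

lemma primitive_sum_bound:
  obtains C \<delta> where "C > 0" "\<delta> > 0" "\<delta> < 1"
    "\<And>h n. h \<in> cuspidal \<Longrightarrow> n > 0 \<Longrightarrow> odd n \<Longrightarrow> \<bar>\<Sum>y\<in>primitive n. h y\<bar> \<le> C * of_int n powr (1 - \<delta>) * l2norm h"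
proof -
  obtain \<theta> C0 where \<theta>: "9 / 10 \<le> \<theta>" "\<theta> < 1" "C0 > 0"
    and B: "\<And>f m. f \<in> cuspidal \<Longrightarrow> l2norm (hecke_op m f) \<le> C0 * (of_int l * \<theta>) ^ m * l2norm f"
    and X: "\<forall>f m \<gamma> j. f \<in> cuspidal \<longrightarrow> \<gamma> \<in> primitive_pow l j \<longrightarrow> l2norm (restricted_hecke_op m \<gamma> f) \<le> C0 * (of_int l * \<theta>) ^ m * l2norm f"
    using cuspidal_restricted_hecke_op_bound by metis
  obtain C1 \<delta> where C1: "C1 > 0" "\<delta> > 0" "\<delta> < 1"
    and S: "\<And>h m. h \<in> cuspidal \<Longrightarrow> m > 0 \<Longrightarrow> odd m \<Longrightarrow> \<not> l dvd m \<Longrightarrow> \<bar>\<Sum>y\<in>primitive m. h y\<bar> \<le> C1 * of_int m powr (1 - \<delta>) * l2norm h"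
    using primitive_sum_bound_coprime[OF \<theta> X] by blast
  obtain C2 where C2: "C2 \<ge> 1" "\<And>m X. 0 \<le> m \<Longrightarrow> real_of_int m \<le> X \<Longrightarrow> 1 \<le> X \<Longrightarrow> real (card (two_squares m)) \<le> C2 * X powr (\<delta> / 2)"
    using two_squares_bound[of "\<delta> / 2"] C1 by auto
  define L where "L = real_of_int l"
  have L: "L \<ge> 3" using l_gt_2 by (simp add: L_def)
  have lnL: "ln L > 0" using L by simp
  define \<sigma> where "\<sigma> = - ln \<theta> / ln L"
  have \<sigma>: "\<sigma> > 0" unfolding \<sigma>_def using lnL \<theta> by (intro divide_pos_pos) auto
  have \<theta>L: "\<theta> ^ j = (L ^ j) powr (- \<sigma>)" for j
  proof -
    have "(L ^ j) powr (- \<sigma>) = exp (- \<sigma> * (real j * ln L))" using L by (simp add: powr_def ln_realpow)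
    also have "- \<sigma> * (real j * ln L) = real j * ln \<theta>" using lnL by (simp add: \<sigma>_def)
    also have "exp (real j * ln \<theta>) = \<theta> ^ j" using \<theta> by (simp add: exp_of_nat_mult)
    finally show ?thesis by simp
  qed
  \<comment> \<open>The geometric mean keeps half of each saving. For the power of \<open>m\<close>
    these are \<open>\<delta>\<close> from \<open>A\<close>, reduced by the loss
    \<open>\<delta> / 2\<close> in \<open>Bb\<close>, so \<open>\<delta> / 4\<close>
    remains.\<close>
  define \<rho> where "\<rho> = min (\<sigma> / 2) (\<delta> / 4)"
  have \<rho>: "\<rho> > 0" "\<rho> < 1" "\<rho> \<le> \<sigma> / 2" "\<rho> \<le> \<delta> / 4" using \<sigma> C1 by (auto simp: \<rho>_def)
  define K where "K = (2 * C1) * (9 * C2 * C0)"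
  have K: "K > 0" using C1 C2 \<theta> by (simp add: K_def)
  have "\<bar>\<Sum>y\<in>primitive n. h y\<bar> \<le> sqrt K * of_int n powr (1 - \<rho>) * l2norm h" if h: "h \<in> cuspidal" and n: "n > 0" "odd n" for h n
  proof -
    define j where "j = multiplicity l n"
    obtain m where m: "n = l ^ j * m" "\<not> l dvd m"
      using multiplicity_decompose'[of n l] n prime_l not_prime_unit unfolding j_def by (metis less_irrefl)
    have m0: "m > 0" using m n l_pow_pos[of j] by (metis zero_less_mult_pos)
    have mo: "odd m" using m n by auto
    define a where "a = L ^ j"
    have a1: "a \<ge> 1" using L by (simp add: a_def one_le_power)
    define M where "M = real_of_int m"
    have M1: "M \<ge> 1" using m0 by (simp add: M_def)
    have N: "real_of_int n = a * M" by (simp add: m a_def M_def L_def)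
    have cPA: "real (card (primitive_pow l j)) \<le> 16 * a"
      using card_primitive_pow_le[of j] of_int_le_iff[of "int (card (primitive_pow l j))" "16 * l ^ j", where ?'a = real] by (simp add: a_def L_def)
    define T where "T = (\<Sum>y\<in>primitive n. h y)"
    have T8: "8 * T = (\<Sum>c\<in>primitive_pow l j. \<Sum>y\<in>primitive m. h (c * y))" using primitive_mult_sum[OF m(2) m0, where j = j and F = h] by (simp add: T_def m)
    have A: "\<bar>T\<bar> \<le> 2 * C1 * (a * M powr (1 - \<delta>)) * l2norm h"
    proof -
      have "8 * \<bar>T\<bar> = \<bar>\<Sum>c\<in>primitive_pow l j. \<Sum>y\<in>primitive m. h (c * y)\<bar>" using T8 by simp
      also have "\<dots> \<le> (\<Sum>c\<in>primitive_pow l j. \<bar>\<Sum>y\<in>primitive m. h (c * y)\<bar>)" by (rule sum_abs)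
      also have "\<dots> \<le> (\<Sum>c\<in>primitive_pow l j. C1 * M powr (1 - \<delta>) * l2norm h)"
      proof (rule sum_mono)
        fix c assume c: "c \<in> primitive_pow l j"
        have "\<bar>\<Sum>y\<in>primitive m. h (c * y)\<bar> \<le> C1 * of_int m powr (1 - \<delta>) * l2norm (\<lambda>y. h (c * y))"
          by (rule S[OF cuspidal_primitive_pow[OF h c] m0 mo m(2)])
        also have "l2norm (\<lambda>y. h (c * y)) = l2norm h" using c by (intro l2norm_shiftl cuspidal_periodic[OF h] p_ndvd_primitive_pow)
        finally show "\<bar>\<Sum>y\<in>primitive m. h (c * y)\<bar> \<le> C1 * M powr (1 - \<delta>) * l2norm h" by (simp add: M_def)
      qed
      also have "\<dots> = real (card (primitive_pow l j)) * (C1 * M powr (1 - \<delta>) * l2norm h)" by simp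
      also have "\<dots> \<le> (16 * a) * (C1 * M powr (1 - \<delta>) * l2norm h)" using cPA C1 by (intro mult_right_mono) auto
      finally show ?thesis by (simp add: mult_ac)
    qed
    have Bb: "\<bar>T\<bar> \<le> 9 * C2 * C0 * (a * a powr (- \<sigma>) * (M * M powr (\<delta> / 2))) * l2norm h"
    proof -
      have "8 * \<bar>T\<bar> = \<bar>\<Sum>y\<in>primitive m. hecke_op j h y\<bar>"
      proof -
        have "8 * T = (\<Sum>y\<in>primitive m. hecke_op j h y)" unfolding T8 hecke_op_def by (rule sum.swap)
        then show ?thesis by simp
      qed
      also have "\<dots> \<le> (\<Sum>y\<in>primitive m. \<bar>hecke_op j h y\<bar>)" by (rule sum_abs)
      also have "\<dots> \<le> (\<Sum>y\<in>primitive m. l2norm (hecke_op j h))" by (intro sum_mono abs_le_l2norm cuspidal_periodic cuspidal_hecke_op h)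
      also have "\<dots> = real (card (primitive m)) * l2norm (hecke_op j h)" by simp
      also have "\<dots> \<le> (9 * M * (C2 * M powr (\<delta> / 2))) * (C0 * (L * \<theta>) ^ j * l2norm h)"
      proof (rule mult_mono)
        have "card (primitive m) \<le> card {x. nrm x = m}" by (rule card_mono[OF finite_nrm]) (auto simp: primitive_def)
        then have "real (card (primitive m)) \<le> real (card {x. nrm x = m})" by simp
        also have "\<dots> \<le> 9 * real_of_int m * (C2 * M powr (\<delta> / 2))"
          by (rule nrm_bound[of M]) (use C2(2) M1 m0 in \<open>auto simp: M_def\<close>)
        finally show "real (card (primitive m)) \<le> 9 * M * (C2 * M powr (\<delta> / 2))" by (simp add: M_def)
        show "l2norm (hecke_op j h) \<le> C0 * (L * \<theta>) ^ j * l2norm h" using B[OF h] by (simp add: L_def)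
      qed (use M1 C2 in auto)
      also have "(L * \<theta>) ^ j = a * a powr (- \<sigma>)" by (simp add: power_mult_distrib \<theta>L a_def)
      finally have "8 * \<bar>T\<bar> \<le> 9 * C2 * C0 * (a * a powr (- \<sigma>) * (M * M powr (\<delta> / 2))) * l2norm h" by (simp add: mult_ac)
      then show ?thesis by linarith
    qed
    have "\<bar>T\<bar> * \<bar>T\<bar> \<le> (2 * C1 * (a * M powr (1 - \<delta>)) * l2norm h) * (9 * C2 * C0 * (a * a powr (- \<sigma>) * (M * M powr (\<delta> / 2))) * l2norm h)"
      using A Bb C1 a1 by (intro mult_mono) auto
    also have "\<dots> = K * ((a * a * a powr (- \<sigma>)) * (M powr (1 - \<delta>) * (M * M powr (\<delta> / 2)))) * (l2norm h)\<^sup>2"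
      by (simp add: K_def power2_eq_square mult_ac)
    also have "\<dots> \<le> K * ((a powr (1 - \<rho>))\<^sup>2 * (M powr (1 - \<rho>))\<^sup>2) * (l2norm h)\<^sup>2"
    proof (intro mult_right_mono mult_left_mono mult_mono)
      have "a * a * a powr (- \<sigma>) = a powr (2 - \<sigma>)"
      proof -
        have "a * a = a powr 2" using a1 by (simp add: power2_eq_square)
        then show ?thesis by (simp add: powr_add[symmetric])
      qed
      also have "\<dots> \<le> a powr (2 * (1 - \<rho>))" using a1 \<rho> by (intro powr_mono) auto
      finally show "a * a * a powr (- \<sigma>) \<le> (a powr (1 - \<rho>))\<^sup>2" by (simp add: power2_eq_square powr_add[symmetric])
      have "M powr (1 - \<delta>) * (M * M powr (\<delta> / 2)) = M powr (2 - \<delta> / 2)"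
        using M1 by (simp add: powr_mult_base powr_add[symmetric])
      also have "\<dots> \<le> M powr (2 * (1 - \<rho>))" using M1 \<rho> by (intro powr_mono) auto
      finally show "M powr (1 - \<delta>) * (M * M powr (\<delta> / 2)) \<le> (M powr (1 - \<rho>))\<^sup>2" by (simp add: power2_eq_square powr_add[symmetric])
    qed (use K M1 in auto)
    also have "\<dots> = (sqrt K * of_int n powr (1 - \<rho>) * l2norm h)\<^sup>2"
      unfolding N using K a1 M1 by (simp add: power_mult_distrib powr_mult)
    finally have "\<bar>T\<bar>\<^sup>2 \<le> (sqrt K * of_int n powr (1 - \<rho>) * l2norm h)\<^sup>2" by (simp add: power2_eq_square)
    then show ?thesis unfolding T_def using K by (elim power2_le_imp_le) (intro mult_nonneg_nonneg, auto)
  qed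
  then show thesis using that[of "sqrt K" \<rho>] K \<rho> by simp
qed

text \<open>The vectors are sorted by their content \<open>c\<close>, and the number of contents
  costs half of the saving. If \<open>p\<close> divides \<open>c\<close>, then
  \<open>x \<mapsto> h (c * x)\<close> is constant and the bound for cuspidal functions says
  nothing; this is why \<open>h\<close> vanishes on the multiples of \<open>p\<close>.\<close>

lemma sphere_sum_bound:
  obtains C \<delta> where "C > 0" "\<delta> > 0" "\<delta> < 1"
    "\<And>h n. h \<in> cuspidal \<Longrightarrow> (\<And>x. qdvd p x \<Longrightarrow> h x = 0) \<Longrightarrow> n > 0 \<Longrightarrow> odd n \<Longrightarrow>
      \<bar>\<Sum>x\<in>{x. nrm x = n}. h x\<bar> \<le> C * of_int n powr (1 - \<delta>) * l2norm h"
proof -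
  obtain C0 \<delta> where C0: "C0 > 0" "\<delta> > 0" "\<delta> < 1"
    and S: "\<And>h n. h \<in> cuspidal \<Longrightarrow> n > 0 \<Longrightarrow> odd n \<Longrightarrow> \<bar>\<Sum>y\<in>primitive n. h y\<bar> \<le> C0 * of_int n powr (1 - \<delta>) * l2norm h"
    using primitive_sum_bound by blast
  obtain D where D: "D \<ge> 1" "\<And>n. n > 0 \<Longrightarrow> real (card (divisor_set n)) \<le> D * real n powr (\<delta> / 2)"
    using divisor_bound[of "\<delta> / 2"] C0 by auto
  have "\<bar>\<Sum>x\<in>{x. nrm x = n}. h x\<bar> \<le> D * C0 * of_int n powr (1 - \<delta> / 2) * l2norm h"
    if h: "h \<in> cuspidal" and h0: "\<And>x. qdvd p x \<Longrightarrow> h x = 0" and n: "n > 0" "odd n" for h n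
  proof -
    define N where "N = real_of_int n"
    have N1: "N \<ge> 1" using n by (simp add: N_def)
    define I where "I = {c::int. c > 0 \<and> c\<^sup>2 dvd n}"
    have Isub: "I \<subseteq> int ` divisor_set (nat n)"
    proof
      fix c assume "c \<in> I"
      then have c: "c > 0" "c dvd n" by (auto simp: I_def power2_eq_square intro: dvd_mult_left)
      then show "c \<in> int ` divisor_set (nat n)" using n by (intro image_eqI[of _ _ "nat c"]) (auto simp: divisor_set_def nat_dvd_iff)
    qed
    have fI: "finite I" by (rule finite_subset[OF Isub]) (use n in \<open>simp add: finite_divisor_set\<close>)
    have cI: "real (card I) \<le> D * N powr (\<delta> / 2)"
    proof -
      have "card I \<le> card (int ` divisor_set (nat n))" using n by (intro card_mono[OF _ Isub]) (simp add: finite_divisor_set)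
      also have "\<dots> \<le> card (divisor_set (nat n))" using n by (intro card_image_le) (simp add: finite_divisor_set)
      finally have "real (card I) \<le> real (card (divisor_set (nat n)))" by simp
      then show ?thesis using D(2)[of "nat n"] n by (simp add: N_def)
    qed
    have eq: "{x. nrm x = n} = (\<Union>c\<in>I. (\<lambda>y. of_int c * y) ` primitive (n div c\<^sup>2))"
    proof (intro Set.set_eqI iffI)
      fix x assume "x \<in> {x. nrm x = n}"
      then have x: "nrm x = n" by simp
      then have "x \<noteq> 0" using n by auto
      then obtain c w where c: "c > 0" "x = of_int c * w" "\<And>r. prime r \<Longrightarrow> \<not> qdvd r w" using content_decomp by blast
      have nc: "n = c\<^sup>2 * nrm w" using x c by (simp add: nrm_mult)
      then have "w \<in> primitive (n div c\<^sup>2)" using c by (simp add: primitive_def)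
      moreover have "c \<in> I" using nc c by (simp add: I_def)
      ultimately show "x \<in> (\<Union>c\<in>I. (\<lambda>y. of_int c * y) ` primitive (n div c\<^sup>2))" using c(2) by blast
    next
      fix x assume "x \<in> (\<Union>c\<in>I. (\<lambda>y. of_int c * y) ` primitive (n div c\<^sup>2))"
      then obtain c y where "c \<in> I" "y \<in> primitive (n div c\<^sup>2)" "x = of_int c * y" by blast
      then show "x \<in> {x. nrm x = n}" by (simp add: I_def primitive_def nrm_mult)
    qed
    have disj: "c = c'" if c: "c \<in> I" "c' \<in> I" and y: "y \<in> primitive (n div c\<^sup>2)" "y' \<in> primitive (n div c'\<^sup>2)" and e: "of_int c * y = of_int c' * y'"
      for c c' y y'
    proof -
      have one: "c' dvd c" if c: "c > 0" "c' > 0" and y: "\<And>r. prime r \<Longrightarrow> \<not> qdvd r y" and e: "of_int c * y = of_int c' * y'" for c c' y y'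
      proof (rule ccontr)
        assume nd: "\<not> c' dvd c"
        define g where "g = gcd c c'"
        have g0: "g > 0" using c by (simp add: g_def)
        obtain u where u: "c' = g * u" by (metis dvdE g_def gcd_dvd2)
        obtain v where v: "c = g * v" by (metis dvdE g_def gcd_dvd1)
        have cop: "coprime u v"
        proof -
          have "coprime (c div gcd c c') (c' div gcd c c')" using c by (intro div_gcd_coprime) auto
          moreover have "c div g = v" "c' div g = u" using u v g0 by simp_all
          ultimately show ?thesis unfolding g_def[symmetric] by (simp add: coprime_commute)
        qed
        have "u > 0" using u c g0 by (simp add: zero_less_mult_iff)
        moreover have "u \<noteq> 1" using nd u v by auto
        ultimately have "u \<noteq> 0" "\<not> is_unit u" by auto
        then obtain r where r: "prime r" "r dvd u" using prime_divisor_exists[of u] by auto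
        have "of_int g * (of_int v * y) = of_int g * (of_int u * y')" using e u v by (simp add: mult.assoc)
        then have "of_int v * y = of_int u * y'" using g0 by (simp add: of_int_cancel)
        then have "qdvd r (of_int v * y)" using qdvd_of_int_dvd[OF r(2), of y'] by simp
        moreover have "coprime r v" using cop r(2) by (metis coprime_divisors dvd_refl)
        ultimately have "qdvd r y" using qdvd_of_int_coprime by blast
        then show False using y r by blast
      qed
      have "c' dvd c" by (rule one[of c c' y y']) (use c y e in \<open>auto simp: I_def primitive_def\<close>)
      moreover have "c dvd c'" by (rule one[of c' c y' y]) (use c y e in \<open>auto simp: I_def primitive_def\<close>)
      ultimately show ?thesis using c by (auto simp: I_def intro: zdvd_antisym_nonneg)
    qed
    have "(\<Sum>x\<in>{x. nrm x = n}. h x) = (\<Sum>c\<in>I. \<Sum>x\<in>(\<lambda>y. of_int c * y) ` primitive (n div c\<^sup>2). h x)"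
      unfolding eq
    proof (rule sum.UNION_disjoint[OF fI])
      show "\<forall>c\<in>I. finite ((\<lambda>y. of_int c * y) ` primitive (n div c\<^sup>2))" by (simp add: finite_primitive)
      show "\<forall>c\<in>I. \<forall>c'\<in>I. c \<noteq> c' \<longrightarrow> (\<lambda>y. of_int c * y) ` primitive (n div c\<^sup>2) \<inter> (\<lambda>y. of_int c' * y) ` primitive (n div c'\<^sup>2) = {}"
        using disj by blast
    qed
    also have "\<dots> = (\<Sum>c\<in>I. \<Sum>y\<in>primitive (n div c\<^sup>2). h (of_int c * y))"
    proof (rule sum.cong[OF refl])
      fix c assume "c \<in> I"
      then have "inj_on (\<lambda>y. of_int c * y) (primitive (n div c\<^sup>2))" by (auto simp: inj_on_def of_int_cancel I_def)
      then show "(\<Sum>x\<in>(\<lambda>y. of_int c * y) ` primitive (n div c\<^sup>2). h x) = (\<Sum>y\<in>primitive (n div c\<^sup>2). h (of_int c * y))"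
        by (simp add: sum.reindex)
    qed
    finally have "\<bar>\<Sum>x\<in>{x. nrm x = n}. h x\<bar> \<le> (\<Sum>c\<in>I. \<bar>\<Sum>y\<in>primitive (n div c\<^sup>2). h (of_int c * y)\<bar>)"
      by (simp add: sum_abs)
    also have "\<dots> \<le> (\<Sum>c\<in>I. C0 * N powr (1 - \<delta>) * l2norm h)"
    proof (rule sum_mono)
      fix c assume c: "c \<in> I"
      then have c0: "c > 0" by (simp add: I_def)
      obtain m where m: "n = c\<^sup>2 * m" using c by (auto simp: I_def elim: dvdE)
      have m0: "m > 0" using m n c0 by (simp add: zero_less_mult_iff)
      have mo: "odd m" using m n by auto
      have mN: "real_of_int m \<le> N"
      proof -
        have "c\<^sup>2 \<ge> 1" using c0 by (simp add: one_le_power)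
        then have "1 * m \<le> c\<^sup>2 * m" using m0 by (intro mult_right_mono) auto
        then have "m \<le> n" by (simp add: m)
        then show ?thesis by (simp add: N_def)
      qed
      have dm: "n div c\<^sup>2 = m" using m c0 by simp
      show "\<bar>\<Sum>y\<in>primitive (n div c\<^sup>2). h (of_int c * y)\<bar> \<le> C0 * N powr (1 - \<delta>) * l2norm h"
      proof (cases "p dvd c")
        case True
        then have "h (of_int c * y) = 0" for y by (intro h0 qdvd_of_int_dvd)
        then show ?thesis using C0 by simp
      next
        case False
        have "\<bar>\<Sum>y\<in>primitive m. h (of_int c * y)\<bar> \<le> C0 * of_int m powr (1 - \<delta>) * l2norm (\<lambda>y. h (of_int c * y))"
          by (rule S[OF cuspidal_scalar[OF h False] m0 mo])
        also have "l2norm (\<lambda>y. h (of_int c * y)) = l2norm h"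
          using False prime_p by (intro l2norm_shiftl cuspidal_periodic[OF h]) (simp add: prime_dvd_power_iff)
        also have "C0 * of_int m powr (1 - \<delta>) * l2norm h \<le> C0 * N powr (1 - \<delta>) * l2norm h"
          using C0 mN m0 by (intro mult_right_mono mult_left_mono powr_mono2) auto
        finally show ?thesis unfolding dm .
      qed
    qed
    also have "\<dots> = real (card I) * (C0 * N powr (1 - \<delta>) * l2norm h)" by simp
    also have "\<dots> \<le> (D * N powr (\<delta> / 2)) * (C0 * N powr (1 - \<delta>) * l2norm h)" using cI C0 by (intro mult_right_mono) auto
    also have "\<dots> = D * C0 * (N powr (\<delta> / 2) * N powr (1 - \<delta>)) * l2norm h" by (simp add: mult_ac)
    also have "N powr (\<delta> / 2) * N powr (1 - \<delta>) = N powr (1 - \<delta> / 2)" by (simp add: powr_add[symmetric])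
    finally show ?thesis by (simp add: N_def)
  qed
  then show thesis using that[of "D * C0" "\<delta> / 2"] D C0 by simp
qed

end

section \<open>Residue classes in dimension four\<close>

definition class_count :: "int \<Rightarrow> quat \<Rightarrow> int \<Rightarrow> nat" where
  "class_count p u n = card {x. nrm x = n \<and> qdvd p (x - u)}"

text \<open>Odd norms only, and constants that depend on the two classes: in this form it is an
  equivalence relation and can be chained freely. Uniformity is recovered from the finiteness of the
  residues.\<close>

definition equi :: "int \<Rightarrow> quat \<Rightarrow> quat \<Rightarrow> bool" where
  "equi p u v \<longleftrightarrow> (\<exists>C \<delta>. C > 0 \<and> \<delta> > 0 \<and> (\<forall>n>0. odd n \<longrightarrow>
     \<bar>real (class_count p u n) - real (class_count p v n)\<bar> \<le> C * of_int n powr (1 - \<delta>)))"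

lemma equi_eq: "(\<And>n. class_count p u n = class_count p v n) \<Longrightarrow> equi p u v"
  unfolding equi_def by (intro exI[of _ 1]) auto

lemma equi_sym: "equi p u v \<Longrightarrow> equi p v u"
  unfolding equi_def by (simp add: abs_minus_commute)

lemma equi_trans:
  assumes "equi p u v" "equi p v w"
  shows "equi p u w"
proof -
  obtain C1 d1 where 1: "C1 > 0" "d1 > 0" "\<forall>n>0. odd n \<longrightarrow> \<bar>real (class_count p u n) - real (class_count p v n)\<bar> \<le> C1 * of_int n powr (1 - d1)"
    using assms(1) unfolding equi_def by blast
  obtain C2 d2 where 2: "C2 > 0" "d2 > 0" "\<forall>n>0. odd n \<longrightarrow> \<bar>real (class_count p v n) - real (class_count p w n)\<bar> \<le> C2 * of_int n powr (1 - d2)"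
    using assms(2) unfolding equi_def by blast
  have "\<bar>real (class_count p u n) - real (class_count p w n)\<bar> \<le> (C1 + C2) * of_int n powr (1 - min d1 d2)" if n: "n > 0" "odd n" for n
  proof -
    have "of_int n powr (1 - d1) \<le> (of_int n :: real) powr (1 - min d1 d2)" "of_int n powr (1 - d2) \<le> (of_int n :: real) powr (1 - min d1 d2)"
      using n by (intro powr_mono; simp)+
    then have "C1 * of_int n powr (1 - d1) \<le> C1 * of_int n powr (1 - min d1 d2)" "C2 * of_int n powr (1 - d2) \<le> C2 * of_int n powr (1 - min d1 d2)"
      using 1 2 by (intro mult_left_mono; simp)+
    then show ?thesis using 1(3)[rule_format, OF n] 2(3)[rule_format, OF n] by (simp add: distrib_right)
  qed
  then show ?thesis unfolding equi_def using 1 2 by (intro exI[of _ "C1 + C2"] exI[of _ "min d1 d2"]) auto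
qed

lemma class_count_cong: "qdvd p (u - v) \<Longrightarrow> class_count p u n = class_count p v n"
proof -
  assume d: "qdvd p (u - v)"
  have "qdvd p (x - u) \<longleftrightarrow> qdvd p (x - v)" for x
    using qdvd_add[OF _ d, of "x - u"] qdvd_diff[OF _ d, of "x - v"] by (auto simp: algebra_simps)
  then show ?thesis by (simp add: class_count_def)
qed

lemma equi_cong: "equi p u v \<Longrightarrow> qdvd p (u - u') \<Longrightarrow> qdvd p (v - v') \<Longrightarrow> equi p u' v'"
  unfolding equi_def by (simp add: class_count_cong[of p u u'] class_count_cong[of p v v'])

lemma class_count_reindex:
  assumes "\<And>x. nrm (f x) = nrm x" "\<And>x. nrm (g x) = nrm x" "\<And>x. g (f x) = x" "\<And>x. f (g x) = x"
    "\<And>x. qdvd p (x - u) \<longleftrightarrow> qdvd p (f x - v)"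
  shows "class_count p u n = class_count p v n"
  unfolding class_count_def
proof (rule bij_betw_same_card[of f], rule bij_betw_byWitness[of _ g])
  show "g ` {x. nrm x = n \<and> qdvd p (x - v)} \<subseteq> {x. nrm x = n \<and> qdvd p (x - u)}"
    using assms(2,4,5) by auto
qed (use assms in auto)

lemma class_count_unit: "nrm e = 1 \<Longrightarrow> class_count p u n = class_count p (e * u) n"
proof (rule class_count_reindex[of "\<lambda>x. e * x" "\<lambda>x. qcnj e * x"])
  assume e: "nrm e = 1"
  fix x
  show "qdvd p (x - u) \<longleftrightarrow> qdvd p (e * x - e * u)"
  proof
    assume "qdvd p (x - u)"
    then show "qdvd p (e * x - e * u)" using qdvd_multl[of p "x - u" e] by (simp add: right_diff_distrib)
  next
    assume "qdvd p (e * x - e * u)"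
    then have "qdvd p (e * (x - u))" by (simp add: right_diff_distrib)
    then have "qdvd p (qcnj e * (e * (x - u)))" by (rule qdvd_multl)
    then show "qdvd p (x - u)" by (simp add: mult_cnj' e)
  qed
qed (auto simp: nrm_mult mult_cnj')

lemma class_count_cnj: "class_count p u n = class_count p (qcnj u) n"
proof (rule class_count_reindex[of qcnj qcnj])
  show "qdvd p (x - u) \<longleftrightarrow> qdvd p (qcnj x - qcnj u)" for x using qdvd_cnj[of p "x - u"] by simp
qed auto

lemma class_count_minus: "class_count p u n = class_count p (- u) n"
  using class_count_unit[of "-1" p u n] by simp

lemma not_qdvd_mult:
  assumes p: "prime p" and u: "\<not> qdvd p u" and a: "\<not> p dvd nrm a"
  shows "\<not> qdvd p (a * u)"
proof
  assume "qdvd p (a * u)"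
  then have "qdvd p (qcnj a * (a * u))" by (rule qdvd_multl)
  then have "qdvd p (of_int (nrm a) * u)" by (simp add: mult_cnj')
  then show False using u a p by (subst (asm) qdvd_of_int_coprime) (auto simp: prime_imp_coprime)
qed

context level
begin

text \<open>As \<open>l * u = qcnj a' * (a' * u)\<close>, both classes arise from
  \<open>a' * u\<close> by multiplication with a quaternion of norm \<open>l\<close>. No
  norm-invariant function separates them, so the difference of their indicators is cuspidal.\<close>

lemma equi_step:
  assumes a: "nrm a = l" "nrm a' = l" and u: "\<not> qdvd p u"
  shows "equi p (a * (a' * u)) (of_int l * u)"
proof -
  have pl: "\<not> p dvd l" using p_ndvd_l_pow[of 1] by simp
  define v where "v = a * (a' * u)"
  define w where "w = of_int l * u"
  have v0: "\<not> qdvd p v" unfolding v_def using not_qdvd_mult[OF prime_p] u a pl by metis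
  have w0: "\<not> qdvd p w" unfolding w_def using u coprime_p[OF pl] by (simp add: qdvd_of_int_coprime coprime_commute)
  define I :: "quat \<Rightarrow> quat \<Rightarrow> real" where "I t x = (if qdvd p (x - t) then 1 else 0)" for t x
  have I_periodic: "I t x = I t y" if "qdvd p (x - y)" for t x y
  proof -
    have "qdvd p (x - t) \<longleftrightarrow> qdvd p (y - t)"
      using qdvd_add[OF that, of "y - t"] qdvd_diff[OF _ that, of "x - t"] by (auto simp: algebra_simps)
    then show ?thesis by (simp add: I_def)
  qed
  define h where "h x = I v x - I w x" for x
  have hp: "periodic p h" unfolding periodic_def h_def using I_periodic by fastforce
  have ipI: "(\<Sum>x\<in>quat_residues p. I t x * f0 x) = f0 t" if f0: "periodic p f0" for t f0
  proof -
    have qm: "quat_mod p t \<in> quat_residues p" using p_gt_2 by (simp add: quat_mod_in_quat_residues)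
    have iff: "qdvd p (x - t) \<longleftrightarrow> x = quat_mod p t" if "x \<in> quat_residues p" for x
    proof
      assume "qdvd p (x - t)"
      then have "qdvd p (x - quat_mod p t)" using qdvd_add[OF _ qdvd_quat_mod[of p t], of "x - t"] by simp
      then show "x = quat_mod p t" using quat_residues_eq[OF that qm] by blast
    next
      assume "x = quat_mod p t"
      then show "qdvd p (x - t)" using qdvd_quat_mod[of p t] qdvd_diff_sym by blast
    qed
    have "(\<Sum>x\<in>quat_residues p. I t x * f0 x) = (\<Sum>x\<in>quat_residues p. if x = quat_mod p t then f0 x else 0)"
      by (intro sum.cong refl) (auto simp: I_def iff)
    also have "\<dots> = f0 (quat_mod p t)" using qm by (simp add: finite_quat_residues)
    also have "\<dots> = f0 t" using perD[OF f0 qdvd_quat_mod] by simp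
    finally show ?thesis .
  qed
  have "l2inner h f0 = 0" if f0: "norm_invariant f0" for f0
  proof -
    have "l2inner h f0 = f0 v - f0 w"
      using ipI[OF norm_invariant_periodic[OF f0]] by (simp add: l2inner_def h_def left_diff_distrib sum_subtractf)
    also have "f0 v = f0 (qcnj a' * (a' * u))" unfolding v_def by (rule norm_invariant_D[OF f0]) (use a in auto)
    finally show ?thesis by (simp add: mult_cnj' a w_def)
  qed
  then have hV: "h \<in> cuspidal" using hp by (simp add: cuspidal_def)
  have h0: "h x = 0" if "qdvd p x" for x
  proof -
    have "\<not> qdvd p (x - t)" if "\<not> qdvd p t" for t
      using qdvd_diff[OF \<open>qdvd p x\<close>, of "x - t"] that by auto
    then show ?thesis using v0 w0 by (simp add: h_def I_def)
  qed
  obtain C \<delta> where C: "C > 0" "\<delta> > 0" "\<delta> < 1"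
    and S: "\<And>h n. h \<in> cuspidal \<Longrightarrow> (\<And>x. qdvd p x \<Longrightarrow> h x = 0) \<Longrightarrow> n > 0 \<Longrightarrow> odd n \<Longrightarrow>
      \<bar>\<Sum>x\<in>{x. nrm x = n}. h x\<bar> \<le> C * of_int n powr (1 - \<delta>) * l2norm h"
    using sphere_sum_bound by blast
  have rcI: "(\<Sum>x\<in>{x. nrm x = n}. I t x) = real (class_count p t n)" for t n
  proof -
    have "(\<Sum>x\<in>{x. nrm x = n}. I t x) = real (card {x \<in> {x. nrm x = n}. qdvd p (x - t)})"
      unfolding I_def by (simp add: finite_nrm flip: sum.inter_filter)
    also have "{x \<in> {x. nrm x = n}. qdvd p (x - t)} = {x. nrm x = n \<and> qdvd p (x - t)}" by auto
    finally show ?thesis by (simp add: class_count_def)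
  qed
  have "\<bar>real (class_count p v n) - real (class_count p w n)\<bar> \<le> (C * l2norm h + 1) * of_int n powr (1 - \<delta>)" if n: "n > 0" "odd n" for n
  proof -
    have "(\<Sum>x\<in>{x. nrm x = n}. h x) = real (class_count p v n) - real (class_count p w n)"
      unfolding h_def by (simp add: sum_subtractf rcI)
    then have "\<bar>real (class_count p v n) - real (class_count p w n)\<bar> \<le> C * of_int n powr (1 - \<delta>) * l2norm h"
      using S[OF hV h0 n] by simp
    also have "\<dots> \<le> (C * l2norm h + 1) * of_int n powr (1 - \<delta>)" by (simp add: algebra_simps)
    finally show ?thesis .
  qed
  moreover have "C * l2norm h + 1 > 0" using C by (intro add_nonneg_pos) auto
  ultimately show ?thesis unfolding equi_def v_def[symmetric] w_def[symmetric] using C by blast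
qed

end

section \<open>Linking the nonzero classes of equal norm modulo \<open>p\<close>\<close>

context
  fixes p :: int
  assumes p: "prime p" and op: "odd p"
begin

interpretation P: odd_prime p by standard (use p op in auto)

text \<open>Here the auxiliary prime runs through the prime factors of \<open>c\<close>. If
  \<open>l\<close> divides \<open>w\<close>, it is cancelled; otherwise \<open>w\<close> begins with
  two factors of norm \<open>l\<close>, which \<open>equi_step\<close> trades for the scalar
  \<open>l\<close>.\<close>

lemma equi_norm_square:
  assumes "c > 0" "odd c" "\<not> p dvd c" "nrm w = c\<^sup>2" "\<not> qdvd p u"
  shows "equi p (w * u) (of_int c * u)"
  using assms
proof (induction "nat c" arbitrary: c w u rule: less_induct)
  case less
  show ?case
  proof (cases "c = 1")
    case True
    then show ?thesis using less.prems by (intro equi_eq) (simp add: class_count_unit[of w p u])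
  next
    case False
    then obtain l where l: "prime l" "l dvd c" using prime_divisor_exists[of c] less.prems(1) by auto
    obtain b where b: "c = l * b" using l(2) by (auto elim: dvdE)
    have l2: "l \<ge> 2" using prime_ge_2_int[OF l(1)] .
    have b0: "b > 0" using b less.prems(1) l2 by (simp add: zero_less_mult_iff)
    have bc: "b < c" using b b0 l2 by (simp add: mult_less_cancel_right1)
    have ob: "odd b" "odd l" "\<not> p dvd b" "\<not> p dvd l" using b less.prems by auto
    interpret odd_prime l by standard (use l ob in auto)
    interpret level l p by standard (use p op ob in auto)
    have nbc: "nat b < nat c" using bc b0 by simp
    have lu: "\<not> qdvd p (of_int l * u)" using less.prems(5) coprime_p[OF ob(4)] by (simp add: qdvd_of_int_coprime coprime_commute)
    have cu: "of_int b * (of_int l * u) = of_int c * u" unfolding b by (simp add: quat_eq_iff)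
    show ?thesis
    proof (cases "qdvd l w")
      case True
      then obtain w1 where w1: "w = of_int l * w1" by (rule qdvdE)
      have "l\<^sup>2 * nrm w1 = l\<^sup>2 * b\<^sup>2" using less.prems(4) w1 b by (simp add: nrm_mult power_mult_distrib)
      then have "nrm w1 = b\<^sup>2" using l2 by simp
      from less.hyps[OF nbc b0 ob(1,3) this lu] have "equi p (w1 * (of_int l * u)) (of_int c * u)" unfolding cu .
      moreover have "w1 * (of_int l * u) = w * u" unfolding w1 by (simp only: of_int_mid mult.assoc)
      ultimately show ?thesis by simp
    next
      case False
      have "l dvd nrm w" using less.prems(4) b by (simp add: power2_eq_square)
      then have "card (left_factors l w) = 8" using card_left_factors_l[of 1 w] False by simp
      then have "left_factors l w \<noteq> {}" by auto
      then obtain a w1 where a: "nrm a = l" "w = a * w1" by (auto simp: left_factors_def)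
      have nw1: "nrm w1 = l * b\<^sup>2" using less.prems(4) a b l2 by (simp add: nrm_mult power2_eq_square)
      have "\<not> qdvd l w1" using False a qdvd_multl by auto
      then have "card (left_factors l w1) = 8" using card_left_factors_l[of 1 w1] nw1 by simp
      then have "left_factors l w1 \<noteq> {}" by auto
      then obtain a' w2 where a': "nrm a' = l" "w1 = a' * w2" by (auto simp: left_factors_def)
      have nw2: "nrm w2 = b\<^sup>2" using nw1 a' l2 by (simp add: nrm_mult)
      have w2u: "\<not> qdvd p (w2 * u)" using not_qdvd_mult[OF p less.prems(5)] nw2 ob(3) p by (simp add: prime_dvd_power_iff)
      have "equi p (a * (a' * (w2 * u))) (of_int l * (w2 * u))" by (rule equi_step[OF a(1) a'(1) w2u])
      moreover have "of_int l * (w2 * u) = w2 * (of_int l * u)" by (simp only: of_int_mid)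
      moreover have "equi p (w2 * (of_int l * u)) (of_int c * u)"
        using less.hyps[OF nbc b0 ob(1,3) nw2 lu] unfolding cu .
      ultimately show ?thesis using equi_trans a a' by (simp add: mult.assoc)
    qed
  qed
qed

text \<open>For \<open>nrm g\<close> congruent to 1, the square of \<open>1 + g\<close> is congruent
  to \<open>(2 + tr g) * g\<close> and its norm to the square of \<open>2 + tr g\<close>. So
  \<open>g\<close> is, up to a scalar, the square of an integral \<open>\<gamma>\<close>, and
  \<open>equi_norm_square\<close> applies to \<open>\<gamma> * \<gamma>\<close> with
  \<open>c = nrm \<gamma>\<close>.\<close>

lemma equi_mult_left_aux:
  assumes g: "p dvd nrm g - 1" and u: "\<not> qdvd p u" and t: "\<not> p dvd 2 + tr g"
  shows "equi p (g * u) u"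
proof -
  \<comment> \<open>Adding \<open>p\<close> keeps the class modulo \<open>p\<close> and changes the
    parity of the norm.\<close>
  define \<gamma> where "\<gamma> = (if odd (nrm (1 + g)) then 1 + g else 1 + g + of_int p)"
  have pg: "qdvd p (\<gamma> - (1 + g))" using qdvd_triv[of p 1] by (simp add: \<gamma>_def)
  have og: "odd (nrm \<gamma>)"
  proof (cases "odd (nrm (1 + g))")
    case False
    have "nrm (1 + g + of_int p) = nrm (1 + g) + (2 * (p * (1 + q0 g)) + p * p)"
      by (simp add: nrm_def power2_eq_square algebra_simps)
    then show ?thesis using False op by (simp add: \<gamma>_def)
  qed (simp add: \<gamma>_def)
  define c where "c = nrm \<gamma>"
  have "nrm \<gamma> \<noteq> 0" using og by (metis even_zero)
  then have c: "c > 0" "odd c" using og nrm_ge_0[of \<gamma>] unfolding c_def by linarith+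
  obtain z where z: "\<gamma> = 1 + g + of_int p * z"
    using pg by (auto simp: qdvd_iff algebra_simps)
  have ceq: "p dvd c - (2 + tr g)"
  proof -
    have "c = nrm (1 + g) + p * (tr ((1 + g) * qcnj z) + p * nrm z)"
      unfolding c_def z by (simp add: nrm_def tr_def power2_eq_square algebra_simps)
    moreover have "nrm (1 + g) = 2 + tr g + (nrm g - 1)" by (simp add: nrm_def tr_def power2_eq_square algebra_simps)
    ultimately have "c - (2 + tr g) = (nrm g - 1) + p * (tr ((1 + g) * qcnj z) + p * nrm z)" by simp
    then show ?thesis using g by (simp only: dvd_add dvd_triv_left)
  qed
  have pc: "\<not> p dvd c"
  proof
    assume "p dvd c"
    then have "p dvd c - (c - (2 + tr g))" using ceq by (rule dvd_diff)
    then show False using t by simp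
  qed
  obtain c' k where c': "c' * c = 1 + p * k" using inverse_mod[OF P.coprime_l[OF pc]] by metis
  have pc': "\<not> p dvd c'"
  proof
    assume "p dvd c'"
    then have "p dvd c' * c - p * k" by simp
    then show False using c' P.l_gt_2 by simp
  qed
  define u' where "u' = of_int c' * u"
  have u': "\<not> qdvd p u'" unfolding u'_def using u P.coprime_l[OF pc'] by (simp add: qdvd_of_int_coprime coprime_commute)
  have "equi p (\<gamma> * \<gamma> * u') (of_int c * u')"
    by (rule equi_norm_square[OF c pc _ u']) (simp add: nrm_mult c_def power2_eq_square)
  moreover have "qdvd p (of_int c * u' - u)"
  proof -
    have "of_int c * u' - u = of_int (c' * c - 1) * u" unfolding u'_def by (simp add: quat_eq_iff algebra_simps)
    moreover have "p dvd c' * c - 1" using c' by simp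
    ultimately show ?thesis by (simp only: qdvd_of_int_dvd)
  qed
  moreover have "qdvd p (\<gamma> * \<gamma> * u' - g * u)"
  proof -
    have 1: "qdvd p (\<gamma> * \<gamma> - of_int c * g)"
    proof -
      have "\<gamma> * \<gamma> - of_int c * g = (\<gamma> * \<gamma> - (1 + g) * (1 + g)) + ((1 + g) * (1 + g) - of_int c * g)" by simp
      moreover have "\<gamma> * \<gamma> - (1 + g) * (1 + g) = \<gamma> * (\<gamma> - (1 + g)) + (\<gamma> - (1 + g)) * (1 + g)" by (simp add: algebra_simps)
      then have "qdvd p (\<gamma> * \<gamma> - (1 + g) * (1 + g))" using pg by (metis qdvd_add qdvd_multl qdvd_multr)
      moreover have "(1 + g) * (1 + g) - of_int c * g = - (of_int (c - (2 + tr g)) * g) - of_int (nrm g - 1) * 1"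
        by (simp add: quat_eq_iff tr_def nrm_def power2_eq_square algebra_simps)
      then have "qdvd p ((1 + g) * (1 + g) - of_int c * g)"
        using qdvd_of_int_dvd[OF ceq, of g] qdvd_of_int_dvd[OF g, of 1] by (simp only: qdvd_diff qdvd_minus)
      ultimately show ?thesis using qdvd_add by metis
    qed
    have "\<gamma> * \<gamma> * u' - g * u = (\<gamma> * \<gamma> - of_int c * g) * u' + g * (of_int c * u' - u)"
      by (simp add: left_diff_distrib right_diff_distrib mult.assoc of_int_mid)
    then show ?thesis using qdvd_add[OF qdvd_multr[OF 1] qdvd_multl[OF \<open>qdvd p (of_int c * u' - u)\<close>]] by metis
  qed
  ultimately show ?thesis using equi_cong by blast
qed

text \<open>\<open>2 + tr g\<close> and \<open>2 + tr (- g)\<close> add up to 4, so at least one of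
  them is a unit modulo \<open>p\<close>; the sign of \<open>g\<close> does not matter by
  \<open>class_count_minus\<close>.\<close>

lemma equi_mult_left:
  assumes g: "p dvd nrm g - 1" and u: "\<not> qdvd p u"
  shows "equi p (g * u) u"
proof (cases "p dvd 2 + tr g")
  case False
  then show ?thesis using equi_mult_left_aux[OF g u] by blast
next
  case True
  have "\<not> p dvd 2 + tr (- g)"
  proof
    assume "p dvd 2 + tr (- g)"
    then have "p dvd (2 + tr g) + (2 + tr (- g))" using True by (rule dvd_add[rotated])
    then have "p dvd 4" by (simp add: tr_def)
    then have "p dvd 2 * 2" by simp
    then have "p dvd 2" using p prime_dvd_mult_iff by blast
    then show False using P.l_gt_2 zdvd_imp_le[of p 2] by simp
  qed
  then have "equi p (- g * u) u" using equi_mult_left_aux[of "- g" u] g u by simp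
  moreover have "equi p (g * u) (- g * u)" by (rule equi_eq) (simp add: class_count_minus[of p "g * u"])
  ultimately show ?thesis using equi_trans by blast
qed

lemma equi_mult_right:
  assumes g: "p dvd nrm g - 1" and u: "\<not> qdvd p u"
  shows "equi p (u * g) u"
proof -
  have "equi p (qcnj g * qcnj u) (qcnj u)" by (rule equi_mult_left) (use g u in auto)
  moreover have "equi p (u * g) (qcnj g * qcnj u)" by (rule equi_eq) (simp add: class_count_cnj[of p "u * g"] cnj_mult)
  moreover have "equi p (qcnj u) u" by (rule equi_eq) (simp add: class_count_cnj[of p u])
  ultimately show ?thesis using equi_trans by blast
qed

text \<open>If the norm is a unit, the quotient of \<open>v\<close> by \<open>u\<close> has norm 1
  modulo \<open>p\<close>. Isotropic classes have no quotient; they are both linked to a nonzero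
  \<open>z = u * \<kappa> * v\<close>, which arises from \<open>u\<close> by a right and from
  \<open>v\<close> by a left multiplication of norm 1.\<close>

lemma equi_all:
  assumes u: "\<not> qdvd p u" and v: "\<not> qdvd p v" and n: "p dvd nrm u - nrm v"
  shows "equi p u v"
proof (cases "p dvd nrm u")
  case False
  obtain c' k where c': "c' * nrm u = 1 + p * k" using inverse_mod[OF P.coprime_l[OF False]] by metis
  define g where "g = of_int c' * (v * qcnj u)"
  have 1: "p dvd nrm g - 1"
  proof -
    have "nrm g - 1 = (c' * nrm u)\<^sup>2 - 1 - (c'\<^sup>2 * nrm u) * (nrm u - nrm v)"
      by (simp add: g_def nrm_mult power2_eq_square algebra_simps)
    moreover have "(c' * nrm u)\<^sup>2 - 1 = p * (2 * k + p * k\<^sup>2)" unfolding c' by (simp add: power2_eq_square algebra_simps)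
    ultimately show ?thesis using n by simp
  qed
  have "g * u = of_int c' * (v * (qcnj u * u))" by (simp add: g_def mult.assoc)
  also have "\<dots> = of_int (c' * nrm u) * v" by (simp add: mult_cnj quat_eq_iff)
  finally have "g * u - v = of_int (c' * nrm u - 1) * v" by (simp add: left_diff_distrib)
  moreover have "p dvd c' * nrm u - 1" using c' by simp
  ultimately have "qdvd p (g * u - v)" by (simp only: qdvd_of_int_dvd)
  then have "equi p v u" using equi_cong[OF equi_mult_left[OF 1 u], of v u] by simp
  then show ?thesis by (rule equi_sym)
next
  case True
  have pv: "p dvd nrm v"
  proof -
    have "p dvd nrm u - (nrm u - nrm v)" using True n by (rule dvd_diff)
    then show ?thesis by simp
  qed
  obtain \<kappa> where \<kappa>: "\<not> qdvd p (u * \<kappa> * v)" using quat_prime[OF p op u v] by blast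
  define z where "z = u * \<kappa> * v"
  have z: "\<not> qdvd p z" using \<kappa> by (simp add: z_def)
  obtain g where g: "\<not> p dvd tr (z * g)" using tr_witness[OF p op z] by blast
  obtain s k where s: "s * tr (z * g) = 1 + p * k" using inverse_mod[OF P.coprime_l[OF g]] by metis
  define t where "t = of_int s * qcnj g"
  have trt: "tr (z * qcnj t) = 1 + p * k"
    using s by (simp add: t_def cnj_mult of_int_comm) (simp add: tr_def algebra_simps)
  obtain a where a: "nrm u = p * a" using True by (auto elim: dvdE)
  obtain b where b: "nrm v = p * b" using pv by (auto elim: dvdE)
  have nadd: "nrm (x + y) = nrm x + tr (x * qcnj y) + nrm y" for x y
    by (simp add: nrm_def tr_def power2_eq_square algebra_simps)
  have "equi p z u"
  proof -
    \<comment> \<open>The term \<open>qcnj u * t\<close> does not change \<open>u * h\<close> modulo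
      \<open>p\<close>, because \<open>p\<close> divides \<open>nrm u\<close>. It only adjusts the
      norm of \<open>h\<close>: the cross term is \<open>tr (z * qcnj t)\<close>, which
      \<open>t\<close> was chosen to make 1.\<close>
    define h where "h = \<kappa> * v + qcnj u * t"
    have "tr (\<kappa> * v * qcnj (qcnj u * t)) = tr (z * qcnj t)"
    proof -
      have "tr (\<kappa> * v * qcnj (qcnj u * t)) = tr ((\<kappa> * v * qcnj t) * u)" by (simp add: cnj_mult mult.assoc)
      also have "\<dots> = tr (u * (\<kappa> * v * qcnj t))" by (rule tr_comm)
      finally show ?thesis by (simp add: z_def mult.assoc)
    qed
    then have "nrm h - 1 = p * (nrm \<kappa> * b + k + a * nrm t)"
      unfolding h_def nadd trt by (simp add: nrm_mult a b trt algebra_simps)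
    then have "equi p (u * h) u" by (intro equi_mult_right u) simp
    moreover have "qdvd p (u * h - z)"
    proof -
      have "u * h - z = of_int (p * a) * t"
        by (simp add: h_def z_def distrib_left mult.assoc mult_cnj' a)
      then show ?thesis by (simp only: qdvd_of_int_dvd dvd_triv_left)
    qed
    ultimately show ?thesis using equi_cong[of p "u * h" u z u] by simp
  qed
  moreover have "equi p z v"
  proof -
    define h where "h = u * \<kappa> + t * qcnj v"
    have "tr (u * \<kappa> * qcnj (t * qcnj v)) = tr (z * qcnj t)" by (simp add: cnj_mult z_def mult.assoc)
    then have "nrm h - 1 = p * (nrm \<kappa> * a + k + b * nrm t)"
      unfolding h_def nadd by (simp add: nrm_mult a b trt algebra_simps)
    then have "equi p (h * v) v" by (intro equi_mult_left v) simp
    moreover have "qdvd p (h * v - z)"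
    proof -
      have "h * v - z = of_int (p * b) * t"
        by (simp add: h_def z_def distrib_right mult.assoc mult_cnj b of_int_comm del: of_int_mult)
      then show ?thesis by (simp only: qdvd_of_int_dvd dvd_triv_left)
    qed
    ultimately show ?thesis using equi_cong[of p "h * v" v z v] by simp
  qed
  ultimately show ?thesis using equi_sym equi_trans by blast
qed

lemma uniform_constants:
  fixes P :: "'a \<Rightarrow> int \<Rightarrow> real"
  assumes "finite A" "\<And>a. a \<in> A \<Longrightarrow> \<exists>C \<delta>. C > 0 \<and> \<delta> > 0 \<and> (\<forall>n>0. Q n \<longrightarrow> P a n \<le> C * of_int n powr (1 - \<delta>))"
  shows "\<exists>C \<delta>. C > 0 \<and> \<delta> > 0 \<and> \<delta> < 1 \<and> (\<forall>a\<in>A. \<forall>n>0. Q n \<longrightarrow> P a n \<le> C * of_int n powr (1 - \<delta>))"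
  using assms
proof (induction A rule: finite_induct)
  case empty
  show ?case by (intro exI[of _ 1] exI[of _ "1/2"]) auto
next
  case (insert a A)
  obtain C1 d1 where 1: "C1 > 0" "d1 > 0" "d1 < 1" "\<forall>a\<in>A. \<forall>n>0. Q n \<longrightarrow> P a n \<le> C1 * of_int n powr (1 - d1)"
    using insert.IH insert.prems by auto
  obtain C2 d2 where 2: "C2 > 0" "d2 > 0" "\<forall>n>0. Q n \<longrightarrow> P a n \<le> C2 * of_int n powr (1 - d2)"
    using insert.prems by blast
  define C where "C = max C1 C2"
  define d where "d = min d1 d2"
  have mono: "C' * of_int n powr (1 - d') \<le> C * of_int n powr (1 - d)" if "C' \<le> C" "d \<le> d'" "n > 0" for C' d' and n :: int
    using that 1 by (intro mult_mono powr_mono) (auto simp: C_def)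
  have "P b n \<le> C * of_int n powr (1 - d)" if "b \<in> insert a A" "n > 0" "Q n" for b n
  proof (cases "b = a")
    case True
    then show ?thesis using 2(3) that mono[of C2 d2 n] by (fastforce simp: C_def d_def)
  next
    case False
    then show ?thesis using 1(4) that mono[of C1 d1 n] by (fastforce simp: C_def d_def)
  qed
  moreover have "C > 0" "d > 0" "d < 1" using 1 2 by (auto simp: C_def d_def)
  ultimately show ?case by blast
qed

lemma equi_uniform_odd:
  obtains C \<delta> where "C > 0" "\<delta> > 0" "\<delta> < 1"
    "\<And>u v n. \<not> qdvd p u \<Longrightarrow> \<not> qdvd p v \<Longrightarrow> p dvd nrm u - nrm v \<Longrightarrow> n > 0 \<Longrightarrow> odd n \<Longrightarrow>
      \<bar>real (class_count p u n) - real (class_count p v n)\<bar> \<le> C * of_int n powr (1 - \<delta>)"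
proof -
  define A where "A = {(u, v) \<in> quat_residues p \<times> quat_residues p. \<not> qdvd p u \<and> \<not> qdvd p v \<and> p dvd nrm u - nrm v}"
  have fA: "finite A" by (rule finite_subset[of _ "quat_residues p \<times> quat_residues p"]) (auto simp: A_def finite_quat_residues)
  have "\<exists>C \<delta>. C > 0 \<and> \<delta> > 0 \<and> \<delta> < 1 \<and> (\<forall>a\<in>A. \<forall>n>0. odd n \<longrightarrow>
     \<bar>real (class_count p (fst a) n) - real (class_count p (snd a) n)\<bar> \<le> C * of_int n powr (1 - \<delta>))"
  proof (rule uniform_constants[OF fA])
    fix a assume "a \<in> A"
    then have "equi p (fst a) (snd a)" by (intro equi_all) (auto simp: A_def)
    then show "\<exists>C \<delta>. C > 0 \<and> \<delta> > 0 \<and> (\<forall>n>0. odd n \<longrightarrow> \<bar>real (class_count p (fst a) n) - real (class_count p (snd a) n)\<bar> \<le> C * of_int n powr (1 - \<delta>))"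
      unfolding equi_def .
  qed
  then obtain C \<delta> where C: "C > 0" "\<delta> > 0" "\<delta> < 1"
    and b: "\<forall>a\<in>A. \<forall>n>0. odd n \<longrightarrow> \<bar>real (class_count p (fst a) n) - real (class_count p (snd a) n)\<bar> \<le> C * of_int n powr (1 - \<delta>)" by blast
  have l2norm: "p dvd nrm (quat_mod p x) - nrm x" for x
  proof -
    have "p dvd (a mod p)\<^sup>2 - a\<^sup>2" for a by (metis mod_eq_dvd_iff power_mod)
    from dvd_add[OF dvd_add[OF this[of "q0 x"] this[of "q1 x"]] dvd_add[OF this[of "q2 x"] this[of "q3 x"]]]
    show ?thesis by (simp add: nrm_def quat_mod_def algebra_simps)
  qed
  have nq: "qdvd p (quat_mod p x) \<longleftrightarrow> qdvd p x" for x by (simp add: qdvd_def quat_mod_def dvd_eq_mod_eq_0)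
  have "\<bar>real (class_count p u n) - real (class_count p v n)\<bar> \<le> C * of_int n powr (1 - \<delta>)"
    if u: "\<not> qdvd p u" "\<not> qdvd p v" "p dvd nrm u - nrm v" and n: "n > 0" "odd n" for u v n
  proof -
    have "p dvd (nrm (quat_mod p u) - nrm u) + (nrm u - nrm v) - (nrm (quat_mod p v) - nrm v)"
      by (rule dvd_diff[OF dvd_add[OF l2norm u(3)] l2norm])
    then have "(quat_mod p u, quat_mod p v) \<in> A" using u nq P.l_gt_2 by (simp add: A_def quat_mod_in_quat_residues)
    then have "\<bar>real (class_count p (quat_mod p u) n) - real (class_count p (quat_mod p v) n)\<bar> \<le> C * of_int n powr (1 - \<delta>)" using b n by fastforce
    then show ?thesis using class_count_cong[OF qdvd_quat_mod] by simp
  qed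
  then show thesis using that[OF C] by blast
qed

section \<open>Even norms: division by a quaternion of norm 2\<close>

definition half_mod :: int where "half_mod = (p + 1) div 2"

lemma half_mod: "2 * half_mod = p + 1"
  using op by (auto simp: half_mod_def elim: oddE)

lemma half_mod_ndvd: "\<not> p dvd half_mod"
proof
  assume "p dvd half_mod"
  then have "p dvd 2 * half_mod - p" by (intro dvd_diff dvd_mult) auto
  then show False using half_mod P.l_gt_2 by simp
qed

lemma half_iff:
  assumes e: "nrm e = 2" and x: "x = e * y"
  shows "qdvd p (x - u) \<longleftrightarrow> qdvd p (y - of_int half_mod * (qcnj e * u))"
proof -
  have c2: "coprime p 2" using op by simp
  have y: "of_int 2 * y = qcnj e * x" by (simp add: x mult_cnj' e)
  have "of_int 2 * (y - of_int half_mod * (qcnj e * u)) = qcnj e * (x - u) - of_int p * (qcnj e * u)"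
  proof -
    have "of_int 2 * (of_int half_mod * (qcnj e * u)) = of_int (2 * half_mod) * (qcnj e * u)" by (simp only: of_int_mult mult.assoc)
    also have "\<dots> = of_int p * (qcnj e * u) + qcnj e * u" unfolding half_mod by (simp add: distrib_right)
    finally show ?thesis unfolding right_diff_distrib y by simp
  qed
  then have "qdvd p (y - of_int half_mod * (qcnj e * u)) \<longleftrightarrow> qdvd p (qcnj e * (x - u))"
    using qdvd_of_int_coprime[OF c2] qdvd_diff_triv by metis
  also have "\<dots> \<longleftrightarrow> qdvd p (x - u)"
  proof
    assume "qdvd p (qcnj e * (x - u))"
    then have "qdvd p (e * (qcnj e * (x - u)))" by (rule qdvd_multl)
    then have "qdvd p (of_int 2 * (x - u))" by (simp add: mult_cnj' e)
    then show "qdvd p (x - u)" using qdvd_of_int_coprime[OF c2] by blast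
  qed (rule qdvd_multl)
  finally show ?thesis by simp
qed

lemma card_half:
  assumes e: "nrm e = 2"
  shows "card {x. nrm x = 2 * n \<and> qdvd 2 (qcnj e * x) \<and> qdvd p (x - u)} = class_count p (of_int half_mod * (qcnj e * u)) n"
  unfolding class_count_def
proof (rule bij_betw_same_card[symmetric, of "\<lambda>y. e * y"], rule bij_betw_imageI)
  have e0: "e \<noteq> 0" using e by auto
  show "inj_on (\<lambda>y. e * y) {x. nrm x = n \<and> qdvd p (x - of_int half_mod * (qcnj e * u))}"
    using e0 by (auto simp: inj_on_def quat_cancel_left)
  show "(\<lambda>y. e * y) ` {x. nrm x = n \<and> qdvd p (x - of_int half_mod * (qcnj e * u))} = {x. nrm x = 2 * n \<and> qdvd 2 (qcnj e * x) \<and> qdvd p (x - u)}"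
  proof (intro Set.set_eqI iffI)
    fix x assume "x \<in> (\<lambda>y. e * y) ` {x. nrm x = n \<and> qdvd p (x - of_int half_mod * (qcnj e * u))}"
    then obtain y where y: "x = e * y" "nrm y = n" "qdvd p (y - of_int half_mod * (qcnj e * u))" by blast
    have "qcnj e * x = of_int 2 * y" by (simp add: y mult_cnj' e)
    then have "qdvd 2 (qcnj e * x)" by (simp only: qdvd_triv)
    then show "x \<in> {x. nrm x = 2 * n \<and> qdvd 2 (qcnj e * x) \<and> qdvd p (x - u)}"
      using half_iff[OF e y(1)] y e by (simp add: nrm_mult)
  next
    fix x assume "x \<in> {x. nrm x = 2 * n \<and> qdvd 2 (qcnj e * x) \<and> qdvd p (x - u)}"
    then have x: "nrm x = 2 * n" "qdvd 2 (qcnj e * x)" "qdvd p (x - u)" by auto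
    obtain y where y: "qcnj e * x = of_int 2 * y" using x(2) by (rule qdvdE)
    have "of_int 2 * x = e * (qcnj e * x)" by (simp only: mult_cnj' e)
    also have "\<dots> = of_int 2 * (e * y)" unfolding y by (rule of_int_mid)
    finally have xy: "x = e * y" by (subst (asm) of_int_cancel) auto
    then have "nrm y = n" using x(1) e by (simp add: nrm_mult)
    then show "x \<in> (\<lambda>y. e * y) ` {x. nrm x = n \<and> qdvd p (x - of_int half_mod * (qcnj e * u))}"
      using xy half_iff[OF e xy] x by blast
  qed
qed

abbreviation "e1 \<equiv> Quat 1 1 0 0"
abbreviation "e2 \<equiv> Quat 1 0 1 0"
abbreviation "e3 \<equiv> Quat 1 0 0 1"

lemma nrm_e: "nrm e1 = 2" "nrm e2 = 2" "nrm e3 = 2"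
  by (simp_all add: nrm_def)

lemma mod4_square: "(a::int)\<^sup>2 mod 4 = (if even a then 0 else 1)"
proof (cases "even a")
  case True
  then obtain b where "a = 2 * b" ..
  then show ?thesis by (simp add: power2_eq_square)
next
  case False
  then obtain b where "a = 2 * b + 1" by (rule oddE)
  then have "a\<^sup>2 = 4 * (b\<^sup>2 + b) + 1" by (simp add: power2_eq_square algebra_simps)
  then show ?thesis using False mod_mult_self4[of 4 "b\<^sup>2 + b" 1] by simp
qed

lemma qdvd_2_iff:
  "qdvd 2 (qcnj e1 * x) \<longleftrightarrow> even (q0 x + q1 x) \<and> even (q2 x + q3 x)"
  "qdvd 2 (qcnj e2 * x) \<longleftrightarrow> even (q0 x + q2 x) \<and> even (q1 x + q3 x)"
  "qdvd 2 (qcnj e3 * x) \<longleftrightarrow> even (q0 x + q3 x) \<and> even (q1 x + q2 x)"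
  by (auto simp: qdvd_def)

lemma nrm_mod4: "nrm x mod 4 = (of_bool (odd (q0 x)) + of_bool (odd (q1 x)) + of_bool (odd (q2 x)) + of_bool (odd (q3 x))) mod 4"
proof -
  have s: "a\<^sup>2 mod 4 = of_bool (odd a)" for a :: int using mod4_square[of a] by auto
  have "nrm x mod 4 = ((q0 x)\<^sup>2 mod 4 + (q1 x)\<^sup>2 mod 4 + (q2 x)\<^sup>2 mod 4 + (q3 x)\<^sup>2 mod 4) mod 4"
    unfolding nrm_def by (intro mod_add_cong) simp_all
  then show ?thesis by (simp only: s)
qed

text \<open>When 4 divides the norm, all coordinates have the same parity; so every vector is
  left-divisible by \<open>e1\<close>, and nothing is counted twice.\<close>

lemma class_count_four_dvd:
  assumes "even n"
  shows "class_count p u (2 * n) = class_count p (of_int half_mod * (qcnj e1 * u)) n"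
proof -
  have "{x. nrm x = 2 * n \<and> qdvd p (x - u)} = {x. nrm x = 2 * n \<and> qdvd 2 (qcnj e1 * x) \<and> qdvd p (x - u)}"
  proof -
    have "qdvd 2 (qcnj e1 * x)" if "nrm x = 2 * n" for x
    proof -
      have "nrm x mod 4 = 0" using that assms by auto
      then show ?thesis unfolding nrm_mod4 qdvd_2_iff
        by (cases "even (q0 x)"; cases "even (q1 x)"; cases "even (q2 x)"; cases "even (q3 x)") auto
    qed
    then show ?thesis by blast
  qed
  then show ?thesis using card_half[OF nrm_e(1), of n u] by (simp add: class_count_def)
qed

text \<open>A norm that is 2 modulo 4 has exactly two odd coordinates, and exactly one of the three
  pairings puts them together. The three left divisibilities are therefore exclusive and
  exhaustive.\<close>

lemma class_count_two_mod_four: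
  assumes "odd n"
  shows "class_count p u (2 * n) = class_count p (of_int half_mod * (qcnj e1 * u)) n + class_count p (of_int half_mod * (qcnj e2 * u)) n + class_count p (of_int half_mod * (qcnj e3 * u)) n"
proof -
  define S where "S e = {x. nrm x = 2 * n \<and> qdvd 2 (qcnj e * x) \<and> qdvd p (x - u)}" for e
  have fin: "finite (S e)" for e by (rule finite_subset[OF _ finite_nrm[of "2 * n"]]) (auto simp: S_def)
  have m4: "nrm x mod 4 = 2" if "nrm x = 2 * n" for x using that assms by (auto elim!: oddE)
  have cov: "qdvd 2 (qcnj e1 * x) \<or> qdvd 2 (qcnj e2 * x) \<or> qdvd 2 (qcnj e3 * x)" if "nrm x = 2 * n" for x
    using m4[OF that] unfolding nrm_mod4 qdvd_2_iff
    by (cases "even (q0 x)"; cases "even (q1 x)"; cases "even (q2 x)"; cases "even (q3 x)") auto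
  have dis: "\<not> (qdvd 2 (qcnj e1 * x) \<and> qdvd 2 (qcnj e2 * x))" "\<not> (qdvd 2 (qcnj e1 * x) \<and> qdvd 2 (qcnj e3 * x))"
    "\<not> (qdvd 2 (qcnj e2 * x) \<and> qdvd 2 (qcnj e3 * x))" if "nrm x = 2 * n" for x
    using m4[OF that] unfolding nrm_mod4 qdvd_2_iff
    by (cases "even (q0 x)"; cases "even (q1 x)"; cases "even (q2 x)"; cases "even (q3 x)"; auto)+
  have "{x. nrm x = 2 * n \<and> qdvd p (x - u)} = S e1 \<union> S e2 \<union> S e3" using cov by (auto simp: S_def)
  then have "class_count p u (2 * n) = card (S e1 \<union> S e2 \<union> S e3)" by (simp add: class_count_def)
  also have "\<dots> = card (S e1 \<union> S e2) + card (S e3)"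
    using dis fin by (intro card_Un_disjoint) (auto simp: S_def)
  also have "card (S e1 \<union> S e2) = card (S e1) + card (S e2)"
    using dis fin by (intro card_Un_disjoint) (auto simp: S_def)
  finally show ?thesis unfolding S_def card_half[OF nrm_e(1)] card_half[OF nrm_e(2)] card_half[OF nrm_e(3)] .
qed

lemma half_class:
  assumes e: "nrm e = 2" and u: "\<not> qdvd p u" "\<not> qdvd p v" "p dvd nrm u - nrm v"
  shows "\<not> qdvd p (of_int half_mod * (qcnj e * u))" "\<not> qdvd p (of_int half_mod * (qcnj e * v))"
    "p dvd nrm (of_int half_mod * (qcnj e * u)) - nrm (of_int half_mod * (qcnj e * v))"
proof -
  have "\<not> p dvd 2" using P.l_gt_2 zdvd_imp_le[of p 2] by auto
  then have "\<not> qdvd p (qcnj e * x)" if "\<not> qdvd p x" for x using not_qdvd_mult[OF p that, of "qcnj e"] e by simp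
  then show "\<not> qdvd p (of_int half_mod * (qcnj e * u))" "\<not> qdvd p (of_int half_mod * (qcnj e * v))"
    using u P.coprime_l[OF half_mod_ndvd] by (simp_all add: qdvd_of_int_coprime coprime_commute)
  have "nrm (of_int half_mod * (qcnj e * u)) - nrm (of_int half_mod * (qcnj e * v)) = (half_mod\<^sup>2 * 2) * (nrm u - nrm v)"
    by (simp add: nrm_mult e algebra_simps)
  then show "p dvd nrm (of_int half_mod * (qcnj e * u)) - nrm (of_int half_mod * (qcnj e * v))" using u(3) by simp
qed

lemma equi_uniform:
  obtains C \<delta> where "C > 0" "\<delta> > 0" "\<delta> < 1"
    "\<And>u v n. \<not> qdvd p u \<Longrightarrow> \<not> qdvd p v \<Longrightarrow> p dvd nrm u - nrm v \<Longrightarrow> n > 0 \<Longrightarrow>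
      \<bar>real (class_count p u n) - real (class_count p v n)\<bar> \<le> C * of_int n powr (1 - \<delta>)"
proof -
  obtain C \<delta> where C: "C > 0" "\<delta> > 0" "\<delta> < 1"
    and O: "\<And>u v n. \<not> qdvd p u \<Longrightarrow> \<not> qdvd p v \<Longrightarrow> p dvd nrm u - nrm v \<Longrightarrow> n > 0 \<Longrightarrow> odd n \<Longrightarrow>
      \<bar>real (class_count p u n) - real (class_count p v n)\<bar> \<le> C * of_int n powr (1 - \<delta>)"
    using equi_uniform_odd by blast
  \<comment> \<open>The factor 3 enters only in the passage from an odd number to its double, which
    happens once; further doublings use \<open>class_count_four_dvd\<close> and keep the
    constant.\<close>
  have "\<bar>real (class_count p u n) - real (class_count p v n)\<bar> \<le> 3 * C * of_int n powr (1 - \<delta>)"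
    if "\<not> qdvd p u" "\<not> qdvd p v" "p dvd nrm u - nrm v" "n > 0" for u v n
    using that
  proof (induction "nat n" arbitrary: n u v rule: less_induct)
    case less
    show ?case
    proof (cases "odd n")
      case True
      have "0 \<le> C * of_int n powr (1 - \<delta>)" using C by simp
      then show ?thesis using O[OF less.prems True] by simp
    next
      case False
      then obtain m where m: "n = 2 * m" by auto
      have m0: "m > 0" using m less.prems by simp
      have mono: "of_int m powr (1 - \<delta>) \<le> (of_int n :: real) powr (1 - \<delta>)" using m m0 C by (intro powr_mono2) auto
      show ?thesis
      proof (cases "odd m")
        case True
        have b: "\<bar>real (class_count p (of_int half_mod * (qcnj e * u)) m) - real (class_count p (of_int half_mod * (qcnj e * v)) m)\<bar> \<le> C * of_int m powr (1 - \<delta>)"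
          if "nrm e = 2" for e using O[OF half_class[OF that less.prems(1-3)] m0 True] .
        have "\<bar>real (class_count p u n) - real (class_count p v n)\<bar> \<le> 3 * (C * of_int m powr (1 - \<delta>))"
          using b[OF nrm_e(1)] b[OF nrm_e(2)] b[OF nrm_e(3)] unfolding m class_count_two_mod_four[OF True] by linarith
        also have "\<dots> \<le> 3 * (C * of_int n powr (1 - \<delta>))" using mono C by simp
        finally show ?thesis by simp
      next
        case False
        have "\<bar>real (class_count p (of_int half_mod * (qcnj e1 * u)) m) - real (class_count p (of_int half_mod * (qcnj e1 * v)) m)\<bar> \<le> 3 * C * of_int m powr (1 - \<delta>)"
          using less.hyps[of m] half_class[OF nrm_e(1) less.prems(1-3)] m m0 by simp
        also have "\<dots> \<le> 3 * C * of_int n powr (1 - \<delta>)" using mono C by simp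
        finally show ?thesis using class_count_four_dvd[of m] False unfolding m by simp
      qed
    qed
  qed
  then show thesis using that[of "3 * C" \<delta>] C by simp
qed

end

text \<open>Prime powers are split off by the eight-to-one product of
  \<open>primitive_mult_sum\<close>; each contributes at least \<open>8 * l ^ j\<close>.\<close>

lemma card_primitive_ge:
  assumes "n > 0" "odd n"
  shows "real (card (primitive n)) \<ge> 8 * of_int n"
  using assms
proof (induction "nat n" arbitrary: n rule: less_induct)
  case less
  show ?case
  proof (cases "n = 1")
    case True
    have "\<not> qdvd r x" if "nrm x = 1" "prime r" for x r
    proof
      assume "qdvd r x"
      then have "r\<^sup>2 dvd 1" using qdvd_nrm[of r x] that by simp
      then have "r dvd 1" by (metis dvd_trans dvd_triv_left power2_eq_square)
      then show False using that not_prime_unit by blast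
    qed
    then have "primitive n = {u. nrm u = 1}" using True by (auto simp: primitive_def)
    then show ?thesis using True by (simp add: card_units)
  next
    case False
    then obtain l where l: "prime l" "l dvd n" using prime_divisor_exists[of n] less.prems(1) by auto
    have ol: "odd l" using l less.prems by (auto elim: dvdE)
    interpret odd_prime l by standard (use l ol in auto)
    define j where "j = multiplicity l n"
    have j: "j \<ge> 1" using l less.prems by (auto simp: j_def Suc_le_eq prime_multiplicity_gt_zero_iff)
    have "n \<noteq> 0" "\<not> is_unit l" using less.prems l not_prime_unit by auto
    from multiplicity_decompose'[OF this] obtain m where m: "n = l ^ j * m" "\<not> l dvd m" unfolding j_def by metis
    have m0: "m > 0" using m less.prems l_pow_pos[of j] by (metis zero_less_mult_pos)
    have mo: "odd m" using m less.prems by auto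
    have "l ^ j > 1" using l_gt_2 j one_less_power[of l j] by simp
    then have "m < n" using m m0 by simp
    then have IH: "real (card (primitive m)) \<ge> 8 * of_int m" using less.hyps[of m] m0 mo by simp
    have "real (card (primitive_pow l j)) * real (card (primitive m)) = 8 * real (card (primitive n))"
      using primitive_mult_sum[OF m(2) m0, where j = j and F = "\<lambda>_. 1"] by (simp add: m)
    moreover have "real (card (primitive_pow l j)) \<ge> 8 * of_int (l ^ j)"
      using card_primitive_pow_ge[of j] of_int_le_iff[of "8 * l ^ j" "int (card (primitive_pow l j))", where ?'a = real] by simp
    then have "(8 * of_int (l ^ j)) * (8 * of_int m) \<le> real (card (primitive_pow l j)) * real (card (primitive m))"
      using IH m0 by (intro mult_mono) auto
    ultimately show ?thesis by (simp add: m mult_ac)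
  qed
qed

section \<open>Higher dimensions\<close>

definition square_sum :: "int list \<Rightarrow> int" where
  "square_sum x = (\<Sum>a\<leftarrow>x. a\<^sup>2)"

lemma square_sum_simps [simp]: "square_sum [] = 0" "square_sum (a # x) = a\<^sup>2 + square_sum x" "square_sum (x @ y) = square_sum x + square_sum y" "square_sum (rev x) = square_sum x"
  by (simp_all add: square_sum_def rev_map[symmetric])

lemma square_sum_ge_0 [simp]: "square_sum x \<ge> 0"
  by (induction x) auto

lemma sq_le_square_sum: "a \<in> set x \<Longrightarrow> a\<^sup>2 \<le> square_sum x"
proof (induction x)
  case (Cons b x)
  then show ?case by (auto intro: add_increasing)
qed simp

lemma finite_square_sum: "finite {x. length x = d \<and> square_sum x = n}"
proof (rule finite_subset)
  show "{x. length x = d \<and> square_sum x = n} \<subseteq> {x. set x \<subseteq> {-n..n} \<and> length x = d}"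
  proof safe
    fix x a assume "n = square_sum x" "d = length x" "a \<in> set x"
    then have "\<bar>a\<bar> \<le> square_sum x" by (intro abs_le_of_square_le sq_le_square_sum)
    then show "a \<in> {- square_sum x..square_sum x}" by auto
  qed
qed (simp add: finite_lists_length_eq)

definition zero_mod :: "int \<Rightarrow> int list \<Rightarrow> bool" where
  "zero_mod p x \<longleftrightarrow> (\<forall>a\<in>set x. p dvd a)"

lemma zero_mod_simps [simp]: "zero_mod p []" "zero_mod p (a # x) \<longleftrightarrow> p dvd a \<and> zero_mod p x"
  "zero_mod p (x @ y) \<longleftrightarrow> zero_mod p x \<and> zero_mod p y" "zero_mod p (rev x) \<longleftrightarrow> zero_mod p x"
  by (auto simp: zero_mod_def)

definition list_cong :: "int \<Rightarrow> int list \<Rightarrow> int list \<Rightarrow> bool" where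
  "list_cong p = list_all2 (\<lambda>a b. p dvd a - b)"

lemma list_cong_zero_mod: "list_cong p x u \<Longrightarrow> zero_mod p x \<longleftrightarrow> zero_mod p u"
  unfolding list_cong_def by (induction rule: list_all2_induct) (auto simp: dvd_diff_left_iff dvd_diff_right_iff) 

definition list_class_count :: "int \<Rightarrow> int list \<Rightarrow> int \<Rightarrow> nat" where
  "list_class_count p u n = card {x. list_cong p x u \<and> square_sum x = n}"

lemma finite_list_cong: "finite {x. list_cong p x u \<and> square_sum x = n}"
  by (rule finite_subset[OF _ finite_square_sum[of "length u" n]]) (auto simp: list_cong_def dest: list_all2_lengthD)

lemma list_class_count_rev: "list_class_count p (rev u) n = list_class_count p u n"
  unfolding list_class_count_def
  by (rule bij_betw_same_card[of rev], rule bij_betw_byWitness[where f' = rev])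
     (auto simp: list_cong_def list_all2_rev1)

lemma list_class_count_Cons:
  "list_class_count p (t # u) n = (\<Sum>s | p dvd s - t \<and> s\<^sup>2 \<le> n. list_class_count p u (n - s\<^sup>2))"
proof -
  let ?S = "{s. p dvd s - t \<and> s\<^sup>2 \<le> n}"
  let ?F = "\<lambda>s. {y. list_cong p y u \<and> square_sum y = n - s\<^sup>2}"
  have fin: "finite ?S"
    by (rule finite_subset[of _ "{-n..n}"]) (use abs_le_of_square_le in \<open>auto simp: abs_le_iff dest!: abs_le_of_square_le\<close>)
  have "{x. list_cong p x (t # u) \<and> square_sum x = n} = (\<lambda>(s, y). s # y) ` Sigma ?S ?F"
  proof (intro Set.set_eqI iffI)
    fix x assume x: "x \<in> {x. list_cong p x (t # u) \<and> square_sum x = n}"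
    then obtain s y where sy: "x = s # y" "p dvd s - t" "list_cong p y u"
      by (auto simp: list_cong_def list_all2_Cons2)
    then have "s\<^sup>2 \<le> n" "square_sum y = n - s\<^sup>2" using x square_sum_ge_0[of y] by (auto simp del: square_sum_ge_0)
    then show "x \<in> (\<lambda>(s, y). s # y) ` Sigma ?S ?F" using sy by (auto simp: image_iff)
  qed (auto simp: list_cong_def)
  moreover have "inj_on (\<lambda>(s, y). s # y) (Sigma ?S ?F)" by (auto simp: inj_on_def)
  ultimately have "list_class_count p (t # u) n = card (Sigma ?S ?F)" by (simp add: list_class_count_def card_image)
  then show ?thesis using fin finite_list_cong by (simp add: card_SigmaI list_class_count_def)
qed

text \<open>For the coordinates with \<open>s\<^sup>2 = n\<close>, where nothing is left for the
  others, while \<open>equi_dim\<close> speaks of positive \<open>n\<close>.\<close>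

lemma list_class_count_nonpos: "\<not> zero_mod p u \<Longrightarrow> n \<le> 0 \<Longrightarrow> list_class_count p u n = 0"
proof -
  assume u: "\<not> zero_mod p u" and n: "n \<le> 0"
  have "False" if x: "list_cong p x u" "square_sum x = n" for x
  proof -
    obtain a where a: "a \<in> set x" "\<not> p dvd a" using list_cong_zero_mod[OF x(1)] u by (auto simp: zero_mod_def)
    then have "a\<^sup>2 \<le> 0" using sq_le_square_sum[OF a(1)] x n by linarith
    then show False using a by simp
  qed
  then have "{x. list_cong p x u \<and> square_sum x = n} = {}" by blast
  then show ?thesis unfolding list_class_count_def by (simp only: card.empty)
qed

text \<open>A leading 1 keeps the vector nonzero, and two further coordinates reach every
  residue.\<close>

lemma sum_three_squares_mod:
  fixes p c :: int
  assumes "prime p" "odd p" "d \<ge> 3"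
  obtains y where "length y = d" "\<not> zero_mod p y" "p dvd square_sum y - c"
proof -
  obtain x z where "p dvd x\<^sup>2 + z\<^sup>2 - (c - 1)" by (rule sum_two_squares_mod[OF assms(1,2)])
  moreover have "square_sum (replicate k 0) = 0" for k by (induction k) auto
  ultimately show thesis using that[of "1 # x # z # replicate (d - 3) 0"] assms not_prime_unit[of p]
    by (auto simp: algebra_simps)
qed

text \<open>The bound has to be summed over \<open>n - s\<^sup>2\<close> for varying
  \<open>s\<close>; hence it is uniform in the classes and covers even \<open>n\<close> also in
  dimension 4.\<close>

definition equi_dim :: "int \<Rightarrow> nat \<Rightarrow> real \<Rightarrow> real \<Rightarrow> bool" where
  "equi_dim p d C e \<longleftrightarrow> (\<forall>u v n. length u = d \<longrightarrow> length v = d \<longrightarrow> \<not> zero_mod p u \<longrightarrow> \<not> zero_mod p v \<longrightarrow>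
     p dvd square_sum u - square_sum v \<longrightarrow> n > 0 \<longrightarrow> \<bar>real (list_class_count p u n) - real (list_class_count p v n)\<bar> \<le> C * of_int n powr e)"

lemma equi_dim_4:
  assumes "prime p" "odd p"
  obtains C \<delta> where "C > 0" "\<delta> > 0" "\<delta> < 1" "equi_dim p 4 C (1 - \<delta>)"
proof -
  obtain C \<delta> where C: "C > 0" "\<delta> > 0" "\<delta> < 1" and
    B: "\<And>u v n. \<not> qdvd p u \<Longrightarrow> \<not> qdvd p v \<Longrightarrow> p dvd nrm u - nrm v \<Longrightarrow> n > 0 \<Longrightarrow>
      \<bar>real (class_count p u n) - real (class_count p v n)\<bar> \<le> C * of_int n powr (1 - \<delta>)"
    using equi_uniform[OF assms] by blast
  have ex: "\<exists>a b c e. u = [a, b, c, e]" if "length u = 4" for u :: "int list"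
    using that by (auto simp: numeral_eq_Suc length_Suc_conv)
  have r: "list_class_count p [a, b, c, e] n = class_count p (Quat a b c e) n" for a b c e n
    unfolding list_class_count_def class_count_def
    by (rule bij_betw_same_card[symmetric, of "\<lambda>x. [q0 x, q1 x, q2 x, q3 x]"], rule bij_betw_imageI)
       (auto simp: inj_on_def quat_eq_iff list_cong_def list_all2_Cons2 nrm_def qdvd_def image_iff add.assoc intro!: exI[of _ "Quat _ _ _ _"])
  have "equi_dim p 4 C (1 - \<delta>)" unfolding equi_dim_def
  proof (intro allI impI)
    fix u v :: "int list" and n :: int assume h: "length u = 4" "length v = 4" "\<not> zero_mod p u" "\<not> zero_mod p v" "p dvd square_sum u - square_sum v" "0 < n"
    obtain a b c e a' b' c' e' where uv: "u = [a, b, c, e]" "v = [a', b', c', e']" using ex h(1,2) by metis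
    show "\<bar>real (list_class_count p u n) - real (list_class_count p v n)\<bar> \<le> C * of_int n powr (1 - \<delta>)"
      unfolding uv r by (rule B) (use h uv in \<open>auto simp: qdvd_def nrm_def add.assoc\<close>)
  qed
  then show thesis using that C by blast
qed

text \<open>The first coordinate has at most \<open>3 * sqrt n\<close> values, each with the error
  of dimension \<open>d\<close>. The exponent grows by \<open>1 / 2\<close>, as does that of the
  number of vectors, so the saving persists.\<close>

lemma list_class_count_Cons_diff:
  assumes E: "equi_dim p d C e" and e: "e \<ge> 0" and C: "C \<ge> 0"
    and u: "length u = d" "length v = d" "\<not> zero_mod p u" "\<not> zero_mod p v" "p dvd square_sum u - square_sum v" and n: "n > 0"
  shows "\<bar>real (list_class_count p (t # u) n) - real (list_class_count p (t # v) n)\<bar> \<le> 3 * C * of_int n powr (e + 1 / 2)"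
proof -
  let ?S = "{s. p dvd s - t \<and> s\<^sup>2 \<le> n}"
  let ?c = "\<lambda>u s. real (list_class_count p u (n - s\<^sup>2))"
  have sub: "?S \<subseteq> {s. s\<^sup>2 \<le> n}" by auto
  have b: "\<bar>?c u s - ?c v s\<bar> \<le> C * of_int n powr e" if "s \<in> ?S" for s
  proof (cases "n - s\<^sup>2 > 0")
    case True
    have "\<bar>?c u s - ?c v s\<bar> \<le> C * of_int (n - s\<^sup>2) powr e" using E u True unfolding equi_dim_def by blast
    also have "\<dots> \<le> C * of_int n powr e" using True C e by (intro mult_left_mono powr_mono2) auto
    finally show ?thesis .
  qed (use list_class_count_nonpos[OF u(3)] list_class_count_nonpos[OF u(4)] C in auto)
  have "\<bar>real (list_class_count p (t # u) n) - real (list_class_count p (t # v) n)\<bar> = \<bar>\<Sum>s\<in>?S. ?c u s - ?c v s\<bar>"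
    by (simp add: list_class_count_Cons sum_subtractf)
  also have "\<dots> \<le> (\<Sum>s\<in>?S. \<bar>?c u s - ?c v s\<bar>)" by (rule sum_abs)
  also have "\<dots> \<le> (\<Sum>s\<in>?S. C * of_int n powr e)" using b by (rule sum_mono)
  also have "\<dots> = real (card ?S) * (C * of_int n powr e)" by simp
  also have "\<dots> \<le> (3 * of_int n powr (1 / 2)) * (C * of_int n powr e)"
  proof (rule mult_right_mono)
    have "real (card ?S) \<le> real (card {s. s\<^sup>2 \<le> n})" using card_mono[OF card_squares_le(1) sub] n by simp
    also have "\<dots> \<le> 2 * sqrt (of_int n) + 1" using card_squares_le(2)[of n] n by simp
    also have "\<dots> \<le> 3 * sqrt (of_int n)" using n by simp
    finally show "real (card ?S) \<le> 3 * of_int n powr (1 / 2)" using n by (simp add: powr_half_sqrt)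
  qed (use C in auto)
  also have "\<dots> = 3 * C * of_int n powr (e + 1 / 2)" by (simp add: powr_add)
  finally show ?thesis .
qed

text \<open>A move replaces all coordinates but the first, or all but the last. The obstacle is a
  class whose only nonzero coordinate is the fixed one, so the middle coordinates are made nonzero
  first. Four moves of cost 3 give the constant 12.\<close>

lemma equi_dim_Suc:
  assumes p: "prime p" "odd p" and d: "d \<ge> 4" and E: "equi_dim p d C e" and e: "e \<ge> 0" and C: "C \<ge> 0"
  shows "equi_dim p (Suc d) (12 * C) (e + 1 / 2)"
proof -
  define D where "D k u v \<longleftrightarrow> (\<forall>n>0. \<bar>real (list_class_count p u n) - real (list_class_count p v n)\<bar> \<le> real k * (3 * C * of_int n powr (e + 1 / 2)))" for k u v
  have D_trans: "D (j + k) u w" if "D j u v" "D k v w" for j k u v w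
    unfolding D_def
  proof (intro allI impI)
    fix n :: int assume "n > 0"
    then show "\<bar>real (list_class_count p u n) - real (list_class_count p w n)\<bar> \<le> real (j + k) * (3 * C * of_int n powr (e + 1 / 2))"
      using that unfolding D_def of_nat_add distrib_right by fastforce
  qed
  have D_sym: "D k v u" if "D k u v" for k u v using that by (simp add: D_def abs_minus_commute)
  have first: "D 1 (t # u) (t # v)" if "length u = d" "length v = d" "\<not> zero_mod p u" "\<not> zero_mod p v" "p dvd square_sum u - square_sum v" for t u v
    using list_class_count_Cons_diff[OF E e C that] by (simp add: D_def)
  have last: "D 1 (u @ [t]) (v @ [t])" if "length u = d" "length v = d" "\<not> zero_mod p u" "\<not> zero_mod p v" "p dvd square_sum u - square_sum v" for t u v
    using first[of "rev u" "rev v" t] that list_class_count_rev[of p "u @ [t]"] list_class_count_rev[of p "v @ [t]"] by (simp add: D_def)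
  \<comment> \<open>One move makes the middle part nonzero modulo \<open>p\<close>; which end stays
    fixed depends on where \<open>u\<close> is nonzero.\<close>
  have norm: "\<exists>t w s. length w = d - 1 \<and> \<not> zero_mod p w \<and> p dvd t\<^sup>2 + square_sum w + s\<^sup>2 - square_sum u \<and> D 1 u (t # w @ [s])"
    if u: "length u = Suc d" "\<not> zero_mod p u" for u
  proof -
    obtain t w s where tws: "u = t # w @ [s]" "length w = d - 1"
    proof -
      obtain t x where x: "u = t # x" "length x = d" using u(1) by (auto simp: length_Suc_conv)
      then obtain w s where "x = w @ [s]" using d by (cases x rule: rev_cases) auto
      then show thesis using that[of t w s] x by auto
    qed
    have d1: "Suc (d - 1) = d" "d - 1 \<ge> 3" using d by auto
    show ?thesis
    proof (cases "zero_mod p (w @ [s])")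
      case False
      obtain y where y: "length y = d - 1" "\<not> zero_mod p y" "p dvd square_sum y - (square_sum w + s\<^sup>2)" by (rule sum_three_squares_mod[OF p d1(2)])
      have "p dvd square_sum (w @ [s]) - square_sum (y @ [0])" using y(3) by (simp add: dvd_diff_commute)
      then have "D 1 u (t # y @ [0])" unfolding tws by (intro first) (use False y tws d1 in auto)
      moreover have "p dvd t\<^sup>2 + square_sum y + 0\<^sup>2 - square_sum u" using y(3) by (simp add: tws algebra_simps)
      ultimately show ?thesis using y by blast
    next
      case True
      obtain y where y: "length y = d - 1" "\<not> zero_mod p y" "p dvd square_sum y - (t\<^sup>2 + square_sum w)" by (rule sum_three_squares_mod[OF p d1(2)])
      have "p dvd square_sum (t # w) - square_sum (0 # y)" using y(3) by (simp add: dvd_diff_commute)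
      then have "D 1 ((t # w) @ [s]) ((0 # y) @ [s])" by (intro last) (use u True y tws d1 in auto)
      then have "D 1 u (0 # y @ [s])" by (simp add: tws)
      moreover have "p dvd 0\<^sup>2 + square_sum y + s\<^sup>2 - square_sum u" using y(3) by (simp add: tws algebra_simps)
      ultimately show ?thesis using y by blast
    qed
  qed
  have "D 4 u v" if uv: "length u = Suc d" "length v = Suc d" "\<not> zero_mod p u" "\<not> zero_mod p v" "p dvd square_sum u - square_sum v" for u v
  proof -
    have d1: "Suc (d - 1) = d" "d - 1 \<ge> 3" using d by auto
    obtain t w s where w: "length w = d - 1" "\<not> zero_mod p w" "p dvd t\<^sup>2 + square_sum w + s\<^sup>2 - square_sum u" "D 1 u (t # w @ [s])"
      using norm uv by blast
    obtain t' w' s' where w': "length w' = d - 1" "\<not> zero_mod p w'" "p dvd t'\<^sup>2 + square_sum w' + s'\<^sup>2 - square_sum v" "D 1 v (t' # w' @ [s'])"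
      using norm uv by blast
    \<comment> \<open>The middle is chosen such that the first entry \<open>t\<close> and the last
      entry \<open>s'\<close> can be combined: \<open>t # y @ [s']\<close> is one move away from
      both normalised classes.\<close>
    obtain y where y: "length y = d - 1" "\<not> zero_mod p y" "p dvd square_sum y - (square_sum w + s\<^sup>2 - s'\<^sup>2)" by (rule sum_three_squares_mod[OF p d1(2)])
    have "p dvd square_sum (w @ [s]) - square_sum (y @ [s'])" using y(3) by (subst dvd_diff_commute) (simp add: algebra_simps)
    then have 1: "D 1 (t # w @ [s]) (t # y @ [s'])" by (intro first) (use w y d1 in auto)
    have "p dvd (square_sum y - (square_sum w + s\<^sup>2 - s'\<^sup>2)) + (t\<^sup>2 + square_sum w + s\<^sup>2 - square_sum u) + (square_sum u - square_sum v) - (t'\<^sup>2 + square_sum w' + s'\<^sup>2 - square_sum v)"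
      by (rule dvd_diff[OF dvd_add[OF dvd_add[OF y(3) w(3)] uv(5)] w'(3)])
    then have "p dvd square_sum (t # y) - square_sum (t' # w')" by (simp add: algebra_simps)
    then have "D 1 ((t # y) @ [s']) ((t' # w') @ [s'])" by (intro last) (use w' y d1 in auto)
    then have 2: "D 1 (t # y @ [s']) (t' # w' @ [s'])" by simp
    have "D (1 + 1 + 1 + 1) u v" using D_trans[OF D_trans[OF D_trans[OF w(4) 1] 2] D_sym[OF w'(4)]] .
    then show ?thesis by (simp add: numeral_eq_Suc)
  qed
  then show ?thesis unfolding equi_dim_def D_def by (simp add: mult.assoc) 
qed

lemma equi_dim_ge_4:
  assumes p: "prime p" "odd p" and "d \<ge> 4"
  shows "\<exists>C \<delta>. C > 0 \<and> \<delta> > 0 \<and> \<delta> < 1 \<and> equi_dim p d C (real d / 2 - 1 - \<delta>)"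
  using \<open>d \<ge> 4\<close>
proof (induction d rule: dec_induct)
  case base
  obtain C \<delta> where "C > 0" "\<delta> > 0" "\<delta> < 1" "equi_dim p 4 C (1 - \<delta>)" using equi_dim_4[OF p] by blast
  then show ?case by auto
next
  case (step d)
  then obtain C \<delta> where C: "C > 0" "\<delta> > 0" "\<delta> < 1" "equi_dim p d C (real d / 2 - 1 - \<delta>)" by blast
  have "equi_dim p (Suc d) (12 * C) (real d / 2 - 1 - \<delta> + 1 / 2)"
    by (rule equi_dim_Suc[OF p _ C(4)]) (use step C in auto)
  also have "real d / 2 - 1 - \<delta> + 1 / 2 = real (Suc d) / 2 - 1 - \<delta>" by (simp add: field_simps)
  finally show ?case using C by (intro exI[of _ "12 * C"] exI[of _ \<delta>]) auto
qed

section \<open>Lower bounds for the number of vectors\<close>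

definition nonzero_sphere :: "int \<Rightarrow> nat \<Rightarrow> int \<Rightarrow> int list set" where
  "nonzero_sphere p d n = {x. length x = d \<and> \<not> zero_mod p x \<and> square_sum x = n}"

lemma finite_nonzero_sphere: "finite (nonzero_sphere p d n)"
  by (rule finite_subset[OF _ finite_square_sum[of d n]]) (auto simp: nonzero_sphere_def)

lemma card_nonzero_sphere_4:
  assumes "prime p" "n > 0" "odd n"
  shows "real (card (nonzero_sphere p 4 n)) \<ge> 8 * of_int n"
proof -
  have "card (primitive n) \<le> card (nonzero_sphere p 4 n)"
    by (rule card_inj_on_le[where f = "\<lambda>x. [q0 x, q1 x, q2 x, q3 x]"])
       (use assms finite_nonzero_sphere in \<open>auto simp: inj_on_def quat_eq_iff primitive_def nonzero_sphere_def nrm_def qdvd_def add.assoc\<close>)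
  then show ?thesis using card_primitive_ge[OF assms(2,3)] by linarith
qed

text \<open>The lower bound in dimension 4 concerns odd norms. A coordinate \<open>s\<close> of
  parity opposite to \<open>n\<close> leaves an odd \<open>n - s\<^sup>2\<close>, and
  \<open>2 * s\<^sup>2 \<le> n\<close> keeps this at least \<open>n / 2\<close>.\<close>

lemma opposite_parity_squares:
  assumes "n > 0"
  obtains S where "finite S" "real (card S) \<ge> sqrt (of_int n) / 8" "\<And>s. s \<in> S \<Longrightarrow> 2 * s\<^sup>2 \<le> n \<and> odd (n - s\<^sup>2)"
proof -
  define r :: int where "r = (if odd n then 0 else 1)"
  define q where "q = sqrt (of_int n)"
  define m where "m = nat \<lceil>q / 8\<rceil>"
  let ?f = "\<lambda>k::nat. 2 * int k + r"
  have q: "q \<ge> 1" "q\<^sup>2 = of_int n" using assms by (auto simp: q_def)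
  have "2 * (?f k)\<^sup>2 \<le> n \<and> odd (n - (?f k)\<^sup>2)" if "k < m" for k
  proof
    have k: "8 * real k \<le> q" using that by (simp add: m_def) linarith
    \<comment> \<open>For \<open>k \<ge> 1\<close> the value is at most \<open>3 * k\<close>, hence
      at most \<open>3 / 8 * q\<close>, and twice the square of \<open>3 / 8\<close> is below 1. For
      \<open>k = 0\<close> the value 1 occurs only with even \<open>n\<close>, so
      \<open>n \<ge> 2\<close>.\<close>
    show "2 * (?f k)\<^sup>2 \<le> n"
    proof (cases "k = 0")
      case True
      then show ?thesis using assms by (auto simp: r_def)
    next
      case False
      then have "2 * real k + of_int r \<le> 3 / 8 * q" using k by (auto simp: r_def)
      then have "(2 * real k + of_int r)\<^sup>2 \<le> (3 / 8 * q)\<^sup>2" by (intro power_mono) (auto simp: r_def)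
      then have "2 * (2 * real k + of_int r)\<^sup>2 \<le> of_int n"
        unfolding power_mult_distrib q(2) using assms by (simp add: power2_eq_square)
      then have "real_of_int (2 * (?f k)\<^sup>2) \<le> of_int n" by simp
      then show ?thesis by (simp only: of_int_le_iff)
    qed
    show "odd (n - (?f k)\<^sup>2)" by (auto simp: r_def)
  qed
  then have "2 * s\<^sup>2 \<le> n \<and> odd (n - s\<^sup>2)" if "s \<in> ?f ` {..<m}" for s using that by blast
  moreover have "inj_on ?f {..<m}" by (auto simp: inj_on_def)
  then have "card (?f ` {..<m}) = m" by (simp add: card_image)
  moreover have "real m \<ge> q / 8" using q unfolding m_def by linarith
  ultimately show thesis using that[of "?f ` {..<m}"] by (simp add: q_def)
qed

text \<open>Odd norms in dimension \<open>d\<close> already give all norms in dimension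
  \<open>Suc d\<close>; this is why the parity condition disappears from dimension 5 on.\<close>

lemma card_nonzero_sphere_Suc:
  assumes L: "\<And>m. m > 0 \<Longrightarrow> odd m \<Longrightarrow> real (card (nonzero_sphere p d m)) \<ge> c * of_int m powr e"
    and "c > 0" "e \<ge> 0" "n > 0"
  shows "real (card (nonzero_sphere p (Suc d) n)) \<ge> (c / 8 / 2 powr e) * of_int n powr (e + 1 / 2)"
proof -
  obtain S where S: "finite S" "real (card S) \<ge> sqrt (of_int n) / 8" "\<And>s. s \<in> S \<Longrightarrow> 2 * s\<^sup>2 \<le> n \<and> odd (n - s\<^sup>2)"
    using opposite_parity_squares[OF \<open>n > 0\<close>] by blast
  have b: "c * (of_int n / 2) powr e \<le> real (card (nonzero_sphere p d (n - s\<^sup>2)))" if "s \<in> S" for s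
  proof -
    have s: "2 * s\<^sup>2 \<le> n" "odd (n - s\<^sup>2)" using S(3)[OF that] by auto
    then have "of_int (2 * s\<^sup>2) \<le> (of_int n :: real)" by (simp only: of_int_le_iff)
    then have "(of_int n / 2) powr e \<le> of_int (n - s\<^sup>2) powr e" using assms by (intro powr_mono2) auto
    then have "c * (of_int n / 2) powr e \<le> c * of_int (n - s\<^sup>2) powr e" using assms by simp
    also have "\<dots> \<le> real (card (nonzero_sphere p d (n - s\<^sup>2)))" using s assms by (intro L) auto
    finally show ?thesis .
  qed
  have "(c / 8 / 2 powr e) * of_int n powr (e + 1 / 2) = (sqrt (of_int n) / 8) * (c * (of_int n / 2) powr e)"
    using assms by (simp add: powr_add powr_divide powr_half_sqrt)
  also have "\<dots> \<le> real (card S) * (c * (of_int n / 2) powr e)" using S(2) assms by (intro mult_right_mono) auto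
  also have "\<dots> = (\<Sum>s\<in>S. c * (of_int n / 2) powr e)" by simp
  also have "\<dots> \<le> (\<Sum>s\<in>S. real (card (nonzero_sphere p d (n - s\<^sup>2))))" using b by (rule sum_mono)
  also have "\<dots> = real (card (Sigma S (\<lambda>s. nonzero_sphere p d (n - s\<^sup>2))))"
    using S(1) finite_nonzero_sphere by (simp add: card_SigmaI)
  also have "\<dots> \<le> real (card (nonzero_sphere p (Suc d) n))"
    unfolding of_nat_le_iff
    by (rule card_inj_on_le[where f = "\<lambda>(s, y). s # y"])
       (use finite_nonzero_sphere in \<open>auto simp: inj_on_def nonzero_sphere_def\<close>)
  finally show ?thesis .
qed

lemma card_nonzero_sphere_ge:
  assumes p: "prime p" and "d \<ge> 4"
  shows "\<exists>c>0. \<forall>n>0. d \<ge> 5 \<or> odd n \<longrightarrow> real (card (nonzero_sphere p d n)) \<ge> c * of_int n powr (real d / 2 - 1)"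
  using \<open>d \<ge> 4\<close>
proof (induction d rule: dec_induct)
  case base
  show ?case using card_nonzero_sphere_4[OF p] by (intro exI[of _ 8]) auto
next
  case (step d)
  then obtain c where c: "c > 0" "\<And>n. n > 0 \<Longrightarrow> odd n \<Longrightarrow> real (card (nonzero_sphere p d n)) \<ge> c * of_int n powr (real d / 2 - 1)"
    by blast
  have "real (card (nonzero_sphere p (Suc d) n)) \<ge> (c / 8 / 2 powr (real d / 2 - 1)) * of_int n powr (real (Suc d) / 2 - 1)" if "n > 0" for n
    using card_nonzero_sphere_Suc[OF c(2) c(1) _ that] step by (simp add: field_simps)
  then show ?case using c(1) by (intro exI[of _ "c / 8 / 2 powr (real d / 2 - 1)"]) auto
qed

text \<open>The fibres have average size \<open>card X / card A\<close>. If any two differ by at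
  most \<open>K\<close>, then each differs from the average by at most \<open>K\<close>.\<close>

lemma average_fiber_diff:
  fixes f :: "'b \<Rightarrow> complex"
  assumes X: "finite X" "r ` X \<subseteq> A" "X \<noteq> {}" and A: "finite A"
    and D: "\<And>u v. u \<in> A \<Longrightarrow> v \<in> A \<Longrightarrow> \<bar>real (card {x \<in> X. r x = u}) - real (card {x \<in> X. r x = v})\<bar> \<le> K"
  shows "norm (1 / of_nat (card X) * (\<Sum>x\<in>X. f (r x)) - 1 / of_nat (card A) * (\<Sum>u\<in>A. f u))
    \<le> (\<Sum>u\<in>A. norm (f u)) * (K / real (card X))"
proof -
  define k where "k u = card {x \<in> X. r x = u}" for u
  have A0: "card A > 0" "card X > 0" using X A by (auto simp: card_gt_0_iff)
  have tot: "(\<Sum>u\<in>A. k u) = card X"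
    using sum.group[OF X(1) A X(2), of "\<lambda>_. 1::nat"] by (simp add: k_def)
  have "(\<Sum>x\<in>X. f (r x)) = (\<Sum>u\<in>A. \<Sum>x | x \<in> X \<and> r x = u. f (r x))"
    using sum.group[OF X(1) A X(2), of "\<lambda>x. f (r x)"] by simp
  also have "\<dots> = (\<Sum>u\<in>A. of_nat (k u) * f u)" by (intro sum.cong) (auto simp: k_def)
  finally have S: "(\<Sum>x\<in>X. f (r x)) = (\<Sum>u\<in>A. of_nat (k u) * f u)" .
  have b: "\<bar>real (k u) / real (card X) - 1 / real (card A)\<bar> \<le> K / real (card X)" if "u \<in> A" for u
  proof -
    have "real (card A) * real (k u) - real (card X) = (\<Sum>v\<in>A. real (k u) - real (k v))"
      unfolding tot[symmetric] by (simp add: sum_subtractf)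
    also have "\<bar>\<dots>\<bar> \<le> (\<Sum>v\<in>A. \<bar>real (k u) - real (k v)\<bar>)" by (rule sum_abs)
    also have "\<dots> \<le> (\<Sum>v\<in>A. K)" using D that unfolding k_def by (intro sum_mono) blast
    finally have "\<bar>real (card A) * real (k u) - real (card X)\<bar> \<le> real (card A) * K" by simp
    moreover have "real (k u) / real (card X) - 1 / real (card A) = (real (card A) * real (k u) - real (card X)) / (real (card A) * real (card X))"
      using A0 by (simp add: field_simps)
    ultimately show ?thesis using A0 by (simp add: abs_divide abs_mult divide_simps mult_ac)
  qed
  have "1 / of_nat (card X) * (\<Sum>x\<in>X. f (r x)) - 1 / of_nat (card A) * (\<Sum>u\<in>A. f u)
    = (\<Sum>u\<in>A. of_real (real (k u) / real (card X) - 1 / real (card A)) * f u)"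
    unfolding S sum_distrib_left sum_subtractf[symmetric] by (intro sum.cong) (auto simp: algebra_simps)
  also have "norm \<dots> \<le> (\<Sum>u\<in>A. norm (f u) * (K / real (card X)))"
  proof (rule sum_norm_le)
    fix u assume "u \<in> A"
    then show "norm (of_real (real (k u) / real (card X) - 1 / real (card A)) * f u) \<le> norm (f u) * (K / real (card X))"
      unfolding norm_mult norm_of_real mult.commute[of _ "norm (f u)"] using b by (intro mult_left_mono) auto
  qed
  finally show ?thesis unfolding sum_distrib_right .
qed

section \<open>From lists to the vectors of the statement, and the limit\<close>

lemma card_int_vecs_list:
  "card {x \<in> int_vecs d. P (map x [0..<d])} = card {l. length l = d \<and> P l}"
proof (rule bij_betw_same_card, rule bij_betw_byWitness)
  show "\<forall>x\<in>{x \<in> int_vecs d. P (map x [0..<d])}. (\<lambda>i\<in>{..<d}. map x [0..<d] ! i) = x"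
    by (auto simp: int_vecs_def fun_eq_iff PiE_iff extensional_def)
  have m: "map (\<lambda>i\<in>{..<d}. l ! i) [0..<d] = l" if "length l = d" for l :: "int list"
    using that by (intro nth_equalityI) auto
  then show "\<forall>l\<in>{l. length l = d \<and> P l}. map (\<lambda>i\<in>{..<d}. l ! i) [0..<d] = l" by blast
  show "(\<lambda>l. \<lambda>i\<in>{..<d}. l ! i) ` {l. length l = d \<and> P l} \<subseteq> {x \<in> int_vecs d. P (map x [0..<d])}"
    using m by (auto simp: int_vecs_def simp del: map_eq_conv split: if_splits)
qed auto

lemma square_sum_map_upt: "square_sum (map x [0..<d]) = Q_int d x x"
  by (induction d) (auto simp: Q_int_def power2_eq_square)

lemma zero_mod_map_upt: "x \<in> int_vecs d \<Longrightarrow> zero_mod (int p) (map x [0..<d]) \<longleftrightarrow> x \<in> multiple_vecs p d"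
  by (auto simp: zero_mod_def multiple_vecs_def int_vecs_def PiE_iff)

lemma card_X_int': "card (X_int' p d n) = card (nonzero_sphere (int p) d (int n))"
proof -
  have "X_int' p d n = {x \<in> int_vecs d. \<not> zero_mod (int p) (map x [0..<d]) \<and> square_sum (map x [0..<d]) = int n}"
    by (auto simp: X_int'_def zero_mod_map_upt square_sum_map_upt)
  then show ?thesis using card_int_vecs_list[of d "\<lambda>l. \<not> zero_mod (int p) l \<and> square_sum l = int n"]
    by (simp add: nonzero_sphere_def)
qed

lemma residue_vecs_iff: "p > 0 \<Longrightarrow> u \<in> residue_vecs p d \<longleftrightarrow> u \<in> int_vecs d \<and> (\<forall>i<d. 0 \<le> u i \<and> u i < int p)"
  by (auto simp: residue_vecs_def int_vecs_def residue_ring_def PiE_iff)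

lemma zero_vec_iff:
  assumes "p > 0" "u \<in> residue_vecs p d"
  shows "u = zero_vec d \<longleftrightarrow> zero_mod (int p) (map u [0..<d])"
proof
  assume "zero_mod (int p) (map u [0..<d])"
  then have "u i = 0" if "i < d" for i
    using that assms zdvd_not_zless[of "u i" "int p"] by (force simp: zero_mod_def residue_vecs_iff)
  then show "u = zero_vec d" using assms
    by (auto simp: zero_vec_def fun_eq_iff residue_vecs_iff int_vecs_def PiE_iff extensional_def)
qed (auto simp: zero_vec_def zero_mod_def)

lemma reduce_eq_iff:
  assumes "p > 0" "u \<in> residue_vecs p d"
  shows "reduce p d x = u \<longleftrightarrow> list_cong (int p) (map x [0..<d]) (map u [0..<d])"
proof -
  have "reduce p d x = u \<longleftrightarrow> (\<forall>i<d. x i mod int p = u i)"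
    using assms by (auto simp: reduce_def fun_eq_iff residue_vecs_iff int_vecs_def PiE_iff extensional_def)
  also have "\<dots> \<longleftrightarrow> (\<forall>i<d. int p dvd x i - u i)"
    using assms by (auto simp: residue_vecs_iff mod_eq_dvd_iff[symmetric])
  finally show ?thesis by (simp add: list_cong_def list_all2_conv_all_nth)
qed

text \<open>A vector in a nonzero class is not a multiple of \<open>p\<close>, so the fibre inside
  \<open>X_int'\<close> is the whole class.\<close>

lemma card_fiber_reduce:
  assumes "p > 0" "u \<in> residue_vecs p d" "u \<noteq> zero_vec d"
  shows "card {x \<in> X_int' p d n. reduce p d x = u} = list_class_count (int p) (map u [0..<d]) (int n)"
proof -
  let ?u = "map u [0..<d]"
  have "{x \<in> X_int' p d n. reduce p d x = u} = {x \<in> int_vecs d. list_cong (int p) (map x [0..<d]) ?u \<and> square_sum (map x [0..<d]) = int n}"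
    using assms zero_mod_map_upt[of _ d p] list_cong_zero_mod[of "int p" _ ?u] by (auto simp: X_int'_def square_sum_map_upt reduce_eq_iff zero_vec_iff)
  also have "card \<dots> = card {l. length l = d \<and> list_cong (int p) l ?u \<and> square_sum l = int n}" by (rule card_int_vecs_list)
  also have "{l. length l = d \<and> list_cong (int p) l ?u \<and> square_sum l = int n} = {l. list_cong (int p) l ?u \<and> square_sum l = int n}"
    by (auto simp: list_cong_def dest: list_all2_lengthD)
  finally show ?thesis by (simp add: list_class_count_def)
qed

lemma Q_mod_eq:
  assumes "p > 1"
  shows "Q_mod p d x y = Q_int d x y mod int p"
proof -
  interpret residues "int p" "residue_ring (int p)" by unfold_locales (use assms in auto)
  show ?thesis
  proof (induction d)
    case 0
    show ?case using assms by (simp add: Q_mod_def Q_int_def zero_cong)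
  next
    case (Suc d)
    have "(\<lambda>i. x i \<otimes>\<^bsub>residue_ring (int p)\<^esub> y i) \<in> A \<rightarrow> carrier (residue_ring (int p))" for A
      using assms by (auto simp: res_mult_eq res_carrier_eq)
    then show ?case using Suc assms unfolding Q_mod_def Q_int_def lessThan_Suc
      by (simp add: res_add_eq res_mult_eq res_carrier_eq mod_simps add.commute)
  qed
qed

lemma finite_X_mod: "p > 0 \<Longrightarrow> finite (X_mod p d a)"
  by (rule finite_subset[of _ "residue_vecs p d"]) (auto simp: X_mod_def residue_vecs_def residue_ring_def intro: finite_PiE)

lemma reduce_in_X_mod:
  assumes p: "p > 1" and a: "0 \<le> a" "a < int p" and n: "[int n = a] (mod int p)" and x: "x \<in> X_int' p d n"
  shows "reduce p d x \<in> X_mod p d a - {zero_vec d}"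
proof
  have r: "reduce p d x \<in> residue_vecs p d" using p by (simp add: residue_vecs_iff reduce_def int_vecs_def)
  have "Q_int d (reduce p d x) (reduce p d x) mod int p = Q_int d x x mod int p"
    unfolding Q_int_def reduce_def
    by (subst (1 2) mod_sum_eq[symmetric]) (simp add: mod_mult_eq)
  also have "\<dots> = a" using n x a by (simp add: X_int'_def cong_def)
  finally show "reduce p d x \<in> X_mod p d a" using r p by (simp add: X_mod_def Q_mod_eq)
  have "list_cong (int p) (map x [0..<d]) (map (reduce p d x) [0..<d])" using reduce_eq_iff[OF _ r, of x] p by simp
  then show "reduce p d x \<notin> {zero_vec d}" using x r p list_cong_zero_mod zero_mod_map_upt zero_vec_iff[OF _ r]
    by (fastforce simp: X_int'_def)
qed

text \<open>With \<open>X_int'\<close> and without the zero vector, both parts of the theorem become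
  one statement, since for \<open>a \<noteq> 0\<close> nothing is removed. Dividing the error bound
  of \<open>equi_dim_ge_4\<close> by the lower bound for the number of vectors leaves
  \<open>n powr (- \<delta>)\<close>.\<close>

lemma equidistribution:
  fixes f :: "(nat \<Rightarrow> int) \<Rightarrow> complex"
  assumes d: "d \<ge> 4" and p: "prime p" "odd p" and a: "0 \<le> a" "a < int p"
    and N: "\<And>n. n \<in> N \<Longrightarrow> [int n = a] (mod int p)" "\<And>n. n \<in> N \<Longrightarrow> d \<ge> 5 \<or> odd n"
  shows "((\<lambda>n. 1 / of_nat (card (X_int' p d n)) * (\<Sum>x\<in>X_int' p d n. f (reduce p d x)))
    \<longlongrightarrow> 1 / of_nat (card (X_mod p d a - {zero_vec d})) * (\<Sum>x\<in>X_mod p d a - {zero_vec d}. f x))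
    (at_top_through N)"
proof -
  have p1: "p > 1" "p > 0" "prime (int p)" "odd (int p)" using p prime_gt_1_nat[of p] by auto
  let ?A = "X_mod p d a - {zero_vec d}"
  obtain C \<delta> where C: "C > 0" "\<delta> > 0" "\<delta> < 1" "equi_dim (int p) d C (real d / 2 - 1 - \<delta>)"
    using equi_dim_ge_4[OF p1(3,4) d] by blast
  obtain c where c: "c > 0" and
    L: "\<And>n. n > 0 \<Longrightarrow> d \<ge> 5 \<or> odd n \<Longrightarrow> real (card (nonzero_sphere (int p) d n)) \<ge> c * of_int n powr (real d / 2 - 1)"
    using card_nonzero_sphere_ge[OF p1(3) d] by blast
  define K where "K = (\<Sum>u\<in>?A. norm (f u)) * (C / c)"
  have "norm (1 / of_nat (card (X_int' p d n)) * (\<Sum>x\<in>X_int' p d n. f (reduce p d x)) - 1 / of_nat (card ?A) * (\<Sum>x\<in>?A. f x))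
    \<le> K * real n powr (- \<delta>)" if n: "n \<in> N" "n > 0" for n
  proof -
    let ?X = "X_int' p d n"
    have low: "real (card ?X) \<ge> c * real n powr (real d / 2 - 1)"
      using L[of "int n"] N(2)[OF n(1)] n by (simp add: card_X_int')
    then have pos: "real (card ?X) > 0" using c n by (smt (verit) mult_pos_pos of_nat_0_less_iff powr_gt_zero)
    then have X: "finite ?X" "?X \<noteq> {}" by (auto intro: card_ge_0_finite)
    have D: "\<bar>real (card {x \<in> ?X. reduce p d x = u}) - real (card {x \<in> ?X. reduce p d x = v})\<bar> \<le> C * real n powr (real d / 2 - 1 - \<delta>)"
      if "u \<in> ?A" "v \<in> ?A" for u v
    proof -
      have uv: "u \<in> residue_vecs p d" "u \<noteq> zero_vec d" "v \<in> residue_vecs p d" "v \<noteq> zero_vec d"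
        "Q_int d u u mod int p = a" "Q_int d v v mod int p = a"
        using that p1 by (auto simp: X_mod_def Q_mod_eq)
      have "int p dvd square_sum (map u [0..<d]) - square_sum (map v [0..<d])"
        using uv(5,6) by (simp add: square_sum_map_upt flip: mod_eq_dvd_iff)
      moreover have "length (map u [0..<d]) = d" "length (map v [0..<d]) = d" "int n > 0"
        "\<not> zero_mod (int p) (map u [0..<d])" "\<not> zero_mod (int p) (map v [0..<d])"
        using uv zero_vec_iff p1 n(2) by auto
      ultimately have "\<bar>real (list_class_count (int p) (map u [0..<d]) (int n)) - real (list_class_count (int p) (map v [0..<d]) (int n))\<bar>
        \<le> C * of_int (int n) powr (real d / 2 - 1 - \<delta>)"
        using C(4) unfolding equi_dim_def by blast
      then show ?thesis using uv p1 by (simp add: card_fiber_reduce)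
    qed
    have "norm (1 / of_nat (card ?X) * (\<Sum>x\<in>?X. f (reduce p d x)) - 1 / of_nat (card ?A) * (\<Sum>x\<in>?A. f x))
      \<le> (\<Sum>u\<in>?A. norm (f u)) * (C * real n powr (real d / 2 - 1 - \<delta>) / real (card ?X))"
      using X D reduce_in_X_mod[OF p1(1) a N(1)[OF n(1)]] finite_X_mod[OF p1(2)]
      by (intro average_fiber_diff) auto
    also have "\<dots> \<le> (\<Sum>u\<in>?A. norm (f u)) * (C * real n powr (real d / 2 - 1 - \<delta>) / (c * real n powr (real d / 2 - 1)))"
      using low pos c C(1) n(2) by (intro mult_left_mono divide_left_mono sum_nonneg mult_pos_pos) auto
    also have "real n powr (real d / 2 - 1 - \<delta>) = real n powr (real d / 2 - 1) * real n powr (- \<delta>)"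
      by (simp add: powr_add[symmetric])
    also have "C * (real n powr (real d / 2 - 1) * real n powr (- \<delta>)) / (c * real n powr (real d / 2 - 1)) = C / c * real n powr (- \<delta>)"
      using n(2) c by simp
    finally show ?thesis by (simp add: K_def)
  qed
  then have ev: "\<forall>\<^sub>F n in at_top_through N. norm (1 / of_nat (card (X_int' p d n)) * (\<Sum>x\<in>X_int' p d n. f (reduce p d x)) - 1 / of_nat (card ?A) * (\<Sum>x\<in>?A. f x))
    \<le> norm (real n powr (- \<delta>)) * K"
    unfolding at_top_through_def eventually_inf_principal
    by (auto simp: mult.commute[of _ K] intro: eventually_mono[OF eventually_gt_at_top[of 0]])
  have "((\<lambda>n. real n powr (- \<delta>)) \<longlongrightarrow> 0) sequentially"
    using C(2) by (intro tendsto_neg_powr filterlim_real_sequentially) auto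
  then have "((\<lambda>n. real n powr (- \<delta>)) \<longlongrightarrow> 0) (at_top_through N)"
    unfolding at_top_through_def by (rule tendsto_mono[rotated]) simp
  then show ?thesis by (intro LIM_zero_cancel[OF tendsto_0_le[OF _ ev]])
qed


theorem theorem1p1:
  fixes d p :: nat and a :: int
  assumes "d \<ge> 4" and "prime p" and "odd p"
    and "a \<in> carrier (residue_ring (int p))"
  shows
    "(a \<noteq> 0 \<longrightarrow>
       (d \<ge> 5 \<longrightarrow>
         (\<forall>f :: (nat \<Rightarrow> int) \<Rightarrow> complex.
           ((\<lambda>n. 1 / of_nat (card (X_int d n)) * (\<Sum>x\<in>X_int d n. f (reduce p d x)))
             \<longlongrightarrow> 1 / of_nat (card (X_mod p d a)) * (\<Sum>x\<in>X_mod p d a. f x))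
           (at_top_through {n. [int n = a] (mod int p)}))) \<and>
       (d = 4 \<longrightarrow>
         (\<forall>f :: (nat \<Rightarrow> int) \<Rightarrow> complex.
           ((\<lambda>n. 1 / of_nat (card (X_int d n)) * (\<Sum>x\<in>X_int d n. f (reduce p d x)))
             \<longlongrightarrow> 1 / of_nat (card (X_mod p d a)) * (\<Sum>x\<in>X_mod p d a. f x))
           (at_top_through {n. odd n \<and> [int n = a] (mod int p)})))) \<and>
     (a = 0 \<longrightarrow>
       (d \<ge> 5 \<longrightarrow>
         (\<forall>f :: (nat \<Rightarrow> int) \<Rightarrow> complex.
           ((\<lambda>n. 1 / of_nat (card (X_int' p d n)) * (\<Sum>x\<in>X_int' p d n. f (reduce p d x)))
             \<longlongrightarrow> 1 / (of_nat (card (X_mod p d 0)) - 1)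
                  * (\<Sum>x\<in>X_mod p d 0 - {zero_vec d}. f x))
           (at_top_through {n. p dvd n}))) \<and>
       (d = 4 \<longrightarrow>
         (\<forall>f :: (nat \<Rightarrow> int) \<Rightarrow> complex.
           ((\<lambda>n. 1 / of_nat (card (X_int' p d n)) * (\<Sum>x\<in>X_int' p d n. f (reduce p d x)))
             \<longlongrightarrow> 1 / (of_nat (card (X_mod p d 0)) - 1)
                  * (\<Sum>x\<in>X_mod p d 0 - {zero_vec d}. f x))
           (at_top_through {n. odd n \<and> p dvd n}))))"
proof -
  have p: "p > 1" "p > 0" using assms(2) prime_gt_1_nat[of p] by auto
  have a: "0 \<le> a" "a < int p" using assms(4) by (auto simp: residue_ring_def)
  have zero: "zero_vec d \<in> residue_vecs p d" "Q_mod p d (zero_vec d) (zero_vec d) = 0"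
    using p by (auto simp: residue_vecs_iff int_vecs_def zero_vec_def Q_mod_eq Q_int_def)
  \<comment> \<open>A multiple of \<open>p\<close> has norm 0 modulo \<open>p\<close>, so for
    \<open>a \<noteq> 0\<close> the two sets of vectors coincide.\<close>
  have X: "X_int d n = X_int' p d n" if "[int n = a] (mod int p)" "a \<noteq> 0" for n
  proof -
    have "x \<notin> multiple_vecs p d" if "Q_int d x x = int n" for x
    proof
      assume "x \<in> multiple_vecs p d"
      then have "int p dvd Q_int d x x" by (auto simp: multiple_vecs_def Q_int_def PiE_iff intro!: dvd_sum)
      then show False using \<open>[int n = a] (mod int p)\<close> \<open>a \<noteq> 0\<close> a that by (auto simp: cong_def)
    qed
    then show ?thesis by (auto simp: X_int_def X_int'_def)
  qed
  have A: "X_mod p d a - {zero_vec d} = X_mod p d a" if "a \<noteq> 0" using that zero by (auto simp: X_mod_def)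
  \<comment> \<open>The zero vector does belong to \<open>X_mod p d 0\<close>, so the complex
    subtraction of 1 is the cardinality of the remaining set.\<close>
  have A0: "of_nat (card (X_mod p d 0 - {zero_vec d})) = (of_nat (card (X_mod p d 0)) - 1 :: complex)"
  proof -
    have z: "zero_vec d \<in> X_mod p d 0" using zero by (simp add: X_mod_def)
    then have "card (X_mod p d 0) > 0" using finite_X_mod[OF p(2)] by (auto simp: card_gt_0_iff)
    then show ?thesis using z by (simp add: card_Diff_singleton of_nat_diff)
  qed
  have nonzero: "((\<lambda>n. 1 / of_nat (card (X_int d n)) * (\<Sum>x\<in>X_int d n. f (reduce p d x)))
      \<longlongrightarrow> 1 / of_nat (card (X_mod p d a)) * (\<Sum>x\<in>X_mod p d a. f x)) (at_top_through N)"
    if "a \<noteq> 0" "\<And>n. n \<in> N \<Longrightarrow> [int n = a] (mod int p)" "\<And>n. n \<in> N \<Longrightarrow> d \<ge> 5 \<or> odd n" for f :: "_ \<Rightarrow> complex" and N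
  proof -
    have "\<forall>\<^sub>F n in at_top_through N. 1 / of_nat (card (X_int' p d n)) * (\<Sum>x\<in>X_int' p d n. f (reduce p d x))
      = 1 / of_nat (card (X_int d n)) * (\<Sum>x\<in>X_int d n. f (reduce p d x))"
      unfolding at_top_through_def eventually_inf_principal using X that by (auto intro: always_eventually)
    from Lim_transform_eventually[OF equidistribution[OF assms(1-3) a that(2,3)] this] show ?thesis
      unfolding A[OF that(1)] by simp
  qed
  have null: "((\<lambda>n. 1 / of_nat (card (X_int' p d n)) * (\<Sum>x\<in>X_int' p d n. f (reduce p d x)))
      \<longlongrightarrow> 1 / (of_nat (card (X_mod p d 0)) - 1) * (\<Sum>x\<in>X_mod p d 0 - {zero_vec d}. f x)) (at_top_through N)"
    if "\<And>n. n \<in> N \<Longrightarrow> p dvd n" "\<And>n. n \<in> N \<Longrightarrow> d \<ge> 5 \<or> odd n" for f :: "_ \<Rightarrow> complex" and N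
    using equidistribution[OF assms(1-3), of 0 N f] that p by (simp add: A0 cong_0_iff)
  show ?thesis by (intro conjI impI allI; (rule nonzero | rule null)) auto
qed

end
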